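(* Let $\mu>0$ and let $\sigma\in\mathcal{C}^\infty(\mathbb{R}^d)$ satisfy, for some $C_0>0$, $$|\partial^\alpha_\xi\sigma(\xi)|\le C_0^{|\alpha|+1}(\alpha!)^\mu,\qquad \xi\in\mathbb{R}^d,\ \alpha\in\mathbb{N}^d.$$ Then the Wigner kernel of $\sigma(D_x)$ is given by $$k_W(z,w)=\delta(\xi-\eta)\,a_1(x-y)\,a_2(x-y,\xi),\qquad z=(x,\xi),\ w=(y,\eta)\in\mathbb{R}^{2d},$$ where $a_1\in\mathcal{C}^\infty(\mathbb{R}^d)$ satisfies $|a_1(s)|\le Ce^{-\varepsilon|s|^{1/\mu}}$, $s\in\mathbb{R}^d$, for some $C>0$, $\varepsilon>0$, and, for each $\xi\in\mathbb{R}^d$, $a_2(x-y,\xi)$ is the kernel of a bounded convolution operator $$\Big\|\int_{\mathbb{R}^d}a_2(\cdot-y,\xi)g(y)\,dy\Big\|_2\le C\|g\|_2,\qquad g\in L^2(\mathbb{R}^d),$$ with $C$ independent of $\xi$.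
   Context: Fourier transform: $\widehat f(\xi)=\mathcal{F}f(\xi)=\int f(x)e^{-2\pi i x\cdot\xi}dx$; $\sigma(D_x)f=\mathcal{F}^{-1}(\sigma\widehat f)$. Cross-Wigner distribution: $W(f,g)(x,\xi)=\int_{\mathbb{R}^d}f(x+\frac y2)\overline{g(x-\frac y2)}e^{-2\pi i y\cdot\xi}dy$. The Wigner kernel of a continuous linear $T:\mathcal{S}(\mathbb{R}^d)\to\mathcal{S}'(\mathbb{R}^d)$ is the unique $k_W\in\mathcal{S}'(\mathbb{R}^{4d})$ with $W(Tf,Tg)(z)=\int_{\mathbb{R}^{2d}}k_W(z,w)W(f,g)(w)\,dw$ for all $f,g\in\mathcal{S}(\mathbb{R}^d)$, in the distributional sense. For a tempered distribution $F(s,\xi)$, $\delta(\xi-\eta)F(x-y,\xi)$ denotes $\Phi\mapsto\langle F(s,\xi),\int_{\mathbb{R}^d}\Phi(y+s,\xi,y,\xi)\,dy\rangle$ (bilinear pairing in $(s,\xi)$). $a_2(\cdot,\xi)$ is in general a tempered distribution and the integral defining the convolution operator is understood in the distributional sense. *)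

theory Defs
  imports "HOL-Analysis.Analysis"
begin

text \<open>
  The space \<open>R^d\<close> is an arbitrary Euclidean space \<open>'a\<close>; phase space is \<open>'a \<times> 'a\<close>, and kernels live
  on \<open>('a \<times> 'a) \<times> ('a \<times> 'a)\<close>. A multi-index is a function \<open>'a \<Rightarrow> nat\<close> of which only the values on
  \<open>Basis\<close> matter.
\<close>

subsection \<open>Partial derivatives and smooth functions\<close>

definition partial :: "'a::euclidean_space \<Rightarrow> ('a \<Rightarrow> complex) \<Rightarrow> 'a \<Rightarrow> complex" where
  "partial b f x = vector_derivative (\<lambda>t. f (x + t *\<^sub>R b)) (at 0)"

fun partials :: "'a::euclidean_space list \<Rightarrow> ('a \<Rightarrow> complex) \<Rightarrow> 'a \<Rightarrow> complex" where
  "partials [] f = f"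
| "partials (b # bs) f = partial b (partials bs f)"

definition smooth :: "('a::euclidean_space \<Rightarrow> complex) \<Rightarrow> bool" where
  "smooth f \<longleftrightarrow> (\<forall>bs\<in>lists Basis. \<forall>x. partials bs f differentiable (at x))"

definition mi_abs :: "('a::euclidean_space \<Rightarrow> nat) \<Rightarrow> nat" where
  "mi_abs \<alpha> = (\<Sum>b\<in>Basis. \<alpha> b)"

definition mi_fact :: "('a::euclidean_space \<Rightarrow> nat) \<Rightarrow> nat" where
  "mi_fact \<alpha> = (\<Prod>b\<in>Basis. fact (\<alpha> b))"

text \<open>
  The derivative \<open>\<partial>\<^sup>\<alpha>\<close> differentiates \<open>\<alpha> b\<close> times in each basis direction \<open>b\<close>, in an arbitrary but
  fixed order. It is only used for smooth functions, for which the order is immaterial.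
\<close>

definition mderiv :: "('a::euclidean_space \<Rightarrow> nat) \<Rightarrow> ('a \<Rightarrow> complex) \<Rightarrow> 'a \<Rightarrow> complex" where
  "mderiv \<alpha> = partials (SOME bs. bs \<in> lists Basis \<and> (\<forall>b\<in>Basis. count_list bs b = \<alpha> b))"

subsection \<open>Schwartz functions, test functions and tempered distributions\<close>

definition schwartz :: "('a::euclidean_space \<Rightarrow> complex) set" where
  "schwartz = {f. smooth f \<and>
     (\<forall>N \<alpha>. bounded (range (\<lambda>x. (1 + norm x) ^ N *\<^sub>R mderiv \<alpha> f x)))}"

text \<open>An increasing family of norms that generates the topology of the Schwartz space.\<close>

definition schwartz_norm :: "nat \<Rightarrow> ('a::euclidean_space \<Rightarrow> complex) \<Rightarrow> real" where
  "schwartz_norm N f =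
     (SUP (\<alpha>, x) \<in> {\<alpha>. mi_abs \<alpha> \<le> N} \<times> UNIV. (1 + norm x) ^ N * norm (mderiv \<alpha> f x))"

definition test_functions :: "('a::euclidean_space \<Rightarrow> complex) set" where
  "test_functions = {f. smooth f \<and> compact (closure {x. f x \<noteq> 0})}"

text \<open>
  A tempered distribution is a functional on all functions, but only its values on the Schwartz
  space are meaningful. Pairings are bilinear, not sesquilinear.
\<close>

definition tempered :: "(('a::euclidean_space \<Rightarrow> complex) \<Rightarrow> complex) \<Rightarrow> bool" where
  "tempered u \<longleftrightarrow>
     (\<forall>f\<in>schwartz. \<forall>g\<in>schwartz. u (\<lambda>x. f x + g x) = u f + u g) \<and>
     (\<forall>c. \<forall>f\<in>schwartz. u (\<lambda>x. c * f x) = c * u f) \<and>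
     (\<exists>C N. \<forall>f\<in>schwartz. norm (u f) \<le> C * schwartz_norm N f)"

subsection \<open>Fourier transform, Fourier multipliers and the cross-Wigner distribution\<close>

definition fourier :: "('a::euclidean_space \<Rightarrow> complex) \<Rightarrow> 'a \<Rightarrow> complex" where
  "fourier f \<xi> = (LINT x|lborel. f x * exp (- 2 * pi * \<i> * (x \<bullet> \<xi>)))"

definition inverse_fourier :: "('a::euclidean_space \<Rightarrow> complex) \<Rightarrow> 'a \<Rightarrow> complex" where
  "inverse_fourier f x = (LINT \<xi>|lborel. f \<xi> * exp (2 * pi * \<i> * (x \<bullet> \<xi>)))"

definition fourier_multiplier ::
  "('a::euclidean_space \<Rightarrow> complex) \<Rightarrow> ('a \<Rightarrow> complex) \<Rightarrow> 'a \<Rightarrow> complex" where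
  "fourier_multiplier \<sigma> f = inverse_fourier (\<lambda>\<xi>. \<sigma> \<xi> * fourier f \<xi>)"

definition wigner ::
  "('a::euclidean_space \<Rightarrow> complex) \<Rightarrow> ('a \<Rightarrow> complex) \<Rightarrow> 'a \<times> 'a \<Rightarrow> complex" where
  "wigner f g = (\<lambda>(x, \<xi>). LINT y|lborel.
     f (x + (1/2) *\<^sub>R y) * cnj (g (x - (1/2) *\<^sub>R y)) * exp (- 2 * pi * \<i> * (y \<bullet> \<xi>)))"

subsection \<open>The Wigner kernel\<close>

text \<open>
  The identity \<open>W(Tf,Tg)(z) = \<integral> k(z,w) W(f,g)(w) dw\<close> in the distributional sense: both sides, as
  distributions in \<open>z\<close>, are paired with an arbitrary Schwartz function \<open>\<Phi>\<close>. The operator \<open>T\<close> is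
  function-valued, so that the left-hand side is the distribution given by the function \<open>W(Tf,Tg)\<close>.
\<close>

definition wigner_kernel_identity ::
  "(('a::euclidean_space \<Rightarrow> complex) \<Rightarrow> 'a \<Rightarrow> complex) \<Rightarrow>
   ((('a \<times> 'a) \<times> ('a \<times> 'a) \<Rightarrow> complex) \<Rightarrow> complex) \<Rightarrow> bool" where
  "wigner_kernel_identity T k \<longleftrightarrow>
     (\<forall>f\<in>schwartz. \<forall>g\<in>schwartz. \<forall>\<Phi>\<in>schwartz.
        has_bochner_integral lborel (\<lambda>z. wigner (T f) (T g) z * \<Phi> z)
          (k (\<lambda>(z, w). \<Phi> z * wigner f g w)))"

text \<open>\<open>k\<close> is the unique tempered distribution with this property.\<close>

definition is_wigner_kernel ::
  "(('a::euclidean_space \<Rightarrow> complex) \<Rightarrow> 'a \<Rightarrow> complex) \<Rightarrow>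
   ((('a \<times> 'a) \<times> ('a \<times> 'a) \<Rightarrow> complex) \<Rightarrow> complex) \<Rightarrow> bool" where
  "is_wigner_kernel T k \<longleftrightarrow>
     tempered k \<and> wigner_kernel_identity T k \<and>
     (\<forall>k'. tempered k' \<and> wigner_kernel_identity T k' \<longrightarrow> (\<forall>\<Psi>\<in>schwartz. k' \<Psi> = k \<Psi>))"

text \<open>The distribution \<open>\<delta>(\<xi> - \<eta>) F(x - y, \<xi>)\<close> in the variables \<open>((x, \<xi>), (y, \<eta>))\<close>.\<close>

definition delta_kernel ::
  "(('a::euclidean_space \<times> 'a \<Rightarrow> complex) \<Rightarrow> complex) \<Rightarrow>
   (('a \<times> 'a) \<times> ('a \<times> 'a) \<Rightarrow> complex) \<Rightarrow> complex" where
  "delta_kernel F \<Phi> = F (\<lambda>(s, \<xi>). LINT y|lborel. \<Phi> ((y + s, \<xi>), (y, \<xi>)))"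

text \<open>
  \<open>F(s, \<xi>) = a\<^sub>1(s) a\<^sub>2(s, \<xi>)\<close>, where \<open>a\<^sub>1\<close> is a smooth function and \<open>a\<^sub>2(\<cdot>, \<xi>)\<close> a tempered distribution for
  each \<open>\<xi>\<close>. As nothing is assumed on the growth of the derivatives of \<open>a\<^sub>1\<close>, the product is taken in
  the usual way on compactly supported test functions; these are dense in the Schwartz space, so
  that this determines the tempered distribution \<open>F\<close>.
\<close>

definition is_product ::
  "(('a::euclidean_space \<times> 'a \<Rightarrow> complex) \<Rightarrow> complex) \<Rightarrow>
   ('a \<Rightarrow> complex) \<Rightarrow> ('a \<Rightarrow> ('a \<Rightarrow> complex) \<Rightarrow> complex) \<Rightarrow> bool" where
  "is_product F a\<^sub>1 a\<^sub>2 \<longleftrightarrow>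
     (\<forall>\<Phi>\<in>test_functions.
        has_bochner_integral lborel (\<lambda>\<xi>. a\<^sub>2 \<xi> (\<lambda>s. a\<^sub>1 s * \<Phi> (s, \<xi>))) (F \<Phi>))"

subsection \<open>Bounded convolution operators\<close>

definition square_integrable :: "('a::euclidean_space \<Rightarrow> complex) set" where
  "square_integrable =
     {f. f \<in> borel_measurable lborel \<and> integrable lborel (\<lambda>x. (norm (f x))\<^sup>2)}"

definition norm2 :: "('a::euclidean_space \<Rightarrow> complex) \<Rightarrow> real" where
  "norm2 f = sqrt (LINT x|lborel. (norm (f x))\<^sup>2)"

text \<open>\<open>(u * g)(x) = \<integral> u(x - y) g(y) dy\<close> for a tempered distribution \<open>u\<close> and a Schwartz function \<open>g\<close>.\<close>

definition convolution ::
  "(('a::euclidean_space \<Rightarrow> complex) \<Rightarrow> complex) \<Rightarrow> ('a \<Rightarrow> complex) \<Rightarrow> 'a \<Rightarrow> complex" where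
  "convolution u g x = u (\<lambda>s. g (x - s))"

text \<open>
  \<open>u(x - y)\<close> is the kernel of a convolution operator of norm at most \<open>C\<close> on \<open>L\<^sup>2\<close>: a linear
  operator on the whole of \<open>L\<^sup>2\<close>, written on representatives, that is convolution with \<open>u\<close> on
  the Schwartz space.
\<close>

definition bounded_convolution_kernel ::
  "real \<Rightarrow> (('a::euclidean_space \<Rightarrow> complex) \<Rightarrow> complex) \<Rightarrow> bool" where
  "bounded_convolution_kernel C u \<longleftrightarrow>
     (\<exists>A. (\<forall>f\<in>square_integrable. A f \<in> square_integrable) \<and>
          (\<forall>f\<in>square_integrable. \<forall>g\<in>square_integrable.
             AE x in lborel. A (\<lambda>x. f x + g x) x = A f x + A g x) \<and>
          (\<forall>c. \<forall>f\<in>square_integrable. AE x in lborel. A (\<lambda>x. c * f x) x = c * A f x) \<and>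
          (\<forall>g\<in>schwartz. AE x in lborel. A g x = convolution u g x) \<and>
          (\<forall>g\<in>square_integrable. norm2 (A g) \<le> C * norm2 g))"

end

theory Submission
  imports Defs "HOL-Probability.Characteristic_Functions" "HOL-Probability.Sinc_Integral"
begin

text \<open>
  On the Fourier side, \<open>W(\<sigma>(D)f, \<sigma>(D)g)(x, \<xi>)\<close> is the inverse Fourier transform, in a variable \<open>\<eta>\<close> dual
  to \<open>x\<close>, of \<open>w\<^sub>\<xi>(\<eta>)\<close> times the Fourier transform of \<open>W(f, g)(\<cdot>, \<xi>)\<close>, where
  \<open>w\<^sub>\<xi>(\<eta>) = \<sigma>(\<xi> + \<eta>/2) cnj (\<sigma>(\<xi> - \<eta>/2))\<close>. Hence the kernel is \<open>\<delta>(\<xi> - \<eta>) F(x - y, \<xi>)\<close>, where \<open>F(\<cdot>, \<xi>)\<close> is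
  the distribution with Fourier transform \<open>w\<^sub>\<xi>\<close>.

  To split off the decay, let \<open>G(t)\<close> be the sum of \<open>(\<delta>t)\<^sup>k / (k!)\<^sup>\<mu>\<close> over even \<open>k\<close>. It is at least 1 and
  grows like \<open>exp (\<epsilon>|t|\<^bsup>1/\<mu>\<^esup>)\<close>, so that the reciprocal \<open>a\<^sub>1(s)\<close> of \<open>\<Sum>\<^sub>b G(s \<bullet> b)\<close> is smooth with the required
  decay. Multiplication of \<open>F(\<cdot>, \<xi>)\<close> by \<open>s \<bullet> b\<close> is \<open>(\<i>/2\<pi>) \<partial>\<^sub>b\<close> on the Fourier side; therefore
  \<open>a\<^sub>2 = F / a\<^sub>1\<close> has the Fourier transform \<open>\<Sum>\<^sub>b \<Sum>\<^sub>k \<delta>\<^sup>k (\<i>/2\<pi>)\<^sup>k \<partial>\<^sub>b\<^sup>k w\<^sub>\<xi> / (k!)\<^sup>\<mu>\<close>, which the Gevrey estimates bound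
  uniformly in \<open>\<xi>\<close> when \<open>\<delta>\<close> is small.

  The kernel is unique because cross-Wigner distributions of Gaussians are time-frequency shifts of
  Gaussians, and the tensor products of these span a dense subspace of the Schwartz space.
\<close>

subsection \<open>Lebesgue integration on Euclidean spaces\<close>

text \<open>Restricting \<open>gseries\<close> to even k makes all its terms nonnegative on the real
  line, so the denominator has no zero. Summing over coordinates, rather than using a function of
  the norm, keeps the denominator smooth and produces pure derivatives on the Fourier side: one
  single series for each basis vector. The k-th derivative of w is at most
  \<open>C\<^sub>0 ^ (k + 2) * (fact k) powr \<mu>\<close>. The factorials cancel, and the choice
  \<open>\<delta> = pi / C\<^sub>0\<close> turns the remaining ratio
  \<open>\<delta> * C\<^sub>0 / (2 * pi)\<close> into 1/2. The resulting bound on the symbol becomes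
  the bound on L^2 by Plancherel. Neither the functions obtained from the multiplier nor the
  diagonal integrals of test functions are shown to be Schwartz functions. They are handled through
  quantitative decay of their Fourier transforms, and \<open>F\<close> is defined by an integral
  that makes sense for this larger class. The Gaussian \<open>gauss 2\<close> is fixed for the
  density argument because it is, up to a constant, the Wigner distribution of
  \<open>gauss 1\<close>, and because Gaussians on a product space are tensor products.\<close>

lemma integrable_lborel_affine:
  fixes f :: "'a::euclidean_space \<Rightarrow> 'b::{banach, second_countable_topology}"
  assumes f: "integrable lborel f" and c: "c \<noteq> 0"
  shows "integrable lborel (\<lambda>x. f (t + c *\<^sub>R x))"
proof -
  have [measurable]: "f \<in> borel_measurable borel"
    using f by (auto dest: borel_measurable_integrable)
  have "integrable lborel (\<lambda>x. \<bar>c\<bar> ^ DIM('a) *\<^sub>R f (t + c *\<^sub>R x))"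
    using f
    apply (subst (asm) lborel_affine[OF c, of t])
    apply (subst (asm) integrable_density)
       apply (auto simp: integrable_distr_eq)
    done
  from integrable_scaleR_right[OF this, of "inverse (\<bar>c\<bar> ^ DIM('a))"] show ?thesis
    using c by simp
qed

lemma integral_lborel_affine:
  fixes f :: "'a::euclidean_space \<Rightarrow> 'b::{banach, second_countable_topology}"
  assumes [measurable]: "f \<in> borel_measurable borel" and c: "c \<noteq> 0"
  shows "(LINT x|lborel. f x) = \<bar>c\<bar> ^ DIM('a) *\<^sub>R (LINT x|lborel. f (t + c *\<^sub>R x))"
  apply (subst lborel_affine[OF c, of t])
  apply (subst integral_density)
     apply (auto simp: integral_distr)
  done

lemma integral_lborel_translate:
  fixes f :: "'a::euclidean_space \<Rightarrow> 'b::{banach, second_countable_topology}"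
  assumes "f \<in> borel_measurable borel"
  shows "(LINT x|lborel. f (t + x)) = (LINT x|lborel. f x)"
  using integral_lborel_affine[OF assms, of 1 t] by simp

lemma integral_lborel_reflect:
  fixes f :: "'a::euclidean_space \<Rightarrow> 'b::{banach, second_countable_topology}"
  assumes "f \<in> borel_measurable borel"
  shows "(LINT x|lborel. f (t - x)) = (LINT x|lborel. f x)"
  using integral_lborel_affine[OF assms, of "-1" t] by simp

lemma integrable_lborel_translate:
  fixes f :: "'a::euclidean_space \<Rightarrow> 'b::{banach, second_countable_topology}"
  assumes "integrable lborel f"
  shows "integrable lborel (\<lambda>x. f (t + x))"
  using integrable_lborel_affine[OF assms, of 1 t] by simp

lemma integrable_lborel_reflect:
  fixes f :: "'a::euclidean_space \<Rightarrow> 'b::{banach, second_countable_topology}"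
  assumes "integrable lborel f"
  shows "integrable lborel (\<lambda>x. f (t - x))"
  using integrable_lborel_affine[OF assms, of "-1" t] by simp

lemma integrable_lborel_pairI:
  fixes f :: "'a::euclidean_space \<times> 'b::euclidean_space \<Rightarrow> 'c::{banach, second_countable_topology}"
  assumes "f \<in> borel_measurable borel"
    and "\<And>x. integrable lborel (\<lambda>y. f (x, y))"
    and "integrable lborel (\<lambda>x. LINT y|lborel. norm (f (x, y)))"
  shows "integrable lborel f"
  using lborel_pair.Fubini_integrable[of f] assms by (simp add: lborel_prod)

lemma integrable_lborel_pairI':
  fixes f :: "'a::euclidean_space \<times> 'b::euclidean_space \<Rightarrow> 'c::{banach, second_countable_topology}"
  assumes f: "f \<in> borel_measurable borel"
    and "\<And>y. integrable lborel (\<lambda>x. f (x, y))"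
    and "integrable lborel (\<lambda>y. LINT x|lborel. norm (f (x, y)))"
  shows "integrable lborel f"
proof -
  have "integrable lborel (\<lambda>(y, x). f (x, y))"
    using assms by (intro integrable_lborel_pairI) (auto simp: borel_prod[symmetric])
  then have "integrable (lborel \<Otimes>\<^sub>M lborel) (\<lambda>(y, x). f (x, y))"
    by (simp add: lborel_prod)
  from lborel_pair.integrable_product_swap[OF this] show ?thesis
    by (simp add: lborel_prod)
qed

lemma integrable_lborel_swap:
  fixes f :: "'a::euclidean_space \<times> 'b::euclidean_space \<Rightarrow> 'c::{banach, second_countable_topology}"
  assumes "integrable lborel f"
  shows "integrable lborel (\<lambda>(y, x). f (x, y))"
  using lborel_pair.integrable_product_swap[of f] assms by (simp add: lborel_prod)

lemma integral_lborel_pair: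
  fixes f :: "'a::euclidean_space \<times> 'b::euclidean_space \<Rightarrow> 'c::{banach, second_countable_topology}"
  assumes f: "integrable lborel f"
  shows "(LINT x|lborel. LINT y|lborel. f (x, y)) = (LINT z|lborel. f z)"
    and "(LINT y|lborel. LINT x|lborel. f (x, y)) = (LINT z|lborel. f z)"
    and "integrable lborel (\<lambda>x. LINT y|lborel. f (x, y))"
    and "integrable lborel (\<lambda>y. LINT x|lborel. f (x, y))"
    and "AE x in lborel. integrable lborel (\<lambda>y. f (x, y))"
    and "AE y in lborel. integrable lborel (\<lambda>x. f (x, y))"
proof -
  have f': "integrable (lborel \<Otimes>\<^sub>M lborel) f" using f by (simp add: lborel_prod)
  have g': "integrable (lborel \<Otimes>\<^sub>M lborel) (\<lambda>(x, y). f (x, y))" using f' by simp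
  show "(LINT x|lborel. LINT y|lborel. f (x, y)) = (LINT z|lborel. f z)"
    using lborel_pair.integral_fst'[OF f'] by (simp add: lborel_prod)
  show "(LINT y|lborel. LINT x|lborel. f (x, y)) = (LINT z|lborel. f z)"
    using lborel_pair.integral_snd[OF g'] by (simp add: lborel_prod)
  show "integrable lborel (\<lambda>x. LINT y|lborel. f (x, y))"
    using lborel_pair.integrable_fst'[OF f'] .
  show "integrable lborel (\<lambda>y. LINT x|lborel. f (x, y))"
    using lborel_pair.integrable_snd[OF g'] .
  show "AE x in lborel. integrable lborel (\<lambda>y. f (x, y))"
    using lborel_pair.AE_integrable_fst'[OF f'] .
  show "AE y in lborel. integrable lborel (\<lambda>x. f (x, y))"
    using lborel_pair.AE_integrable_snd[OF g'] .
qed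

lemma integrable_lborel_pair_mult:
  fixes g :: "'a::euclidean_space \<Rightarrow> 'c::{real_normed_algebra, banach, second_countable_topology}"
    and h :: "'b::euclidean_space \<Rightarrow> 'c"
  assumes g: "integrable lborel g" and h: "integrable lborel h"
  shows "integrable lborel (\<lambda>(x, y). g x * h y)"
proof -
  have [measurable]: "g \<in> borel_measurable borel" "h \<in> borel_measurable borel"
    using g h by (auto dest: borel_measurable_integrable)
  have meas: "(\<lambda>(x, y). norm (g x) * norm (h y)) \<in> borel_measurable borel"
    by (simp add: borel_prod[symmetric])
  have "integrable lborel (\<lambda>(x, y). norm (g x) * norm (h y))"
    by (rule integrable_lborel_pairI[OF meas]) (auto simp: g h)
  then show ?thesis
    by (rule Bochner_Integration.integrable_bound) (auto simp: borel_prod[symmetric] norm_mult_ineq)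
qed

text \<open>\<open>lborel\<close> is the image of the product measure on coordinate functions, so
  Fubini for finite product measures applies.\<close>

lemma integral_prod_Basis:
  fixes f :: "'a::euclidean_space \<Rightarrow> real \<Rightarrow> 'c::{real_normed_field, banach, second_countable_topology}"
  assumes f: "\<And>b. b \<in> Basis \<Longrightarrow> integrable lborel (f b)"
  shows "(LINT x|lborel. (\<Prod>b\<in>Basis. f b (x \<bullet> b))) = (\<Prod>b\<in>Basis. (LINT t|lborel. f b t))"
    and "integrable lborel (\<lambda>x::'a. \<Prod>b\<in>Basis. f b (x \<bullet> b))"
proof -
  interpret product_sigma_finite "\<lambda>_::'a. lborel :: real measure"
    by standard
  have [measurable]: "\<And>b. b \<in> Basis \<Longrightarrow> f b \<in> borel_measurable borel"
    using f by (auto dest: borel_measurable_integrable)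
  have eq: "((\<Sum>b\<in>Basis. x b *\<^sub>R b) \<bullet> c) = x c" if "c \<in> Basis" for x :: "'a \<Rightarrow> real" and c
    using that by (simp add: inner_sum_left inner_Basis if_distrib sum.delta cong: if_cong)
  show "(LINT x|lborel. (\<Prod>b\<in>Basis. f b (x \<bullet> b))) = (\<Prod>b\<in>Basis. (LINT t|lborel. f b t))"
    by (subst lborel_eq, subst integral_distr)
       (auto simp: eq product_integral_prod f)
  show "integrable lborel (\<lambda>x::'a. \<Prod>b\<in>Basis. f b (x \<bullet> b))"
    by (subst lborel_eq, subst integrable_distr_eq)
       (auto simp: eq product_integrable_prod f)
qed

text \<open>Each factor \<open>1 + (x \<bullet> b)\<^sup>2\<close> is at most
  \<open>(1 + norm x)\<^sup>2\<close>, so the weight is dominated by a product of one-dimensional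
  functions 1/(1 + t^2). This is the origin of the order \<open>2 * DIM('a)\<close> in the later
  decay estimates.\<close>

lemma integrable_inverse_norm_power:
  assumes "2 * DIM('a) \<le> k"
  shows "integrable lborel (\<lambda>x::'a::euclidean_space. inverse ((1 + norm x) ^ k))"
proof (rule Bochner_Integration.integrable_bound)
  have "integrable lborel (\<lambda>t::real. inverse (1 + t\<^sup>2))"
    using integrable_inverse_1_plus_square by (simp add: set_integrable_def)
  then show "integrable lborel (\<lambda>x::'a. \<Prod>b\<in>Basis. inverse (1 + (x \<bullet> b)\<^sup>2))"
    by (intro integral_prod_Basis(2))
  show "AE x in lborel. norm (inverse ((1 + norm (x::'a)) ^ k)) \<le> norm (\<Prod>b\<in>Basis. inverse (1 + (x \<bullet> b)\<^sup>2))"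
  proof (intro AE_I2)
    fix x :: 'a
    have "(\<Prod>b\<in>Basis. 1 + (x \<bullet> b)\<^sup>2) \<le> (\<Prod>b\<in>(Basis::'a set). (1 + norm x)\<^sup>2)"
    proof (intro prod_mono conjI)
      fix b :: 'a assume "b \<in> Basis"
      then have "(x \<bullet> b)\<^sup>2 \<le> (norm x)\<^sup>2"
        using Basis_le_norm[of b x] by (metis abs_le_square_iff abs_norm_cancel)
      then show "1 + (x \<bullet> b)\<^sup>2 \<le> (1 + norm x)\<^sup>2"
        using norm_ge_zero[of x] by (simp add: power2_sum del: norm_ge_zero)
    qed auto
    also have "\<dots> = (1 + norm x) ^ (2 * DIM('a))"
      by (simp add: power_mult)
    also have "\<dots> \<le> (1 + norm x) ^ k"
      using assms by (intro power_increasing) auto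
    finally have "inverse ((1 + norm x) ^ k) \<le> inverse (\<Prod>b\<in>Basis. 1 + (x \<bullet> b)\<^sup>2)"
      by (intro le_imp_inverse_le prod_pos) (auto simp: add_pos_nonneg)
    then show "norm (inverse ((1 + norm x) ^ k)) \<le> norm (\<Prod>b\<in>Basis. inverse (1 + (x \<bullet> b)\<^sup>2))"
      by (simp add: prod_inversef prod_norm[symmetric] power_inverse abs_prod flip: prod_inversef)
  qed
qed auto

lemma integrable_decay:
  fixes f :: "'a::euclidean_space \<Rightarrow> 'b::{banach, second_countable_topology}"
  assumes f: "f \<in> borel_measurable borel" and k: "2 * DIM('a) \<le> k"
    and bnd: "\<And>x. (1 + norm x) ^ k * norm (f x) \<le> C"
  shows "integrable lborel f"
proof (rule Bochner_Integration.integrable_bound)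
  show "integrable lborel (\<lambda>x::'a. C * inverse ((1 + norm x) ^ k))"
    using k by (intro integrable_mult_right integrable_inverse_norm_power)
  have "norm (f x) \<le> C * inverse ((1 + norm x) ^ k)" for x
  proof -
    have "0 < (1 + norm x) ^ k" by (intro zero_less_power) (simp add: add_pos_nonneg)
    then show ?thesis using bnd[of x] by (simp add: field_simps)
  qed
  then show "AE x in lborel. norm (f x) \<le> norm (C * inverse ((1 + norm x) ^ k))"
    by (intro AE_I2) (use abs_ge_self order_trans in fastforce)
qed (use f in simp)

lemma integral_decay_le:
  fixes f :: "'a::euclidean_space \<Rightarrow> 'b::{banach, second_countable_topology}"
  assumes f: "f \<in> borel_measurable borel" and k: "2 * DIM('a) \<le> k" and bnd: "\<And>x. (1 + norm x) ^ k * norm (f x) \<le> B"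
  shows "(LINT x|lborel. norm (f x)) \<le> (LINT x::'a|lborel. inverse ((1 + norm x) ^ k)) * B"
proof -
  have "(LINT x|lborel. norm (f x)) \<le> (LINT x::'a|lborel. inverse ((1 + norm x) ^ k) * B)"
  proof (rule integral_mono)
    show "integrable lborel (\<lambda>x::'a. inverse ((1 + norm x) ^ k) * B)"
      by (intro integrable_mult_left integrable_inverse_norm_power k)
    show "norm (f x) \<le> inverse ((1 + norm x) ^ k) * B" for x
    proof -
      have "(1 + norm x) ^ k > 0" by (simp add: add_pos_nonneg)
      then show ?thesis using bnd[of x] by (simp add: field_simps)
    qed
  qed (use integrable_decay[OF f k bnd] in auto)
  then show ?thesis by simp
qed

subsection \<open>Characters and Gaussians\<close>

text \<open>The character exp(2 pi i t) of a real argument: phases are merged by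
  \<open>ch_add\<close>, which leaves identities between real inner products instead of complex
  exponents.\<close>

definition ch :: "real \<Rightarrow> complex" where
  "ch t = cis (2 * pi * t)"

lemma norm_ch [simp]: "norm (ch t) = 1"
  by (simp add: ch_def)

lemma ch_0 [simp]: "ch 0 = 1"
  by (simp add: ch_def)

lemma ch_add: "ch (s + t) = ch s * ch t"
  by (simp add: ch_def cis_mult ring_distribs)

lemma ch_uminus: "ch (- t) = cnj (ch t)"
  by (simp add: ch_def cis_cnj)

lemma ch_mult_uminus [simp]: "ch (- t) * ch t = 1"
  by (simp_all flip: ch_add)

lemma ch_sum: "ch (sum f A) = (\<Prod>a\<in>A. ch (f a))"
  by (induction A rule: infinite_finite_induct) (auto simp: ch_add)

lemma ch_eq_exp: "exp (2 * pi * \<i> * t) = ch t" "exp (- 2 * pi * \<i> * t) = ch (- t)"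
  by (simp_all add: ch_def cis_conv_exp mult_ac)

lemma continuous_on_ch [continuous_intros]:
  "continuous_on A f \<Longrightarrow> continuous_on A (\<lambda>x. ch (f x))"
  unfolding ch_def by (intro continuous_intros)

lemma measurable_ch [measurable (raw)]:
  assumes "f \<in> borel_measurable M"
  shows "(\<lambda>x. ch (f x)) \<in> borel_measurable M"
proof -
  have [measurable]: "ch \<in> borel_measurable borel"
    by (intro borel_measurable_continuous_onI continuous_intros)
  show ?thesis using assms by measurable
qed

lemma has_vector_derivative_ch [derivative_intros]:
  assumes "(f has_real_derivative f') (at t within S)"
  shows "((\<lambda>t. ch (f t)) has_vector_derivative 2 * pi * \<i> * f' * ch (f t)) (at t within S)"
  using assms unfolding ch_def has_vector_derivative_complex_iff
  by (auto intro!: derivative_eq_intros)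

lemma fourier_ch: "fourier f \<xi> = (LINT x|lborel. f x * ch (- (x \<bullet> \<xi>)))"
  unfolding fourier_def by (simp add: ch_eq_exp[symmetric])

lemma inverse_fourier_ch: "inverse_fourier f \<xi> = (LINT x|lborel. f x * ch (x \<bullet> \<xi>))"
  unfolding inverse_fourier_def by (simp add: ch_eq_exp[symmetric] inner_commute)

lemma fourier_eq_inverse_fourier: "fourier f \<xi> = inverse_fourier f (- \<xi>)"
  by (simp add: fourier_ch inverse_fourier_ch)

lemma integrable_mult_ch:
  assumes "integrable M f" and "g \<in> borel_measurable M"
  shows "integrable M (\<lambda>x. f x * ch (g x))"
  using assms(1) by (rule Bochner_Integration.integrable_bound)
    (use assms in \<open>auto dest: borel_measurable_integrable simp: norm_mult\<close>)

lemma power_le_fact_exp: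
  assumes "0 \<le> (x::real)" shows "x ^ n \<le> fact n * exp x"
proof -
  have "(\<Sum>k\<in>{n}. x ^ k /\<^sub>R fact k) \<le> (\<Sum>k. x ^ k /\<^sub>R fact k)"
    using assms by (intro sum_le_suminf summable_exp_generic) auto
  then show ?thesis by (simp add: exp_def field_simps)
qed

text \<open>With this normalisation \<open>gauss 1\<close> is its own Fourier transform, and the
  transform of \<open>gauss \<kappa>\<close> is a multiple of
  \<open>gauss (1 / \<kappa>)\<close>.\<close>

definition gauss :: "real \<Rightarrow> 'a::euclidean_space \<Rightarrow> real" where
  "gauss \<kappa> x = exp (- (pi * \<kappa> * (norm x)\<^sup>2))"

lemma gauss_pos [simp]: "0 < gauss \<kappa> x" "0 \<le> gauss \<kappa> x"
  by (simp_all add: gauss_def)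

lemma gauss_minus [simp]: "gauss \<kappa> (- x) = gauss \<kappa> x"
  by (simp add: gauss_def)

lemma measurable_gauss [measurable (raw)]:
  "f \<in> borel_measurable M \<Longrightarrow> (\<lambda>x. gauss \<kappa> (f x)) \<in> borel_measurable M"
  unfolding gauss_def by measurable

text \<open>The power is at most a factorial times \<open>exp (1 + norm x)\<close>, and the
  quadratic exponent of the Gaussian absorbs the linear one.\<close>

lemma gauss_decay:
  assumes "\<kappa> > 0"
  shows "\<exists>C>0. \<forall>x::'a::euclidean_space. (1 + norm x) ^ k * gauss \<kappa> x \<le> C"
proof (intro exI conjI allI)
  show "0 < fact k * exp (1 + 1 / (4 * (pi * \<kappa>)))" by simp
  fix x :: 'a
  define a where "a = pi * \<kappa>"
  have a: "a > 0" using assms by (simp add: a_def)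
  \<comment> \<open>Completing the square: the maximum of t - a t^2 is 1/(4a).\<close>
  have "0 \<le> (2 * a * norm x - 1)\<^sup>2" by simp
  then have "4 * a * (norm x - a * (norm x)\<^sup>2) \<le> 1"
    by (simp add: power2_eq_square algebra_simps)
  then have *: "norm x - a * (norm x)\<^sup>2 \<le> 1 / (4 * a)"
    using a by (simp add: field_simps)
  have "(1 + norm x) ^ k * gauss \<kappa> x \<le> (fact k * exp (1 + norm x)) * gauss \<kappa> x"
    by (intro mult_right_mono power_le_fact_exp) auto
  also have "\<dots> = fact k * exp (1 + (norm x - a * (norm x)\<^sup>2))"
    by (simp add: gauss_def a_def flip: exp_add)
  also have "\<dots> \<le> fact k * exp (1 + 1 / (4 * (pi * \<kappa>)))"
    using * unfolding a_def by (intro mult_left_mono) auto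
  finally show "(1 + norm x) ^ k * gauss \<kappa> x \<le> fact k * exp (1 + 1 / (4 * (pi * \<kappa>)))" .
qed

lemma gauss_prod: "gauss \<kappa> x = (\<Prod>b\<in>Basis. gauss \<kappa> (x \<bullet> b))"
proof -
  have "(norm x)\<^sup>2 = (\<Sum>b\<in>Basis. (x \<bullet> b)\<^sup>2)"
    unfolding power2_norm_eq_inner by (subst euclidean_inner) (simp add: power2_eq_square)
  then show ?thesis
    by (simp add: gauss_def sum_distrib_left exp_sum flip: sum_negf)
qed

lemma integrable_power_gauss:
  assumes "\<kappa> > 0"
  shows "integrable lborel (\<lambda>x::'a::euclidean_space. (1 + norm x) ^ k * gauss \<kappa> x)"
proof -
  from gauss_decay[OF assms, of "k + 2 * DIM('a)"] obtain C where
    C: "\<And>x::'a. (1 + norm x) ^ (k + 2 * DIM('a)) * gauss \<kappa> x \<le> C" by blast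
  have 1: "(1 + norm x) ^ (2 * DIM('a)) * norm ((1 + norm x) ^ k * gauss \<kappa> x) \<le> C" for x :: 'a
    using C[of x] by (simp add: abs_mult power_add mult_ac)
  show ?thesis by (rule integrable_decay[OF _ order_refl 1]) measurable
qed

lemma integrable_gauss: "\<kappa> > 0 \<Longrightarrow> integrable lborel (gauss \<kappa> :: 'a::euclidean_space \<Rightarrow> real)"
  using integrable_power_gauss[of \<kappa> 0] by simp

text \<open>After rescaling, the integral is the characteristic function of the standard normal
  distribution.\<close>

lemma inverse_fourier_gauss_real:
  assumes "\<kappa> > 0"
  shows "(LINT x|lborel. gauss \<kappa> (x::real) * ch (x * c)) = (1 / sqrt \<kappa>) * exp (- (pi * c\<^sup>2 / \<kappa>))"
proof -
  \<comment> \<open>Chosen so that \<open>pi * \<kappa> * (s * u)\<^sup>2 = u\<^sup>2 / 2\<close>,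
    the exponent of the normal density.\<close>
  define s where "s = 1 / sqrt (2 * pi * \<kappa>)"
  have s: "s > 0" "s\<^sup>2 = 1 / (2 * pi * \<kappa>)"
    using assms by (auto simp: s_def power_divide)
  have eq: "gauss \<kappa> (s * u) * ch (s * u * c)
      = sqrt (2 * pi) * (std_normal_density u *\<^sub>R iexp ((2 * pi * s * c) * u))" for u
  proof -
    have "pi * \<kappa> * (s * u)\<^sup>2 = u\<^sup>2 / 2"
      using assms by (simp add: power_mult_distrib s)
    then show ?thesis
      by (simp add: gauss_def std_normal_density_def ch_def cis_conv_exp mult_ac scaleR_conv_of_real)
  qed
  have t: "(2 * pi * s * c)\<^sup>2 / 2 = pi * c\<^sup>2 / \<kappa>"
    using assms by (simp add: power_mult_distrib s power2_eq_square[of pi] field_simps)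
  have "(LINT x|lborel. gauss \<kappa> (x::real) * ch (x * c)) = s *\<^sub>R (LINT u|lborel. gauss \<kappa> (s * u) * ch (s * u * c))"
    using s by (subst lborel_integral_real_affine[where c = s and t = 0]) auto
  also have "\<dots> = s *\<^sub>R (sqrt (2 * pi) * (LINT u|lborel. std_normal_density u *\<^sub>R iexp ((2 * pi * s * c) * u)))"
    by (simp only: eq integral_mult_right_zero)
  also have "(LINT u|lborel. std_normal_density u *\<^sub>R iexp ((2 * pi * s * c) * u))
      = char std_normal_distribution (2 * pi * s * c)"
    unfolding char_def by (subst integral_density) auto
  also have "\<dots> = exp (- (pi * c\<^sup>2 / \<kappa>))"
    unfolding char_std_normal_distribution using t by simp
  also have "s *\<^sub>R (sqrt (2 * pi) * complex_of_real (exp (- (pi * c\<^sup>2 / \<kappa>)))) = (1 / sqrt \<kappa>) * exp (- (pi * c\<^sup>2 / \<kappa>))"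
    using assms by (simp add: s_def real_sqrt_mult scaleR_conv_of_real field_simps)
  finally show ?thesis .
qed

lemma inverse_fourier_gauss:
  assumes "\<kappa> > 0"
  shows "(LINT x|lborel. gauss \<kappa> (x::'a::euclidean_space) * ch (x \<bullet> c)) = (1 / sqrt \<kappa>) ^ DIM('a) * gauss (1 / \<kappa>) c"
proof -
  have int: "integrable lborel (\<lambda>t::real. complex_of_real (gauss \<kappa> t) * ch (t * (c \<bullet> b)))" for b
    using assms by (intro integrable_mult_ch integrable_of_real integrable_gauss) auto
  have "(LINT x|lborel. gauss \<kappa> (x::'a) * ch (x \<bullet> c))
      = (LINT x|lborel. (\<Prod>b\<in>Basis. gauss \<kappa> ((x::'a) \<bullet> b) * ch ((x \<bullet> b) * (c \<bullet> b))))"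
  proof (intro Bochner_Integration.integral_cong refl)
    fix x :: 'a
    show "gauss \<kappa> x * ch (x \<bullet> c) = (\<Prod>b\<in>Basis. gauss \<kappa> (x \<bullet> b) * ch ((x \<bullet> b) * (c \<bullet> b)))"
      by (simp add: gauss_prod[of \<kappa> x] euclidean_inner[of x c] ch_sum prod.distrib)
  qed
  also have "\<dots> = (\<Prod>b\<in>Basis. (LINT t|lborel. gauss \<kappa> t * ch (t * (c \<bullet> (b::'a)))))"
    by (rule integral_prod_Basis(1)) (rule int)
  also have "\<dots> = (\<Prod>b\<in>(Basis::'a set). complex_of_real (1 / sqrt \<kappa>) * gauss (1 / \<kappa>) (c \<bullet> b))"
    using assms by (intro prod.cong refl) (subst inverse_fourier_gauss_real, auto simp: gauss_def)
  also have "\<dots> = (1 / sqrt \<kappa>) ^ DIM('a) * gauss (1 / \<kappa>) c"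
    by (simp add: prod.distrib gauss_prod[of _ c] del: of_real_divide times_divide_eq_left)
  finally show ?thesis .
qed

lemma integral_gauss:
  assumes "\<kappa> > 0"
  shows "(LINT x|lborel. gauss \<kappa> (x::'a::euclidean_space)) = (1 / sqrt \<kappa>) ^ DIM('a)"
proof -
  have "complex_of_real (LINT x|lborel. gauss \<kappa> (x::'a)) = complex_of_real ((1 / sqrt \<kappa>) ^ DIM('a))"
    using inverse_fourier_gauss[OF assms, of "0::'a"] by (simp add: gauss_def)
  then show ?thesis by (simp only: of_real_eq_iff)
qed

subsection \<open>Directional derivatives\<close>

text \<open>A relation, so that existence and value of the derivative along every line in direction
  \<open>b\<close> are proved together by exhibiting it. \<open>dirderiv_partial\<close> then yields
  \<open>partial\<close>, which by itself carries no existence statement.\<close>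

definition dirderiv :: "'a::euclidean_space \<Rightarrow> ('a \<Rightarrow> complex) \<Rightarrow> ('a \<Rightarrow> complex) \<Rightarrow> bool" where
  "dirderiv b f f' \<longleftrightarrow> (\<forall>x. ((\<lambda>t. f (x + t *\<^sub>R b)) has_vector_derivative f' x) (at 0))"

lemma dirderivD_at:
  assumes "dirderiv b f f'"
  shows "((\<lambda>t. f (x + t *\<^sub>R b)) has_vector_derivative f' (x + t *\<^sub>R b)) (at t)"
proof -
  have 1: "((\<lambda>s. f ((x + t *\<^sub>R b) + s *\<^sub>R b)) has_vector_derivative f' (x + t *\<^sub>R b)) (at (t - t))"
    using assms by (simp add: dirderiv_def)
  have 2: "((\<lambda>s. s - t) has_vector_derivative 1) (at t)"
    by (auto intro!: derivative_eq_intros)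
  from vector_diff_chain_at[OF 2 1] show ?thesis by (simp add: o_def algebra_simps)
qed

lemma dirderiv_partial: "dirderiv b f f' \<Longrightarrow> partial b f = f'"
  by (auto simp: dirderiv_def partial_def intro!: ext vector_derivative_at)

lemma dirderiv_unique: "dirderiv b f f' \<Longrightarrow> dirderiv b f f'' \<Longrightarrow> f' = f''"
  using dirderiv_partial by blast

lemma dirderiv_add: "dirderiv b f f' \<Longrightarrow> dirderiv b g g' \<Longrightarrow> dirderiv b (\<lambda>x. f x + g x) (\<lambda>x. f' x + g' x)"
  by (auto simp: dirderiv_def intro!: derivative_intros)

lemma dirderiv_cmult: "dirderiv b f f' \<Longrightarrow> dirderiv b (\<lambda>x. c * f x) (\<lambda>x. c * f' x)"
  by (auto simp: dirderiv_def intro!: derivative_intros)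

lemma dirderiv_const: "dirderiv b (\<lambda>x. c) (\<lambda>x. 0)"
  by (auto simp: dirderiv_def)

lemma dirderiv_sum:
  "(\<And>i. i \<in> A \<Longrightarrow> dirderiv b (f i) (f' i)) \<Longrightarrow> dirderiv b (\<lambda>x. \<Sum>i\<in>A. f i x) (\<lambda>x. \<Sum>i\<in>A. f' i x)"
  by (auto simp: dirderiv_def intro!: has_vector_derivative_sum)

lemma dirderiv_mult:
  assumes "dirderiv b f f'" "dirderiv b g g'"
  shows "dirderiv b (\<lambda>x. f x * g x) (\<lambda>x. f' x * g x + f x * g' x)"
proof -
  have "((\<lambda>t. f (x + t *\<^sub>R b) * g (x + t *\<^sub>R b)) has_vector_derivative f' x * g x + f x * g' x) (at 0)" for x
    using has_vector_derivative_mult[of "\<lambda>t. f (x + t *\<^sub>R b)" "f' x" 0 UNIV "\<lambda>t. g (x + t *\<^sub>R b)" "g' x"] assms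
    by (simp add: dirderiv_def add.commute)
  then show ?thesis by (simp add: dirderiv_def)
qed

lemma dirderiv_cnj: "dirderiv b f f' \<Longrightarrow> dirderiv b (\<lambda>x. cnj (f x)) (\<lambda>x. cnj (f' x))"
  by (auto simp: dirderiv_def intro!: has_vector_derivative_cnj)

lemma dirderiv_affine:
  assumes "dirderiv b f f'"
  shows "dirderiv b (\<lambda>x. f (a + c *\<^sub>R x)) (\<lambda>x. of_real c * f' (a + c *\<^sub>R x))"
proof -
  have "((\<lambda>t. f (a + c *\<^sub>R (x + t *\<^sub>R b))) has_vector_derivative of_real c * f' (a + c *\<^sub>R x)) (at 0)" for x
  proof -
    have 1: "((\<lambda>t. f ((a + c *\<^sub>R x) + t *\<^sub>R b)) has_vector_derivative f' (a + c *\<^sub>R x)) (at (c * 0))"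
      using assms by (simp add: dirderiv_def)
    have 2: "((\<lambda>t. c * t) has_real_derivative c) (at 0)"
      by (auto intro!: derivative_eq_intros)
    from vector_diff_chain_at[OF 2[unfolded has_real_derivative_iff_has_vector_derivative] 1]
    show ?thesis by (simp add: o_def algebra_simps scaleR_conv_of_real)
  qed
  then show ?thesis by (simp add: dirderiv_def)
qed

lemma dirderiv_ch: "dirderiv b (\<lambda>x. ch (x \<bullet> \<eta>)) (\<lambda>x. 2 * pi * \<i> * (b \<bullet> \<eta>) * ch (x \<bullet> \<eta>))"
proof -
  have "((\<lambda>t. ch ((x + t *\<^sub>R b) \<bullet> \<eta>)) has_vector_derivative 2 * pi * \<i> * (b \<bullet> \<eta>)
      * ch ((x + 0 *\<^sub>R b) \<bullet> \<eta>)) (at 0)" for x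
    by (rule has_vector_derivative_ch) (auto intro!: derivative_eq_intros simp: inner_add_left)
  then show ?thesis by (simp add: dirderiv_def)
qed

text \<open>By translation invariance of Lebesgue measure, the difference quotients of \<open>f\<close> have integral zero.\<close>

lemma integral_dirderiv_eq_0:
  fixes f :: "'a::euclidean_space \<Rightarrow> complex"
  assumes d: "dirderiv b f f'" and f: "integrable lborel f" and f': "integrable lborel f'"
    and cont: "continuous_on UNIV f'"
  shows "(LINT x|lborel. f' x) = 0"
proof -
  have [measurable]: "f \<in> borel_measurable borel" "f' \<in> borel_measurable borel"
    using f f' by (auto dest: borel_measurable_integrable)
  have FTC: "(LINT t|lborel. indicator {0..1} t *\<^sub>R f' (x + t *\<^sub>R b)) = f (x + b) - f x" for x
    by (subst integral_FTC_atLeastAtMost[where F = "\<lambda>t. f (x + t *\<^sub>R b)"])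
      (auto intro!: continuous_on_compose2[OF cont] continuous_intros
        has_vector_derivative_at_within dirderivD_at[OF d])
  have tr: "integrable lborel (\<lambda>x. f' (x + t *\<^sub>R b))" "integrable lborel (\<lambda>x. f (x + t *\<^sub>R b))" for t
    using integrable_lborel_translate[OF f', of "t *\<^sub>R b"] integrable_lborel_translate[OF f, of "t *\<^sub>R b"]
    by (simp_all add: add.commute)
  have tri: "(LINT x|lborel. f' (x + t *\<^sub>R b)) = (LINT x|lborel. f' x)"
      "(LINT x|lborel. f (x + b)) = (LINT x|lborel. f x)"
      "(LINT x|lborel. norm (f' (x + t *\<^sub>R b))) = (LINT x|lborel. norm (f' x))" for t
    using integral_lborel_translate[of f' "t *\<^sub>R b"] integral_lborel_translate[of f b]
      integral_lborel_translate[of "\<lambda>x. norm (f' x)" "t *\<^sub>R b"] by (simp_all add: add.commute)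
  have int: "integrable lborel (\<lambda>(t::real, x). indicator {0..1} t *\<^sub>R f' (x + t *\<^sub>R b))"
  proof (rule integrable_lborel_pairI)
    show "(\<lambda>(t::real, x). indicator {0..1} t *\<^sub>R f' (x + t *\<^sub>R b)) \<in> borel_measurable borel"
      by (simp add: borel_prod[symmetric])
    have "integrable lborel (\<lambda>t::real. indicator {0..1} t * (LINT x|lborel. norm (f' x)))"
      by (intro integrable_mult_left) (simp add: integrable_indicator_iff)
    then show "integrable lborel (\<lambda>t::real. LINT x|lborel.
        norm (case (t, x) of (t, x) \<Rightarrow> indicator {0..1} t *\<^sub>R f' (x + t *\<^sub>R b)))"
      by (simp add: tri)
  qed (simp add: tr)
  \<comment> \<open>The integral of \<open>f'\<close> is replaced by the mean, over t in [0, 1], of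
    the equal integrals of its translates. After exchanging the order, the fundamental theorem of
    calculus leaves the integral of \<open>f (x + b) - f x\<close>.\<close>
  have "(LINT x|lborel. f' x) = (LINT t|lborel. (indicator {0..1} (t::real) *\<^sub>R (LINT x|lborel. f' x)))"
    by (simp add: measure_def)
  also have "\<dots> = (LINT t|lborel. LINT x|lborel. indicator {0..1} (t::real) *\<^sub>R f' (x + t *\<^sub>R b))"
    by (simp add: tri)
  also have "\<dots> = (LINT x|lborel. LINT t|lborel. indicator {0..1} (t::real) *\<^sub>R f' (x + t *\<^sub>R b))"
    using integral_lborel_pair(1,2)[OF int] by simp
  also have "\<dots> = (LINT x|lborel. f (x + b) - f x)"
    by (simp only: FTC)
  also have "\<dots> = 0"
    using tr(2)[of 1] f by (subst Bochner_Integration.integral_diff) (auto simp: tri)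
  finally show ?thesis .
qed

lemma integral_by_parts_dirderiv:
  fixes f g :: "'a::euclidean_space \<Rightarrow> complex"
  assumes "dirderiv b f f'" "dirderiv b g g'"
    and "continuous_on UNIV f" "continuous_on UNIV f'" "continuous_on UNIV g" "continuous_on UNIV g'"
    and "integrable lborel (\<lambda>x. f x * g x)"
    and i: "integrable lborel (\<lambda>x. f' x * g x)" "integrable lborel (\<lambda>x. f x * g' x)"
  shows "(LINT x|lborel. f' x * g x) = - (LINT x|lborel. f x * g' x)"
proof -
  have "(LINT x|lborel. f' x * g x + f x * g' x) = 0"
    by (rule integral_dirderiv_eq_0[OF dirderiv_mult]) (use assms in \<open>auto intro!: continuous_intros\<close>)
  then show ?thesis using i by (simp add: eq_neg_iff_add_eq_0)
qed

section \<open>Derivatives and decay of the Fourier transform\<close>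

lemma norm_inverse_fourier_le: "norm (inverse_fourier f \<eta>) \<le> (LINT x|lborel. norm (f x))"
  unfolding inverse_fourier_ch by (rule order_trans[OF integral_norm_bound]) (simp add: norm_mult)

lemma inverse_fourier_dirderiv:
  assumes "dirderiv b f f'" "continuous_on UNIV f" "continuous_on UNIV f'"
    and "integrable lborel f" "integrable lborel f'"
  shows "inverse_fourier f' \<eta> = - (2 * pi * \<i> * (b \<bullet> \<eta>)) * inverse_fourier f \<eta>"
proof -
  have "inverse_fourier f' \<eta> = - (LINT x|lborel. f x * (2 * pi * \<i> * (b \<bullet> \<eta>) * ch (x \<bullet> \<eta>)))"
    unfolding inverse_fourier_ch
    by (rule integral_by_parts_dirderiv[OF assms(1) dirderiv_ch])
      (use assms integrable_mult_ch[of lborel f "\<lambda>x. x \<bullet> \<eta>"] integrable_mult_ch[of lborel f' "\<lambda>x. x \<bullet> \<eta>"] in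
        \<open>auto intro!: continuous_intros integrable_mult_right simp: mult.left_commute[of "f _"] simp
            del: integrable_mult_right_iff\<close>)
  also have "(LINT x|lborel. f x * (2 * pi * \<i> * (b \<bullet> \<eta>) * ch (x \<bullet> \<eta>))) = 2 * pi * \<i> * (b \<bullet> \<eta>) * inverse_fourier f \<eta>"
    unfolding inverse_fourier_ch by (subst integral_mult_right_zero[symmetric]) (simp add: mult_ac)
  finally show ?thesis by simp
qed

text \<open>\<open>D n\<close> is the n-th derivative of \<open>D 0\<close> in the fixed direction
  \<open>b\<close>. Listing all derivatives explicitly allows repeated integration by parts for
  products, affine substitutions and slices, whose sequences are built from those of the
  ingredients.\<close>

definition dseq :: "'a::euclidean_space \<Rightarrow> (nat \<Rightarrow> 'a \<Rightarrow> complex) \<Rightarrow> bool" where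
  "dseq b D \<longleftrightarrow> (\<forall>n. continuous_on UNIV (D n) \<and> dirderiv b (D n) (D (Suc n)))"

lemma inverse_fourier_dseq:
  assumes "dseq b D" and "\<And>k. k \<le> n \<Longrightarrow> integrable lborel (D k)"
  shows "inverse_fourier (D n) \<eta> = (- (2 * pi * \<i> * (b \<bullet> \<eta>))) ^ n * inverse_fourier (D 0) \<eta>"
  using assms(2)
proof (induction n)
  case (Suc n)
  have "inverse_fourier (D (Suc n)) \<eta> = - (2 * pi * \<i> * (b \<bullet> \<eta>)) * inverse_fourier (D n) \<eta>"
    using assms(1) Suc.prems by (intro inverse_fourier_dirderiv) (auto simp: dseq_def)
  with Suc show ?case by simp
qed simp

text \<open>Both sides are compared with the largest of 1 and the coordinates. Powers of single
  coordinates are what repeated differentiation in one direction produces on the Fourier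
  side.\<close>

lemma one_plus_norm_power_le:
  fixes x :: "'a::euclidean_space"
  shows "(1 + norm x) ^ k \<le> (1 + DIM('a)) ^ k * (1 + (\<Sum>b\<in>Basis. \<bar>x \<bullet> b\<bar> ^ k))"
proof -
  define m where "m = Max (insert 1 ((\<lambda>b. \<bar>x \<bullet> b\<bar>) ` Basis))"
  have m: "1 \<le> m" "\<And>b. b \<in> Basis \<Longrightarrow> \<bar>x \<bullet> b\<bar> \<le> m"
    unfolding m_def by (rule Max_ge; simp)+
  have "m \<in> insert 1 ((\<lambda>b. \<bar>x \<bullet> b\<bar>) ` Basis)" unfolding m_def by (rule Max_in) auto
  then have mk: "m ^ k \<le> 1 + (\<Sum>b\<in>Basis. \<bar>x \<bullet> b\<bar> ^ k)"
    by (auto intro!: sum_nonneg order_trans[OF member_le_sum[of _ Basis "\<lambda>b. \<bar>x \<bullet> b\<bar> ^ k"]])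
  have "norm x \<le> (\<Sum>b\<in>Basis. \<bar>x \<bullet> b\<bar>)" by (rule norm_le_l1)
  also have "\<dots> \<le> (\<Sum>b\<in>(Basis::'a set). m)" using m by (intro sum_mono) auto
  finally have "1 + norm x \<le> (1 + DIM('a)) * m" using m by (simp add: algebra_simps)
  then have "(1 + norm x) ^ k \<le> ((1 + DIM('a)) * m) ^ k" by (intro power_mono) auto
  also have "\<dots> = (1 + DIM('a)) ^ k * m ^ k" by (simp add: power_mult_distrib)
  also have "\<dots> \<le> (1 + DIM('a)) ^ k * (1 + (\<Sum>b\<in>Basis. \<bar>x \<bullet> b\<bar> ^ k))"
    using mk by (intro mult_left_mono) auto
  finally show ?thesis by simp
qed

text \<open>Integration by parts \<open>k\<close> times in each basis direction bounds the
  \<open>k\<close>-th powers of the coordinates of \<eta>, and these bound the weight. The factors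
  \<open>(2 * pi) ^ k\<close> are at least 1 and are dropped.\<close>

lemma inverse_fourier_decay:
  fixes D :: "'a::euclidean_space \<Rightarrow> nat \<Rightarrow> 'a \<Rightarrow> complex"
  assumes D: "\<And>b. b \<in> Basis \<Longrightarrow> dseq b (D b)" "\<And>b. b \<in> Basis \<Longrightarrow> D b 0 = f"
    and int: "\<And>b n. b \<in> Basis \<Longrightarrow> n \<le> k \<Longrightarrow> integrable lborel (D b n)"
  shows "(1 + norm \<eta>) ^ k * norm (inverse_fourier f \<eta>)
    \<le> (1 + DIM('a)) ^ k * ((LINT x|lborel. norm (f x)) + (\<Sum>b\<in>Basis. LINT x|lborel. norm (D b k x)))"
proof -
  have 1: "\<bar>\<eta> \<bullet> b\<bar> ^ k * norm (inverse_fourier f \<eta>) \<le> (LINT x|lborel. norm (D b k x))" if b: "b \<in> Basis" for b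
  proof -
    have "\<bar>\<eta> \<bullet> b\<bar> ^ k * norm (inverse_fourier f \<eta>) \<le> (2 * pi * \<bar>b \<bullet> \<eta>\<bar>) ^ k * norm (inverse_fourier f \<eta>)"
    proof (intro mult_right_mono power_mono)
      have "1 * \<bar>b \<bullet> \<eta>\<bar> \<le> (2 * pi) * \<bar>b \<bullet> \<eta>\<bar>" using pi_gt3 by (intro mult_right_mono) auto
      then show "\<bar>\<eta> \<bullet> b\<bar> \<le> 2 * pi * \<bar>b \<bullet> \<eta>\<bar>" by (simp add: inner_commute)
    qed auto
    also have "\<dots> = norm (inverse_fourier (D b k) \<eta>)"
      by (subst inverse_fourier_dseq[OF D(1)[OF b]])
        (use int b D(2)[OF b] in \<open>auto simp: norm_mult norm_power\<close>)
    also have "\<dots> \<le> (LINT x|lborel. norm (D b k x))" by (rule norm_inverse_fourier_le)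
    finally show ?thesis .
  qed
  have "(1 + norm \<eta>) ^ k * norm (inverse_fourier f \<eta>)
      \<le> ((1 + DIM('a)) ^ k * (1 + (\<Sum>b\<in>Basis. \<bar>\<eta> \<bullet> b\<bar> ^ k))) * norm (inverse_fourier f \<eta>)"
    by (intro mult_right_mono one_plus_norm_power_le) auto
  also have "\<dots> = (1 + DIM('a)) ^ k * (norm (inverse_fourier f \<eta>)
      + (\<Sum>b\<in>Basis. \<bar>\<eta> \<bullet> b\<bar> ^ k * norm (inverse_fourier f \<eta>)))"
    by (simp add: algebra_simps sum_distrib_left)
  also have "\<dots> \<le> (1 + DIM('a)) ^ k * ((LINT x|lborel. norm (f x)) + (\<Sum>b\<in>Basis. LINT x|lborel. norm (D b k x)))"
    using 1 by (intro mult_left_mono add_mono sum_mono norm_inverse_fourier_le) auto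
  finally show ?thesis .
qed

subsection \<open>Parameter integrals\<close>

lemma has_vector_derivative_0_iff:
  fixes f :: "real \<Rightarrow> complex"
  shows "(f has_vector_derivative D) (at 0) \<longleftrightarrow> ((\<lambda>t. (1 / t) *\<^sub>R (f t - f 0)) \<longlongrightarrow> D) (at 0)"
  by (simp add: has_vector_derivative_complex_iff has_field_derivative_iff tendsto_complex_iff)

text \<open>Dominated convergence of the difference quotients along sequences; the mean value
  inequality turns the bound \<open>g\<close> on the derivatives into a bound on the
  quotients.\<close>

lemma has_vector_derivative_integral:
  fixes h :: "'a \<Rightarrow> real \<Rightarrow> complex"
  assumes d: "\<And>y t. ((\<lambda>t. h y t) has_vector_derivative h' y t) (at t)"
    and int: "\<And>t. integrable M (\<lambda>y. h y t)" and meas: "(\<lambda>y. h' y 0) \<in> borel_measurable M"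
    and bnd: "\<And>y t. y \<in> space M \<Longrightarrow> \<bar>t\<bar> \<le> 1 \<Longrightarrow> norm (h' y t) \<le> g y" and g: "integrable M g"
  shows "((\<lambda>t. LINT y|M. h y t) has_vector_derivative (LINT y|M. h' y 0)) (at 0)"
proof -
  have [measurable]: "(\<lambda>y. h y t) \<in> borel_measurable M" for t using int by auto
  have "((\<lambda>t. (1 / t) *\<^sub>R ((LINT y|M. h y t) - (LINT y|M. h y 0))) \<longlongrightarrow> (LINT y|M. h' y 0)) (at 0)"
    unfolding tendsto_at_iff_sequentially
  proof (intro allI impI)
    fix X :: "nat \<Rightarrow> real" assume X: "\<forall>i. X i \<in> UNIV - {0}" "X \<longlonglongrightarrow> 0"
    then have X0: "X i \<noteq> 0" for i by auto
    \<comment> \<open>From \<open>N\<close> on the increments lie in [-1, 1], where \<open>g\<close>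
      is a majorant; the limit is insensitive to the initial segment.\<close>
    have "eventually (\<lambda>i. \<bar>X i\<bar> < 1) sequentially"
      by (rule order_tendstoD(2)[OF tendsto_rabs_zero[OF X(2)]]) simp
    then obtain N where N: "\<And>i. i \<ge> N \<Longrightarrow> \<bar>X i\<bar> < 1" by (auto simp: eventually_sequentially)
    have "(\<lambda>i. LINT y|M. (1 / X (i + N)) *\<^sub>R (h y (X (i + N)) - h y 0)) \<longlonglongrightarrow> (LINT y|M. h' y 0)"
    proof (rule integral_dominated_convergence[where w = g])
      show "AE y in M. (\<lambda>i. (1 / X (i + N)) *\<^sub>R (h y (X (i + N)) - h y 0)) \<longlonglongrightarrow> h' y 0"
      proof (intro AE_I2)
        fix y
        have "((\<lambda>t. (1 / t) *\<^sub>R (h y t - h y 0)) \<longlongrightarrow> h' y 0) (at 0)"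
          using d[of y 0] by (simp add: has_vector_derivative_0_iff)
        then have "(\<lambda>i. (1 / X i) *\<^sub>R (h y (X i) - h y 0)) \<longlonglongrightarrow> h' y 0"
          using X by (auto simp: tendsto_at_iff_sequentially o_def)
        then show "(\<lambda>i. (1 / X (i + N)) *\<^sub>R (h y (X (i + N)) - h y 0)) \<longlonglongrightarrow> h' y 0"
          by (rule LIMSEQ_ignore_initial_segment)
      qed
      show "AE y in M. norm ((1 / X (i + N)) *\<^sub>R (h y (X (i + N)) - h y 0)) \<le> g y" for i
      proof (intro AE_I2)
        fix y assume y: "y \<in> space M"
        let ?t = "X (i + N)"
        have "norm (h y ?t - h y 0) \<le> g y * norm (?t - 0)"
        proof (rule differentiable_bound[where S = "cball 0 1" and f' = "\<lambda>t s. s *\<^sub>R h' y t"])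
          show "(h y has_derivative (\<lambda>s. s *\<^sub>R h' y t)) (at t within cball 0 1)" for t
            using d[of y t] by (auto simp: has_vector_derivative_def intro: has_derivative_at_withinI)
          show "onorm (\<lambda>s. s *\<^sub>R h' y t) \<le> g y" if "t \<in> cball 0 1" for t
          proof (rule onorm_le)
            fix s :: real
            have "norm (h' y t) \<le> g y" using that by (intro bnd[OF y]) (simp add: dist_norm)
            then show "norm (s *\<^sub>R h' y t) \<le> g y * norm s"
              by (simp add: mult.commute[of "g y"] mult_left_mono)
          qed
        qed (use N[of "i + N"] in \<open>auto simp: dist_norm\<close>)
        then show "norm ((1 / ?t) *\<^sub>R (h y ?t - h y 0)) \<le> g y"
          using X0[of "i + N"] by (simp add: divide_le_eq flip: norm_inverse divide_inverse)
      qed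
    qed (use meas g in auto)
    then have "(\<lambda>i. (1 / X (i + N)) *\<^sub>R ((LINT y|M. h y (X (i + N))) - (LINT y|M. h y 0))) \<longlonglongrightarrow> (LINT y|M. h' y 0)"
      using int by simp
    then show "((\<lambda>t. (1 / t) *\<^sub>R ((LINT y|M. h y t) - (LINT y|M. h y 0))) \<circ> X) \<longlonglongrightarrow> (LINT y|M. h' y 0)"
      unfolding o_def by (rule LIMSEQ_offset)
  qed
  then show ?thesis
    by (simp add: has_vector_derivative_0_iff)
qed

text \<open>The majorant may depend on the point: the difference quotients at \<open>x\<close>
  involve only the segment from \<open>x - b\<close> to \<open>x + b\<close>.\<close>

lemma dirderiv_integral:
  fixes h :: "'b \<Rightarrow> 'a::euclidean_space \<Rightarrow> complex"
  assumes d: "\<And>y. dirderiv b (h y) (h' y)"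
    and int: "\<And>x. integrable M (\<lambda>y. h y x)" and meas: "\<And>x. (\<lambda>y. h' y x) \<in> borel_measurable M"
    and bnd: "\<And>x. \<exists>g. integrable M g \<and> (\<forall>y\<in>space M. \<forall>t. \<bar>t\<bar> \<le> 1 \<longrightarrow> norm (h' y (x + t *\<^sub>R b)) \<le> g y)"
  shows "dirderiv b (\<lambda>x. LINT y|M. h y x) (\<lambda>x. LINT y|M. h' y x)"
  unfolding dirderiv_def
proof
  fix x
  from bnd[of x] obtain g where g: "integrable M g" "\<And>y t. y \<in> space M \<Longrightarrow> \<bar>t\<bar> \<le> 1 \<Longrightarrow> norm (h' y (x + t *\<^sub>R b)) \<le> g y"
    by blast
  show "((\<lambda>t. LINT y|M. h y (x + t *\<^sub>R b)) has_vector_derivative (LINT y|M. h' y x)) (at 0)"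
    using has_vector_derivative_integral[of "\<lambda>y t. h y (x + t *\<^sub>R b)" "\<lambda>y t. h' y (x + t *\<^sub>R b)" M g]
      dirderivD_at[OF d] int meas g by simp
qed

subsection \<open>Square integrable functions\<close>

lemma square_integrable_measurable [measurable_dest]:
  "f \<in> square_integrable \<Longrightarrow> f \<in> borel_measurable borel"
  by (simp add: square_integrable_def)

lemma square_integrableI:
  assumes "f \<in> borel_measurable borel" and "integrable lborel (\<lambda>x. (norm (f x))\<^sup>2)"
  shows "f \<in> square_integrable"
  using assms by (simp add: square_integrable_def)

lemma square_integrableD: "f \<in> square_integrable \<Longrightarrow> integrable lborel (\<lambda>x. (norm (f x))\<^sup>2)"
  by (simp add: square_integrable_def)

lemma square_integrable_cmult:
  assumes "f \<in> square_integrable"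
  shows "(\<lambda>x. c * f x) \<in> square_integrable"
  using integrable_mult_right[OF square_integrableD[OF assms], of "(norm c)\<^sup>2"] assms
  by (intro square_integrableI) (auto simp: norm_mult power_mult_distrib)

lemma square_integrable_add:
  assumes "f \<in> square_integrable" "g \<in> square_integrable"
  shows "(\<lambda>x. f x + g x) \<in> square_integrable"
proof (rule square_integrableI)
  have [measurable]: "f \<in> borel_measurable borel" "g \<in> borel_measurable borel"
    using assms by auto
  show "(\<lambda>x. f x + g x) \<in> borel_measurable borel" by measurable
  have "integrable lborel (\<lambda>x. 2 * (norm (f x))\<^sup>2 + 2 * (norm (g x))\<^sup>2)"
    using assms by (intro Bochner_Integration.integrable_add integrable_mult_right square_integrableD)
  then show "integrable lborel (\<lambda>x. (norm (f x + g x))\<^sup>2)"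
  proof (rule Bochner_Integration.integrable_bound)
    have "(norm (f x + g x))\<^sup>2 \<le> 2 * (norm (f x))\<^sup>2 + 2 * (norm (g x))\<^sup>2" for x
    proof -
      have "(norm (f x + g x))\<^sup>2 \<le> (norm (f x) + norm (g x))\<^sup>2"
        by (intro power_mono norm_triangle_ineq) auto
      also have "\<dots> \<le> 2 * (norm (f x))\<^sup>2 + 2 * (norm (g x))\<^sup>2"
        using zero_le_power2[of "norm (f x) - norm (g x)"] by (simp add: power2_sum power2_diff)
      finally show ?thesis .
    qed
    then show "AE x in lborel. norm ((norm (f x + g x))\<^sup>2) \<le> norm (2 * (norm (f x))\<^sup>2 + 2 * (norm (g x))\<^sup>2)"
      by (intro AE_I2) (smt (verit) real_norm_def zero_le_power2)
  qed simp
qed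

lemma square_integrable_diff:
  assumes "f \<in> square_integrable" "g \<in> square_integrable"
  shows "(\<lambda>x. f x - g x) \<in> square_integrable"
  using square_integrable_add[OF assms(1) square_integrable_cmult[OF assms(2), of "-1"]] by simp

lemma square_integrable_bounded:
  assumes f: "integrable lborel f" and B: "\<And>x. norm (f x) \<le> B"
  shows "f \<in> square_integrable"
proof (rule square_integrableI)
  show [measurable]: "f \<in> borel_measurable borel" using f by auto
  have "integrable lborel (\<lambda>x. B * norm (f x))" using f by (intro integrable_mult_right integrable_norm)
  then show "integrable lborel (\<lambda>x. (norm (f x))\<^sup>2)"
  proof (rule Bochner_Integration.integrable_bound)
    have "norm (f x) * norm (f x) \<le> B * norm (f x)" for x by (intro mult_right_mono B) auto
    then show "AE x in lborel. norm ((norm (f x))\<^sup>2) \<le> norm (B * norm (f x))"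
      by (intro AE_I2) (smt (verit) power2_eq_square real_norm_def zero_le_power2)
  qed simp
qed

lemma integrable_mult_square_integrable:
  assumes "f \<in> square_integrable" "g \<in> square_integrable"
  shows "integrable lborel (\<lambda>x. f x * g x)"
proof (rule Bochner_Integration.integrable_bound)
  have [measurable]: "f \<in> borel_measurable borel" "g \<in> borel_measurable borel"
    using assms by auto
  show "integrable lborel (\<lambda>x. (norm (f x))\<^sup>2 + (norm (g x))\<^sup>2)"
    using assms by (intro Bochner_Integration.integrable_add square_integrableD)
  have "norm (f x * g x) \<le> (norm (f x))\<^sup>2 + (norm (g x))\<^sup>2" for x
    using zero_le_power2[of "norm (f x) - norm (g x)"] mult_nonneg_nonneg[OF norm_ge_zero[of "f x"]
        norm_ge_zero[of "g x"]]
    unfolding power2_diff norm_mult by linarith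
  then show "AE x in lborel. norm (f x * g x) \<le> norm ((norm (f x))\<^sup>2 + (norm (g x))\<^sup>2)"
    by (intro AE_I2) (smt (verit) real_norm_def)
  show "(\<lambda>x. f x * g x) \<in> borel_measurable lborel" by measurable
qed

lemma norm2_nonneg [simp]: "0 \<le> norm2 f"
  by (simp add: norm2_def)

lemma norm2_power2: "(norm2 f)\<^sup>2 = (LINT x|lborel. (norm (f x))\<^sup>2)"
  by (simp add: norm2_def)

lemma norm2_leI: "(LINT x|lborel. (norm (f x))\<^sup>2) \<le> c\<^sup>2 \<Longrightarrow> 0 \<le> c \<Longrightarrow> norm2 f \<le> c"
  unfolding norm2_def by (rule real_le_lsqrt) auto

lemma norm2_mono:
  assumes "f \<in> borel_measurable borel" "g \<in> square_integrable" "c \<ge> 0" and le: "\<And>x. norm (f x) \<le> c * norm (g x)"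
  shows "f \<in> square_integrable" "norm2 f \<le> c * norm2 g"
proof -
  have i: "integrable lborel (\<lambda>x. c\<^sup>2 * (norm (g x))\<^sup>2)"
    using assms by (intro integrable_mult_right square_integrableD)
  have le2: "(norm (f x))\<^sup>2 \<le> c\<^sup>2 * (norm (g x))\<^sup>2" for x
    using power_mono[OF le[of x], of 2] by (simp add: power_mult_distrib)
  show f: "f \<in> square_integrable"
    by (rule square_integrableI[OF assms(1) Bochner_Integration.integrable_bound[OF i]])
      (use assms(1) le2 in auto)
  have "(LINT x|lborel. (norm (f x))\<^sup>2) \<le> (LINT x|lborel. c\<^sup>2 * (norm (g x))\<^sup>2)"
    by (rule integral_mono[OF square_integrableD[OF f] i le2])
  also have "\<dots> = (c * norm2 g)\<^sup>2" by (simp add: power_mult_distrib norm2_power2)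
  finally show "norm2 f \<le> c * norm2 g" using assms(3) by (intro norm2_leI) auto
qed

lemma norm2_cmult: "norm2 (\<lambda>x. c * f x) = norm c * norm2 f"
  by (simp add: norm2_def norm_mult power_mult_distrib real_sqrt_mult)

text \<open>The weighted inequality 2ab \<le> t a^2 + b^2/t splits the square of the sum, and t =
  B/A turns the right-hand side into (A + B)^2. The slack \<open>e / 2\<close> in \<open>A\<close>
  and \<open>B\<close> keeps this quotient meaningful when a norm vanishes.\<close>

lemma norm2_triangle:
  assumes f: "f \<in> square_integrable" and g: "g \<in> square_integrable"
  shows "norm2 (\<lambda>x. f x + g x) \<le> norm2 f + norm2 g"
proof (rule field_le_epsilon)
  fix e :: real assume e: "e > 0"
  define A B where "A = norm2 f + e / 2" and "B = norm2 g + e / 2"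
  have A: "A > 0" and B: "B > 0" using e by (auto simp: A_def B_def add_nonneg_pos)
  define t where "t = B / A"
  have t: "t > 0" using A B by (simp add: t_def)
  have pt: "(norm (f x + g x))\<^sup>2 \<le> (1 + t) * (norm (f x))\<^sup>2 + (1 + 1 / t) * (norm (g x))\<^sup>2" for x
  proof -
    have "(norm (f x + g x))\<^sup>2 \<le> (norm (f x) + norm (g x))\<^sup>2"
      by (intro power_mono norm_triangle_ineq) auto
    also have "\<dots> \<le> (1 + t) * (norm (f x))\<^sup>2 + (1 + 1 / t) * (norm (g x))\<^sup>2"
    proof -
      have "0 \<le> (t * norm (f x) - norm (g x))\<^sup>2 / t" using t by simp
      also have "\<dots> = t * (norm (f x))\<^sup>2 + (norm (g x))\<^sup>2 / t - 2 * norm (f x) * norm (g x)"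
        using t by (simp add: power2_eq_square field_simps)
      finally show ?thesis by (simp add: power2_sum algebra_simps)
    qed
    finally show ?thesis .
  qed
  have "(LINT x|lborel. (norm (f x + g x))\<^sup>2)
      \<le> (LINT x|lborel. (1 + t) * (norm (f x))\<^sup>2 + (1 + 1 / t) * (norm (g x))\<^sup>2)"
    using square_integrableD[OF square_integrable_add[OF f g]] square_integrableD[OF f] square_integrableD[OF g] pt
    by (intro integral_mono) auto
  also have "\<dots> = (1 + t) * (norm2 f)\<^sup>2 + (1 + 1 / t) * (norm2 g)\<^sup>2"
    using square_integrableD[OF f] square_integrableD[OF g] by (simp add: norm2_power2)
  also have "\<dots> \<le> (1 + t) * A\<^sup>2 + (1 + 1 / t) * B\<^sup>2"
    using t e by (intro add_mono mult_left_mono power_mono) (auto simp: A_def B_def)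
  also have "\<dots> = (A + B)\<^sup>2" using A B by (simp add: t_def power2_eq_square field_simps)
  finally have "norm2 (\<lambda>x. f x + g x) \<le> A + B" using A B by (intro norm2_leI) auto
  then show "norm2 (\<lambda>x. f x + g x) \<le> norm2 f + norm2 g + e" by (simp add: A_def B_def)
qed

section \<open>Completeness of L^2 and extension of bounded operators\<close>

lemma norm2_minus_commute: "norm2 (\<lambda>x. f x - g x) = norm2 (\<lambda>x. g x - f x)"
  by (simp add: norm2_def norm_minus_commute)

lemma norm2_triangle_diff:
  assumes "f \<in> square_integrable" "g \<in> square_integrable" "h \<in> square_integrable"
  shows "norm2 (\<lambda>x. f x - h x) \<le> norm2 (\<lambda>x. f x - g x) + norm2 (\<lambda>x. g x - h x)"
  using norm2_triangle[OF square_integrable_diff[OF assms(1,2)] square_integrable_diff[OF assms(2,3)]] by simp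

lemma norm2_eq_0_AE:
  assumes "f \<in> square_integrable" "norm2 f \<le> 0"
  shows "AE x in lborel. f x = 0"
proof -
  have "norm2 f = 0" using assms(2) norm2_nonneg[of f] by linarith
  then have "(LINT x|lborel. (norm (f x))\<^sup>2) = 0" using norm2_power2[of f] by simp
  then show ?thesis
    using square_integrableD[OF assms(1)] by (subst (asm) integral_nonneg_eq_0_iff_AE) auto
qed

text \<open>Riesz-Fischer for a rapidly convergent sequence. The weight \<open>4 ^ n\<close> in
  \<open>q\<close> leaves integrals of size \<open>(1/4) ^ n\<close>, so the sum \<open>Q\<close> is
  integrable. Each increment is then at most \<open>(1/2) ^ n * sqrt (Q x)\<close> almost
  everywhere, which gives both pointwise convergence and a majorant for the tails.\<close>

lemma square_integrable_complete:
  assumes f: "\<And>n. f n \<in> square_integrable" and d: "\<And>n. norm2 (\<lambda>x. f (Suc n) x - f n x) \<le> (1/4) ^ n"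
  shows "\<exists>h\<in>square_integrable. (\<lambda>n. norm2 (\<lambda>x. h x - f n x)) \<longlonglongrightarrow> 0"
proof -
  have [measurable]: "f n \<in> borel_measurable borel" for n using f by auto
  define q where "q n x = 4 ^ n * (norm (f (Suc n) x - f n x))\<^sup>2" for n x
  have q0: "0 \<le> q n x" for n x by (simp add: q_def)
  have [measurable]: "q n \<in> borel_measurable borel" for n unfolding q_def by measurable
  have qi: "integrable lborel (q n)" for n
    unfolding q_def using square_integrableD[OF square_integrable_diff[OF f f]] by (intro integrable_mult_right)
  have qle: "(LINT x|lborel. q n x) \<le> (1/4) ^ n" for n
  proof -
    have "(LINT x|lborel. q n x) = 4 ^ n * (norm2 (\<lambda>x. f (Suc n) x - f n x))\<^sup>2"
      by (simp add: q_def norm2_power2)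
    also have "\<dots> \<le> 4 ^ n * ((1/4) ^ n)\<^sup>2" using d by (intro mult_left_mono power_mono) auto
    also have "\<dots> = (1/4) ^ n" by (simp add: power2_eq_square power_divide)
    finally show ?thesis .
  qed
  have sumq: "AE x in lborel. summable (\<lambda>n. q n x)"
  proof -
    have "(\<integral>\<^sup>+x. (\<Sum>n. ennreal (q n x)) \<partial>lborel) = (\<Sum>n. \<integral>\<^sup>+x. ennreal (q n x) \<partial>lborel)"
      by (rule nn_integral_suminf) measurable
    also have "\<dots> \<le> (\<Sum>n. ennreal ((1/4) ^ n))"
      using qle by (intro suminf_le) (auto simp: nn_integral_eq_integral[OF qi] q0 intro!: ennreal_leI)
    also have "\<dots> = ennreal (1 / (1 - 1/4))"
      by (rule suminf_ennreal_eq, simp, rule geometric_sums, simp)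
    also have "\<dots> < \<infinity>" by simp
    finally have "AE x in lborel. (\<Sum>n. ennreal (q n x)) \<noteq> \<infinity>"
      by (intro nn_integral_PInf_AE) auto
    then show ?thesis
      by eventually_elim (auto intro!: summable_suminf_not_top q0)
  qed
  define Q where "Q x = (\<Sum>n. q n x)" for x
  have Qi: "integrable lborel Q"
    unfolding Q_def
  proof (rule integrable_suminf[OF qi])
    show "AE x in lborel. summable (\<lambda>n. norm (q n x))" using sumq by (simp add: q0)
    show "summable (\<lambda>n. LINT x|lborel. norm (q n x))"
      by (rule summable_comparison_test[OF _ summable_geometric[of "1/4 :: real"]])
        (auto simp: q0 qle intro!: exI[of _ 0])
  qed
  \<comment> \<open>On the null set where the sequence diverges \<open>lim\<close> has an arbitrary
    value; the estimates below hold almost everywhere.\<close>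
  define h where "h x = lim (\<lambda>n. f n x)" for x
  have [measurable]: "h \<in> borel_measurable borel" unfolding h_def by measurable
  have bnd: "AE x in lborel. \<forall>n. norm (h x - f n x) \<le> 2 * (1/2) ^ n * sqrt (Q x)"
    using sumq
  proof eventually_elim
    fix x assume s: "summable (\<lambda>n. q n x)"
    have dn: "norm (f (Suc n) x - f n x) \<le> (1/2) ^ n * sqrt (Q x)" for n
    proof -
      have "q n x \<le> Q x" unfolding Q_def using s q0 sum_le_suminf[of "\<lambda>n. q n x" "{n}"] by auto
      then have "sqrt (q n x) \<le> sqrt (Q x)" by simp
      moreover have "sqrt (q n x) = 2 ^ n * norm (f (Suc n) x - f n x)"
        by (simp add: q_def real_sqrt_mult real_sqrt_power)
      ultimately show ?thesis by (simp add: field_simps power_divide)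
    qed
    have sd: "summable (\<lambda>n. norm (f (Suc n) x - f n x))"
      by (rule summable_comparison_test[OF _ summable_mult2[OF summable_geometric[of "1/2 :: real"]]])
        (use dn in \<open>auto intro!: exI[of _ 0]\<close>)
    have part: "(\<Sum>k<m. f (Suc (n + k)) x - f (n + k) x) = f (n + m) x - f n x" for m n
      using sum_lessThan_telescope[of "\<lambda>k. f (n + k) x" m] by simp
    have "convergent (\<lambda>m. \<Sum>k<m. f (Suc k) x - f k x)"
      using summable_norm_cancel[OF sd] by (simp add: summable_iff_convergent)
    then have "convergent (\<lambda>m. (f m x - f 0 x) + f 0 x)"
      using part[of 0] by (intro convergent_add convergent_const) simp
    then have lim: "(\<lambda>m. f m x) \<longlonglongrightarrow> h x" unfolding h_def by (simp add: convergent_LIMSEQ_iff)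
    show "\<forall>n. norm (h x - f n x) \<le> 2 * (1/2) ^ n * sqrt (Q x)"
    proof
      fix n
      have Q0: "0 \<le> Q x" unfolding Q_def using s q0 by (intro suminf_nonneg) auto
      have "norm (f (n + m) x - f n x) \<le> 2 * (1/2) ^ n * sqrt (Q x)" for m
      proof -
        have "norm (f (n + m) x - f n x) \<le> (\<Sum>k<m. norm (f (Suc (n + k)) x - f (n + k) x))"
          unfolding part[symmetric] by (rule norm_sum)
        also have "\<dots> \<le> (\<Sum>k<m. (1/2) ^ (n + k) * sqrt (Q x))" using dn by (intro sum_mono) auto
        also have "\<dots> = (\<Sum>k<m. (1/2) ^ k) * ((1/2) ^ n * sqrt (Q x))"
          by (simp add: sum_distrib_left sum_distrib_right power_add mult_ac)
        also have "\<dots> \<le> 2 * ((1/2) ^ n * sqrt (Q x))"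
          using Q0 by (intro mult_right_mono) (auto simp: sum_gp_strict)
        finally show ?thesis by simp
      qed
      moreover have "(\<lambda>m. norm (f (n + m) x - f n x)) \<longlonglongrightarrow> norm (h x - f n x)"
        using LIMSEQ_ignore_initial_segment[OF lim, of n] by (intro tendsto_intros) (simp add: add.commute)
      ultimately show "norm (h x - f n x) \<le> 2 * (1/2) ^ n * sqrt (Q x)"
        by (intro LIMSEQ_le_const2) auto
    qed
  qed
  have b2: "(norm (h x - f n x))\<^sup>2 \<le> (2 * (1/2) ^ n)\<^sup>2 * Q x"
      if "norm (h x - f n x) \<le> 2 * (1/2) ^ n * sqrt (Q x)" "0 \<le> Q x" for n x
    using power_mono[OF that(1), of 2] that(2) by (simp add: power_mult_distrib)
  have Q0: "AE x in lborel. 0 \<le> Q x"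
    using sumq by eventually_elim (auto simp: Q_def q0 intro!: suminf_nonneg)
  have i: "integrable lborel (\<lambda>x. (norm (h x - f n x))\<^sup>2)"
    and le: "(LINT x|lborel. (norm (h x - f n x))\<^sup>2) \<le> (2 * (1/2) ^ n)\<^sup>2 * (LINT x|lborel. Q x)" for n
  proof -
    have ae: "AE x in lborel. (norm (h x - f n x))\<^sup>2 \<le> (2 * (1/2) ^ n)\<^sup>2 * Q x"
      using bnd Q0 by eventually_elim (rule b2, auto)
    have iQ: "integrable lborel (\<lambda>x. (2 * (1/2) ^ n)\<^sup>2 * Q x)" using Qi by (intro integrable_mult_right)
    show i: "integrable lborel (\<lambda>x. (norm (h x - f n x))\<^sup>2)"
      by (rule Bochner_Integration.integrable_bound[OF iQ]) (use ae in \<open>auto elim!: eventually_mono\<close>)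
    have "(LINT x|lborel. (norm (h x - f n x))\<^sup>2) \<le> (LINT x|lborel. (2 * (1/2) ^ n)\<^sup>2 * Q x)"
      by (rule integral_mono_AE[OF i iQ ae])
    then show "(LINT x|lborel. (norm (h x - f n x))\<^sup>2) \<le> (2 * (1/2) ^ n)\<^sup>2 * (LINT x|lborel. Q x)" by simp
  qed
  have hf: "(\<lambda>x. h x - f n x) \<in> square_integrable" for n using i by (intro square_integrableI) auto
  show ?thesis
  proof
    show "h \<in> square_integrable" using square_integrable_add[OF hf[of 0] f[of 0]] by simp
    have iq0: "0 \<le> (LINT x|lborel. Q x)" using Q0 by (rule integral_nonneg_AE)
    have le2: "norm2 (\<lambda>x. h x - f n x) \<le> 2 * (1/2) ^ n * sqrt (LINT x|lborel. Q x)" for n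
      using le[of n] iq0 by (intro norm2_leI) (auto simp: power_mult_distrib)
    have lim2: "(\<lambda>n. 2 * (1/2) ^ n * sqrt (LINT x|lborel. Q x)) \<longlonglongrightarrow> 2 * 0 * sqrt (LINT x|lborel. Q x)"
      by (intro tendsto_intros LIMSEQ_realpow_zero) auto
    show "(\<lambda>n. norm2 (\<lambda>x. h x - f n x)) \<longlonglongrightarrow> 0"
    proof (rule tendsto_sandwich[where f = "\<lambda>_. 0" and h = "\<lambda>n. 2 * (1/2) ^ n * sqrt (LINT x|lborel. Q x)"])
      show "\<forall>\<^sub>F n in sequentially. norm2 (\<lambda>x. h x - f n x) \<le> 2 * (1/2) ^ n * sqrt (LINT x|lborel. Q x)"
        using le2 by (rule always_eventually[OF allI])
      show "(\<lambda>n. 2 * (1/2) ^ n * sqrt (LINT x|lborel. Q x)) \<longlonglongrightarrow> 0" using lim2 by simp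
      show "\<forall>\<^sub>F n in sequentially. 0 \<le> norm2 (\<lambda>x. h x - f n x)" by simp
    qed simp
  qed
qed

text \<open>\<open>A f\<close> is any square integrable function whose distance to
  \<open>M g\<close> is at most \<open>C\<close> times the distance of \<open>f\<close> to
  \<open>g\<close>, for all \<open>g\<close> in \<open>D\<close>. By density this determines
  \<open>A f\<close> up to a null set, so linearity and agreement with \<open>M\<close> follow from
  the inequality without tracking approximating sequences.\<close>

lemma bounded_extension_square_integrable:
  fixes D :: "('a::euclidean_space \<Rightarrow> complex) set" and M :: "('a \<Rightarrow> complex) \<Rightarrow> 'a \<Rightarrow> complex"
  assumes D: "D \<subseteq> square_integrable" and M: "\<And>f. f \<in> D \<Longrightarrow> M f \<in> square_integrable"
    and Dadd: "\<And>f g. f \<in> D \<Longrightarrow> g \<in> D \<Longrightarrow> (\<lambda>x. f x + g x) \<in> D"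
    and Dcmult: "\<And>c f. f \<in> D \<Longrightarrow> (\<lambda>x. c * f x) \<in> D"
    and Madd: "\<And>f g. f \<in> D \<Longrightarrow> g \<in> D \<Longrightarrow> M (\<lambda>x. f x + g x) = (\<lambda>x. M f x + M g x)"
    and Mcmult: "\<And>c f. f \<in> D \<Longrightarrow> M (\<lambda>x. c * f x) = (\<lambda>x. c * M f x)"
    and bnd: "\<And>f. f \<in> D \<Longrightarrow> norm2 (M f) \<le> C * norm2 f" and C: "C > 0"
    and dense: "\<And>f e. f \<in> square_integrable \<Longrightarrow> e > 0 \<Longrightarrow> \<exists>g\<in>D. norm2 (\<lambda>x. f x - g x) < e"
  shows "\<exists>A. (\<forall>f\<in>square_integrable. A f \<in> square_integrable) \<and>
          (\<forall>f\<in>square_integrable. \<forall>g\<in>square_integrable.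
             AE x in lborel. A (\<lambda>x. f x + g x) x = A f x + A g x) \<and>
          (\<forall>c. \<forall>f\<in>square_integrable. AE x in lborel. A (\<lambda>x. c * f x) x = c * A f x) \<and>
          (\<forall>g\<in>D. AE x in lborel. A g x = M g x) \<and>
          (\<forall>g\<in>square_integrable. norm2 (A g) \<le> C * norm2 g)"
proof -
  have Ddiff: "(\<lambda>x. f x - g x) \<in> D" and Mdiff: "M (\<lambda>x. f x - g x) = (\<lambda>x. M f x - M g x)"
    if "f \<in> D" "g \<in> D" for f g
    using Dadd[OF that(1) Dcmult[OF that(2), of "-1"]] Madd[OF that(1) Dcmult[OF that(2), of "-1"]]
      Mcmult[OF that(2), of "-1"] by simp_all
  have L: "f \<in> square_integrable" if "f \<in> D" for f using D that by auto
  have lip: "norm2 (\<lambda>x. M f x - M g x) \<le> C * norm2 (\<lambda>x. f x - g x)" if "f \<in> D" "g \<in> D" for f g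
    using bnd[OF Ddiff[OF that]] Mdiff[OF that] by simp
  have ex: "\<exists>h\<in>square_integrable. \<forall>g\<in>D. norm2 (\<lambda>x. h x - M g x) \<le> C * norm2 (\<lambda>x. f x - g x)"
    if f: "f \<in> square_integrable" for f
  proof -
    \<comment> \<open>Two errors \<open>\<epsilon> n\<close>, multiplied by \<open>C\<close>, add up
      to the rate \<open>(1/4) ^ n\<close> demanded by
      \<open>square_integrable_complete\<close>.\<close>
    define \<epsilon> where "\<epsilon> n = (1/4) ^ n / (2 * C)" for n
    have \<epsilon>: "\<epsilon> n > 0" "\<epsilon> (Suc n) \<le> \<epsilon> n" "C * (\<epsilon> n + \<epsilon> n) = (1/4) ^ n" for n
      using C by (auto simp: \<epsilon>_def field_simps)
    have "\<forall>n. \<exists>g\<in>D. norm2 (\<lambda>x. f x - g x) < \<epsilon> n"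
      using \<epsilon> by (intro allI dense f) auto
    then obtain g where g: "\<And>n. g n \<in> D" "\<And>n. norm2 (\<lambda>x. f x - g n x) < \<epsilon> n"
      by metis
    have "norm2 (\<lambda>x. M (g (Suc n)) x - M (g n) x) \<le> (1/4) ^ n" for n
    proof -
      have "norm2 (\<lambda>x. g (Suc n) x - g n x) \<le> norm2 (\<lambda>x. g (Suc n) x - f x) + norm2 (\<lambda>x. f x - g n x)"
        by (intro norm2_triangle_diff L g f)
      also have "\<dots> \<le> \<epsilon> n + \<epsilon> n"
        using g(2)[of "Suc n"] g(2)[of n] \<epsilon>(2)[of n] norm2_minus_commute[of "g (Suc n)" f] by linarith
      finally have "C * norm2 (\<lambda>x. g (Suc n) x - g n x) \<le> (1/4) ^ n"
        using C \<epsilon>(3)[of n] mult_left_mono[of _ _ C] by (metis less_imp_le)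
      then show ?thesis using lip[OF g(1)[of "Suc n"] g(1)[of n]] by linarith
    qed
    from square_integrable_complete[of "\<lambda>n. M (g n)", OF M[OF g(1)] this]
    obtain h where h: "h \<in> square_integrable" "(\<lambda>n. norm2 (\<lambda>x. h x - M (g n) x)) \<longlonglongrightarrow> 0" by blast
    have "norm2 (\<lambda>x. h x - M k x) \<le> C * norm2 (\<lambda>x. f x - k x)" if k: "k \<in> D" for k
    proof (rule LIMSEQ_le_const)
      have "(\<lambda>n. (1/4) ^ n / (2 * C)) \<longlonglongrightarrow> 0 / (2 * C)" using C by (intro tendsto_intros LIMSEQ_realpow_zero) auto
      then have "(\<lambda>n. norm2 (\<lambda>x. h x - M (g n) x) + C * (\<epsilon> n + norm2 (\<lambda>x. f x - k x))) \<longlonglongrightarrow> 0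
          + C * (0 + norm2 (\<lambda>x. f x - k x))"
        unfolding \<epsilon>_def using h by (intro tendsto_intros) auto
      then show "(\<lambda>n. norm2 (\<lambda>x. h x - M (g n) x) + C * (\<epsilon> n + norm2 (\<lambda>x. f x - k x))) \<longlonglongrightarrow> C * norm2 (\<lambda>x. f x - k x)"
        by simp
      show "\<exists>N. \<forall>n\<ge>N. norm2 (\<lambda>x. h x - M k x) \<le> norm2 (\<lambda>x. h x - M (g n) x) + C * (\<epsilon> n + norm2 (\<lambda>x. f x - k x))"
      proof (intro exI[of _ 0] allI impI)
        fix n :: nat
        have 1: "norm2 (\<lambda>x. h x - M k x) \<le> norm2 (\<lambda>x. h x - M (g n) x) + norm2 (\<lambda>x. M (g n) x - M k x)"
          by (intro norm2_triangle_diff h M g k)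
        have "norm2 (\<lambda>x. g n x - k x) \<le> norm2 (\<lambda>x. g n x - f x) + norm2 (\<lambda>x. f x - k x)"
          by (intro norm2_triangle_diff L g f k)
        also have "\<dots> \<le> \<epsilon> n + norm2 (\<lambda>x. f x - k x)"
          using g(2)[of n] norm2_minus_commute[of "g n" f] by linarith
        finally have "C * norm2 (\<lambda>x. g n x - k x) \<le> C * (\<epsilon> n + norm2 (\<lambda>x. f x - k x))"
          using C by simp
        then show "norm2 (\<lambda>x. h x - M k x) \<le> norm2 (\<lambda>x. h x - M (g n) x) + C * (\<epsilon> n + norm2 (\<lambda>x. f x - k x))"
          using 1 lip[OF g(1)[of n] k] by linarith
      qed
    qed
    with h show ?thesis by blast
  qed
  define A where "A f = (SOME h. h \<in> square_integrable
      \<and> (\<forall>g\<in>D. norm2 (\<lambda>x. h x - M g x) \<le> C * norm2 (\<lambda>x. f x - g x)))" for f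
  have A: "A f \<in> square_integrable" "\<And>g. g \<in> D \<Longrightarrow> norm2 (\<lambda>x. A f x - M g x) \<le> C * norm2 (\<lambda>x. f x - g x)"
    if "f \<in> square_integrable" for f
    using someI_ex[of "\<lambda>h. h \<in> square_integrable
        \<and> (\<forall>g\<in>D. norm2 (\<lambda>x. h x - M g x) \<le> C * norm2 (\<lambda>x. f x - g x))"] ex[OF that]
    unfolding A_def by blast+
  show ?thesis
  proof (intro exI[of _ A] conjI ballI allI)
    fix f g :: "'a \<Rightarrow> complex" assume f: "f \<in> square_integrable" and g: "g \<in> square_integrable"
    note fg = square_integrable_add[OF f g]
    let ?S = "\<lambda>x. A f x + A g x"
    have S: "?S \<in> square_integrable" by (intro square_integrable_add A f g)
    have "norm2 (\<lambda>x. A (\<lambda>x. f x + g x) x - ?S x) \<le> 0"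
    proof (rule field_le_epsilon)
      fix e :: real assume "e > 0"
      \<comment> \<open>Four errors of size \<open>C * e'\<close> have to add up to
        \<open>e\<close>.\<close>
      define e' where "e' = e / (4 * C)"
      have e': "e' > 0" using \<open>e > 0\<close> C by (simp add: e'_def)
      from dense[OF f e'] dense[OF g e'] obtain k l where k: "k \<in> D" "norm2 (\<lambda>x. f x - k x) < e'"
        and l: "l \<in> D" "norm2 (\<lambda>x. g x - l x) < e'" by blast
      have 1: "norm2 (\<lambda>x. A (\<lambda>x. f x + g x) x - (M k x + M l x)) \<le> C * (e' + e')"
      proof -
        have a: "norm2 (\<lambda>x. A (\<lambda>x. f x + g x) x - M (\<lambda>x. k x + l x) x) \<le> C * norm2 (\<lambda>x. (f x + g x) - (k x + l x))"
          by (intro A fg Dadd k l)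
        have "norm2 (\<lambda>x. (f x + g x) - (k x + l x)) \<le> norm2 (\<lambda>x. f x - k x) + norm2 (\<lambda>x. g x - l x)"
          using norm2_triangle[OF square_integrable_diff[OF f L[OF k(1)]] square_integrable_diff[OF g L[OF l(1)]]]
          by (simp add: algebra_simps)
        also have "\<dots> \<le> e' + e'" using k l by linarith
        finally have "C * norm2 (\<lambda>x. (f x + g x) - (k x + l x)) \<le> C * (e' + e')" using C by simp
        with a show ?thesis using Madd[OF k(1) l(1)] by simp
      qed
      have 2: "norm2 (\<lambda>x. (M k x + M l x) - ?S x) \<le> C * (e' + e')"
      proof -
        have "norm2 (\<lambda>x. (M k x + M l x) - ?S x) \<le> norm2 (\<lambda>x. A f x - M k x) + norm2 (\<lambda>x. A g x - M l x)"
          using norm2_triangle[OF square_integrable_diff[OF A(1)[OF f] M[OF k(1)]]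
              square_integrable_diff[OF A(1)[OF g] M[OF l(1)]]]
          by (subst norm2_minus_commute) (simp add: algebra_simps)
        also have "\<dots> \<le> C * norm2 (\<lambda>x. f x - k x) + C * norm2 (\<lambda>x. g x - l x)"
          by (intro add_mono A f g k l)
        also have "\<dots> \<le> C * e' + C * e'" using k l C by (intro add_mono mult_left_mono) auto
        finally show ?thesis by (simp add: distrib_left)
      qed
      have "norm2 (\<lambda>x. A (\<lambda>x. f x + g x) x - ?S x) \<le> C * (e' + e') + C * (e' + e')"
        by (rule order_trans[OF norm2_triangle_diff add_mono[OF 1 2]])
          (intro A fg S square_integrable_add M k l)+
      also have "\<dots> = e" using C by (simp add: e'_def field_simps)
      finally show "norm2 (\<lambda>x. A (\<lambda>x. f x + g x) x - ?S x) \<le> 0 + e" by simp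
    qed
    from norm2_eq_0_AE[OF square_integrable_diff[OF A(1)[OF fg] S] this]
    show "AE x in lborel. A (\<lambda>x. f x + g x) x = A f x + A g x" by simp
  next
    fix c and f :: "'a \<Rightarrow> complex" assume f: "f \<in> square_integrable"
    note cf = square_integrable_cmult[OF f, of c]
    let ?S = "\<lambda>x. c * A f x"
    have S: "?S \<in> square_integrable" by (intro square_integrable_cmult A f)
    have "norm2 (\<lambda>x. A (\<lambda>x. c * f x) x - ?S x) \<le> 0"
    proof (rule field_le_epsilon)
      fix e :: real assume "e > 0"
      \<comment> \<open>The summand 1 keeps the divisor positive when \<open>c\<close> is 0.\<close>
      define e' where "e' = e / (2 * C * (norm c + 1))"
      have nc: "norm c + 1 > 0" by (simp add: add_nonneg_pos)
      have e': "e' > 0" using \<open>e > 0\<close> C nc by (simp add: e'_def)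
      from dense[OF f e'] obtain k where k: "k \<in> D" "norm2 (\<lambda>x. f x - k x) < e'" by blast
      have 1: "norm2 (\<lambda>x. A (\<lambda>x. c * f x) x - c * M k x) \<le> C * (norm c * norm2 (\<lambda>x. f x - k x))"
        using A(2)[OF cf Dcmult[OF k(1), of c]] Mcmult[OF k(1), of c] norm2_cmult[of c "\<lambda>x. f x - k x"]
        by (simp add: right_diff_distrib)
      have 2: "norm2 (\<lambda>x. c * M k x - ?S x) \<le> norm c * (C * norm2 (\<lambda>x. f x - k x))"
        using mult_left_mono[OF A(2)[OF f k(1)], of "norm c"] norm2_cmult[of c "\<lambda>x. A f x - M k x"]
        by (subst norm2_minus_commute) (simp add: right_diff_distrib)
      have "norm2 (\<lambda>x. A (\<lambda>x. c * f x) x - ?S x) \<le> C * (norm c * norm2 (\<lambda>x. f x - k x))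
          + norm c * (C * norm2 (\<lambda>x. f x - k x))"
        by (rule order_trans[OF norm2_triangle_diff add_mono[OF 1 2]])
          (intro A cf S square_integrable_cmult M k)+
      also have "\<dots> = (2 * C) * (norm c * norm2 (\<lambda>x. f x - k x))" by (simp add: algebra_simps)
      also have "\<dots> \<le> (2 * C) * ((norm c + 1) * e')"
        using k C nc by (intro mult_left_mono mult_mono) auto
      also have "\<dots> = e" using C nc by (simp add: e'_def)
      finally show "norm2 (\<lambda>x. A (\<lambda>x. c * f x) x - ?S x) \<le> 0 + e" by simp
    qed
    from norm2_eq_0_AE[OF square_integrable_diff[OF A(1)[OF cf] S] this]
    show "AE x in lborel. A (\<lambda>x. c * f x) x = c * A f x" by simp
  next
    fix g assume g: "g \<in> D"
    have "norm2 (\<lambda>x. A g x - M g x) \<le> 0" using A(2)[OF L[OF g] g] by (simp add: norm2_def)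
    from norm2_eq_0_AE[OF square_integrable_diff[OF A(1)[OF L[OF g]] M[OF g]] this]
    show "AE x in lborel. A g x = M g x" by simp
  next
    fix g :: "'a \<Rightarrow> complex" assume g: "g \<in> square_integrable"
    from dense[OF g, of 1] obtain k where k: "k \<in> D" by auto
    have "(\<lambda>x. 0) \<in> D" "M (\<lambda>x. 0) = (\<lambda>x. 0)" using Dcmult[OF k, of 0] Mcmult[OF k, of 0] by simp_all
    with A(2)[OF g, of "\<lambda>x. 0"] show "norm2 (A g) \<le> C * norm2 g" by simp
  qed (use A in auto)
qed

lemma measurable_cnj [measurable (raw)]:
  assumes "f \<in> borel_measurable M"
  shows "(\<lambda>x. cnj (f x)) \<in> borel_measurable M"
  by (rule borel_measurable_continuous_on[OF _ assms]) (intro continuous_intros)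

subsection \<open>Plancherel and Parseval on \<open>L\<^sup>1 \<inter> L\<^sup>2\<close>\<close>

lemma integrable_bounded_mult:
  fixes f g :: "'a \<Rightarrow> complex"
  assumes [measurable]: "f \<in> borel_measurable M" and g: "integrable M g" and B: "\<And>x. norm (f x) \<le> B"
  shows "integrable M (\<lambda>x. f x * g x)"
proof (rule Bochner_Integration.integrable_bound)
  show "integrable M (\<lambda>x. B * norm (g x))" using g by (intro integrable_mult_right integrable_norm)
  have "norm (f x * g x) \<le> norm (B * norm (g x))" for x
    using B[of x] by (simp add: norm_mult abs_mult) (intro mult_right_mono, auto)
  then show "AE x in M. norm (f x * g x) \<le> norm (B * norm (g x))" by simp
qed (use g in auto)

lemma inverse_fourier_measurable [measurable]:
  assumes [measurable]: "f \<in> borel_measurable borel"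
  shows "inverse_fourier f \<in> borel_measurable borel"
  unfolding inverse_fourier_ch[abs_def] by measurable

lemma fourier_measurable [measurable]:
  assumes [measurable]: "f \<in> borel_measurable borel"
  shows "fourier f \<in> borel_measurable borel"
  unfolding fourier_ch[abs_def] by measurable

text \<open>Fubini for the kernel \<open>ch (c * (x \<bullet> \<xi>))\<close>. The real factor
  \<open>c\<close> lets one statement serve both signs of the exponent.\<close>

lemma fourier_multiplication:
  fixes p q :: "'a::euclidean_space \<Rightarrow> complex"
  assumes p: "integrable lborel p" and q: "integrable lborel q"
  shows "(LINT x|lborel. (LINT \<xi>|lborel. p \<xi> * ch (c * (x \<bullet> \<xi>))) * q x)
    = (LINT \<xi>|lborel. p \<xi> * (LINT x|lborel. q x * ch (c * (x \<bullet> \<xi>))))"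
proof -
  have [measurable]: "p \<in> borel_measurable borel" "q \<in> borel_measurable borel" using p q by auto
  have int: "integrable lborel (\<lambda>(x, \<xi>). q x * p \<xi> * ch (c * (x \<bullet> \<xi>)))"
    by (rule Bochner_Integration.integrable_bound[OF integrable_lborel_pair_mult[OF q p]])
      (auto simp: norm_mult borel_prod[symmetric])
  have "(LINT x|lborel. (LINT \<xi>|lborel. p \<xi> * ch (c * (x \<bullet> \<xi>))) * q x)
      = (LINT x|lborel. (LINT \<xi>|lborel. q x * p \<xi> * ch (c * (x \<bullet> \<xi>))))"
    by (simp add: mult.assoc mult.commute[of _ "q _"])
  also have "\<dots> = (LINT \<xi>|lborel. (LINT x|lborel. q x * p \<xi> * ch (c * (x \<bullet> \<xi>))))"
    using integral_lborel_pair(1,2)[OF int] by simp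
  also have "\<dots> = (LINT \<xi>|lborel. p \<xi> * (LINT x|lborel. q x * ch (c * (x \<bullet> \<xi>))))"
    by (subst integral_mult_right_zero[symmetric]) (simp add: mult_ac)
  finally show ?thesis .
qed

text \<open>The Fourier transform of \<open>gauss \<kappa>\<close>: a probability density that
  concentrates at 0 as \<kappa> tends to 0, and hence an approximate identity.\<close>

definition heat :: "real \<Rightarrow> 'a::euclidean_space \<Rightarrow> real" where
  "heat \<kappa> x = (1 / sqrt \<kappa>) ^ DIM('a) * gauss (1 / \<kappa>) x"

lemma heat_nonneg [simp]: "\<kappa> > 0 \<Longrightarrow> 0 \<le> heat \<kappa> x"
  by (simp add: heat_def)

lemma heat_minus [simp]: "heat \<kappa> (- x) = heat \<kappa> x"
  by (simp add: heat_def)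

lemma heat_diff_commute: "heat \<kappa> (x - y) = heat \<kappa> (y - x)"
  using heat_minus[of \<kappa> "x - y"] by simp

lemma measurable_heat [measurable (raw)]:
  "f \<in> borel_measurable M \<Longrightarrow> (\<lambda>x. heat \<kappa> (f x)) \<in> borel_measurable M"
  unfolding heat_def by measurable

lemma integrable_heat: "\<kappa> > 0 \<Longrightarrow> integrable lborel (heat \<kappa> :: 'a::euclidean_space \<Rightarrow> real)"
  unfolding heat_def[abs_def] by (intro integrable_mult_right integrable_gauss) simp

lemma integral_heat: "\<kappa> > 0 \<Longrightarrow> (LINT x|lborel. heat \<kappa> (x::'a::euclidean_space)) = 1"
  by (simp add: heat_def[abs_def] integral_gauss real_sqrt_divide flip: power_mult_distrib)

lemma integrable_heat_shift: "\<kappa> > 0 \<Longrightarrow> integrable lborel (\<lambda>x. heat \<kappa> (x - t :: 'a::euclidean_space))"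
  using integrable_lborel_translate[OF integrable_heat, of \<kappa> "- t"] by simp

lemma integral_heat_shift: "\<kappa> > 0 \<Longrightarrow> (LINT x|lborel. heat \<kappa> (x - t :: 'a::euclidean_space)) = 1"
  using integral_lborel_translate[of "heat \<kappa>" "- t"] integral_heat[of \<kappa>] by simp

lemma inverse_fourier_gauss_heat:
  "\<kappa> > 0 \<Longrightarrow> (LINT x|lborel. gauss \<kappa> (x::'a::euclidean_space) * ch (x \<bullet> c)) = heat \<kappa> c"
  by (simp add: inverse_fourier_gauss heat_def)

lemma inverse_fourier_heat:
  assumes "\<kappa> > 0"
  shows "(LINT x|lborel. heat \<kappa> (x::'a::euclidean_space) * ch (x \<bullet> c)) = gauss \<kappa> c"
proof -
  have "(LINT x|lborel. heat \<kappa> (x::'a) * ch (x \<bullet> c))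
      = complex_of_real ((1 / sqrt \<kappa>) ^ DIM('a)) * (LINT x|lborel. gauss (1 / \<kappa>) (x::'a) * ch (x \<bullet> c))"
    by (subst integral_mult_right_zero[symmetric]) (simp add: heat_def mult.assoc)
  also have "\<dots> = complex_of_real ((1 / sqrt \<kappa>) ^ DIM('a) * ((1 / sqrt (1 / \<kappa>)) ^ DIM('a) * gauss \<kappa> c))"
    using assms by (subst inverse_fourier_gauss) auto
  also have "(1 / sqrt \<kappa>) ^ DIM('a) * ((1 / sqrt (1 / \<kappa>)) ^ DIM('a) * gauss \<kappa> c) = gauss \<kappa> c"
    using assms by (simp add: real_sqrt_divide flip: mult.assoc power_mult_distrib)
  finally show ?thesis .
qed

text \<open>The substitution moves the dependence on \<kappa> from the density into the argument of
  \<open>p\<close>, where continuity of \<open>p\<close> can act.\<close>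

lemma integral_heat_rescale:
  fixes p :: "'a::euclidean_space \<Rightarrow> complex"
  assumes "\<kappa> > 0" and [measurable]: "p \<in> borel_measurable borel"
  shows "(LINT \<xi>|lborel. p \<xi> * heat \<kappa> (\<xi> - \<zeta>)) = (LINT u|lborel. p (\<zeta> + sqrt \<kappa> *\<^sub>R u) * gauss 1 u)"
proof -
  have "(LINT \<xi>|lborel. p \<xi> * heat \<kappa> (\<xi> - \<zeta>))
      = \<bar>sqrt \<kappa>\<bar> ^ DIM('a) *\<^sub>R (LINT u|lborel. p (\<zeta> + sqrt \<kappa> *\<^sub>R u) * heat \<kappa> (sqrt \<kappa> *\<^sub>R u))"
    using assms by (subst integral_lborel_affine[where t = \<zeta> and c = "sqrt \<kappa>"]) auto
  also have "\<dots> = (LINT u|lborel. \<bar>sqrt \<kappa>\<bar> ^ DIM('a) *\<^sub>R (p (\<zeta> + sqrt \<kappa> *\<^sub>R u) * heat \<kappa> (sqrt \<kappa> *\<^sub>R u)))"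
    by simp
  also have "\<dots> = (LINT u|lborel. p (\<zeta> + sqrt \<kappa> *\<^sub>R u) * gauss 1 u)"
    using assms by (intro Bochner_Integration.integral_cong refl)
      (simp add: heat_def gauss_def scaleR_conv_of_real power_mult_distrib power_divide)
  finally show ?thesis .
qed

lemma tendsto_integral_heat:
  fixes p :: "'a::euclidean_space \<Rightarrow> complex"
  assumes p: "continuous_on UNIV p" "\<And>x. norm (p x) \<le> B" and \<kappa>: "\<kappa> \<longlonglongrightarrow> 0" "\<And>n. \<kappa> n > 0"
  shows "(\<lambda>n. LINT \<xi>|lborel. p \<xi> * heat (\<kappa> n) (\<xi> - \<zeta>)) \<longlonglongrightarrow> p \<zeta>"
proof -
  have [measurable]: "p \<in> borel_measurable borel" by (rule borel_measurable_continuous_onI[OF p(1)])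
  have "(\<lambda>n. LINT u|lborel. p (\<zeta> + sqrt (\<kappa> n) *\<^sub>R u) * gauss 1 u) \<longlonglongrightarrow> (LINT u|lborel. p \<zeta> * gauss 1 (u::'a))"
  proof (rule integral_dominated_convergence[where w = "\<lambda>u. B * gauss 1 u"])
    show "integrable lborel (\<lambda>u::'a. B * gauss 1 u)" by (intro integrable_mult_right integrable_gauss) simp
    show "AE u in lborel. (\<lambda>n. p (\<zeta> + sqrt (\<kappa> n) *\<^sub>R u) * gauss 1 u) \<longlonglongrightarrow> p \<zeta> * gauss 1 u"
    proof (intro AE_I2)
      fix u :: 'a
      have "(\<lambda>n. \<zeta> + sqrt (\<kappa> n) *\<^sub>R u) \<longlonglongrightarrow> \<zeta> + sqrt 0 *\<^sub>R u" by (intro tendsto_intros \<kappa>)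
      then have "(\<lambda>n. p (\<zeta> + sqrt (\<kappa> n) *\<^sub>R u)) \<longlonglongrightarrow> p (\<zeta> + sqrt 0 *\<^sub>R u)"
        by (rule continuous_on_tendsto_compose[OF p(1)]) auto
      then show "(\<lambda>n. p (\<zeta> + sqrt (\<kappa> n) *\<^sub>R u) * gauss 1 u) \<longlonglongrightarrow> p \<zeta> * gauss 1 u"
        by (intro tendsto_intros) simp
    qed
  qed (auto simp: norm_mult intro!: mult_right_mono p)
  also have "(LINT u|lborel. p \<zeta> * gauss 1 (u::'a)) = p \<zeta>"
    using integral_gauss[of 1, where 'a = 'a] by simp
  finally show ?thesis using \<kappa> by (simp add: integral_heat_rescale)
qed

lemma norm_integral_heat_le:
  fixes p :: "'a::euclidean_space \<Rightarrow> complex"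
  assumes [measurable]: "p \<in> borel_measurable borel" and B: "\<And>x. norm (p x) \<le> B" and \<kappa>: "\<kappa> > 0"
  shows "norm (LINT \<xi>|lborel. p \<xi> * heat \<kappa> (\<xi> - \<zeta>)) \<le> B"
proof -
  have "norm (LINT \<xi>|lborel. p \<xi> * heat \<kappa> (\<xi> - \<zeta>)) \<le> (LINT \<xi>|lborel. norm (p \<xi> * heat \<kappa> (\<xi> - \<zeta>)))"
    by (rule integral_norm_bound)
  also have "\<dots> \<le> (LINT \<xi>|lborel. B * heat \<kappa> (\<xi> - \<zeta>))"
    using \<kappa> B order_trans[OF norm_ge_zero B]
    by (intro integral_mono_AE') (auto simp: norm_mult intro!: integrable_mult_right
        integrable_heat_shift mult_right_mono)
  also have "\<dots> = B" using \<kappa> by (simp add: integral_heat_shift)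
  finally show ?thesis .
qed

lemma cnj_inverse_fourier:
  "cnj (inverse_fourier r x) = (LINT \<zeta>|lborel. cnj (r \<zeta>) * ch (- 1 * (x \<bullet> \<zeta>)))"
proof -
  have "cnj (inverse_fourier r x) = (LINT \<zeta>|lborel. cnj (r \<zeta> * ch (\<zeta> \<bullet> x)))"
    unfolding inverse_fourier_ch by (subst Bochner_Integration.integral_cnj[symmetric]) (simp add: inner_commute)
  then show ?thesis by (simp add: ch_uminus inner_commute)
qed

text \<open>The Gaussian weight makes the exchanges of integrals legitimate for merely integrable
  \<open>p\<close> and \<open>r\<close>. Its transform \<open>heat \<kappa>\<close> replaces
  \<open>p\<close> by a mean around \<zeta>.\<close>

lemma gauss_parseval:
  fixes p r :: "'a::euclidean_space \<Rightarrow> complex"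
  assumes p: "integrable lborel p" and r: "integrable lborel r" and \<kappa>: "\<kappa> > 0"
  shows "(LINT x|lborel. inverse_fourier p x * cnj (inverse_fourier r x) * gauss \<kappa> x)
    = (LINT \<zeta>|lborel. cnj (r \<zeta>) * (LINT \<xi>|lborel. p \<xi> * heat \<kappa> (\<xi> - \<zeta>)))"
proof -
  have [measurable]: "p \<in> borel_measurable borel" "r \<in> borel_measurable borel" using p r by auto
  have g: "integrable lborel (\<lambda>x::'a. complex_of_real (gauss \<kappa> x))"
    using integrable_gauss[OF \<kappa>] by (intro integrable_of_real)
  have i1: "integrable lborel (\<lambda>x. inverse_fourier p x * gauss \<kappa> x)"
    by (rule integrable_bounded_mult[OF _ g norm_inverse_fourier_le]) simp
  have "(LINT x|lborel. inverse_fourier p x * cnj (inverse_fourier r x) * gauss \<kappa> x)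
      = (LINT x|lborel. (LINT \<zeta>|lborel. cnj (r \<zeta>) * ch (- 1 * (x \<bullet> \<zeta>))) * (inverse_fourier p x * gauss \<kappa> x))"
    by (simp only: cnj_inverse_fourier mult_ac)
  also have "\<dots> = (LINT \<zeta>|lborel. cnj (r \<zeta>) * (LINT x|lborel. (inverse_fourier p x * gauss \<kappa> x) * ch (- 1 * (x \<bullet> \<zeta>))))"
    using r i1 by (intro fourier_multiplication) auto
  also have "(\<lambda>\<zeta>. LINT x|lborel. (inverse_fourier p x * gauss \<kappa> x) * ch (- 1 * (x \<bullet> \<zeta>)))
      = (\<lambda>\<zeta>. LINT \<xi>|lborel. p \<xi> * heat \<kappa> (\<xi> - \<zeta>))"
  proof
    fix \<zeta>
    have "(LINT x|lborel. (inverse_fourier p x * gauss \<kappa> x) * ch (- 1 * (x \<bullet> \<zeta>)))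
        = (LINT x|lborel. (LINT \<xi>|lborel. p \<xi> * ch (1 * (x \<bullet> \<xi>))) * (gauss \<kappa> x * ch (- 1 * (x \<bullet> \<zeta>))))"
      by (simp add: inverse_fourier_ch inner_commute mult.assoc)
    also have "\<dots> = (LINT \<xi>|lborel. p \<xi> * (LINT x|lborel. gauss \<kappa> x * ch (- 1 * (x \<bullet> \<zeta>)) * ch (1 * (x \<bullet> \<xi>))))"
      using p g by (intro fourier_multiplication integrable_mult_ch) auto
    also have "\<dots> = (LINT \<xi>|lborel. p \<xi> * (LINT x|lborel. gauss \<kappa> x * ch (x \<bullet> (\<xi> - \<zeta>))))"
      by (simp add: mult.assoc inner_diff_right flip: ch_add)
    also have "\<dots> = (LINT \<xi>|lborel. p \<xi> * heat \<kappa> (\<xi> - \<zeta>))"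
      using \<kappa> by (simp add: inverse_fourier_gauss_heat)
    finally show "(LINT x|lborel. (inverse_fourier p x * gauss \<kappa> x) * ch (- 1 * (x \<bullet> \<zeta>)))
        = (LINT \<xi>|lborel. p \<xi> * heat \<kappa> (\<xi> - \<zeta>))" .
  qed
  finally show ?thesis .
qed

lemma integrable_lborel_shear:
  fixes f :: "'a::euclidean_space \<Rightarrow> real"
  assumes f: "integrable lborel f" and \<kappa>: "\<kappa> > 0"
  shows "integrable lborel (\<lambda>(x, y). f x * heat \<kappa> (y - x))"
    and "integrable lborel (\<lambda>(x, y). f y * heat \<kappa> (y - x))"
proof -
  have [measurable]: "f \<in> borel_measurable borel" using f by auto
  show 1: "integrable lborel (\<lambda>(x, y). f x * heat \<kappa> (y - x))"
    by (rule integrable_lborel_pairI)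
      (use f \<kappa> in \<open>auto simp: borel_prod[symmetric] abs_mult integral_heat_shift intro!:
          integrable_mult_right integrable_heat_shift\<close>)
  from integrable_lborel_swap[OF 1] show "integrable lborel (\<lambda>(x, y). f y * heat \<kappa> (y - x))"
    by (simp add: heat_diff_commute)
qed

lemma of_real_eq_le_norm: "complex_of_real a = z \<Longrightarrow> a \<le> norm z"
  by auto

text \<open>With the weight \<open>gauss \<kappa>\<close> inserted, the squared norm becomes a double integral against the
  probability density \<open>heat \<kappa>\<close>, which is estimated by AM-GM; then \<open>\<kappa>\<close> tends to \<open>0\<close>.\<close>

lemma plancherel_le:
  fixes h :: "'a::euclidean_space \<Rightarrow> complex"
  assumes h: "integrable lborel h" and h2: "h \<in> square_integrable"
  shows "inverse_fourier h \<in> square_integrable" and "norm2 (inverse_fourier h) \<le> norm2 h"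
proof -
  let ?H = "inverse_fourier h"
  have [measurable]: "h \<in> borel_measurable borel" using h by auto
  define I where "I = (LINT x|lborel. (norm (h x))\<^sup>2)"
  note q = square_integrableD[OF h2]
  have le: "(LINT x|lborel. (norm (?H x))\<^sup>2 * gauss \<kappa> x) \<le> I" if \<kappa>: "\<kappa> > 0" for \<kappa>
  proof -
    have "complex_of_real (LINT x|lborel. (norm (?H x))\<^sup>2 * gauss \<kappa> x)
        = (LINT x|lborel. ?H x * cnj (?H x) * gauss \<kappa> x)"
      unfolding integral_complex_of_real[symmetric] by (simp only: of_real_mult complex_norm_square)
    also have "\<dots> = (LINT \<zeta>|lborel. cnj (h \<zeta>) * (LINT \<xi>|lborel. h \<xi> * heat \<kappa> (\<xi> - \<zeta>)))"
      by (rule gauss_parseval[OF h h \<kappa>])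
    finally have "(LINT x|lborel. (norm (?H x))\<^sup>2 * gauss \<kappa> x)
        \<le> norm (LINT \<zeta>|lborel. cnj (h \<zeta>) * (LINT \<xi>|lborel. h \<xi> * heat \<kappa> (\<xi> - \<zeta>)))"
      by (rule of_real_eq_le_norm)
    also have "\<dots> \<le> (LINT \<zeta>|lborel. norm (cnj (h \<zeta>) * (LINT \<xi>|lborel. h \<xi> * heat \<kappa> (\<xi> - \<zeta>))))"
      by (rule integral_norm_bound)
    also have "\<dots> \<le> (LINT \<zeta>|lborel. LINT \<xi>|lborel. (1/2) * ((norm (h \<zeta>))\<^sup>2 * heat \<kappa> (\<xi> - \<zeta>))
        + (1/2) * ((norm (h \<xi>))\<^sup>2 * heat \<kappa> (\<xi> - \<zeta>)))"
    proof (rule integral_mono_AE')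
      note s = integrable_lborel_shear[OF q \<kappa>]
      have i: "integrable lborel (\<lambda>(\<zeta>, \<xi>). (1/2) * ((norm (h \<zeta>))\<^sup>2 * heat \<kappa> (\<xi> - \<zeta>))
          + (1/2) * ((norm (h \<xi>))\<^sup>2 * heat \<kappa> (\<xi> - \<zeta>)))"
        using Bochner_Integration.integrable_add[OF integrable_mult_right[OF s(1), of "1/2"]
            integrable_mult_right[OF s(2), of "1/2"]]
        by (simp add: case_prod_unfold)
      show "integrable lborel (\<lambda>\<zeta>. LINT \<xi>|lborel. (1/2) * ((norm (h \<zeta>))\<^sup>2 * heat \<kappa> (\<xi> - \<zeta>))
          + (1/2) * ((norm (h \<xi>))\<^sup>2 * heat \<kappa> (\<xi> - \<zeta>)))"
        using integral_lborel_pair(3)[OF i] by simp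
      show "AE \<zeta> in lborel. norm (cnj (h \<zeta>) * (LINT \<xi>|lborel. h \<xi> * heat \<kappa> (\<xi> - \<zeta>)))
          \<le> (LINT \<xi>|lborel. (1/2) * ((norm (h \<zeta>))\<^sup>2 * heat \<kappa> (\<xi> - \<zeta>)) + (1/2) * ((norm (h \<xi>))\<^sup>2 * heat \<kappa> (\<xi> - \<zeta>)))"
        using integral_lborel_pair(5)[OF i]
      proof eventually_elim
        fix \<zeta>
        assume ii: "integrable lborel (\<lambda>\<xi>. case (\<zeta>, \<xi>) of (\<zeta>, \<xi>) \<Rightarrow> (1/2)
            * ((norm (h \<zeta>))\<^sup>2 * heat \<kappa> (\<xi> - \<zeta>)) + (1/2) * ((norm (h \<xi>))\<^sup>2 * heat \<kappa> (\<xi> - \<zeta>)))"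
        have "norm (cnj (h \<zeta>) * (LINT \<xi>|lborel. h \<xi> * heat \<kappa> (\<xi> - \<zeta>)))
            = norm (LINT \<xi>|lborel. cnj (h \<zeta>) * (h \<xi> * heat \<kappa> (\<xi> - \<zeta>)))"
          by simp
        also have "\<dots> \<le> (LINT \<xi>|lborel. norm (cnj (h \<zeta>) * (h \<xi> * heat \<kappa> (\<xi> - \<zeta>))))" by (rule integral_norm_bound)
        also have "\<dots> \<le> (LINT \<xi>|lborel. (1/2) * ((norm (h \<zeta>))\<^sup>2 * heat \<kappa> (\<xi> - \<zeta>))
            + (1/2) * ((norm (h \<xi>))\<^sup>2 * heat \<kappa> (\<xi> - \<zeta>)))"
        proof (rule integral_mono_AE')
          show "AE \<xi> in lborel. norm (cnj (h \<zeta>) * (h \<xi> * heat \<kappa> (\<xi> - \<zeta>)))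
              \<le> (1/2) * ((norm (h \<zeta>))\<^sup>2 * heat \<kappa> (\<xi> - \<zeta>)) + (1/2) * ((norm (h \<xi>))\<^sup>2 * heat \<kappa> (\<xi> - \<zeta>))"
          proof (intro AE_I2)
            fix \<xi>
            have "norm (h \<zeta>) * norm (h \<xi>) \<le> (1/2) * (norm (h \<zeta>))\<^sup>2 + (1/2) * (norm (h \<xi>))\<^sup>2"
              using zero_le_power2[of "norm (h \<zeta>) - norm (h \<xi>)"] by (simp add: power2_diff)
            from mult_right_mono[OF this heat_nonneg[OF \<kappa>, of "\<xi> - \<zeta>"]]
            show "norm (cnj (h \<zeta>) * (h \<xi> * heat \<kappa> (\<xi> - \<zeta>)))
              \<le> (1/2) * ((norm (h \<zeta>))\<^sup>2 * heat \<kappa> (\<xi> - \<zeta>)) + (1/2) * ((norm (h \<xi>))\<^sup>2 * heat \<kappa> (\<xi> - \<zeta>))"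
              using \<kappa> by (simp add: norm_mult algebra_simps)
          qed
        qed (use ii \<kappa> in \<open>auto intro!: add_nonneg_nonneg\<close>)
        finally show "norm (cnj (h \<zeta>) * (LINT \<xi>|lborel. h \<xi> * heat \<kappa> (\<xi> - \<zeta>)))
          \<le> (LINT \<xi>|lborel. (1/2) * ((norm (h \<zeta>))\<^sup>2 * heat \<kappa> (\<xi> - \<zeta>)) + (1/2) * ((norm (h \<xi>))\<^sup>2 * heat \<kappa> (\<xi> - \<zeta>)))" .
      qed
    qed (use \<kappa> in \<open>auto intro!: AE_I2 integral_nonneg_AE add_nonneg_nonneg\<close>)
    also have "\<dots> = (LINT z|lborel. (1/2) * (case z of (\<zeta>, \<xi>) \<Rightarrow> (norm (h \<zeta>))\<^sup>2 * heat \<kappa> (\<xi> - \<zeta>))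
        + (1/2) * (case z of (\<zeta>, \<xi>) \<Rightarrow> (norm (h \<xi>))\<^sup>2 * heat \<kappa> (\<xi> - \<zeta>)))"
    proof -
      note s = integrable_lborel_shear[OF q \<kappa>]
      have i: "integrable lborel (\<lambda>z. (1/2) * (case z of (\<zeta>, \<xi>) \<Rightarrow> (norm (h \<zeta>))\<^sup>2 * heat \<kappa> (\<xi> - \<zeta>))
          + (1/2) * (case z of (\<zeta>, \<xi>) \<Rightarrow> (norm (h \<xi>))\<^sup>2 * heat \<kappa> (\<xi> - \<zeta>)))"
        using s by (intro Bochner_Integration.integrable_add integrable_mult_right)
      show ?thesis using integral_lborel_pair(1)[OF i] by simp
    qed
    also have "\<dots> = (1/2) * (LINT \<zeta>|lborel. LINT \<xi>|lborel. (norm (h \<zeta>))\<^sup>2 * heat \<kappa> (\<xi> - \<zeta>))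
        + (1/2) * (LINT \<xi>|lborel. LINT \<zeta>|lborel. (norm (h \<xi>))\<^sup>2 * heat \<kappa> (\<zeta> - \<xi>))"
    proof -
      note s = integrable_lborel_shear[OF q \<kappa>]
      have "(LINT z|lborel. (1/2) * (case z of (\<zeta>, \<xi>) \<Rightarrow> (norm (h \<zeta>))\<^sup>2 * heat \<kappa> (\<xi> - \<zeta>))
          + (1/2) * (case z of (\<zeta>, \<xi>) \<Rightarrow> (norm (h \<xi>))\<^sup>2 * heat \<kappa> (\<xi> - \<zeta>)))
          = (1/2) * (LINT z|lborel. (case z of (\<zeta>, \<xi>) \<Rightarrow> (norm (h \<zeta>))\<^sup>2 * heat \<kappa> (\<xi> - \<zeta>))) + (1/2)
              * (LINT z|lborel. (case z of (\<zeta>, \<xi>) \<Rightarrow> (norm (h \<xi>))\<^sup>2 * heat \<kappa> (\<xi> - \<zeta>)))"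
        using s by (subst Bochner_Integration.integral_add) (auto intro!: integrable_mult_right)
      also have "(LINT z|lborel. (case z of (\<zeta>, \<xi>) \<Rightarrow> (norm (h \<zeta>))\<^sup>2 * heat \<kappa> (\<xi> - \<zeta>)))
          = (LINT \<zeta>|lborel. LINT \<xi>|lborel. (norm (h \<zeta>))\<^sup>2 * heat \<kappa> (\<xi> - \<zeta>))"
        by (subst integral_lborel_pair(1)[OF s(1), symmetric]) (simp only: prod.case)
      also have "(LINT z|lborel. (case z of (\<zeta>, \<xi>) \<Rightarrow> (norm (h \<xi>))\<^sup>2 * heat \<kappa> (\<xi> - \<zeta>)))
          = (LINT \<xi>|lborel. LINT \<zeta>|lborel. (norm (h \<xi>))\<^sup>2 * heat \<kappa> (\<xi> - \<zeta>))"
        by (subst integral_lborel_pair(2)[OF s(2), symmetric]) (simp only: prod.case)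
      finally show ?thesis by (simp only: heat_diff_commute)
    qed
    also have "\<dots> = I"
      using \<kappa> by (simp add: integral_heat_shift I_def)
    finally show ?thesis .
  qed
  let ?f = "\<lambda>n x. (norm (?H x))\<^sup>2 * gauss (1 / real (Suc n)) x"
  have nn: "(\<integral>\<^sup>+x. ennreal (?f n x) \<partial>lborel) \<le> ennreal I" for n
  proof -
    have "integrable lborel (\<lambda>x. (complex_of_real (norm (?H x)))\<^sup>2 * complex_of_real (gauss (1 / real (Suc n)) x))"
    proof (rule integrable_bounded_mult)
      show "norm ((complex_of_real (norm (?H x)))\<^sup>2) \<le> (LINT x|lborel. norm (h x))\<^sup>2" for x
        by (simp add: norm_power power_mono norm_inverse_fourier_le)
    qed (auto intro!: integrable_of_real integrable_gauss)
    then have "integrable lborel (\<lambda>x. complex_of_real (?f n x))" by simp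
    then have "integrable lborel (\<lambda>x. Re (complex_of_real (?f n x)))" by (rule integrable_Re)
    then have "integrable lborel (?f n)" by (simp only: Re_complex_of_real)
    then show ?thesis
      by (subst nn_integral_eq_integral) (auto intro!: ennreal_leI le)
  qed
  \<comment> \<open>The weights increase to 1, so monotone convergence applies without prior
    knowledge that \<open>?H\<close> is square integrable.\<close>
  have inc: "incseq (\<lambda>n x. ennreal (?f n x))"
  proof (rule incseq_SucI, rule le_funI, rule ennreal_leI)
    fix n and x :: 'a
    have "1 / real (Suc (Suc n)) * (norm x)\<^sup>2 \<le> 1 / real (Suc n) * (norm x)\<^sup>2"
      by (intro mult_right_mono) (auto simp: field_simps)
    then have "gauss (1 / real (Suc n)) x \<le> gauss (1 / real (Suc (Suc n))) x"
      unfolding gauss_def by (simp only: exp_le_cancel_iff neg_le_iff_le mult.assoc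
          mult_le_cancel_left_pos[OF pi_gt_zero])
    then show "?f n x \<le> ?f (Suc n) x" by (rule mult_left_mono) simp
  qed
  have lim: "(\<lambda>n. ennreal (?f n x)) \<longlonglongrightarrow> ennreal ((norm (?H x))\<^sup>2)" for x
  proof (rule tendsto_ennrealI)
    have "(\<lambda>n. 1 / real (Suc n)) \<longlonglongrightarrow> 0" by (rule LIMSEQ_Suc[OF lim_1_over_n])
    then have "(\<lambda>n. ?f n x) \<longlonglongrightarrow> (norm (?H x))\<^sup>2 * exp (- (pi * 0 * (norm x)\<^sup>2))"
      unfolding gauss_def by (intro tendsto_intros)
    then show "(\<lambda>n. ?f n x) \<longlonglongrightarrow> (norm (?H x))\<^sup>2" by simp
  qed
  have "(\<lambda>n. \<integral>\<^sup>+x. ennreal (?f n x) \<partial>lborel) \<longlonglongrightarrow> (\<integral>\<^sup>+x. ennreal ((norm (?H x))\<^sup>2) \<partial>lborel)"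
    by (rule nn_integral_LIMSEQ[OF inc _ lim]) simp
  then have *: "(\<integral>\<^sup>+x. ennreal ((norm (?H x))\<^sup>2) \<partial>lborel) \<le> ennreal I"
    by (rule LIMSEQ_le_const2) (use nn in auto)
  show H: "?H \<in> square_integrable"
    by (rule square_integrableI) (auto intro!: integrableI_bounded order_le_less_trans[OF *])
  show "norm2 ?H \<le> norm2 h"
  proof (rule norm2_leI)
    have I0: "0 \<le> I" by (simp add: I_def)
    have "ennreal (LINT x|lborel. (norm (?H x))\<^sup>2) \<le> ennreal I"
      using * square_integrableD[OF H] by (subst (asm) nn_integral_eq_integral) auto
    then show "(LINT x|lborel. (norm (?H x))\<^sup>2) \<le> (norm2 h)\<^sup>2"
      using I0 by (simp add: ennreal_le_iff norm2_power2 I_def)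
  qed simp
qed

lemma square_integrable_reflect:
  assumes "f \<in> square_integrable"
  shows "(\<lambda>x. f (- x)) \<in> square_integrable" "norm2 (\<lambda>x. f (- x)) = norm2 f"
proof -
  have [measurable]: "f \<in> borel_measurable borel" using assms by auto
  show "(\<lambda>x. f (- x)) \<in> square_integrable"
    using integrable_lborel_reflect[OF square_integrableD[OF assms], of 0] by (intro square_integrableI) auto
  show "norm2 (\<lambda>x. f (- x)) = norm2 f"
    using integral_lborel_reflect[of "\<lambda>x. (norm (f x))\<^sup>2" 0] by (simp add: norm2_def)
qed

lemma plancherel_fourier_le:
  assumes "integrable lborel h" and "h \<in> square_integrable"
  shows "fourier h \<in> square_integrable" and "norm2 (fourier h) \<le> norm2 h"
  using square_integrable_reflect[OF plancherel_le(1)[OF assms]] plancherel_le(2)[OF assms]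
  by (simp_all add: fourier_eq_inverse_fourier[abs_def])

text \<open>The limit \<kappa> \<rightarrow> 0 in \<open>gauss_parseval\<close>. On the left,
  Plancherel provides an integrable majorant; on the right, the means of the bounded continuous
  function \<open>p\<close> converge pointwise.\<close>

lemma parseval:
  fixes p r :: "'a::euclidean_space \<Rightarrow> complex"
  assumes p: "integrable lborel p" "continuous_on UNIV p" "\<And>x. norm (p x) \<le> B"
    and r: "integrable lborel r" "r \<in> square_integrable"
  shows "(LINT x|lborel. inverse_fourier p x * cnj (inverse_fourier r x)) = (LINT \<zeta>|lborel. p \<zeta> * cnj (r \<zeta>))"
proof (rule LIMSEQ_unique)
  define \<kappa> where "\<kappa> n = 1 / real (Suc n)" for n
  have \<kappa>: "\<kappa> \<longlonglongrightarrow> 0" "\<kappa> n > 0" for n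
    unfolding \<kappa>_def by (rule LIMSEQ_Suc[OF lim_1_over_n]) auto
  have [measurable]: "p \<in> borel_measurable borel" "r \<in> borel_measurable borel" using p r by auto
  have p2: "p \<in> square_integrable" by (rule square_integrable_bounded[OF p(1,3)])
  have cr: "(\<lambda>x. cnj (inverse_fourier r x)) \<in> square_integrable"
    using square_integrableD[OF plancherel_le(1)[OF r]]
    by (intro square_integrableI measurable_cnj inverse_fourier_measurable) auto
  note int = integrable_mult_square_integrable[OF plancherel_le(1)[OF p(1) p2] cr]
  show "(\<lambda>n. LINT x|lborel. inverse_fourier p x * cnj (inverse_fourier r x) * gauss (\<kappa> n) x)
      \<longlonglongrightarrow> (LINT x|lborel. inverse_fourier p x * cnj (inverse_fourier r x))"
  proof (rule integral_dominated_convergence[where w = "\<lambda>x. norm (inverse_fourier p x * cnj (inverse_fourier r x))"])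
    show "AE x in lborel. (\<lambda>n. inverse_fourier p x * cnj (inverse_fourier r x) * gauss (\<kappa> n) x)
        \<longlonglongrightarrow> inverse_fourier p x * cnj (inverse_fourier r x)"
    proof (intro AE_I2)
      fix x :: 'a
      have "(\<lambda>n. exp (- (pi * \<kappa> n * (norm x)\<^sup>2))) \<longlonglongrightarrow> exp (- (pi * 0 * (norm x)\<^sup>2))"
        by (intro tendsto_intros \<kappa>)
      then have "(\<lambda>n. inverse_fourier p x * cnj (inverse_fourier r x) * complex_of_real (gauss (\<kappa> n) x))
        \<longlonglongrightarrow> inverse_fourier p x * cnj (inverse_fourier r x) * of_real (exp (- (pi * 0 * (norm x)\<^sup>2)))"
        unfolding gauss_def by (intro tendsto_mult tendsto_of_real tendsto_const)
      then show "(\<lambda>n. inverse_fourier p x * cnj (inverse_fourier r x) * gauss (\<kappa> n) x)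
        \<longlonglongrightarrow> inverse_fourier p x * cnj (inverse_fourier r x)" by simp
    qed
    have "gauss (\<kappa> n) x \<le> 1" for n and x :: 'a
      using \<kappa>(2)[of n] by (simp add: gauss_def)
    then show "AE x in lborel. norm (inverse_fourier p x * cnj (inverse_fourier r x) * gauss (\<kappa> n) x)
        \<le> norm (inverse_fourier p x * cnj (inverse_fourier r x))" for n
      by (intro AE_I2) (simp add: norm_mult mult_left_le)
  qed (use int in auto)
  have "(\<lambda>n. LINT \<zeta>|lborel. cnj (r \<zeta>) * (LINT \<xi>|lborel. p \<xi> * heat (\<kappa> n) (\<xi> - \<zeta>))) \<longlonglongrightarrow> (LINT \<zeta>|lborel. cnj (r \<zeta>) * p \<zeta>)"
  proof (rule integral_dominated_convergence[where w = "\<lambda>\<zeta>. norm (r \<zeta>) * B"])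
    show "AE \<zeta> in lborel. (\<lambda>n. cnj (r \<zeta>) * (LINT \<xi>|lborel. p \<xi> * heat (\<kappa> n) (\<xi> - \<zeta>))) \<longlonglongrightarrow> cnj (r \<zeta>) * p \<zeta>"
      by (intro AE_I2 tendsto_intros tendsto_integral_heat[OF p(2,3) \<kappa>])
    show "AE \<zeta> in lborel. norm (cnj (r \<zeta>) * (LINT \<xi>|lborel. p \<xi> * heat (\<kappa> n) (\<xi> - \<zeta>))) \<le> norm (r \<zeta>) * B" for n
      by (intro AE_I2) (auto simp: norm_mult intro!: mult_left_mono norm_integral_heat_le p \<kappa>)
  qed (use r in auto)
  then show "(\<lambda>n. LINT x|lborel. inverse_fourier p x * cnj (inverse_fourier r x) * gauss (\<kappa> n) x)
      \<longlonglongrightarrow> (LINT \<zeta>|lborel. p \<zeta> * cnj (r \<zeta>))"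
    by (simp only: gauss_parseval[OF p(1) r(1) \<kappa>(2)] mult.commute[of "p _"])
qed

subsection \<open>Density and Fourier multipliers on \<open>L\<^sup>2\<close>\<close>

text \<open>On these functions a bounded multiplier acts by an absolutely convergent integral, and
  Plancherel applies to the function and to its multiplied transform. They form a dense subspace of
  L^2 containing the Schwartz space.\<close>

definition fourier_nice :: "('a::euclidean_space \<Rightarrow> complex) set" where
  "fourier_nice = {f. integrable lborel f \<and> f \<in> square_integrable \<and> integrable lborel (fourier f)}"

lemma heat_convolution_fourier:
  fixes f :: "'a::euclidean_space \<Rightarrow> complex"
  assumes f: "integrable lborel f" and \<kappa>: "\<kappa> > 0"
  shows "(LINT \<xi>|lborel. f \<xi> * heat \<kappa> (\<xi> - x)) = inverse_fourier (\<lambda>\<xi>. fourier f \<xi> * gauss \<kappa> \<xi>) x"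
proof -
  have g: "integrable lborel (\<lambda>x::'a. complex_of_real (gauss \<kappa> x))"
    using integrable_gauss[OF \<kappa>] by (intro integrable_of_real)
  have "inverse_fourier (\<lambda>\<xi>. fourier f \<xi> * gauss \<kappa> \<xi>) x
      = (LINT \<xi>|lborel. (LINT y|lborel. f y * ch (- 1 * (\<xi> \<bullet> y))) * (gauss \<kappa> \<xi> * ch (\<xi> \<bullet> x)))"
    by (simp add: inverse_fourier_ch fourier_ch inner_commute mult.assoc)
  also have "\<dots> = (LINT y|lborel. f y * (LINT \<xi>|lborel. gauss \<kappa> \<xi> * ch (\<xi> \<bullet> x) * ch (- 1 * (\<xi> \<bullet> y))))"
    using f g by (intro fourier_multiplication integrable_mult_ch) auto
  also have "\<dots> = (LINT y|lborel. f y * (LINT \<xi>|lborel. gauss \<kappa> \<xi> * ch (\<xi> \<bullet> (x - y))))"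
    by (simp add: mult.assoc inner_diff_right flip: ch_add)
  also have "\<dots> = (LINT y|lborel. f y * heat \<kappa> (y - x))"
    using \<kappa> by (simp add: inverse_fourier_gauss_heat heat_diff_commute[of \<kappa> x])
  finally show ?thesis by simp
qed

lemma integrable_heat_convolution:
  fixes f :: "'a::euclidean_space \<Rightarrow> complex"
  assumes f: "integrable lborel f" and \<kappa>: "\<kappa> > 0"
  shows "integrable lborel (\<lambda>(\<xi>, x). f \<xi> * heat \<kappa> (\<xi> - x))"
proof (rule Bochner_Integration.integrable_bound)
  have [measurable]: "f \<in> borel_measurable borel" using f by auto
  show "integrable lborel (\<lambda>(\<xi>, x). norm (f \<xi>) * heat \<kappa> (x - \<xi>))"
    using integrable_lborel_shear(1)[OF integrable_norm[OF f] \<kappa>] by simp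
  show "AE x in lborel. norm (case x of (\<xi>, x) \<Rightarrow> f \<xi> * complex_of_real (heat \<kappa> (\<xi> - x)))
      \<le> norm (case x of (\<xi>, x) \<Rightarrow> norm (f \<xi>) * heat \<kappa> (x - \<xi>))"
    using \<kappa> by (auto simp: norm_mult heat_diff_commute[of \<kappa>] abs_mult)
qed (use f in \<open>auto simp: borel_prod[symmetric]\<close>)

lemma fourier_heat_convolution:
  fixes f :: "'a::euclidean_space \<Rightarrow> complex"
  assumes f: "integrable lborel f" and \<kappa>: "\<kappa> > 0"
  shows "fourier (\<lambda>x. LINT \<xi>|lborel. f \<xi> * heat \<kappa> (\<xi> - x)) \<eta> = fourier f \<eta> * gauss \<kappa> \<eta>"
proof -
  have [measurable]: "f \<in> borel_measurable borel" using f by auto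
  have i: "integrable lborel (\<lambda>(\<xi>, x). f \<xi> * heat \<kappa> (\<xi> - x) * ch (- (x \<bullet> \<eta>)))"
    by (rule Bochner_Integration.integrable_bound[OF integrable_heat_convolution[OF f \<kappa>]])
      (auto simp: norm_mult borel_prod[symmetric])
  have "fourier (\<lambda>x. LINT \<xi>|lborel. f \<xi> * heat \<kappa> (\<xi> - x)) \<eta>
      = (LINT x|lborel. LINT \<xi>|lborel. f \<xi> * heat \<kappa> (\<xi> - x) * ch (- (x \<bullet> \<eta>)))"
    by (simp add: fourier_ch)
  also have "\<dots> = (LINT \<xi>|lborel. LINT x|lborel. f \<xi> * heat \<kappa> (\<xi> - x) * ch (- (x \<bullet> \<eta>)))"
    using integral_lborel_pair(1,2)[OF i] by simp
  also have "\<dots> = (LINT \<xi>|lborel. f \<xi> * ch (- (\<xi> \<bullet> \<eta>)) * gauss \<kappa> \<eta>)"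
  proof (intro Bochner_Integration.integral_cong refl)
    fix \<xi>
    have "(LINT x|lborel. f \<xi> * heat \<kappa> (\<xi> - x) * ch (- (x \<bullet> \<eta>)))
        = (LINT x|lborel. f \<xi> * heat \<kappa> (\<xi> - (\<xi> - x)) * ch (- ((\<xi> - x) \<bullet> \<eta>)))"
      by (rule integral_lborel_reflect[symmetric]) measurable
    also have "\<dots> = (LINT x|lborel. (f \<xi> * ch (- (\<xi> \<bullet> \<eta>))) * (heat \<kappa> x * ch (x \<bullet> \<eta>)))"
      by (intro Bochner_Integration.integral_cong refl) (simp add: inner_diff_left ch_add[symmetric])
    also have "\<dots> = f \<xi> * ch (- (\<xi> \<bullet> \<eta>)) * gauss \<kappa> \<eta>"
      using \<kappa> by (simp add: inverse_fourier_heat)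
    finally show "(LINT x|lborel. f \<xi> * heat \<kappa> (\<xi> - x) * ch (- (x \<bullet> \<eta>))) = f \<xi> * ch (- (\<xi> \<bullet> \<eta>)) * gauss \<kappa> \<eta>" .
  qed
  also have "\<dots> = fourier f \<eta> * gauss \<kappa> \<eta>" by (simp add: fourier_ch)
  finally show ?thesis .
qed

lemma norm_fourier_le: "norm (fourier f \<eta>) \<le> (LINT x|lborel. norm (f x))"
  by (simp add: fourier_eq_inverse_fourier norm_inverse_fourier_le)

text \<open>Smoothing multiplies the transform by \<open>gauss \<kappa>\<close>. This makes it
  integrable, and as the factor is at most 1 the norm does not grow.\<close>

lemma heat_convolution_fourier_nice:
  fixes f :: "'a::euclidean_space \<Rightarrow> complex"
  assumes f: "integrable lborel f" "f \<in> square_integrable" and \<kappa>: "\<kappa> > 0"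
  shows "(\<lambda>x. LINT \<xi>|lborel. f \<xi> * heat \<kappa> (\<xi> - x)) \<in> fourier_nice"
    and "norm2 (\<lambda>x. LINT \<xi>|lborel. f \<xi> * heat \<kappa> (\<xi> - x)) \<le> norm2 f"
proof -
  let ?c = "\<lambda>x. LINT \<xi>|lborel. f \<xi> * heat \<kappa> (\<xi> - x)" and ?h = "\<lambda>\<xi>. fourier f \<xi> * gauss \<kappa> \<xi>"
  have [measurable]: "f \<in> borel_measurable borel" using f by auto
  have eq: "?c = inverse_fourier ?h" using heat_convolution_fourier[OF f(1) \<kappa>] by blast
  have h1: "integrable lborel ?h"
    by (rule integrable_bounded_mult[OF _ integrable_of_real[OF integrable_gauss[OF \<kappa>]] norm_fourier_le]) simp
  have g1: "gauss \<kappa> x \<le> 1" for x :: 'a using \<kappa> by (simp add: gauss_def)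
  have h2: "?h \<in> square_integrable" "norm2 ?h \<le> 1 * norm2 (fourier f)"
    using norm2_mono[OF _ plancherel_fourier_le(1)[OF f], of ?h 1] by (simp_all add: norm_mult mult_left_le g1)
  have c1: "integrable lborel ?c"
    using integral_lborel_pair(4)[OF integrable_heat_convolution[OF f(1) \<kappa>]] by simp
  have c2: "?c \<in> square_integrable" unfolding eq by (rule plancherel_le(1)[OF h1 h2(1)])
  have c3: "integrable lborel (fourier ?c)"
    using h1 fourier_heat_convolution[OF f(1) \<kappa>] by (metis (no_types, lifting) Bochner_Integration.integrable_cong)
  show "?c \<in> fourier_nice" unfolding fourier_nice_def using c1 c2 c3 by blast
  show "norm2 ?c \<le> norm2 f" unfolding eq
    using plancherel_le(2)[OF h1 h2(1)] h2(2) plancherel_fourier_le(2)[OF f] by linarith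
qed

text \<open>Weak convergence against \<open>f\<close>, together with norms not exceeding that of
  \<open>f\<close>, forces convergence in norm: the squared distance is at most
  \<open>2 * (norm2 f)\<^sup>2\<close> minus twice the real part of the inner product, which tends
  to 0.\<close>

lemma fourier_nice_approx_continuous:
  fixes f :: "'a::euclidean_space \<Rightarrow> complex"
  assumes f: "integrable lborel f" "continuous_on UNIV f" "\<And>x. norm (f x) \<le> B" and e: "e > 0"
  shows "\<exists>g\<in>fourier_nice. norm2 (\<lambda>x. f x - g x) < e"
proof -
  define \<kappa> where "\<kappa> n = 1 / real (Suc n)" for n
  have \<kappa>: "\<kappa> \<longlonglongrightarrow> 0" "\<kappa> n > 0" for n
    unfolding \<kappa>_def by (rule LIMSEQ_Suc[OF lim_1_over_n]) auto
  have [measurable]: "f \<in> borel_measurable borel" using f by auto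
  have f2: "f \<in> square_integrable" by (rule square_integrable_bounded[OF f(1,3)])
  define g where "g n x = (LINT \<xi>|lborel. f \<xi> * heat (\<kappa> n) (\<xi> - x))" for n x
  have g: "g n \<in> fourier_nice" "norm2 (g n) \<le> norm2 f" for n
    unfolding g_def[abs_def] by (rule heat_convolution_fourier_nice[OF f(1) f2 \<kappa>(2)])+
  have g2: "g n \<in> square_integrable" for n using g(1)[of n] by (simp add: fourier_nice_def)
  have [measurable]: "g n \<in> borel_measurable borel" for n using g2[of n] by auto
  have cf: "(\<lambda>x. cnj (f x)) \<in> square_integrable"
    using square_integrableD[OF f2] by (intro square_integrableI) auto
  have lim: "(\<lambda>n. LINT x|lborel. g n x * cnj (f x)) \<longlonglongrightarrow> (LINT x|lborel. f x * cnj (f x))"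
  proof (rule integral_dominated_convergence[where w = "\<lambda>x. B * norm (f x)"])
    show "AE x in lborel. (\<lambda>n. g n x * cnj (f x)) \<longlonglongrightarrow> f x * cnj (f x)"
      unfolding g_def by (intro AE_I2 tendsto_intros tendsto_integral_heat[OF f(2,3) \<kappa>])
    show "AE x in lborel. norm (g n x * cnj (f x)) \<le> B * norm (f x)" for n
      unfolding g_def by (auto simp: norm_mult intro!: AE_I2 mult_right_mono norm_integral_heat_le f \<kappa>)
  qed (use f in auto)
  have limR: "(\<lambda>n. 2 * (norm2 f)\<^sup>2 - 2 * Re (LINT x|lborel. g n x * cnj (f x))) \<longlonglongrightarrow> 2 * (norm2 f)\<^sup>2 - 2 * (norm2 f)\<^sup>2"
  proof -
    have "(LINT x|lborel. f x * cnj (f x)) = complex_of_real ((norm2 f)\<^sup>2)"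
      unfolding norm2_power2 by (simp flip: integral_complex_of_real complex_norm_square)
    with lim have "(\<lambda>n. LINT x|lborel. g n x * cnj (f x)) \<longlonglongrightarrow> complex_of_real ((norm2 f)\<^sup>2)" by simp
    from tendsto_Re[OF this] have "(\<lambda>n. Re (LINT x|lborel. g n x * cnj (f x))) \<longlonglongrightarrow> (norm2 f)\<^sup>2"
      by (simp only: Re_complex_of_real)
    then show ?thesis by (intro tendsto_intros)
  qed
  have le: "(norm2 (\<lambda>x. f x - g n x))\<^sup>2 \<le> 2 * (norm2 f)\<^sup>2 - 2 * Re (LINT x|lborel. g n x * cnj (f x))" for n
  proof -
    note i = integrable_mult_square_integrable[OF g2[of n] cf]
    define X where "X x = Re (g n x * cnj (f x))" for x
    have X: "integrable lborel X" "(LINT x|lborel. X x) = Re (LINT x|lborel. g n x * cnj (f x))"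
      unfolding X_def[abs_def] using i by (rule integrable_Re, intro integral_Re)
    have "(norm (f x - g n x))\<^sup>2 = (norm (f x))\<^sup>2 + (norm (g n x))\<^sup>2 - 2 * X x" for x
      unfolding X_def cmod_power2 by (simp add: power2_eq_square algebra_simps)
    then have "(norm2 (\<lambda>x. f x - g n x))\<^sup>2 = (LINT x|lborel. (norm (f x))\<^sup>2 + (norm (g n x))\<^sup>2 - 2 * X x)"
      by (simp add: norm2_power2)
    also have "\<dots> = (norm2 f)\<^sup>2 + (norm2 (g n))\<^sup>2 - 2 * Re (LINT x|lborel. g n x * cnj (f x))"
      using square_integrableD[OF f2] square_integrableD[OF g2[of n]] X(1)
      by (simp add: norm2_power2 flip: X(2))
    also have "(norm2 (g n))\<^sup>2 \<le> (norm2 f)\<^sup>2" by (intro power_mono g) simp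
    finally show ?thesis by simp
  qed
  have "eventually (\<lambda>n. 2 * (norm2 f)\<^sup>2 - 2 * Re (LINT x|lborel. g n x * cnj (f x)) < e\<^sup>2) sequentially"
    using limR e by (intro order_tendstoD(2)) auto
  then obtain n where "2 * (norm2 f)\<^sup>2 - 2 * Re (LINT x|lborel. g n x * cnj (f x)) < e\<^sup>2"
    by (auto simp: eventually_sequentially)
  then have "(norm2 (\<lambda>x. f x - g n x))\<^sup>2 < e\<^sup>2" using le[of n] by linarith
  then have "norm2 (\<lambda>x. f x - g n x) < e" using e by (intro power_less_imp_less_base[of _ 2 e]) auto
  with g(1)[of n] show ?thesis by blast
qed

section \<open>Approximation of arbitrary square integrable functions\<close>

lemma norm2_dominated_convergence:
  fixes f :: "'a::euclidean_space \<Rightarrow> complex"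
  assumes [measurable]: "f \<in> borel_measurable borel" "\<And>n. s n \<in> borel_measurable borel"
    and lim: "AE x in lborel. (\<lambda>n. s n x) \<longlonglongrightarrow> f x"
    and w: "integrable lborel w" and bnd: "\<And>n. AE x in lborel. (norm (f x - s n x))\<^sup>2 \<le> w x"
  shows "(\<lambda>n. norm2 (\<lambda>x. f x - s n x)) \<longlonglongrightarrow> 0"
proof -
  have "(\<lambda>n. LINT x|lborel. (norm (f x - s n x))\<^sup>2) \<longlonglongrightarrow> (LINT (x::'a)|lborel. (0::real))"
  proof (rule integral_dominated_convergence[OF _ _ w])
    show "AE x in lborel. (\<lambda>n. (norm (f x - s n x))\<^sup>2) \<longlonglongrightarrow> 0"
      using lim
    proof eventually_elim
      fix x assume "(\<lambda>n. s n x) \<longlonglongrightarrow> f x"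
      then have "(\<lambda>n. (norm (f x - s n x))\<^sup>2) \<longlonglongrightarrow> (norm (f x - f x))\<^sup>2" by (intro tendsto_intros)
      then show "(\<lambda>n. (norm (f x - s n x))\<^sup>2) \<longlonglongrightarrow> 0" by simp
    qed
  qed (use bnd in auto)
  from tendsto_real_sqrt[OF this] show ?thesis unfolding norm2_def by simp
qed

text \<open>A measurable function is almost everywhere a limit of continuous functions. Retracting
  their values to a disc and cutting them off outside a ball makes the convergence dominated, hence
  valid in \<open>norm2\<close>.\<close>

lemma continuous_approx_bounded:
  fixes f :: "'a::euclidean_space \<Rightarrow> complex"
  assumes f [measurable]: "f \<in> borel_measurable borel" and R: "R > 0" "\<And>x. norm (f x) \<le> R" "\<And>x. norm x > R \<Longrightarrow> f x = 0"
    and e: "e > 0"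
  shows "\<exists>h. integrable lborel h \<and> continuous_on UNIV h \<and> (\<forall>x. norm (h x) \<le> R) \<and> norm2 (\<lambda>x. f x - h x) < e"
proof -
  have "f \<in> borel_measurable (lebesgue_on UNIV)"
    using f by (simp add: measurable_completion lebesgue_on_UNIV_eq)
  then have "f measurable_on UNIV" by (subst measurable_on_iff_borel_measurable) auto
  then obtain N g where N: "negligible N" and g: "\<And>n. continuous_on UNIV (g n)"
    and lim: "\<And>x. x \<notin> N \<Longrightarrow> (\<lambda>n. g n x) \<longlonglongrightarrow> f x"
    unfolding measurable_on_def by auto
  \<comment> \<open>\<open>cl\<close> is the radial retraction onto the disc of radius
    \<open>R\<close>; \<open>cut\<close> is 1 on the ball of radius \<open>R\<close> and 0 from
    radius \<open>R + 1\<close> on.\<close>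
  define cl :: "complex \<Rightarrow> complex" where "cl z = inverse (max 1 (norm z / R)) *\<^sub>R z" for z
  define cut :: "'a \<Rightarrow> real" where "cut x = max 0 (min 1 (R + 1 - norm x))" for x
  have cl: "continuous_on UNIV cl" unfolding cl_def using R
    by (intro continuous_intros ballI) (auto simp: max_def)
  have cl_le: "norm (cl z) \<le> R" for z
    using R by (cases "norm z / R \<ge> 1") (auto simp: cl_def max_def field_simps)
  have cl_id: "cl z = z" if "norm z \<le> R" for z
    using R that by (auto simp: cl_def max_def field_simps)
  have cut: "0 \<le> cut x" "cut x \<le> 1" for x by (auto simp: cut_def)
  define h where "h n x = cut x *\<^sub>R cl (g n x)" for n x
  have h_cont: "continuous_on UNIV (h n)" for n
    unfolding h_def cut_def by (intro continuous_intros continuous_on_compose2[OF cl] g) auto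
  have h_le: "norm (h n x) \<le> R * indicator (cball 0 (R + 1)) x" for n x
  proof -
    have "cut x * norm (cl (g n x)) \<le> 1 * R" using cut[of x] cl_le R(1) by (intro mult_mono) auto
    then have "norm (h n x) \<le> 1 * R" unfolding h_def using cut[of x] by simp
    then show ?thesis by (auto simp: indicator_def h_def cut_def)
  qed
  have ind: "integrable lborel (\<lambda>x::'a. c * indicator (cball 0 (R + 1)) x :: real)" for c
    using emeasure_bounded_finite[of "cball (0::'a) (R + 1)"]
    by (intro integrable_mult_right integrable_real_indicator) auto
  have h_int: "integrable lborel (h n)" for n
    by (rule Bochner_Integration.integrable_bound[OF ind[of R]])
      (use borel_measurable_continuous_onI[OF h_cont] h_le in \<open>auto intro!: AE_I2 order_trans[OF h_le]\<close>)
  have "(\<lambda>n. norm2 (\<lambda>x. f x - h n x)) \<longlonglongrightarrow> 0"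
  proof (rule norm2_dominated_convergence[OF f borel_measurable_continuous_onI[OF h_cont] _ ind[of "(2 * R)\<^sup>2"]])
    have "AE x in lborel. x \<notin> N"
      using AE_not_in[of N lebesgue] N by (simp add: negligible_iff_null_sets AE_completion_iff)
    then show "AE x in lborel. (\<lambda>n. h n x) \<longlonglongrightarrow> f x"
    proof eventually_elim
      fix x assume "x \<notin> N"
      have "(\<lambda>n. cut x *\<^sub>R cl (g n x)) \<longlonglongrightarrow> cut x *\<^sub>R cl (f x)"
        by (intro tendsto_intros continuous_on_tendsto_compose[OF cl lim[OF \<open>x \<notin> N\<close>]]) auto
      also have "cut x *\<^sub>R cl (f x) = f x"
      proof (cases "norm x > R")
        case False
        then have "cut x = 1" by (auto simp: cut_def)
        then show ?thesis using cl_id[OF R(2)] by simp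
      qed (use R(3) cl_id[of 0] R(1) in simp)
      finally show "(\<lambda>n. h n x) \<longlonglongrightarrow> f x" by (simp add: h_def)
    qed
    show "AE x in lborel. (norm (f x - h n x))\<^sup>2 \<le> (2 * R)\<^sup>2 * indicator (cball 0 (R + 1)) x" for n
    proof (intro AE_I2)
      fix x :: 'a
      show "(norm (f x - h n x))\<^sup>2 \<le> (2 * R)\<^sup>2 * indicator (cball 0 (R + 1)) x"
      proof (cases "norm x \<le> R + 1")
        case True
        have "norm (f x - h n x) \<le> norm (f x) + norm (h n x)" by (rule norm_triangle_ineq4)
        also have "\<dots> \<le> 2 * R" using R(2)[of x] h_le[of n x] True by (simp add: indicator_def)
        finally have "(norm (f x - h n x))\<^sup>2 \<le> (2 * R)\<^sup>2" by (rule power_mono) simp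
        then show ?thesis using True by simp
      next
        case False
        then have "f x = 0" "h n x = 0" using R(3)[of x] h_le[of n x] by (auto simp: indicator_def)
        then show ?thesis by simp
      qed
    qed
  qed
  from order_tendstoD(2)[OF this e] obtain n where n: "norm2 (\<lambda>x. f x - h n x) < e"
    by (auto simp: eventually_sequentially)
  have "norm (h n x) \<le> R" for x using h_le[of n x] R(1) by (cases "x \<in> cball 0 (R + 1)") auto
  with n h_int h_cont show ?thesis by blast
qed

lemma truncation_approx:
  assumes f: "f \<in> square_integrable" and e: "e > 0"
  shows "\<exists>R>0. norm2 (\<lambda>x. f x - (if norm (f x) \<le> R \<and> norm x \<le> R then f x else 0)) < e"
proof -
  have [measurable]: "f \<in> borel_measurable borel" using f by auto
  define s where "s n x = (if norm (f x) \<le> real n \<and> norm x \<le> real n then f x else 0)" for n :: nat and x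
  have "(\<lambda>n. norm2 (\<lambda>x. f x - s n x)) \<longlonglongrightarrow> 0"
  proof (rule norm2_dominated_convergence[OF _ _ _ square_integrableD[OF f]])
    show "AE x in lborel. (\<lambda>n. s n x) \<longlonglongrightarrow> f x"
    proof (intro AE_I2)
      fix x
      obtain N :: nat where "max (norm (f x)) (norm x) \<le> real N" using real_arch_simple by blast
      then have "\<forall>n\<ge>N. s n x = f x" by (auto simp: s_def)
      then show "(\<lambda>n. s n x) \<longlonglongrightarrow> f x" by (intro tendsto_eventually) (auto simp: eventually_sequentially)
    qed
  qed (auto simp: s_def)
  from LIMSEQ_Suc[OF this] have "eventually (\<lambda>n. norm2 (\<lambda>x. f x - s (Suc n) x) < e) sequentially"
    using e by (rule order_tendstoD(2))
  then obtain n where "norm2 (\<lambda>x. f x - s (Suc n) x) < e" by (auto simp: eventually_sequentially)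
  then show ?thesis unfolding s_def by (intro exI[of _ "real (Suc n)"]) auto
qed

text \<open>Three approximations with error \<open>e / 3\<close> each: truncation in value and
  argument, replacement by a continuous function, and smoothing by the heat kernel.\<close>

lemma fourier_nice_dense:
  assumes f: "f \<in> square_integrable" and e: "e > 0"
  shows "\<exists>g\<in>fourier_nice. norm2 (\<lambda>x. f x - g x) < e"
proof -
  have [measurable]: "f \<in> borel_measurable borel" using f by auto
  from truncation_approx[OF f, of "e / 3"] e obtain R where R: "R > 0"
    "norm2 (\<lambda>x. f x - (if norm (f x) \<le> R \<and> norm x \<le> R then f x else 0)) < e / 3" by auto
  define t where "t x = (if norm (f x) \<le> R \<and> norm x \<le> R then f x else 0)" for x
  have t: "t \<in> borel_measurable borel" unfolding t_def by measurable
  have t2: "t \<in> square_integrable" by (rule norm2_mono(1)[OF t f, of 1]) (auto simp: t_def)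
  have "norm (t x) \<le> R" "norm x > R \<Longrightarrow> t x = 0" for x using R(1) by (auto simp: t_def)
  from continuous_approx_bounded[OF t R(1) this, of "e / 3"] e obtain h
      where h: "integrable lborel h" "continuous_on UNIV h"
    "\<And>x. norm (h x) \<le> R" "norm2 (\<lambda>x. t x - h x) < e / 3" by auto
  have h2: "h \<in> square_integrable" by (rule square_integrable_bounded[OF h(1,3)])
  from fourier_nice_approx_continuous[OF h(1-3), of "e / 3"] e obtain g
      where g: "g \<in> fourier_nice" "norm2 (\<lambda>x. h x - g x) < e / 3" by auto
  have g2: "g \<in> square_integrable" using g by (simp add: fourier_nice_def)
  have "norm2 (\<lambda>x. f x - g x) < e"
    using norm2_triangle_diff[OF f t2 g2] norm2_triangle_diff[OF t2 h2 g2] R(2) h(4) g(2)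
    unfolding t_def[symmetric] by linarith
  with g show ?thesis by blast
qed

section \<open>Bounded Fourier multipliers\<close>

lemma fourier_add: "integrable lborel f \<Longrightarrow> integrable lborel g
    \<Longrightarrow> fourier (\<lambda>x. f x + g x) = (\<lambda>\<xi>. fourier f \<xi> + fourier g \<xi>)"
  by (auto simp: fourier_ch distrib_right integrable_mult_ch intro!: ext Bochner_Integration.integral_add)

lemma fourier_cmult: "fourier (\<lambda>x. c * f x) = (\<lambda>\<xi>. c * fourier f \<xi>)"
  by (auto simp: fourier_ch mult.assoc)

lemma inverse_fourier_add:
  "integrable lborel f \<Longrightarrow> integrable lborel g \<Longrightarrow> inverse_fourier (\<lambda>x. f x + g x) \<xi>
      = inverse_fourier f \<xi> + inverse_fourier g \<xi>"
  by (auto simp: inverse_fourier_ch distrib_right integrable_mult_ch intro!: Bochner_Integration.integral_add)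

lemma inverse_fourier_cmult: "inverse_fourier (\<lambda>x. c * f x) \<xi> = c * inverse_fourier f \<xi>"
  by (auto simp: inverse_fourier_ch mult.assoc)

text \<open>Plancherel is used for \<open>f\<close> and again for \<open>b\<close> times its
  transform, which bounds the multiplier on \<open>fourier_nice\<close> by \<open>C\<close>. The
  extension to L^2 still agrees with the multiplier on Schwartz functions because these lie in
  \<open>fourier_nice\<close>.\<close>

lemma bounded_convolution_kernel_multiplier:
  fixes b :: "'a::euclidean_space \<Rightarrow> complex"
  assumes b [measurable]: "b \<in> borel_measurable borel" and C: "C > 0" "\<And>\<eta>. norm (b \<eta>) \<le> C"
    and conv: "\<And>g x. g \<in> schwartz \<Longrightarrow> Defs.convolution u g x = fourier_multiplier b g x"
    and nice: "schwartz \<subseteq> (fourier_nice :: ('a \<Rightarrow> complex) set)"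
  shows "bounded_convolution_kernel C u"
proof -
  have i: "integrable lborel (\<lambda>\<xi>. b \<xi> * fourier f \<xi>)" if "f \<in> fourier_nice" for f
    using that C by (intro integrable_bounded_mult[where B = C]) (auto simp: fourier_nice_def)
  have s: "(\<lambda>\<xi>. b \<xi> * fourier f \<xi>) \<in> square_integrable" "norm2 (\<lambda>\<xi>. b \<xi> * fourier f \<xi>) \<le> C * norm2 (fourier f)"
    if "f \<in> fourier_nice" for f
  proof -
    have "fourier f \<in> square_integrable" "f \<in> borel_measurable borel"
      using that plancherel_fourier_le(1)[of f] by (auto simp: fourier_nice_def)
    then show "(\<lambda>\<xi>. b \<xi> * fourier f \<xi>) \<in> square_integrable" "norm2 (\<lambda>\<xi>. b \<xi> * fourier f \<xi>) \<le> C * norm2 (fourier f)"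
      using norm2_mono[of "\<lambda>\<xi>. b \<xi> * fourier f \<xi>" "fourier f" C] C by (auto simp: norm_mult mult_right_mono)
  qed
  have "\<exists>A. (\<forall>f\<in>square_integrable. A f \<in> square_integrable) \<and>
          (\<forall>f\<in>square_integrable. \<forall>g\<in>square_integrable.
             AE x in lborel. A (\<lambda>x. f x + g x) x = A f x + A g x) \<and>
          (\<forall>c. \<forall>f\<in>square_integrable. AE x in lborel. A (\<lambda>x. c * f x) x = c * A f x) \<and>
          (\<forall>g\<in>fourier_nice. AE x in lborel. A g x = fourier_multiplier b g x) \<and>
          (\<forall>g\<in>square_integrable. norm2 (A g :: 'a \<Rightarrow> complex) \<le> C * norm2 g)"
  proof (rule bounded_extension_square_integrable)
    fix f g :: "'a \<Rightarrow> complex" assume f: "f \<in> fourier_nice" and g: "g \<in> fourier_nice"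
    show "(\<lambda>x. f x + g x) \<in> fourier_nice"
      using f g by (auto simp: fourier_nice_def fourier_add square_integrable_add)
    show "fourier_multiplier b (\<lambda>x. f x + g x) = (\<lambda>x. fourier_multiplier b f x + fourier_multiplier b g x)"
      using f g i[OF f] i[OF g] unfolding fourier_multiplier_def
      by (auto simp: fourier_nice_def fourier_add distrib_left inverse_fourier_add intro!: ext)
  next
    fix f :: "'a \<Rightarrow> complex" and c assume f: "f \<in> fourier_nice"
    show "(\<lambda>x. c * f x) \<in> fourier_nice"
      using f by (auto simp: fourier_nice_def fourier_cmult square_integrable_cmult)
    have "(\<lambda>\<xi>. b \<xi> * (c * fourier f \<xi>)) = (\<lambda>\<xi>. c * (b \<xi> * fourier f \<xi>))" by (simp add: mult_ac)
    then show "fourier_multiplier b (\<lambda>x. c * f x) = (\<lambda>x. c * fourier_multiplier b f x)"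
      unfolding fourier_multiplier_def fourier_cmult by (auto simp: inverse_fourier_cmult intro!: ext)
  next
    fix f :: "'a \<Rightarrow> complex" assume f: "f \<in> fourier_nice"
    show "fourier_multiplier b f \<in> square_integrable"
      unfolding fourier_multiplier_def by (rule plancherel_le(1)[OF i[OF f] s(1)[OF f]])
    have "norm2 (fourier_multiplier b f) \<le> C * norm2 (fourier f)"
      unfolding fourier_multiplier_def using plancherel_le(2)[OF i[OF f] s(1)[OF f]] s(2)[OF f] by linarith
    also have "\<dots> \<le> C * norm2 f"
      using f C plancherel_fourier_le(2)[of f] by (intro mult_left_mono) (auto simp: fourier_nice_def)
    finally show "norm2 (fourier_multiplier b f) \<le> C * norm2 f" .
  qed (use C fourier_nice_dense in \<open>auto simp: fourier_nice_def\<close>)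
  then obtain A where A: "\<forall>f\<in>square_integrable. A f \<in> square_integrable"
     "\<forall>f\<in>square_integrable. \<forall>g\<in>square_integrable. AE x in lborel. A (\<lambda>x. f x + g x) x = A f x + A g x"
     "\<forall>c. \<forall>f\<in>square_integrable. AE x in lborel. A (\<lambda>x. c * f x) x = c * A f x"
     "\<forall>g\<in>fourier_nice. AE x in lborel. A g x = fourier_multiplier b g x"
     "\<forall>g\<in>square_integrable. norm2 (A g :: 'a \<Rightarrow> complex) \<le> C * norm2 g" by blast
  show ?thesis
    unfolding bounded_convolution_kernel_def
    using A nice by (intro exI[of _ A]) (auto simp: conv)
qed

subsection \<open>Smooth functions\<close>

text \<open>The mean value inequality, applied to \<phi> minus its linear model
  \<open>t *\<^sub>R c\<close>.\<close>

lemma vector_derivative_bound_linear: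
  fixes \<phi> :: "real \<Rightarrow> complex"
  assumes h: "0 \<le> h" and d: "\<And>t. (\<phi> has_vector_derivative \<phi>' t) (at t)"
    and bnd: "\<And>t. 0 \<le> t \<Longrightarrow> t \<le> h \<Longrightarrow> norm (\<phi>' t - c) \<le> e"
  shows "norm (\<phi> h - \<phi> 0 - h *\<^sub>R c) \<le> e * h"
proof -
  have "norm ((\<phi> h - h *\<^sub>R c) - (\<phi> 0 - 0 *\<^sub>R c)) \<le> e * norm (h - 0)"
  proof (rule differentiable_bound[where S = "{0..h}" and f' = "\<lambda>t s. s *\<^sub>R (\<phi>' t - c)"])
    fix t assume t: "t \<in> {0..h}"
    have "((\<lambda>t. \<phi> t - t *\<^sub>R c) has_vector_derivative (\<phi>' t - 1 *\<^sub>R c)) (at t within {0..h})"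
      by (intro derivative_intros has_vector_derivative_at_within[OF d])
        (auto intro!: derivative_eq_intros simp: has_vector_derivative_def)
    then show "((\<lambda>t. \<phi> t - t *\<^sub>R c) has_derivative (\<lambda>s. s *\<^sub>R (\<phi>' t - c))) (at t within {0..h})"
      by (simp add: has_vector_derivative_def)
    show "onorm (\<lambda>s. s *\<^sub>R (\<phi>' t - c)) \<le> e"
    proof (rule onorm_le)
      fix s :: real
      show "norm (s *\<^sub>R (\<phi>' t - c)) \<le> e * norm s"
        using bnd[of t] t by (simp add: mult.commute[of e] mult_left_mono)
    qed
  qed (use h in auto)
  then show ?thesis using h by (simp add: algebra_simps)
qed

text \<open>The second difference over \<open>h * h\<close> approximates the mixed derivative: the
  linear bound is applied to the difference in direction \<open>b\<close> as a function of the step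
  along \<open>a\<close>, and once more to its derivative.\<close>

lemma mixed_difference_bound:
  assumes ga: "dirderiv a g ga" and gab: "dirderiv b ga gab" and h: "0 \<le> h"
    and bnd: "\<And>s t. 0 \<le> s \<Longrightarrow> s \<le> h \<Longrightarrow> 0 \<le> t \<Longrightarrow> t \<le> h \<Longrightarrow> norm (gab (x + s *\<^sub>R a + t *\<^sub>R b) - c) \<le> e"
  shows "norm (g (x + h *\<^sub>R a + h *\<^sub>R b) - g (x + h *\<^sub>R a) - g (x + h *\<^sub>R b) + g x - (h * h) *\<^sub>R c) \<le> e * h * h"
proof -
  define \<phi> where "\<phi> s = g (x + h *\<^sub>R b + s *\<^sub>R a) - g (x + s *\<^sub>R a)" for s
  have d: "(\<phi> has_vector_derivative (ga (x + h *\<^sub>R b + s *\<^sub>R a) - ga (x + s *\<^sub>R a))) (at s)" for s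
    unfolding \<phi>_def[abs_def] by (intro derivative_intros dirderivD_at[OF ga])
  have "norm (\<phi> h - \<phi> 0 - h *\<^sub>R (h *\<^sub>R c)) \<le> (e * h) * h"
  proof (rule vector_derivative_bound_linear[OF h d])
    fix s assume s: "0 \<le> s" "s \<le> h"
    have "norm (ga (x + s *\<^sub>R a + h *\<^sub>R b) - ga (x + s *\<^sub>R a + 0 *\<^sub>R b) - h *\<^sub>R c) \<le> e * h"
      by (rule vector_derivative_bound_linear[OF h dirderivD_at[OF gab]]) (rule bnd[OF s])
    then show "norm (ga (x + h *\<^sub>R b + s *\<^sub>R a) - ga (x + s *\<^sub>R a) - h *\<^sub>R c) \<le> e * h"
      by (simp add: algebra_simps)
  qed
  then show ?thesis by (simp add: \<phi>_def algebra_simps)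
qed

text \<open>Schwarz's theorem. The second difference is symmetric in \<open>a\<close> and
  \<open>b\<close>, and divided by \<open>h * h\<close> it is close to each of the two mixed
  derivatives.\<close>

lemma dirderiv_commute:
  assumes "dirderiv a g ga" "dirderiv b ga gab" "dirderiv b g gb" "dirderiv a gb gba"
    and cont: "continuous_on UNIV gab" "continuous_on UNIV gba"
  shows "gab = gba"
proof
  fix x
  have near: "\<exists>h>0. \<forall>s t. 0 \<le> s \<longrightarrow> s \<le> h \<longrightarrow> 0 \<le> t \<longrightarrow> t \<le> h \<longrightarrow> norm (f (x + s *\<^sub>R a + t *\<^sub>R b) - f x) \<le> e"
    if f: "continuous_on UNIV f" and e: "e > 0" for f :: "'a \<Rightarrow> complex" and e
  proof -
    from f e obtain d where d: "d > 0" "\<And>y. dist y x < d \<Longrightarrow> dist (f y) (f x) < e"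
      unfolding continuous_on_iff by (metis UNIV_I)
    \<comment> \<open>The parallelogram with sides \<open>h *\<^sub>R a\<close> and
      \<open>h *\<^sub>R b\<close> stays within distance \<open>d\<close> of \<open>x\<close>; the
      summand 1 covers vanishing directions.\<close>
    define h where "h = d / (2 * (norm a + norm b + 1))"
    have pos: "norm a + norm b + 1 > 0" by (simp add: add_nonneg_pos)
    have h: "h > 0" using d pos by (simp add: h_def)
    have "norm (f (x + s *\<^sub>R a + t *\<^sub>R b) - f x) \<le> e" if s: "0 \<le> s" "s \<le> h" and t: "0 \<le> t" "t \<le> h" for s t
    proof -
      have "dist (x + s *\<^sub>R a + t *\<^sub>R b) x \<le> s * norm a + t * norm b"
        using norm_triangle_ineq[of "s *\<^sub>R a" "t *\<^sub>R b"] s t by (simp add: dist_norm add.assoc)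
      also have "\<dots> \<le> h * norm a + h * norm b" using s t by (intro add_mono mult_right_mono) auto
      also have "\<dots> < h * (2 * (norm a + norm b + 1))"
      proof -
        have "h * (norm a + norm b) < h * (2 * (norm a + norm b + 1))"
        proof (rule mult_strict_left_mono[OF _ h])
          show "norm a + norm b < 2 * (norm a + norm b + 1)"
            using add_nonneg_nonneg[OF norm_ge_zero[of a] norm_ge_zero[of b]] by (simp add: add_nonneg_pos)
        qed
        then show ?thesis by (simp add: distrib_left)
      qed
      also have "\<dots> = d" using pos by (simp add: h_def)
      finally show ?thesis using d(2)[of "x + s *\<^sub>R a + t *\<^sub>R b"] by (simp add: dist_norm)
    qed
    with h show ?thesis by blast
  qed
  have "norm (gab x - gba x) \<le> 0"
  proof (rule field_le_epsilon)
    fix e :: real assume e: "e > 0"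
    from near[OF cont(1), of "e/2"] e obtain h1 where h1: "h1 > 0"
      "\<And>s t. 0 \<le> s \<Longrightarrow> s \<le> h1 \<Longrightarrow> 0 \<le> t \<Longrightarrow> t \<le> h1 \<Longrightarrow> norm (gab (x + s *\<^sub>R a + t *\<^sub>R b) - gab x) \<le> e/2"
          by (auto simp del: norm_diff_triangle_ineq)
    from near[OF cont(2), of "e/2"] e obtain h2 where h2: "h2 > 0"
      "\<And>s t. 0 \<le> s \<Longrightarrow> s \<le> h2 \<Longrightarrow> 0 \<le> t \<Longrightarrow> t \<le> h2 \<Longrightarrow> norm (gba (x + s *\<^sub>R a + t *\<^sub>R b) - gba x) \<le> e/2" by auto
    define h where "h = min h1 h2"
    have h: "h > 0" "h \<le> h1" "h \<le> h2" using h1 h2 by (auto simp: h_def)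
    let ?\<Delta> = "g (x + h *\<^sub>R a + h *\<^sub>R b) - g (x + h *\<^sub>R a) - g (x + h *\<^sub>R b) + g x"
    have 1: "norm (?\<Delta> - (h * h) *\<^sub>R gab x) \<le> e/2 * h * h"
      by (rule mixed_difference_bound[OF assms(1,2)]) (use h h1 in auto)
    have "norm (g (x + h *\<^sub>R b + h *\<^sub>R a) - g (x + h *\<^sub>R b) - g (x + h *\<^sub>R a) + g x
        - (h * h) *\<^sub>R gba x) \<le> e/2 * h * h"
    proof (rule mixed_difference_bound[OF assms(3,4)])
      fix s t assume "0 \<le> s" "s \<le> h" "0 \<le> t" "t \<le> h"
      then show "norm (gba (x + s *\<^sub>R b + t *\<^sub>R a) - gba x) \<le> e/2" using h2(2)[of t s] h by (simp add: algebra_simps)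
    qed (use h in auto)
    then have 2: "norm (?\<Delta> - (h * h) *\<^sub>R gba x) \<le> e/2 * h * h" by (simp add: algebra_simps)
    have "(h * h) * norm (gab x - gba x) = norm ((?\<Delta> - (h * h) *\<^sub>R gba x) - (?\<Delta> - (h * h) *\<^sub>R gab x))"
    proof -
      have "(?\<Delta> - (h * h) *\<^sub>R gba x) - (?\<Delta> - (h * h) *\<^sub>R gab x) = (h * h) *\<^sub>R (gab x - gba x)"
        by (simp add: algebra_simps)
      then show ?thesis using h by simp
    qed
    also have "\<dots> \<le> e/2 * h * h + e/2 * h * h" by (rule order_trans[OF norm_triangle_ineq4 add_mono[OF 2 1]])
    also have "\<dots> = (h * h) * e" by simp
    finally show "norm (gab x - gba x) \<le> 0 + e" using h by simp
  qed
  then show "gab x = gba x" by simp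
qed

section \<open>Iterated partial derivatives and their symmetry\<close>

lemma partials_append: "partials (xs @ ys) f = partials xs (partials ys f)"
  by (induction xs) auto

lemma smooth_partials: "smooth f \<Longrightarrow> bs \<in> lists Basis \<Longrightarrow> smooth (partials bs f)"
  unfolding smooth_def by (auto simp flip: partials_append)

lemma smooth_differentiable: "smooth f \<Longrightarrow> f differentiable (at x)"
  unfolding smooth_def by (metis lists.Nil partials.simps(1))

lemma smooth_continuous: "smooth f \<Longrightarrow> continuous_on A f"
  using smooth_differentiable by (blast intro: continuous_at_imp_continuous_on differentiable_imp_continuous_within)

lemma smooth_measurable: "smooth f \<Longrightarrow> f \<in> borel_measurable borel"
  by (intro borel_measurable_continuous_onI smooth_continuous)

lemma has_derivative_dirderiv:
  assumes "\<And>x. (f has_derivative f' x) (at x)"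
  shows "dirderiv b f (\<lambda>x. f' x b)"
  unfolding dirderiv_def
proof
  fix x
  have 1: "((\<lambda>t. x + t *\<^sub>R b) has_derivative (\<lambda>t. t *\<^sub>R b)) (at 0)"
    by (auto intro!: derivative_eq_intros)
  have 2: "(f has_derivative f' x) (at (x + 0 *\<^sub>R b))" using assms by simp
  interpret bounded_linear "f' x" using assms has_derivative_bounded_linear by blast
  from has_derivative_compose[OF 1 2] show "((\<lambda>t. f (x + t *\<^sub>R b)) has_vector_derivative f' x b) (at 0)"
    by (simp add: has_vector_derivative_def scaleR)
qed

lemma smooth_has_derivative:
  assumes "smooth f"
  shows "(f has_derivative (\<lambda>v. \<Sum>b\<in>Basis. (v \<bullet> b) *\<^sub>R partial b f x)) (at x)"
proof -
  define F where "F x = frechet_derivative f (at x)" for x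
  have F: "(f has_derivative F x) (at x)" for x
    unfolding F_def using smooth_differentiable[OF assms] by (simp add: frechet_derivative_works)
  have eq: "partial b f = (\<lambda>x. F x b)" for b by (rule dirderiv_partial[OF has_derivative_dirderiv[OF F]])
  have "F x v = (\<Sum>b\<in>Basis. (v \<bullet> b) *\<^sub>R partial b f x)" for v
  proof -
    interpret bounded_linear "F x" using F has_derivative_bounded_linear by blast
    have "F x v = F x (\<Sum>b\<in>Basis. (v \<bullet> b) *\<^sub>R b)" by (simp add: euclidean_representation)
    also have "\<dots> = (\<Sum>b\<in>Basis. (v \<bullet> b) *\<^sub>R F x b)" by (simp add: sum scaleR)
    finally show ?thesis by (simp add: eq)
  qed
  then have "F x = (\<lambda>v. \<Sum>b\<in>Basis. (v \<bullet> b) *\<^sub>R partial b f x)" by (rule ext)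
  with F[of x] show ?thesis by (simp only:)
qed

lemma smooth_dirderiv:
  assumes "smooth f" "b \<in> Basis"
  shows "dirderiv b f (partial b f)"
proof -
  from has_derivative_dirderiv[OF smooth_has_derivative[OF assms(1)], of b]
  have "dirderiv b f (\<lambda>x. \<Sum>c\<in>Basis. (b \<bullet> c) *\<^sub>R partial c f x)" .
  also have "(\<lambda>x. \<Sum>c\<in>Basis. (b \<bullet> c) *\<^sub>R partial c f x) = partial b f"
    using assms(2) by (intro ext) (simp add: inner_Basis if_distrib[of "\<lambda>c. c *\<^sub>R _"] sum.delta cong: if_cong)
  finally show ?thesis .
qed

lemma smooth_partials_dirderiv:
  "smooth f \<Longrightarrow> b \<in> Basis \<Longrightarrow> bs \<in> lists Basis \<Longrightarrow> dirderiv b (partials bs f) (partials (b # bs) f)"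
  using smooth_dirderiv[OF smooth_partials] by simp

lemma smooth_dseq:
  assumes "smooth f" "b \<in> Basis"
  shows "dseq b (\<lambda>n. partials (replicate n b) f)"
  unfolding dseq_def using assms
  by (auto intro!: smooth_continuous smooth_partials smooth_dirderiv simp: in_lists_conv_set)

lemma partial_commute:
  assumes f: "smooth f" and "a \<in> Basis" "b \<in> Basis"
  shows "partial a (partial b f) = partial b (partial a f)"
proof (rule dirderiv_commute)
  have s: "smooth (partial c f)" if "c \<in> Basis" for c using smooth_partials[OF f, of "[c]"] that by simp
  show "dirderiv b f (partial b f)" "dirderiv a f (partial a f)" using assms by (auto intro: smooth_dirderiv)
  show "dirderiv a (partial b f) (partial a (partial b f))" "dirderiv b (partial a f) (partial b (partial a f))"
    using assms s by (auto intro: smooth_dirderiv)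
  show "continuous_on UNIV (partial a (partial b f))" "continuous_on UNIV (partial b (partial a f))"
    using smooth_partials[OF f, of "[a, b]"] smooth_partials[OF f, of "[b, a]"] assms
        by (auto intro: smooth_continuous)
qed

lemma partials_Cons_append:
  assumes "smooth f" "a \<in> Basis" "xs \<in> lists Basis" "ys \<in> lists Basis"
  shows "partials (a # xs @ ys) f = partials (xs @ a # ys) f"
  using assms(3)
proof (induction xs rule: list.induct)
  case (Cons b xs)
  have "partials (a # (b # xs) @ ys) f = partial a (partial b (partials (xs @ ys) f))" by simp
  also have "\<dots> = partial b (partial a (partials (xs @ ys) f))"
  proof (rule partial_commute[OF smooth_partials[OF assms(1)] assms(2)])
    show "xs @ ys \<in> lists Basis" "b \<in> Basis" using Cons.prems assms(4) by auto
  qed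
  also have "\<dots> = partial b (partials (xs @ a # ys) f)" using Cons by simp
  finally show ?case by simp
qed simp

text \<open>\<open>mderiv\<close> selects some list of directions. For a smooth function every list
  with the same multiset gives the same derivative, since the first direction can be moved to any
  position.\<close>

lemma partials_permute:
  assumes "smooth f" "mset bs = mset cs" "bs \<in> lists Basis"
  shows "partials bs f = partials cs f"
  using assms(2,3)
proof (induction bs arbitrary: cs)
  case (Cons a bs)
  from Cons.prems(1) have "a \<in> set cs" by (metis list.set_intros(1) mset_eq_setD)
  then obtain xs ys where cs: "cs = xs @ a # ys" by (meson split_list)
  have L: "set cs \<subseteq> Basis" using Cons.prems by (metis in_listsD mset_eq_setD subsetI)
  have "partials bs f = partials (xs @ ys) f" using Cons cs by auto
  then have "partials (a # bs) f = partials (a # xs @ ys) f" by simp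
  also have "\<dots> = partials cs f" unfolding cs
    using L cs Cons.prems by (intro partials_Cons_append assms) auto
  finally show ?case .
qed simp

lemma ex_list_count:
  assumes "finite A"
  shows "\<exists>bs\<in>lists A. \<forall>b\<in>A. count_list bs b = \<alpha> b"
  using assms
proof (induction A rule: finite_induct)
  case (insert a A)
  then obtain bs where bs: "bs \<in> lists A" "\<forall>b\<in>A. count_list bs b = \<alpha> b" by blast
  have "a \<notin> set bs" using bs insert by auto
  then have c: "count_list bs a = 0" by (simp add: count_list_0_iff)
  have r: "count_list (replicate n a) b = (if b = a then n else 0)" for n b by (induction n) auto
  show ?case
    using bs c insert by (intro bexI[of _ "replicate (\<alpha> a) a @ bs"]) (auto simp: r in_lists_conv_set)
qed auto

text \<open>A name for the list selected inside \<open>mderiv\<close>.\<close>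

definition mi_list :: "('a::euclidean_space \<Rightarrow> nat) \<Rightarrow> 'a list" where
  "mi_list \<alpha> = (SOME bs. bs \<in> lists Basis \<and> (\<forall>b\<in>Basis. count_list bs b = \<alpha> b))"

lemma mi_list: "mi_list \<alpha> \<in> lists Basis" "b \<in> Basis \<Longrightarrow> count_list (mi_list \<alpha>) b = \<alpha> b"
proof -
  have "\<exists>bs. bs \<in> lists Basis \<and> (\<forall>b\<in>Basis. count_list bs b = \<alpha> b)"
    using ex_list_count[OF finite_Basis, of \<alpha>] by (simp add: Bex_def)
  then have "mi_list \<alpha> \<in> lists Basis \<and> (\<forall>b\<in>Basis. count_list (mi_list \<alpha>) b = \<alpha> b)"
    unfolding mi_list_def by (rule someI_ex)
  then show "mi_list \<alpha> \<in> lists Basis" "b \<in> Basis \<Longrightarrow> count_list (mi_list \<alpha>) b = \<alpha> b"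
    by simp_all
qed

lemma mderiv_mi_list: "mderiv \<alpha> = partials (mi_list \<alpha>)"
  by (simp add: mderiv_def mi_list_def)

lemma length_mi_list: "length (mi_list \<alpha>) = mi_abs \<alpha>"
proof -
  have "length (mi_list \<alpha>) = (\<Sum>b\<in>Basis. count_list (mi_list \<alpha>) b)"
    using mi_list(1)[of \<alpha>] by (intro sum_count_set[symmetric]) auto
  then show ?thesis by (simp add: mi_abs_def mi_list(2))
qed

lemma partials_eq_mderiv:
  assumes "smooth f" "bs \<in> lists Basis"
  shows "partials bs f = mderiv (count_list bs) f"
  unfolding mderiv_mi_list
proof (rule partials_permute[OF assms(1) _ assms(2)])
  have "count_list bs b = count_list (mi_list (count_list bs)) b" for b
  proof (cases "b \<in> Basis")
    \<comment> \<open>Off \<open>Basis\<close> both counts are 0, because neither list contains such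
      a vector.\<close>
    case False
    then have "b \<notin> set bs" "b \<notin> set (mi_list (count_list bs))"
      using assms(2) mi_list(1)[of "count_list bs"] by auto
    then show ?thesis by (simp add: count_list_0_iff)
  qed (simp add: mi_list)
  then show "mset bs = mset (mi_list (count_list bs))"
    by (intro multiset_eqI) (simp add: count_mset)
qed

lemma mi_abs_count_list: "bs \<in> lists Basis \<Longrightarrow> mi_abs (count_list bs) = length bs"
  unfolding mi_abs_def by (intro sum_count_set) auto

lemma finite_lists_le: "finite {bs \<in> lists (Basis :: 'a::euclidean_space set). length bs \<le> N}"
  using finite_lists_length_le[of "Basis :: 'a set" N] by (simp add: Collect_conj_eq lists_eq_set)

subsection \<open>Schwartz functions\<close>

lemma schwartz_smooth: "f \<in> schwartz \<Longrightarrow> smooth f"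
  by (simp add: schwartz_def)

lemma schwartz_partials_bound:
  assumes "f \<in> schwartz" "bs \<in> lists Basis"
  shows "\<exists>C. \<forall>x. (1 + norm x) ^ N * norm (partials bs f x) \<le> C"
proof -
  from assms(1) have "bounded (range (\<lambda>x. (1 + norm x) ^ N *\<^sub>R mderiv (count_list bs) f x))"
    by (simp add: schwartz_def)
  then obtain C where "\<And>x. norm ((1 + norm x) ^ N *\<^sub>R mderiv (count_list bs) f x) \<le> C"
    by (auto simp: bounded_iff)
  then show ?thesis using partials_eq_mderiv[OF schwartz_smooth[OF assms(1)] assms(2)] by auto
qed

lemma schwartzI:
  assumes "smooth f" and "\<And>bs N. bs \<in> lists Basis \<Longrightarrow> \<exists>C. \<forall>x. (1 + norm x) ^ N * norm (partials bs f x) \<le> C"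
  shows "f \<in> schwartz"
  unfolding schwartz_def
proof (safe intro!: assms(1))
  fix N \<alpha>
  from assms(2)[OF mi_list(1), of N \<alpha>] obtain C
      where "\<forall>x. (1 + norm x) ^ N * norm (partials (mi_list \<alpha>) f x) \<le> C" by blast
  then show "bounded (range (\<lambda>x. (1 + norm x) ^ N *\<^sub>R mderiv \<alpha> f x))"
    unfolding bounded_iff mderiv_mi_list by (intro exI[of _ C]) auto
qed

text \<open>The supremum in \<open>schwartz_norm\<close> runs over infinitely many multi-indices, as
  their values off \<open>Basis\<close> are free. It is finite because they select among finitely
  many lists of length at most \<open>N\<close>.\<close>

lemma partials_le_schwartz_norm:
  assumes f: "f \<in> schwartz" and bs: "bs \<in> lists Basis" "length bs \<le> N"
  shows "(1 + norm x) ^ N * norm (partials bs f x) \<le> schwartz_norm N f"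
proof -
  have "\<forall>bs\<in>{bs \<in> lists Basis. length bs \<le> N}. \<exists>C. \<forall>x. (1 + norm x) ^ N * norm (partials bs f x) \<le> C"
    using schwartz_partials_bound[OF f] by blast
  then obtain C where C: "\<And>bs x. bs \<in> lists Basis \<Longrightarrow> length bs \<le> N \<Longrightarrow> (1 + norm x) ^ N * norm (partials bs f x) \<le> C bs"
    by (auto simp: bchoice_iff)
  define M where "M = Max (C ` {bs \<in> lists Basis. length bs \<le> N})"
  have M: "(1 + norm x) ^ N * norm (partials bs f x) \<le> M" if "bs \<in> lists Basis" "length bs \<le> N" for bs x
    using C[OF that] that finite_lists_le unfolding M_def by (intro order_trans[OF C[OF that] Max_ge]) auto
  have "bdd_above ((\<lambda>(\<alpha>, x). (1 + norm x) ^ N * norm (mderiv \<alpha> f x)) ` ({\<alpha>. mi_abs \<alpha> \<le> N} \<times> UNIV))"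
    by (rule bdd_aboveI[where M = M]) (auto simp: mderiv_mi_list length_mi_list intro!: M mi_list)
  from cSUP_upper[OF _ this, of "(count_list bs, x)"]
  show ?thesis
    using bs partials_eq_mderiv[OF schwartz_smooth[OF f] bs(1)] unfolding schwartz_norm_def
    by (simp add: mi_abs_count_list)
qed

lemma schwartz_norm_le:
  fixes f :: "'a::euclidean_space \<Rightarrow> complex"
  assumes "\<And>bs x. bs \<in> lists Basis \<Longrightarrow> length bs \<le> N \<Longrightarrow> (1 + norm x) ^ N * norm (partials bs f x) \<le> B"
  shows "schwartz_norm N f \<le> B"
  unfolding schwartz_norm_def
proof (rule cSUP_least)
  have "((\<lambda>_. 0), 0) \<in> {\<alpha>::'a \<Rightarrow> nat. mi_abs \<alpha> \<le> N} \<times> (UNIV :: 'a set)" by (simp add: mi_abs_def)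
  then show "{\<alpha>::'a \<Rightarrow> nat. mi_abs \<alpha> \<le> N} \<times> (UNIV :: 'a set) \<noteq> {}" by blast
  fix p assume "p \<in> {\<alpha>::'a \<Rightarrow> nat. mi_abs \<alpha> \<le> N} \<times> (UNIV :: 'a set)"
  then obtain \<alpha> x where p: "p = (\<alpha>, x)" "mi_abs \<alpha> \<le> N" by blast
  then have "length (mi_list \<alpha>) \<le> N" by (simp add: length_mi_list)
  from assms[OF mi_list(1) this, of x]
  show "(case p of (\<alpha>, x) \<Rightarrow> (1 + norm x) ^ N * norm (mderiv \<alpha> f x)) \<le> B"
    by (simp add: p(1) mderiv_mi_list)
qed

section \<open>The Schwartz space as a vector space\<close>

lemma partials_add:
  assumes "smooth f" "smooth g" "bs \<in> lists Basis"
  shows "partials bs (\<lambda>x. f x + g x) = (\<lambda>x. partials bs f x + partials bs g x)"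
  using assms(3)
proof (induction bs rule: list.induct)
  case (Cons b bs)
  have "dirderiv b (\<lambda>x. partials bs f x + partials bs g x) (\<lambda>x. partials (b # bs) f x + partials (b # bs) g x)"
    using Cons.prems assms by (intro dirderiv_add smooth_partials_dirderiv) auto
  from dirderiv_partial[OF this] Cons show ?case by simp
qed simp

lemma partials_cmult:
  assumes "smooth f" "bs \<in> lists Basis"
  shows "partials bs (\<lambda>x. c * f x) = (\<lambda>x. c * partials bs f x)"
  using assms(2)
proof (induction bs rule: list.induct)
  case (Cons b bs)
  have "dirderiv b (\<lambda>x. c * partials bs f x) (\<lambda>x. c * partials (b # bs) f x)"
    using Cons.prems assms by (intro dirderiv_cmult smooth_partials_dirderiv) auto
  from dirderiv_partial[OF this] Cons show ?case by simp
qed simp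

lemma smooth_add: "smooth f \<Longrightarrow> smooth g \<Longrightarrow> smooth (\<lambda>x. f x + g x)"
  by (auto simp: smooth_def partials_add)

lemma smooth_cmult: "smooth f \<Longrightarrow> smooth (\<lambda>x. c * f x)"
  by (auto simp: smooth_def partials_cmult intro!: differentiable_mult)

lemma schwartz_add:
  assumes f: "f \<in> schwartz" and g: "g \<in> schwartz"
  shows "(\<lambda>x. f x + g x) \<in> schwartz"
proof (rule schwartzI[OF smooth_add[OF schwartz_smooth[OF f] schwartz_smooth[OF g]]])
  fix bs :: "'a list" and N assume bs: "bs \<in> lists Basis"
  from schwartz_partials_bound[OF f bs] schwartz_partials_bound[OF g bs] obtain C D where
    C: "\<And>x. (1 + norm x) ^ N * norm (partials bs f x) \<le> C"
        and D: "\<And>x. (1 + norm x) ^ N * norm (partials bs g x) \<le> D" by metis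
  have "(1 + norm x) ^ N * norm (partials bs f x + partials bs g x) \<le> C + D" for x
    by (rule order_trans[OF mult_left_mono[OF norm_triangle_ineq]]) (use C[of x] D[of x] in \<open>auto simp: distrib_left\<close>)
  then show "\<exists>C. \<forall>x. (1 + norm x) ^ N * norm (partials bs (\<lambda>x. f x + g x) x) \<le> C"
    using f g bs by (auto simp: partials_add schwartz_smooth)
qed

lemma schwartz_cmult:
  assumes f: "f \<in> schwartz"
  shows "(\<lambda>x. c * f x) \<in> schwartz"
proof (rule schwartzI[OF smooth_cmult[OF schwartz_smooth[OF f]]])
  fix bs :: "'a list" and N assume bs: "bs \<in> lists Basis"
  from schwartz_partials_bound[OF f bs] obtain C where C: "\<And>x. (1 + norm x) ^ N * norm (partials bs f x) \<le> C" by metis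
  have "(1 + norm x) ^ N * norm (c * partials bs f x) \<le> norm c * C" for x
    using mult_left_mono[OF C[of x], of "norm c"] by (simp add: norm_mult mult_ac)
  then show "\<exists>C. \<forall>x. (1 + norm x) ^ N * norm (partials bs (\<lambda>x. c * f x) x) \<le> C"
    using f bs by (auto simp: partials_cmult schwartz_smooth)
qed

lemma schwartz_diff: "f \<in> schwartz \<Longrightarrow> g \<in> schwartz \<Longrightarrow> (\<lambda>x. f x - g x) \<in> schwartz"
  using schwartz_add[OF _ schwartz_cmult[of g "-1"], of f] by simp

section \<open>Integrability and Fourier transforms of Schwartz functions\<close>

lemma schwartz_integrable_bound:
  fixes f :: "'a::euclidean_space \<Rightarrow> complex"
  assumes f: "f \<in> schwartz" and bs: "bs \<in> lists Basis" "length bs \<le> N" and N: "2 * DIM('a) \<le> N"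
  shows "integrable lborel (partials bs f)"
    and "(LINT x|lborel. norm (partials bs f x)) \<le> (LINT x::'a|lborel. inverse ((1 + norm x) ^ N))
        * schwartz_norm N f"
  using integrable_decay[OF _ N partials_le_schwartz_norm[OF f bs]]
      integral_decay_le[OF _ N partials_le_schwartz_norm[OF f bs]]
    smooth_measurable[OF smooth_partials[OF schwartz_smooth[OF f] bs(1)]] by blast+

lemma schwartz_integrable: "f \<in> schwartz \<Longrightarrow> integrable lborel f"
  using schwartz_integrable_bound(1)[of f "[]", OF _ _ _ order_refl] by simp

lemma schwartz_measurable: "f \<in> schwartz \<Longrightarrow> f \<in> borel_measurable borel"
  by (intro smooth_measurable schwartz_smooth)

lemma schwartz_bounded: "f \<in> schwartz \<Longrightarrow> \<exists>B. \<forall>x. norm (f x) \<le> B"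
  using schwartz_partials_bound[of f "[]" 0] by simp

lemma schwartz_decay: "f \<in> schwartz \<Longrightarrow> \<exists>C. \<forall>x. (1 + norm x) ^ N * norm (f x) \<le> C"
  using schwartz_partials_bound[of f "[]" N] by simp

lemma schwartz_inverse_fourier_decay:
  fixes f :: "'a::euclidean_space \<Rightarrow> complex"
  assumes f: "f \<in> schwartz"
  shows "(1 + norm \<eta>) ^ k * norm (inverse_fourier f \<eta>)
    \<le> (1 + DIM('a)) ^ k * ((LINT x|lborel. norm (f x))
        + (\<Sum>b\<in>Basis. LINT x|lborel. norm (partials (replicate k b) f x)))"
proof (rule inverse_fourier_decay[where D = "\<lambda>b n. partials (replicate n b) f"])
  fix b :: 'a and n assume "b \<in> Basis" "n \<le> k"
  then show "integrable lborel (partials (replicate n b) f)"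
    by (intro schwartz_integrable_bound(1)[OF f _ _ order_refl] schwartz_integrable_bound(1)[OF f,
        where N = "max n (2 * DIM('a))"])
      (auto simp: in_lists_conv_set)
qed (auto intro: smooth_dseq schwartz_smooth[OF f])

lemma schwartz_fourier_nice: "schwartz \<subseteq> fourier_nice"
proof
  fix f :: "'a \<Rightarrow> complex" assume f: "f \<in> schwartz"
  from schwartz_bounded[OF f] obtain B where B: "\<And>x. norm (f x) \<le> B" by blast
  have [measurable]: "f \<in> borel_measurable borel" by (rule schwartz_measurable[OF f])
  have "integrable lborel (fourier f)"
    by (rule integrable_decay[OF _ order_refl])
      (simp, use schwartz_inverse_fourier_decay[OF f, of "- _"] in \<open>simp add: fourier_eq_inverse_fourier\<close>)
  then show "f \<in> fourier_nice"
    using schwartz_integrable[OF f] square_integrable_bounded[OF schwartz_integrable[OF f] B]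
        by (simp add: fourier_nice_def)
qed

text \<open>Leibniz's rule, with Pascal's rule collecting the coefficients. The sequence is given
  explicitly because later estimates bound its terms one by one.\<close>

lemma dseq_mult:
  assumes D: "dseq b D" and E: "dseq b E"
  shows "dseq b (\<lambda>n x. \<Sum>k\<le>n. of_nat (n choose k) * (D k x * E (n - k) x))"
  unfolding dseq_def
proof (intro allI conjI)
  fix n
  show "continuous_on UNIV (\<lambda>x. \<Sum>k\<le>n. of_nat (n choose k) * (D k x * E (n - k) x))"
    using D E by (intro continuous_intros) (auto simp: dseq_def)
  have "dirderiv b (\<lambda>x. \<Sum>k\<le>n. of_nat (n choose k) * (D k x * E (n - k) x))
      (\<lambda>x. \<Sum>k\<le>n. of_nat (n choose k) * (D (Suc k) x * E (n - k) x + D k x * E (Suc (n - k)) x))"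
    using D E by (intro dirderiv_sum dirderiv_cmult dirderiv_mult) (auto simp: dseq_def)
  also have "(\<lambda>x. \<Sum>k\<le>n. of_nat (n choose k) * (D (Suc k) x * E (n - k) x + D k x * E (Suc (n - k)) x))
      = (\<lambda>x. \<Sum>k\<le>Suc n. of_nat (Suc n choose k) * (D k x * E (Suc n - k) x))"
  proof
    fix x
    let ?S = "\<Sum>k\<le>n. of_nat (n choose k) * (D (Suc k) x * E (n - k) x)"
    have "(\<Sum>k\<le>n. of_nat (n choose k) * (D (Suc k) x * E (n - k) x + D k x * E (Suc (n - k)) x))
        = ?S + (\<Sum>k\<le>n. of_nat (n choose k) * (D k x * E (Suc n - k) x))"
      by (simp add: distrib_left sum.distrib Suc_diff_le)
    also have "(\<Sum>k\<le>n. of_nat (n choose k) * (D k x * E (Suc n - k) x))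
        = (\<Sum>k\<le>Suc n. of_nat (n choose k) * (D k x * E (Suc n - k) x))"
      by simp
    also have "\<dots> = D 0 x * E (Suc n) x + (\<Sum>k\<le>n. of_nat (n choose Suc k) * (D (Suc k) x * E (n - k) x))"
      by (subst sum.atMost_Suc_shift) simp
    also have "?S + \<dots> = D 0 x * E (Suc n) x + (\<Sum>k\<le>n. of_nat (Suc n choose Suc k) * (D (Suc k) x * E (n - k) x))"
      by (simp add: distrib_right sum.distrib)
    also have "\<dots> = (\<Sum>k\<le>Suc n. of_nat (Suc n choose k) * (D k x * E (Suc n - k) x))"
      by (subst sum.atMost_Suc_shift) simp
    finally show "(\<Sum>k\<le>n. of_nat (n choose k) * (D (Suc k) x * E (n - k) x + D k x * E (Suc (n - k)) x))
      = (\<Sum>k\<le>Suc n. of_nat (Suc n choose k) * (D k x * E (Suc n - k) x))" .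
  qed
  finally show "dirderiv b (\<lambda>x. \<Sum>k\<le>n. of_nat (n choose k) * (D k x * E (n - k) x))
    (\<lambda>x. \<Sum>k\<le>Suc n. of_nat (Suc n choose k) * (D k x * E (Suc n - k) x))" .
qed

subsection \<open>Time-frequency shifts of a Gaussian\<close>

text \<open>Coinduction: smoothness asks for differentiability of all iterated partial derivatives,
  so it suffices to find a class of differentiable functions closed under \<open>partial\<close>.
  The second conclusion keeps the explicit form of the derivatives.\<close>

lemma smooth_coinduct:
  assumes f: "f \<in> X" and d: "\<And>g x. g \<in> X \<Longrightarrow> g differentiable (at x)"
    and p: "\<And>g b. g \<in> X \<Longrightarrow> b \<in> Basis \<Longrightarrow> partial b g \<in> X"
  shows "smooth f" and "bs \<in> lists Basis \<Longrightarrow> partials bs f \<in> X"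
proof -
  have *: "partials bs f \<in> X" if "bs \<in> lists Basis" for bs
    using that by (induction bs rule: list.induct) (auto intro: f p)
  show "bs \<in> lists Basis \<Longrightarrow> partials bs f \<in> X" by (rule *)
  show "smooth f" unfolding smooth_def using * d by blast
qed

text \<open>Complex polynomials in the real coordinates, generated so that closure under derivatives
  and polynomial growth follow by rule induction.\<close>

inductive cpoly :: "('a::euclidean_space \<Rightarrow> complex) \<Rightarrow> bool" where
  cpoly_const: "cpoly (\<lambda>z. k)"
| cpoly_inner: "cpoly (\<lambda>z. of_real (z \<bullet> v))"
| cpoly_add: "cpoly f \<Longrightarrow> cpoly g \<Longrightarrow> cpoly (\<lambda>z. f z + g z)"
| cpoly_mult: "cpoly f \<Longrightarrow> cpoly g \<Longrightarrow> cpoly (\<lambda>z. f z * g z)"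

lemma cpoly_differentiable: "cpoly f \<Longrightarrow> f differentiable (at x)"
proof (induction rule: cpoly.induct)
  case (cpoly_inner v)
  show ?case by (intro differentiableI[where f' = "\<lambda>h. of_real (h \<bullet> v)"]) (auto intro!: derivative_eq_intros)
qed (auto intro!: differentiable_add differentiable_mult)

lemma cpoly_dirderiv: "cpoly f \<Longrightarrow> \<exists>f'. cpoly f' \<and> dirderiv b f f'"
proof (induction rule: cpoly.induct)
  case (cpoly_const k)
  then show ?case by (blast intro: cpoly.cpoly_const dirderiv_const)
next
  case (cpoly_inner v)
  have "dirderiv b (\<lambda>z. complex_of_real (z \<bullet> v)) (\<lambda>z. of_real (b \<bullet> v))"
    unfolding dirderiv_def by (auto intro!: derivative_eq_intros simp: inner_add_left)
  then show ?case by (blast intro: cpoly.cpoly_const)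
next
  case (cpoly_add f g)
  then show ?case by (blast intro: cpoly.cpoly_add dirderiv_add)
next
  case (cpoly_mult f g)
  then obtain f' g' where "cpoly f'" "dirderiv b f f'" "cpoly g'" "dirderiv b g g'" by blast
  with cpoly_mult.hyps show ?case by (blast intro: cpoly.cpoly_add cpoly.cpoly_mult dirderiv_mult)
qed

lemma cpoly_bound: "cpoly f \<Longrightarrow> \<exists>C m. 0 \<le> C \<and> (\<forall>z. norm (f z) \<le> C * (1 + norm z) ^ m)"
proof (induction rule: cpoly.induct)
  case (cpoly_const k)
  then show ?case by (intro exI[of _ "norm k"] exI[of _ 0]) auto
next
  case (cpoly_inner v)
  have "norm (complex_of_real (z \<bullet> v)) \<le> norm v * (1 + norm z) ^ 1" for z
  proof -
    have "norm z * norm v \<le> (1 + norm z) * norm v" by (intro mult_right_mono) auto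
    then show ?thesis using Cauchy_Schwarz_ineq2[of z v] by (simp add: mult.commute)
  qed
  then show ?case by (intro exI[of _ "norm v"] exI[of _ 1]) auto
next
  case (cpoly_add f g)
  then obtain C m D n where C: "0 \<le> C" "\<And>z. norm (f z) \<le> C * (1 + norm z) ^ m"
    and D: "0 \<le> D" "\<And>z. norm (g z) \<le> D * (1 + norm z) ^ n" by blast
  have "norm (f z + g z) \<le> (C + D) * (1 + norm z) ^ (m + n)" for z
  proof -
    have "norm (f z + g z) \<le> C * (1 + norm z) ^ m + D * (1 + norm z) ^ n"
      using norm_triangle_ineq[of "f z" "g z"] C(2)[of z] D(2)[of z] by linarith
    also have "\<dots> \<le> C * (1 + norm z) ^ (m + n) + D * (1 + norm z) ^ (m + n)"
      using C D by (intro add_mono mult_left_mono power_increasing) auto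
    finally show ?thesis by (simp add: distrib_right)
  qed
  then show ?case using C D by (intro exI[of _ "C + D"] exI[of _ "m + n"]) auto
next
  case (cpoly_mult f g)
  then obtain C m D n where C: "0 \<le> C" "\<And>z. norm (f z) \<le> C * (1 + norm z) ^ m"
    and D: "0 \<le> D" "\<And>z. norm (g z) \<le> D * (1 + norm z) ^ n" by blast
  have "norm (f z * g z) \<le> (C * D) * (1 + norm z) ^ (m + n)" for z
  proof -
    have "norm (f z) * norm (g z) \<le> (C * (1 + norm z) ^ m) * (D * (1 + norm z) ^ n)"
      using C D by (intro mult_mono) auto
    then show ?thesis by (simp add: norm_mult power_add mult_ac)
  qed
  then show ?case using C D by (intro exI[of _ "C * D"] exI[of _ "m + n"]) auto
qed

text \<open>A modulated Gaussian with the frequency \<open>fst z\<close> treated as a variable on a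
  par with the point \<open>snd z\<close>. Derivatives in both are partial derivatives of one smooth
  function, which yields the Lipschitz dependence of time-frequency shifts on their
  parameters.\<close>

definition mgauss :: "'a::euclidean_space \<times> 'a \<Rightarrow> complex" where
  "mgauss z = ch (snd z \<bullet> fst z) * gauss 2 (snd z)"

lemma mgauss_exp: "mgauss z = exp (2 * pi * \<i> * (snd z \<bullet> fst z) - 2 * pi * (snd z \<bullet> snd z))"
proof -
  have "mgauss z = exp (2 * pi * \<i> * (snd z \<bullet> fst z)) * exp (complex_of_real (- (pi * 2 * (norm (snd z))\<^sup>2)))"
    unfolding mgauss_def gauss_def ch_eq_exp(1) exp_of_real by simp
  then show ?thesis by (simp add: power2_norm_eq_inner mult_ac flip: exp_add)
qed

lemma mgauss_has_derivative:
  "(mgauss has_derivative (\<lambda>h. (2 * pi * \<i> * (snd h \<bullet> fst z + snd z \<bullet> fst h)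
      - 4 * pi * (snd z \<bullet> snd h)) * mgauss z)) (at z)"
proof -
  let ?q = "\<lambda>z::'a\<times>'a. complex_of_real (2 * pi) * \<i> * complex_of_real (snd z \<bullet> fst z)
      - complex_of_real (2 * pi * (snd z \<bullet> snd z))"
  have q: "(?q has_derivative (\<lambda>h. complex_of_real (2 * pi) * \<i> * complex_of_real (snd h \<bullet> fst z
      + snd z \<bullet> fst h) - complex_of_real (4 * pi * (snd z \<bullet> snd h)))) (at z)"
    by (auto intro!: derivative_eq_intros simp: inner_commute algebra_simps)
  have "(exp has_derivative (\<lambda>w. exp (?q z) * w)) (at (?q z))"
    using DERIV_exp[of "?q z"] by (simp add: has_field_derivative_def)
  from has_derivative_compose[OF q this]
  have "((\<lambda>z. exp (?q z)) has_derivative (\<lambda>h. exp (?q z)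
      * (complex_of_real (2 * pi) * \<i> * complex_of_real (snd h \<bullet> fst z + snd z \<bullet> fst h)
      - complex_of_real (4 * pi * (snd z \<bullet> snd h))))) (at z)" .
  then show ?thesis by (simp add: mgauss_exp[abs_def] mult.commute)
qed

definition mgauss_class :: "('a::euclidean_space \<times> 'a \<Rightarrow> complex) set" where
  "mgauss_class = {\<lambda>z. Q z * mgauss z |Q. cpoly Q}"

lemma mgauss_class_differentiable: "g \<in> mgauss_class \<Longrightarrow> g differentiable (at z)"
  unfolding mgauss_class_def
  using differentiable_mult[OF cpoly_differentiable differentiableI[OF mgauss_has_derivative]] by blast

lemma mgauss_class_partial:
  fixes g :: "'a::euclidean_space \<times> 'a \<Rightarrow> complex"
  assumes "g \<in> mgauss_class"
  shows "partial b g \<in> mgauss_class"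
proof -
  obtain Q where Q: "cpoly Q" and g: "g = (\<lambda>z. Q z * mgauss z)" using assms by (auto simp: mgauss_class_def)
  obtain Q' where Q': "cpoly Q'" "dirderiv b Q Q'" using cpoly_dirderiv[OF Q] by blast
  define L :: "'a \<times> 'a \<Rightarrow> complex" where "L z = 2 * pi * \<i> * of_real (z \<bullet> (snd b, fst b))
      + complex_of_real (- 4 * pi) * of_real (z \<bullet> (0, snd b))" for z
  have L: "cpoly L" unfolding L_def[abs_def] by (intro cpoly_add cpoly_mult cpoly_const cpoly_inner)
  have "dirderiv b mgauss (\<lambda>z. L z * mgauss z)"
    using has_derivative_dirderiv[OF mgauss_has_derivative, of b]
    by (simp add: L_def inner_prod_def inner_commute algebra_simps)
  from dirderiv_partial[OF dirderiv_mult[OF Q'(2) this]]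
  have "partial b g = (\<lambda>z. (Q' z + Q z * L z) * mgauss z)" by (simp add: g algebra_simps)
  moreover have "cpoly (\<lambda>z. Q' z + Q z * L z)" by (intro cpoly_add cpoly_mult Q Q' L)
  ultimately show ?thesis by (auto simp: mgauss_class_def)
qed

lemma mgauss_in_class: "mgauss \<in> mgauss_class"
  using cpoly_const[of 1] by (force simp: mgauss_class_def)

lemma smooth_mgauss: "smooth mgauss"
  by (rule smooth_coinduct(1)[OF mgauss_in_class mgauss_class_differentiable mgauss_class_partial])

lemma one_plus_norm_triangle: "1 + norm (x + y) \<le> (1 + norm x) * (1 + norm y)"
proof -
  have "(1 + norm x) * (1 + norm y) = 1 + norm x + norm y + norm x * norm y" by (simp add: algebra_simps)
  then show ?thesis
    using norm_triangle_ineq[of x y] mult_nonneg_nonneg[OF norm_ge_zero[of x] norm_ge_zero[of y]] by linarith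
qed

lemma one_plus_norm_triangle_power: "(1 + norm (x + y)) ^ n \<le> (1 + norm x) ^ n * (1 + norm y) ^ n"
  using power_mono[OF one_plus_norm_triangle[of x y], of n] by (simp add: power_mult_distrib)

lemma one_plus_norm_Pair_power: "(1 + norm (x, y)) ^ n \<le> (1 + norm x) ^ n * (1 + norm y) ^ n"
proof -
  have "1 + norm (x, y) \<le> (1 + norm x) * (1 + norm y)"
  proof -
    have "(1 + norm x) * (1 + norm y) = 1 + norm x + norm y + norm x * norm y" by (simp add: algebra_simps)
    then show ?thesis
      using norm_Pair_le[of x y] mult_nonneg_nonneg[OF norm_ge_zero[of x] norm_ge_zero[of y]] by linarith
  qed
  from power_mono[OF this, of n] show ?thesis by (simp add: power_mult_distrib)
qed

text \<open>Every derivative is a polynomial times \<open>mgauss\<close>. The Gaussian absorbs all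
  powers of \<open>y\<close> and leaves a power of the frequency \<open>c\<close>.\<close>

lemma mgauss_partials_bound:
  fixes bs :: "('a::euclidean_space \<times> 'a) list"
  assumes "bs \<in> lists Basis"
  shows "\<exists>C m. 0 \<le> C \<and> (\<forall>c y. (1 + norm y) ^ N * norm (partials bs mgauss (c, y)) \<le> C * (1 + norm c) ^ m)"
proof -
  have "partials bs mgauss \<in> mgauss_class"
    by (rule smooth_coinduct(2)[OF mgauss_in_class mgauss_class_differentiable mgauss_class_partial assms])
  then obtain Q where Q: "cpoly Q" "partials bs mgauss = (\<lambda>z. Q z * mgauss z)" by (auto simp: mgauss_class_def)
  from cpoly_bound[OF Q(1)] obtain C m where C: "0 \<le> C" "\<And>z. norm (Q z) \<le> C * (1 + norm z) ^ m" by blast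
  from gauss_decay[of 2 "N + m"] obtain D where D: "0 < D" "\<And>y::'a. (1 + norm y) ^ (N + m) * gauss 2 y \<le> D" by auto
  have "(1 + norm y) ^ N * norm (partials bs mgauss (c, y)) \<le> (C * D) * (1 + norm c) ^ m" for c y
  proof -
    have "(1 + norm y) ^ N * norm (partials bs mgauss (c, y)) = (1 + norm y) ^ N * (norm (Q (c, y)) * gauss 2 y)"
      by (simp add: Q(2) mgauss_def norm_mult)
    also have "\<dots> \<le> (1 + norm y) ^ N * ((C * ((1 + norm c) ^ m * (1 + norm y) ^ m)) * gauss 2 y)"
    proof (intro mult_left_mono mult_right_mono)
      show "norm (Q (c, y)) \<le> C * ((1 + norm c) ^ m * (1 + norm y) ^ m)"
        by (rule order_trans[OF C(2)]) (intro mult_left_mono one_plus_norm_Pair_power C(1))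
    qed auto
    also have "\<dots> = (C * (1 + norm c) ^ m) * ((1 + norm y) ^ (N + m) * gauss 2 y)" by (simp add: power_add mult_ac)
    also have "\<dots> \<le> (C * (1 + norm c) ^ m) * D" using C by (intro mult_left_mono D) auto
    finally show ?thesis by (simp add: mult_ac)
  qed
  then show ?thesis using C D by (intro exI[of _ "C * D"] exI[of _ m]) auto
qed

text \<open>For \<open>p = (a, c)\<close> and the empty list this is \<open>gauss 2\<close>
  translated by \<open>a\<close> and modulated by \<open>c\<close>. The list records derivatives in
  \<open>x\<close>: the direction \<open>(0, b)\<close> is the point variable of
  \<open>mgauss\<close>.\<close>

definition tfg :: "'a::euclidean_space list \<Rightarrow> 'a \<times> 'a \<Rightarrow> 'a \<Rightarrow> complex" where
  "tfg bs p x = partials (map (Pair 0) bs) mgauss (snd p, x - fst p)"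

lemma tfg_Nil: "tfg [] (a, c) x = ch ((x - a) \<bullet> c) * gauss 2 (x - a)"
  by (simp add: tfg_def mgauss_def)

lemma map_Pair_lists: "bs \<in> lists Basis \<Longrightarrow> map (Pair 0) bs \<in> lists Basis"
  by (auto simp: Basis_prod_def)

lemma dirderiv_slice:
  assumes "dirderiv (0, b) f f'"
  shows "dirderiv b (\<lambda>x. f (c, x - a)) (\<lambda>x. f' (c, x - a))"
  unfolding dirderiv_def
proof
  fix x
  have "((\<lambda>t. f ((c, x - a) + t *\<^sub>R (0, b))) has_vector_derivative f' (c, x - a)) (at 0)"
    using assms by (simp add: dirderiv_def)
  then show "((\<lambda>t. f (c, x + t *\<^sub>R b - a)) has_vector_derivative f' (c, x - a)) (at 0)"
    by (simp add: algebra_simps)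
qed

lemma tfg_dirderiv:
  assumes "bs \<in> lists Basis" "b \<in> Basis"
  shows "dirderiv b (tfg bs p) (tfg (b # bs) p)"
proof -
  have "dirderiv (0, b) (partials (map (Pair 0) bs) mgauss) (partials ((0, b) # map (Pair 0) bs) mgauss)"
    by (rule smooth_partials_dirderiv[OF smooth_mgauss _ map_Pair_lists[OF assms(1)]])
      (use assms in \<open>auto simp: Basis_prod_def\<close>)
  from dirderiv_slice[OF this, of "snd p" "fst p"] show ?thesis by (simp add: tfg_def[abs_def])
qed

lemma tfg_partials: "bs \<in> lists Basis \<Longrightarrow> partials bs (tfg [] p) = tfg bs p"
  by (induction bs rule: list.induct) (auto intro: dirderiv_partial tfg_dirderiv)

lemma smooth_tfg: "smooth (tfg [] p)"
  unfolding smooth_def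
proof (intro ballI allI)
  fix bs :: "'a list" and x assume bs: "bs \<in> lists Basis"
  have "partials (map (Pair 0) bs) mgauss differentiable (at (snd p, x - fst p))"
    by (rule smooth_differentiable[OF smooth_partials[OF smooth_mgauss map_Pair_lists[OF bs]]])
  moreover have "(\<lambda>x. (snd p, x - fst p)) differentiable (at x)"
    by (rule differentiableI[where f' = "\<lambda>h. (0, h)"]) (auto intro!: derivative_eq_intros)
  ultimately have "(partials (map (Pair 0) bs) mgauss \<circ> (\<lambda>x. (snd p, x - fst p))) differentiable (at x)"
    by (intro differentiable_chain_at)
  then show "partials bs (tfg [] p) differentiable (at x)"
    unfolding tfg_partials[OF bs] by (simp add: tfg_def[abs_def] o_def)
qed

text \<open>Since \<open>1 + norm\<close> is submultiplicative, the weight at \<open>x\<close> moves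
  to \<open>x - fst p\<close> at the cost of a power of \<open>1 + norm p\<close>. Polynomial growth
  in \<open>p\<close> is what the rapidly decreasing densities of the superpositions can
  absorb.\<close>

lemma tfg_bound:
  fixes bs :: "'a::euclidean_space list"
  assumes "bs \<in> lists Basis"
  shows "\<exists>C m. 0 \<le> C \<and> (\<forall>p x. (1 + norm x) ^ N * norm (tfg bs p x) \<le> C * (1 + norm p) ^ m)"
proof -
  from mgauss_partials_bound[OF map_Pair_lists[OF assms], of N] obtain C m where
    C: "0 \<le> C" "\<And>c y. (1 + norm y) ^ N * norm (partials (map (Pair 0) bs) mgauss (c, y))
        \<le> C * (1 + norm c) ^ m" by blast
  have "(1 + norm x) ^ N * norm (tfg bs p x) \<le> C * (1 + norm p) ^ (m + N)" for p x
  proof -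
    have "(1 + norm x) ^ N * norm (tfg bs p x)
        \<le> ((1 + norm (x - fst p)) ^ N * (1 + norm (fst p)) ^ N) * norm (tfg bs p x)"
      using one_plus_norm_triangle_power[of "x - fst p" "fst p" N] by (intro mult_right_mono) auto
    also have "\<dots> = (1 + norm (fst p)) ^ N
        * ((1 + norm (x - fst p)) ^ N * norm (partials (map (Pair 0) bs) mgauss (snd p, x - fst p)))"
      by (simp add: tfg_def mult_ac)
    also have "\<dots> \<le> (1 + norm p) ^ N * (C * (1 + norm p) ^ m)"
    proof (rule mult_mono)
      show "(1 + norm (fst p)) ^ N \<le> (1 + norm p) ^ N" using norm_fst_le[of "fst p" "snd p"]
          by (intro power_mono) auto
      have "(1 + norm (snd p)) ^ m \<le> (1 + norm p) ^ m" using norm_snd_le[of "snd p" "fst p"]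
          by (intro power_mono) auto
      then show "(1 + norm (x - fst p)) ^ N
          * norm (partials (map (Pair 0) bs) mgauss (snd p, x - fst p)) \<le> C * (1 + norm p) ^ m"
        using C(1) by (intro order_trans[OF C(2)] mult_left_mono)
    qed (use C(1) in auto)
    finally show ?thesis by (simp add: power_add mult_ac)
  qed
  then show ?thesis using C(1) by blast
qed

lemma tfg_schwartz: "tfg [] p \<in> schwartz"
proof (rule schwartzI[OF smooth_tfg])
  fix bs :: "'a list" and N assume bs: "bs \<in> lists Basis"
  from tfg_bound[OF bs, of N] show "\<exists>C. \<forall>x. (1 + norm x) ^ N * norm (partials bs (tfg [] p) x) \<le> C"
    unfolding tfg_partials[OF bs] by metis
qed

text \<open>The mean value inequality along the segment from \<open>q\<close> to \<open>p\<close> in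
  the variables of \<open>mgauss\<close>, with the weight in \<open>x\<close> carried along.\<close>

lemma tfg_lipschitz:
  fixes bs :: "'a::euclidean_space list"
  assumes "bs \<in> lists Basis"
  shows "\<exists>C m. 0 \<le> C \<and> (\<forall>p q x. (1 + norm x) ^ N * norm (tfg bs p x - tfg bs q x)
      \<le> C * (1 + norm p + norm q) ^ m * norm (p - q))"
proof -
  let ?g = "partials (map (Pair 0) bs) mgauss"
  have "\<forall>b\<in>Basis. \<exists>C m. 0 \<le> C \<and> (\<forall>c y. (1 + norm y) ^ N * norm (partial b ?g (c, y)) \<le> C * (1 + norm c) ^ m)"
  proof
    fix b :: "'a \<times> 'a" assume b: "b \<in> Basis"
    then have "b # map (Pair 0) bs \<in> lists Basis" using map_Pair_lists[OF assms] by simp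
    from mgauss_partials_bound[OF this, of N]
    show "\<exists>C m. 0 \<le> C \<and> (\<forall>c y. (1 + norm y) ^ N * norm (partial b ?g (c, y)) \<le> C * (1 + norm c) ^ m)" by simp
  qed
  then obtain C m where C: "\<And>b. b \<in> Basis \<Longrightarrow> 0 \<le> C b"
    "\<And>b c y. b \<in> Basis \<Longrightarrow> (1 + norm y) ^ N * norm (partial b ?g (c, y)) \<le> C b * (1 + norm c) ^ m b" by metis
  define M where "M = N + Max (m ` Basis)"
  have M: "N + m b \<le> M" if "b \<in> Basis" for b using that by (simp add: M_def)
  have "(1 + norm x) ^ N * norm (tfg bs p x - tfg bs q x)
      \<le> (\<Sum>b\<in>Basis. C b) * (1 + norm p + norm q) ^ M * norm (p - q)" for p q x
  proof -
    define z where "z t = (snd q + t *\<^sub>R (snd p - snd q), x - (fst q + t *\<^sub>R (fst p - fst q)))" for t :: real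
    \<comment> \<open>The velocity of \<open>z\<close>; the position enters \<open>mgauss\<close>
      through \<open>x - a\<close>, hence the sign.\<close>
    define v where "v = (snd p - snd q, - (fst p - fst q))"
    have nv: "norm v = norm (p - q)"
        by (simp add: v_def norm_prod_def add.commute norm_minus_commute fst_diff snd_diff)
    let ?B = "(\<Sum>b\<in>Basis. C b) * (1 + norm p + norm q) ^ M * norm (p - q)"
    have der: "((\<lambda>t. (1 + norm x) ^ N *\<^sub>R ?g (z t))
        has_derivative (\<lambda>s. (1 + norm x) ^ N *\<^sub>R (\<Sum>b\<in>Basis. ((s *\<^sub>R v) \<bullet> b) *\<^sub>R partial b ?g
        (z t)))) (at t within {0..1})" for t
    proof -
      have 1: "(z has_derivative (\<lambda>s. s *\<^sub>R v)) (at t within {0..1})"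
        unfolding z_def[abs_def] v_def by (auto intro!: derivative_eq_intros simp: algebra_simps)
      have 2: "(?g has_derivative (\<lambda>w. \<Sum>b\<in>Basis. (w \<bullet> b) *\<^sub>R partial b ?g (z t))) (at (z t))"
        by (rule smooth_has_derivative[OF smooth_partials[OF smooth_mgauss map_Pair_lists[OF assms]]])
      show ?thesis by (intro has_derivative_scaleR_right has_derivative_compose[OF 1 2])
    qed
    have "norm ((1 + norm x) ^ N *\<^sub>R ?g (z 1) - (1 + norm x) ^ N *\<^sub>R ?g (z 0)) \<le> ?B * norm (1 - 0 :: real)"
    proof (rule differentiable_bound[OF _ der])
      fix t :: real assume t: "t \<in> {0..1}"
      define a c where "a = fst q + t *\<^sub>R (fst p - fst q)" and "c = snd q + t *\<^sub>R (snd p - snd q)"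
      have zt: "z t = (c, x - a)" by (simp add: z_def a_def c_def)
      have conv: "norm (w1 + t *\<^sub>R (w2 - w1)) \<le> norm w2 + norm w1" for w1 w2 :: 'a
      proof -
        have "norm (w1 + t *\<^sub>R (w2 - w1)) = norm ((1 - t) *\<^sub>R w1 + t *\<^sub>R w2)" by (simp add: algebra_simps)
        also have "\<dots> \<le> (1 - t) * norm w1 + t * norm w2"
            using t norm_triangle_ineq[of "(1 - t) *\<^sub>R w1" "t *\<^sub>R w2"] by simp
        also have "\<dots> \<le> 1 * norm w1 + 1 * norm w2" using t by (intro add_mono mult_right_mono) auto
        finally show ?thesis by simp
      qed
      have a: "1 + norm a \<le> 1 + norm p + norm q"
        using conv[of "fst q" "fst p"] norm_fst_le[of "fst p" "snd p"]
            norm_fst_le[of "fst q" "snd q"] by (simp add: a_def)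
      have c: "1 + norm c \<le> 1 + norm p + norm q"
        using conv[of "snd q" "snd p"] norm_snd_le[of "snd p" "fst p"]
            norm_snd_le[of "snd q" "fst q"] by (simp add: c_def)
      have bb: "(1 + norm x) ^ N * norm (partial b ?g (z t)) \<le> C b * (1 + norm p + norm q) ^ M"
          if b: "b \<in> Basis" for b
      proof -
        have "(1 + norm x) ^ N * norm (partial b ?g (z t))
            \<le> ((1 + norm (x - a)) ^ N * (1 + norm a) ^ N) * norm (partial b ?g (z t))"
          using one_plus_norm_triangle_power[of "x - a" a N] by (intro mult_right_mono) auto
        also have "\<dots> = (1 + norm a) ^ N * ((1 + norm (x - a)) ^ N * norm (partial b ?g (c, x - a)))"
            by (simp add: zt mult_ac)
        also have "\<dots> \<le> (1 + norm p + norm q) ^ N * (C b * (1 + norm p + norm q) ^ m b)"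
        proof (rule mult_mono[OF power_mono[OF a]])
          show "(1 + norm (x - a)) ^ N * norm (partial b ?g (c, x - a)) \<le> C b * (1 + norm p + norm q) ^ m b"
            by (rule order_trans[OF C(2)[OF b]]) (intro mult_left_mono power_mono c C(1)[OF b], simp)
        qed auto
        also have "\<dots> = C b * (1 + norm p + norm q) ^ (N + m b)" by (simp add: power_add mult_ac)
        also have "\<dots> \<le> C b * (1 + norm p + norm q) ^ M"
          using M[OF b] C(1)[OF b] by (intro mult_left_mono power_increasing) auto
        finally show ?thesis .
      qed
      show "onorm (\<lambda>s. (1 + norm x) ^ N *\<^sub>R (\<Sum>b\<in>Basis. ((s *\<^sub>R v) \<bullet> b) *\<^sub>R partial b ?g (z t))) \<le> ?B"
      proof (rule onorm_le)
        fix s :: real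
        have "norm ((1 + norm x) ^ N *\<^sub>R (\<Sum>b\<in>Basis. ((s *\<^sub>R v) \<bullet> b) *\<^sub>R partial b ?g (z t)))
            \<le> (1 + norm x) ^ N * (\<Sum>b\<in>Basis. norm (((s *\<^sub>R v) \<bullet> b) *\<^sub>R partial b ?g (z t)))"
          unfolding norm_scaleR[of "(1 + norm x) ^ N"]
              by (simp only: power_abs abs_of_nonneg[OF add_nonneg_nonneg[OF zero_le_one norm_ge_zero]])
            (rule mult_left_mono[OF norm_sum], simp)
        also have "\<dots> = (\<Sum>b\<in>Basis. \<bar>(s *\<^sub>R v) \<bullet> b\<bar> * ((1 + norm x) ^ N * norm (partial b ?g (z t))))"
          by (simp add: sum_distrib_left mult_ac)
        also have "\<dots> \<le> (\<Sum>b\<in>Basis. norm (s *\<^sub>R v) * (C b * (1 + norm p + norm q) ^ M))"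
          by (intro sum_mono mult_mono Basis_le_norm bb) auto
        also have "\<dots> = ?B * norm s" by (simp add: nv sum_distrib_left sum_distrib_right mult_ac)
        finally show "norm ((1 + norm x) ^ N *\<^sub>R (\<Sum>b\<in>Basis. ((s *\<^sub>R v) \<bullet> b) *\<^sub>R partial b ?g (z t))) \<le> ?B * norm s" .
      qed
    qed auto
    moreover have "(1 + norm x) ^ N *\<^sub>R ?g (z 1) - (1 + norm x) ^ N *\<^sub>R ?g (z 0)
        = (1 + norm x) ^ N *\<^sub>R (tfg bs p x - tfg bs q x)"
      by (simp add: z_def tfg_def scaleR_diff_right)
    ultimately show ?thesis by simp
  qed
  moreover have "0 \<le> (\<Sum>b\<in>Basis. C b)" using C(1) by (intro sum_nonneg)
  ultimately show ?thesis by blast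
qed

subsection \<open>Density of time-frequency shifts of a Gaussian\<close>

text \<open>The weight of the frequencies that turn \<open>gauss 2\<close> into a narrower Gaussian:
  in the factorisation of \<open>gauss (1 / \<kappa>)\<close> as \<open>gauss 2\<close> times
  \<open>gauss (1 / \<kappa> - 2)\<close>, the second factor is the transform of
  \<open>heat (1 / \<kappa> - 2)\<close>. The power of \<open>1 / sqrt \<kappa>\<close> normalises
  to \<open>heat \<kappa>\<close>; positivity of the exponent explains the condition
  \<open>\<kappa> < 1 / 2\<close>.\<close>

definition hw :: "real \<Rightarrow> 'a::euclidean_space \<Rightarrow> real" where
  "hw \<kappa> c = (1 / sqrt \<kappa>) ^ DIM('a) * heat (1 / \<kappa> - 2) c"

text \<open>Hence the convolution of a Schwartz function with a narrow Gaussian is a superposition of time-frequency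
  shifts of the fixed Gaussian \<open>gauss 2\<close>.\<close>

lemma heat_superposition:
  fixes t :: "'a::euclidean_space"
  assumes "0 < \<kappa>" "\<kappa> < 1 / 2"
  shows "(LINT c|lborel. hw \<kappa> c * (ch (t \<bullet> c) * gauss 2 t)) = heat \<kappa> t"
proof -
  have l: "1 / \<kappa> - 2 > 0" using assms by (simp add: field_simps)
  have "(LINT c|lborel. hw \<kappa> c * (ch (t \<bullet> c) * gauss 2 t))
      = (LINT c|lborel. complex_of_real ((1 / sqrt \<kappa>) ^ DIM('a) * gauss 2 t) * (heat (1 / \<kappa> - 2) c * ch (c \<bullet> t)))"
    by (intro Bochner_Integration.integral_cong refl) (simp add: hw_def inner_commute mult_ac)
  also have "\<dots> = complex_of_real ((1 / sqrt \<kappa>) ^ DIM('a) * gauss 2 t) * gauss (1 / \<kappa> - 2) t"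
    using inverse_fourier_heat[OF l, of t] by simp
  also have "\<dots> = heat \<kappa> t"
    by (simp add: heat_def gauss_def algebra_simps flip: exp_add of_real_mult)
  finally show ?thesis .
qed

lemma integrable_power_hw:
  assumes "0 < \<kappa>" "\<kappa> < 1 / 2"
  shows "integrable lborel (\<lambda>c::'a::euclidean_space. (1 + norm c) ^ k * hw \<kappa> c)"
proof -
  have l: "1 / (1 / \<kappa> - 2) > 0" using assms by (simp add: field_simps)
  from integrable_mult_right[OF integrable_power_gauss[OF l, of k],
      of "(1 / sqrt \<kappa>) ^ DIM('a) * (1 / sqrt (1 / \<kappa> - 2)) ^ DIM('a)"]
  show ?thesis by (simp add: hw_def heat_def mult_ac)
qed

lemma hw_nonneg:
  assumes "0 < \<kappa>" "\<kappa> < 1 / 2"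
  shows "0 \<le> hw \<kappa> c"
proof -
  have "1 / \<kappa> - 2 > 0" using assms by (simp add: field_simps)
  from heat_nonneg[OF this, of c] show ?thesis using assms by (simp add: hw_def)
qed

lemma measurable_hw [measurable]: "hw \<kappa> \<in> borel_measurable borel"
  unfolding hw_def by measurable

lemma schwartz_weighted_integrable:
  fixes f :: "'a::euclidean_space \<Rightarrow> complex"
  assumes f: "f \<in> schwartz"
  shows "integrable lborel (\<lambda>x. (1 + norm x) ^ k * norm (f x))"
proof -
  from schwartz_decay[OF f, of "k + 2 * DIM('a)"] obtain C where
    C: "\<And>x. (1 + norm x) ^ (k + 2 * DIM('a)) * norm (f x) \<le> C" by blast
  have [measurable]: "f \<in> borel_measurable borel" by (rule schwartz_measurable[OF f])
  have 1: "(1 + norm x) ^ (2 * DIM('a)) * norm ((1 + norm x) ^ k * norm (f x)) \<le> C" for x :: 'a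
    using C[of x] by (simp add: abs_mult power_add mult_ac)
  show ?thesis by (rule integrable_decay[OF _ order_refl 1]) measurable
qed

text \<open>The density, over position and frequency, with which the shifts \<open>tfg [] p\<close>
  are superposed to the convolution of \<open>f\<close> with \<open>heat \<kappa>\<close>.\<close>

definition shw :: "('a::euclidean_space \<Rightarrow> complex) \<Rightarrow> real \<Rightarrow> 'a \<times> 'a \<Rightarrow> complex" where
  "shw f \<kappa> p = f (fst p) * hw \<kappa> (snd p)"

lemma measurable_shw:
  assumes [measurable]: "f \<in> borel_measurable borel"
  shows "shw f \<kappa> \<in> borel_measurable borel"
  unfolding shw_def by (simp add: borel_prod[symmetric])

lemma integrable_shw:
  assumes f: "f \<in> schwartz" and \<kappa>: "0 < \<kappa>" "\<kappa> < 1 / 2"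
  shows "integrable lborel (\<lambda>p. (1 + norm p) ^ k * norm (shw f \<kappa> p))"
proof (rule Bochner_Integration.integrable_bound)
  have [measurable]: "f \<in> borel_measurable borel" by (rule schwartz_measurable[OF f])
  note [measurable] = measurable_shw[OF this]
  show "integrable lborel (\<lambda>(a, c). ((1 + norm a) ^ k * norm (f a)) * ((1 + norm c) ^ k * hw \<kappa> c))"
    by (rule integrable_lborel_pair_mult[OF schwartz_weighted_integrable[OF f] integrable_power_hw[OF \<kappa>]])
  show "AE p in lborel. norm ((1 + norm p) ^ k * norm (shw f \<kappa> p))
      \<le> norm (case p of (a, c) \<Rightarrow> ((1 + norm a) ^ k * norm (f a)) * ((1 + norm c) ^ k * hw \<kappa> c))"
  proof (intro AE_I2)
    fix p :: "'a \<times> 'a"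
    obtain a c where p: "p = (a, c)" by fastforce
    have "hw \<kappa> c * (norm (f a) * (1 + norm (a, c)) ^ k)
        \<le> hw \<kappa> c * (norm (f a) * ((1 + norm a) ^ k * (1 + norm c) ^ k))"
      by (intro mult_left_mono one_plus_norm_Pair_power hw_nonneg \<kappa>) auto
    then show "norm ((1 + norm p) ^ k * norm (shw f \<kappa> p))
      \<le> norm (case p of (a, c) \<Rightarrow> ((1 + norm a) ^ k * norm (f a)) * ((1 + norm c) ^ k * hw \<kappa> c))"
      by (simp add: p shw_def norm_mult abs_mult abs_of_nonneg[OF hw_nonneg[OF \<kappa>]] mult_ac)
  qed
qed (use measurable_shw[OF schwartz_measurable[OF f]] in measurable)

lemma measurable_tfg:
  assumes "bs \<in> lists Basis" and s [measurable]: "s \<in> borel_measurable borel"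
  shows "(\<lambda>p. tfg bs (s p) x) \<in> borel_measurable borel"
proof -
  have "continuous_on UNIV (partials (map (Pair 0) bs) mgauss)"
    by (rule smooth_continuous[OF smooth_partials[OF smooth_mgauss map_Pair_lists[OF assms(1)]]])
  then have "continuous_on UNIV (\<lambda>p. partials (map (Pair 0) bs) mgauss (snd p, x - fst p))"
    by (rule continuous_on_compose2) (auto intro!: continuous_intros)
  then have "(\<lambda>p. tfg bs p x) \<in> borel_measurable borel"
    unfolding tfg_def by (rule borel_measurable_continuous_onI)
  from measurable_compose[OF s this] show ?thesis .
qed

text \<open>The map \<open>s\<close> stands for the identity or for a simple function approximating
  it; the bound \<open>2 * norm p\<close> is the one that the approximating functions
  satisfy.\<close>

lemma integrable_shw_tfg:
  assumes f: "f \<in> schwartz" and \<kappa>: "0 < \<kappa>" "\<kappa> < 1 / 2" and bs: "bs \<in> lists Basis"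
    and s: "s \<in> borel_measurable borel" "\<And>p. norm (s p) \<le> 2 * norm p"
  shows "integrable lborel (\<lambda>p. shw f \<kappa> p * tfg bs (s p) x)"
proof -
  from tfg_bound[OF bs, of 0] obtain C m where C: "0 \<le> C" "\<And>p x. norm (tfg bs p x) \<le> C * (1 + norm p) ^ m" by auto
  have "integrable lborel (\<lambda>p. (C * 2 ^ m) * ((1 + norm p) ^ m * norm (shw f \<kappa> p)))"
    by (intro integrable_mult_right integrable_shw f \<kappa>)
  then show ?thesis
  proof (rule Bochner_Integration.integrable_bound)
    show "(\<lambda>p. shw f \<kappa> p * tfg bs (s p) x) \<in> borel_measurable lborel"
      using measurable_shw[OF schwartz_measurable[OF f]] measurable_tfg[OF bs s(1)] by simp
    have "norm (shw f \<kappa> p * tfg bs (s p) x) \<le> (C * 2 ^ m) * ((1 + norm p) ^ m * norm (shw f \<kappa> p))" for p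
    proof -
      have "norm (tfg bs (s p) x) \<le> C * (1 + norm (s p)) ^ m" by (rule C(2))
      also have "\<dots> \<le> C * (2 * (1 + norm p)) ^ m"
        using s(2)[of p] by (intro mult_left_mono power_mono C(1)) auto
      finally have "norm (shw f \<kappa> p) * norm (tfg bs (s p) x) \<le> norm (shw f \<kappa> p) * (C * (2 * (1 + norm p)) ^ m)"
        by (rule mult_left_mono) simp
      then show ?thesis by (simp only: norm_mult power_mult_distrib mult_ac)
    qed
    then show "AE p in lborel. norm (shw f \<kappa> p * tfg bs (s p) x)
        \<le> norm ((C * 2 ^ m) * ((1 + norm p) ^ m * norm (shw f \<kappa> p)))"
      by (intro AE_I2) (use C(1) in \<open>simp add: abs_mult\<close>)
  qed
qed

lemma schwartz_partials_bounded:
  "f \<in> schwartz \<Longrightarrow> bs \<in> lists Basis \<Longrightarrow> \<exists>B. \<forall>x. norm (partials bs f x) \<le> B"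
  using schwartz_partials_bound[of f bs 0] by simp

lemma dirderiv_reflect: "dirderiv b f f' \<Longrightarrow> dirderiv b (\<lambda>x. f (x - t)) (\<lambda>x. f' (x - t))"
  using dirderiv_affine[of b f f' "- t" 1] by simp

text \<open>For the empty list Fubini reduces the claim to \<open>heat_superposition\<close>. Both
  sides can be differentiated under the integral, so the induction step follows from uniqueness of
  directional derivatives.\<close>

lemma tfg_superposition:
  fixes f :: "'a::euclidean_space \<Rightarrow> complex"
  assumes f: "f \<in> schwartz" and \<kappa>: "0 < \<kappa>" "\<kappa> < 1 / 2" and bs: "bs \<in> lists Basis"
  shows "(LINT p|lborel. shw f \<kappa> p * tfg bs p x) = (LINT t|lborel. partials bs f (x - t) * heat \<kappa> t)"
proof -
  have [measurable]: "f \<in> borel_measurable borel" by (rule schwartz_measurable[OF f])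
  have int: "integrable lborel (\<lambda>p. shw f \<kappa> p * tfg bs p x)" if "bs \<in> lists Basis" for bs x
    using integrable_shw_tfg[OF f \<kappa> that, of "\<lambda>p. p"] by simp
  have "(\<lambda>x. LINT p|lborel. shw f \<kappa> p * tfg bs p x) = (\<lambda>x. LINT t|lborel. partials bs f (x - t) * heat \<kappa> t)"
    using bs
  proof (induction bs rule: list.induct)
    case Nil
    show ?case
    proof
      fix x
      have "(LINT p|lborel. shw f \<kappa> p * tfg [] p x)
          = (LINT a|lborel. LINT c|lborel. shw f \<kappa> (a, c) * tfg [] (a, c) x)"
        using integral_lborel_pair(1)[OF int[of "[]" x]] by simp
      also have "\<dots> = (LINT a|lborel. f a * (LINT c|lborel. hw \<kappa> c * (ch ((x - a) \<bullet> c) * gauss 2 (x - a))))"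
        by (simp add: shw_def tfg_Nil mult.assoc)
      also have "\<dots> = (LINT a|lborel. f a * heat \<kappa> (x - a))" using \<kappa> by (simp add: heat_superposition)
      also have "\<dots> = (LINT t|lborel. f (x - t) * heat \<kappa> (x - (x - t)))"
          by (rule integral_lborel_reflect[symmetric]) simp
      finally show "(LINT p|lborel. shw f \<kappa> p * tfg [] p x)
          = (LINT t|lborel. partials [] f (x - t) * heat \<kappa> t)" by simp
    qed
  next
    case (Cons b bs)
    then have b: "b \<in> Basis" and bs: "bs \<in> lists Basis" and bbs: "b # bs \<in> lists Basis" by auto
    from tfg_bound[OF bbs, of 0] obtain C m where C: "0 \<le> C" "\<And>p x. norm (tfg (b # bs) p x)
        \<le> C * (1 + norm p) ^ m" by auto
    have 1: "dirderiv b (\<lambda>x. LINT p|lborel. shw f \<kappa> p * tfg bs p x) (\<lambda>x. LINT p|lborel. shw f \<kappa> p * tfg (b # bs) p x)"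
    proof (rule dirderiv_integral)
      show "dirderiv b (\<lambda>x. shw f \<kappa> p * tfg bs p x) (\<lambda>x. shw f \<kappa> p * tfg (b # bs) p x)" for p
        by (intro dirderiv_cmult tfg_dirderiv b bs)
      show "\<exists>g. integrable lborel g \<and> (\<forall>p\<in>space lborel. \<forall>t. \<bar>t\<bar> \<le> 1
          \<longrightarrow> norm (shw f \<kappa> p * tfg (b # bs) p (x + t *\<^sub>R b)) \<le> g p)" for x
      proof (intro exI conjI ballI allI impI)
        show "integrable lborel (\<lambda>p. C * ((1 + norm p) ^ m * norm (shw f \<kappa> p)))"
          by (intro integrable_mult_right integrable_shw f \<kappa>)
        show "norm (shw f \<kappa> p * tfg (b # bs) p (x + t *\<^sub>R b)) \<le> C * ((1 + norm p) ^ m * norm (shw f \<kappa> p))" for p t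
          using mult_left_mono[OF C(2)[of p "x + t *\<^sub>R b"], of "norm (shw f \<kappa> p)"] by (simp add: norm_mult mult_ac)
      qed
    qed (use int bs bbs in auto)
    from schwartz_partials_bounded[OF f bbs] schwartz_partials_bounded[OF f bs] obtain B B' where
      B: "\<And>x. norm (partials (b # bs) f x) \<le> B" "\<And>x. norm (partials bs f x) \<le> B'" by metis
    have [measurable]: "partials (b # bs) f \<in> borel_measurable borel" "partials bs f \<in> borel_measurable borel"
      using bbs bs by (intro smooth_measurable smooth_partials schwartz_smooth[OF f]; simp)+
    have h: "integrable lborel (\<lambda>t::'a. complex_of_real (heat \<kappa> t))" using integrable_heat[OF \<kappa>(1)]
        by (rule integrable_of_real)
    have 2: "dirderiv b (\<lambda>x. LINT t|lborel. partials bs f (x - t) * heat \<kappa> t)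
        (\<lambda>x. LINT t|lborel. partials (b # bs) f (x - t) * heat \<kappa> t)"
    proof (rule dirderiv_integral)
      show "dirderiv b (\<lambda>x. partials bs f (x - t) * heat \<kappa> t) (\<lambda>x. partials (b # bs) f (x - t) * heat \<kappa> t)" for t
        using dirderiv_cmult[OF dirderiv_reflect[OF
            smooth_partials_dirderiv[OF schwartz_smooth[OF f] b bs]], of "complex_of_real (heat \<kappa> t)" t]
        by (simp add: mult.commute)
      show "integrable lborel (\<lambda>t. partials bs f (x - t) * heat \<kappa> t)" for x
        by (rule integrable_bounded_mult[OF _ h B(2)]) measurable
      show "(\<lambda>t. partials (b # bs) f (x - t) * heat \<kappa> t) \<in> borel_measurable lborel" for x by measurable
      show "\<exists>g. integrable lborel g \<and> (\<forall>t\<in>space lborel. \<forall>s. \<bar>s\<bar> \<le> 1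
          \<longrightarrow> norm (partials (b # bs) f (x + s *\<^sub>R b - t) * heat \<kappa> t) \<le> g t)" for x
        using integrable_heat[OF \<kappa>(1)] \<kappa> B(1)
        by (intro exI[of _ "\<lambda>t. B * heat \<kappa> t"]) (auto simp: norm_mult intro!: mult_right_mono simp
            del: partials.simps)
    qed
    show ?case
      using dirderiv_unique[OF 1] 2 Cons.IH[OF bs] by simp
  qed
  then show ?thesis by (rule fun_cong)
qed

text \<open>A Riemann sum argument: replacing the parameter by a simple function of it makes the
  superposition a finite sum. The Lipschitz bound is uniform in \<open>x\<close> and in the finitely
  many derivatives, so one simple function serves for a whole Schwartz norm.\<close>

lemma tfg_simple_approx:
  fixes f :: "'a::euclidean_space \<Rightarrow> complex"
  assumes f: "f \<in> schwartz" and \<kappa>: "0 < \<kappa>" "\<kappa> < 1 / 2" and e: "e > 0"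
  shows "\<exists>s. simple_function lborel s \<and> (\<forall>p. norm (s p) \<le> 2 * norm p) \<and>
    (\<forall>bs\<in>lists Basis. length bs \<le> N \<longrightarrow> (\<forall>x. (1 + norm x) ^ N *
      norm ((LINT p|lborel. shw f \<kappa> p * tfg bs p x) - (LINT p|lborel. shw f \<kappa> p * tfg bs (s p) x)) \<le> e))"
proof -
  define L where "L = {bs \<in> lists (Basis :: 'a set). length bs \<le> N}"
  have fin: "finite L" unfolding L_def by (rule finite_lists_le)
  have "\<forall>bs\<in>L. \<exists>C m. 0 \<le> C \<and> (\<forall>p q x. (1 + norm x) ^ N * norm (tfg bs p x - tfg bs q x)
      \<le> C * (1 + norm p + norm q) ^ m * norm (p - q))"
    using tfg_lipschitz unfolding L_def by blast
  then obtain C m where C: "\<And>bs. bs \<in> L \<Longrightarrow> 0 \<le> C bs"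
    "\<And>bs p q x. bs \<in> L \<Longrightarrow> (1 + norm x) ^ N * norm (tfg bs p x - tfg bs q x)
        \<le> C bs * (1 + norm p + norm q) ^ m bs * norm (p - q)"
    by metis
  define D M where "D = (\<Sum>bs\<in>L. C bs)" and "M = (\<Sum>bs\<in>L. m bs)"
  have D: "0 \<le> D" unfolding D_def using C(1) by (intro sum_nonneg)
  have lip: "(1 + norm x) ^ N * norm (tfg bs p x - tfg bs q x)
      \<le> D * (1 + norm p + norm q) ^ M * norm (p - q)" if bs: "bs \<in> L" for bs p q x
  proof (rule order_trans[OF C(2)[OF bs]], rule mult_right_mono, rule mult_mono)
    show "C bs \<le> D" unfolding D_def using fin bs C(1) by (intro member_le_sum) auto
    have "m bs \<le> M" unfolding M_def using fin bs by (intro member_le_sum) auto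
    then show "(1 + norm p + norm q) ^ m bs \<le> (1 + norm p + norm q) ^ M" by (intro power_increasing) auto
  qed (use D in auto)
  have "(\<lambda>p. p) \<in> borel_measurable (lborel :: ('a \<times> 'a) measure)" by simp
  \<comment> \<open>Simple functions tending pointwise to the identity, with a growth bound that
    keeps the integrands dominated.\<close>
  from borel_measurable_implies_sequence_metric[OF this, of 0] obtain s where
    s: "\<And>i. simple_function lborel (s i)" "\<And>p. (\<lambda>i. s i p) \<longlonglongrightarrow> p" "\<And>i p. dist (s i p) 0 \<le> 2 * dist p (0 :: 'a \<times> 'a)"
    by auto
  have s3: "norm (s i p) \<le> 2 * norm p" for i p using s(3)[of i p] by simp
  have sm [measurable]: "s i \<in> borel_measurable borel" for i
      using borel_measurable_simple_function[OF s(1)[of i]] by simp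
  note om [measurable] = measurable_shw[OF schwartz_measurable[OF f], of \<kappa>]
  \<comment> \<open>\<open>d i p\<close> bounds the weighted difference of the integrands for all
    \<open>x\<close> and all lists in \<open>L\<close> at once.\<close>
  define d where "d i p = norm (shw f \<kappa> p) * (D * (1 + norm p + norm (s i p)) ^ M * norm (p - s i p))" for i p
  have dom: "integrable lborel (\<lambda>p. (D * 3 ^ Suc M) * ((1 + norm p) ^ Suc M * norm (shw f \<kappa> p)))"
    by (intro integrable_mult_right integrable_shw f \<kappa>)
  have d_le: "d i p \<le> (D * 3 ^ Suc M) * ((1 + norm p) ^ Suc M * norm (shw f \<kappa> p))" for i p
  proof -
    have "norm (p - s i p) \<le> 3 * (1 + norm p)" using norm_triangle_ineq4[of p "s i p"] s3[of i p] by simp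
    moreover have "(1 + norm p + norm (s i p)) ^ M \<le> (3 * (1 + norm p)) ^ M" using s3[of i p]
        by (intro power_mono) auto
    ultimately have "(1 + norm p + norm (s i p)) ^ M * norm (p - s i p) \<le> (3 * (1 + norm p)) ^ M * (3 * (1 + norm p))"
      by (intro mult_mono) auto
    also have "\<dots> = 3 ^ Suc M * (1 + norm p) ^ Suc M" by (simp only: power_Suc power_mult_distrib mult_ac)
    finally have "(norm (shw f \<kappa> p) * D) * ((1 + norm p + norm (s i p)) ^ M * norm (p - s i p))
        \<le> (norm (shw f \<kappa> p) * D) * (3 ^ Suc M * (1 + norm p) ^ Suc M)"
      using D by (intro mult_left_mono) auto
    then show ?thesis by (simp add: d_def mult_ac)
  qed
  have d0: "0 \<le> d i p" for i p using D by (simp add: d_def)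
  have dm: "d i \<in> borel_measurable lborel" for i unfolding d_def by measurable
  have di: "integrable lborel (d i)" for i
    by (rule Bochner_Integration.integrable_bound[OF dom dm])
      (use d_le d0 in \<open>auto intro!: AE_I2 intro: order_trans[OF _ abs_ge_self]\<close>)
  have "(\<lambda>i. LINT p|lborel. d i p) \<longlonglongrightarrow> (LINT (p::'a \<times> 'a)|lborel. (0::real))"
  proof (rule integral_dominated_convergence[OF _ _ dom])
    show "AE p in lborel. (\<lambda>i. d i p) \<longlonglongrightarrow> 0"
    proof (intro AE_I2)
      fix p
      have "(\<lambda>i. norm (shw f \<kappa> p) * (D * (1 + norm p + norm (s i p)) ^ M * norm (p - s i p))) \<longlonglongrightarrow>
          norm (shw f \<kappa> p) * (D * (1 + norm p + norm p) ^ M * norm (p - p))"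
        by (intro tendsto_intros s)
      then show "(\<lambda>i. d i p) \<longlonglongrightarrow> 0" by (simp add: d_def)
    qed
  qed (use dm d_le d0 in auto)
  then have "eventually (\<lambda>i. (LINT p|lborel. d i p) < e) sequentially"
    using e by (intro order_tendstoD(2)) auto
  then obtain i where i: "(LINT p|lborel. d i p) < e" by (auto simp: eventually_sequentially)
  have "(1 + norm x) ^ N * norm ((LINT p|lborel. shw f \<kappa> p * tfg bs p x)
      - (LINT p|lborel. shw f \<kappa> p * tfg bs (s i p) x)) \<le> e"
    if bs: "bs \<in> L" for bs x
  proof -
    have bs': "bs \<in> lists Basis" using bs by (simp add: L_def)
    note i1 = integrable_shw_tfg[OF f \<kappa> bs', of "\<lambda>p. p" x] and i2 = integrable_shw_tfg[OF f \<kappa> bs' sm s3, of i x]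
    have "(1 + norm x) ^ N * norm ((LINT p|lborel. shw f \<kappa> p * tfg bs p x)
        - (LINT p|lborel. shw f \<kappa> p * tfg bs (s i p) x))
        = norm (LINT p|lborel. (1 + norm x) ^ N *\<^sub>R (shw f \<kappa> p * (tfg bs p x - tfg bs (s i p) x)))"
      using i1 i2 by (simp add: right_diff_distrib)
    also have "\<dots> \<le> (LINT p|lborel. norm ((1 + norm x) ^ N *\<^sub>R (shw f \<kappa> p * (tfg bs p x - tfg bs (s i p) x))))"
      by (rule integral_norm_bound)
    also have "\<dots> \<le> (LINT p|lborel. d i p)"
    proof (rule integral_mono_AE')
      show "AE p in lborel. norm ((1 + norm x) ^ N *\<^sub>R (shw f \<kappa> p * (tfg bs p x - tfg bs (s i p) x))) \<le> d i p"
      proof (intro AE_I2)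
        fix p
        show "norm ((1 + norm x) ^ N *\<^sub>R (shw f \<kappa> p * (tfg bs p x - tfg bs (s i p) x))) \<le> d i p"
          using mult_left_mono[OF lip[OF bs, of x p "s i p"], of "norm (shw f \<kappa> p)"]
          by (simp add: d_def norm_mult mult_ac)
      qed
    qed (use di d0 in auto)
    finally show ?thesis using i by simp
  qed
  then show ?thesis using s(1) s3 by (intro exI[of _ "s i"]) (auto simp: L_def)
qed

text \<open>The coefficients are integrals of \<open>om\<close> over the level sets of
  \<open>s\<close> and do not depend on \<open>K\<close>. Hence one and the same linear combination
  represents all derivatives.\<close>

lemma integral_simple_superposition:
  fixes om :: "'a::euclidean_space \<Rightarrow> complex" and s :: "'a \<Rightarrow> 'b" and K :: "'b \<Rightarrow> complex"
  assumes s: "simple_function lborel s" and om: "integrable lborel om"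
  shows "(LINT p|lborel. om p * K (s p)) = (\<Sum>v\<in>range s. (LINT p|lborel. om p * indicator (s -` {v}) p) * K v)"
    (is "?l = ?r" is "_ = (\<Sum>v\<in>_. ?\<alpha> v * _)")
proof -
  have fin: "finite (range s)" using simple_functionD(1)[OF s] by simp
  have sv: "s -` {v} \<in> sets lborel" for v using simple_functionD(2)[OF s, of "{v}"] by simp
  have int: "integrable lborel (\<lambda>p. om p * indicator (s -` {v}) p)" for v
  proof -
    have "integrable lborel (\<lambda>p. indicator (s -` {v}) p *\<^sub>R om p)"
      by (rule integrable_mult_indicator[OF sv om])
    also have "(\<lambda>p. indicator (s -` {v}) p *\<^sub>R om p) = (\<lambda>p. om p * indicator (s -` {v}) p)"
      by (auto simp: indicator_def)
    finally show ?thesis .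
  qed
  have "?r = (LINT p|lborel. (\<Sum>v\<in>range s. (om p * indicator (s -` {v}) p) * K v))"
    using int by (subst Bochner_Integration.integral_sum) auto
  also have "\<dots> = ?l"
  proof (intro Bochner_Integration.integral_cong refl)
    fix p
    have "(\<Sum>v\<in>range s. (om p * indicator (s -` {v}) p) * K v) = (\<Sum>v\<in>range s. if v = s p then om p * K v else 0)"
      by (intro sum.cong refl) (auto simp: indicator_def)
    then show "(\<Sum>v\<in>range s. (om p * indicator (s -` {v}) p) * K v) = om p * K (s p)"
      using fin by (simp add: sum.delta)
  qed
  finally show ?thesis by simp
qed

text \<open>Rescaling the variable by \<open>sqrt \<kappa>\<close> extracts a factor
  \<open>sqrt \<kappa>\<close> from \<open>norm t\<close> and leaves a moment of
  \<open>gauss 1\<close>.\<close>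

lemma heat_moment_small:
  assumes e: "e > 0"
  shows "\<exists>\<kappa>. 0 < \<kappa> \<and> \<kappa> < 1 / 2 \<and> integrable lborel (\<lambda>t::'a::euclidean_space. norm t * (1 + norm t) ^ k * heat \<kappa> t)
    \<and> (LINT t::'a|lborel. norm t * (1 + norm t) ^ k * heat \<kappa> t) \<le> e"
proof -
  define J where "J = (LINT t::'a|lborel. (1 + norm t) ^ Suc k * gauss 1 t)"
  have J0: "0 \<le> J" unfolding J_def by (intro integral_nonneg_AE) auto
  \<comment> \<open>The entry 1/4 gives \<open>\<kappa> < 1 / 2\<close> and
    \<open>sqrt \<kappa> \<le> 1\<close>; the other one gives
    \<open>sqrt \<kappa> * J \<le> e\<close>.\<close>
  define \<kappa> where "\<kappa> = min (1/4) ((e / (J + 1))\<^sup>2)"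
  have \<kappa>: "0 < \<kappa>" "\<kappa> < 1 / 2" using e J0 by (auto simp: \<kappa>_def)
  have "sqrt \<kappa> \<le> sqrt ((e / (J + 1))\<^sup>2)" by (rule real_sqrt_le_mono) (simp add: \<kappa>_def)
  also have "sqrt ((e / (J + 1))\<^sup>2) = e / (J + 1)" using e J0 by (intro real_sqrt_unique) auto
  finally have sk: "sqrt \<kappa> \<le> e / (J + 1)" .
  have sk1: "sqrt \<kappa> \<le> 1" using \<kappa> by simp
  have int: "integrable lborel (\<lambda>t::'a. norm t * (1 + norm t) ^ k * heat \<kappa> t)"
  proof (rule Bochner_Integration.integrable_bound)
    show "integrable lborel (\<lambda>t::'a. (1 / sqrt \<kappa>) ^ DIM('a) * ((1 + norm t) ^ Suc k * gauss (1 / \<kappa>) t))"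
      using \<kappa> by (intro integrable_mult_right integrable_power_gauss) auto
    have "norm t * (1 + norm t) ^ k * heat \<kappa> t
        \<le> (1 / sqrt \<kappa>) ^ DIM('a) * ((1 + norm t) ^ Suc k * gauss (1 / \<kappa>) t)" for t :: 'a
    proof -
      have "norm t * ((1 + norm t) ^ k * heat \<kappa> t) \<le> (1 + norm t) * ((1 + norm t) ^ k * heat \<kappa> t)"
        using \<kappa> by (intro mult_right_mono) auto
      then show ?thesis by (simp add: heat_def mult_ac)
    qed
    then show "AE t in lborel. norm (norm (t::'a) * (1 + norm t) ^ k * heat \<kappa> t)
        \<le> norm ((1 / sqrt \<kappa>) ^ DIM('a) * ((1 + norm t) ^ Suc k * gauss (1 / \<kappa>) t))"
      using \<kappa> by (intro AE_I2) (simp add: abs_mult)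
  qed measurable
  have "complex_of_real (LINT t::'a|lborel. norm t * (1 + norm t) ^ k * heat \<kappa> t)
      = (LINT t::'a|lborel. complex_of_real (norm t * (1 + norm t) ^ k) * heat \<kappa> (t - 0))"
    unfolding integral_complex_of_real[symmetric] by simp
  also have "\<dots> = (LINT u::'a|lborel. complex_of_real (norm (0 + sqrt \<kappa> *\<^sub>R u)
      * (1 + norm (0 + sqrt \<kappa> *\<^sub>R u)) ^ k) * gauss 1 u)"
    by (rule integral_heat_rescale[OF \<kappa>(1)]) measurable
  also have "\<dots> = complex_of_real (LINT u::'a|lborel. (sqrt \<kappa> * norm u) * (1 + sqrt \<kappa> * norm u) ^ k * gauss 1 u)"
    unfolding integral_complex_of_real[symmetric] using \<kappa> by simp
  finally have "(LINT t::'a|lborel. norm t * (1 + norm t) ^ k * heat \<kappa> t)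
      = (LINT u::'a|lborel. (sqrt \<kappa> * norm u) * (1 + sqrt \<kappa> * norm u) ^ k * gauss 1 u)"
    by (simp only: of_real_eq_iff)
  also have "\<dots> \<le> (LINT u::'a|lborel. sqrt \<kappa> * ((1 + norm u) ^ Suc k * gauss 1 u))"
  proof (rule integral_mono_AE')
    show "integrable lborel (\<lambda>u::'a. sqrt \<kappa> * ((1 + norm u) ^ Suc k * gauss 1 u))"
      by (intro integrable_mult_right integrable_power_gauss) simp
    show "AE u::'a in lborel. (sqrt \<kappa> * norm u) * (1 + sqrt \<kappa> * norm u) ^ k * gauss 1 u
        \<le> sqrt \<kappa> * ((1 + norm u) ^ Suc k * gauss 1 u)"
    proof (intro AE_I2)
      fix u :: 'a
      have "sqrt \<kappa> * norm u \<le> 1 * norm u" using sk1 by (intro mult_right_mono) auto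
      then have "(1 + sqrt \<kappa> * norm u) ^ k \<le> (1 + norm u) ^ k" using \<kappa> by (intro power_mono) auto
      then have "norm u * (1 + sqrt \<kappa> * norm u) ^ k \<le> (1 + norm u) * (1 + norm u) ^ k"
        using \<kappa> by (intro mult_mono) auto
      then have "(sqrt \<kappa> * gauss 1 u) * (norm u * (1 + sqrt \<kappa> * norm u) ^ k)
          \<le> (sqrt \<kappa> * gauss 1 u) * ((1 + norm u) * (1 + norm u) ^ k)"
        using \<kappa> by (intro mult_left_mono) auto
      then show "(sqrt \<kappa> * norm u) * (1 + sqrt \<kappa> * norm u) ^ k * gauss 1 u
          \<le> sqrt \<kappa> * ((1 + norm u) ^ Suc k * gauss 1 u)"
        by (simp add: mult_ac)
    qed
  qed (use \<kappa> in auto)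
  also have "\<dots> = sqrt \<kappa> * J" by (simp add: J_def)
  also have "\<dots> \<le> e / (J + 1) * (J + 1)" using sk J0 e by (intro mult_mono) auto
  also have "\<dots> = e" using J0 by simp
  finally show ?thesis using \<kappa> int by blast
qed

text \<open>The mean value inequality on the segment from \<open>x\<close> to \<open>x - t\<close>;
  moving the weight to an intermediate point costs a power of \<open>1 + norm t\<close>.\<close>

lemma schwartz_translation_lipschitz:
  fixes f :: "'a::euclidean_space \<Rightarrow> complex"
  assumes f: "f \<in> schwartz" and bs: "bs \<in> lists Basis"
  shows "\<exists>C\<ge>0. \<forall>x t. (1 + norm x) ^ N * norm (partials bs f x - partials bs f (x - t))
      \<le> C * (norm t * (1 + norm t) ^ N)"
proof -
  let ?g = "partials bs f"
  have sg: "smooth ?g" by (rule smooth_partials[OF schwartz_smooth[OF f] bs])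
  have "\<forall>b\<in>Basis. \<exists>C. \<forall>x. (1 + norm x) ^ N * norm (partial b ?g x) \<le> C"
    using schwartz_partials_bound[OF f, of "b # bs" N for b] bs by auto
  then obtain C where C: "\<And>b x. b \<in> Basis \<Longrightarrow> (1 + norm x) ^ N * norm (partial b ?g x) \<le> C b" by metis
  have C0: "0 \<le> C b" if "b \<in> Basis" for b using C[OF that, of 0] by (auto intro: order_trans[rotated])
  have "(1 + norm x) ^ N * norm (?g x - ?g (x - t)) \<le> (\<Sum>b\<in>Basis. C b) * (norm t * (1 + norm t) ^ N)" for x t
  proof -
    let ?B = "(\<Sum>b\<in>Basis. C b) * (norm t * (1 + norm t) ^ N)"
    have der: "((\<lambda>r. (1 + norm x) ^ N *\<^sub>R ?g (x - r *\<^sub>R t))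
        has_derivative (\<lambda>s. (1 + norm x) ^ N *\<^sub>R (\<Sum>b\<in>Basis. ((- (s *\<^sub>R t)) \<bullet> b) *\<^sub>R partial b ?g
        (x - r *\<^sub>R t)))) (at r within {0..1})" for r
    proof -
      have 1: "((\<lambda>r. x - r *\<^sub>R t) has_derivative (\<lambda>s. - (s *\<^sub>R t))) (at r within {0..1})"
        by (auto intro!: derivative_eq_intros)
      show ?thesis by (intro has_derivative_scaleR_right has_derivative_compose[OF 1 smooth_has_derivative[OF sg]])
    qed
    have "norm ((1 + norm x) ^ N *\<^sub>R ?g (x - 0 *\<^sub>R t) - (1 + norm x) ^ N *\<^sub>R ?g (x - 1 *\<^sub>R t))
        \<le> ?B * norm (0 - 1 :: real)"
    proof (rule differentiable_bound[OF _ der])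
      fix r :: real assume r: "r \<in> {0..1}"
      have "norm (r *\<^sub>R t) \<le> 1 * norm t" using r by (simp add: mult_left_le_one_le)
      then have rt: "(1 + norm (r *\<^sub>R t)) ^ N \<le> (1 + norm t) ^ N" by (intro power_mono) auto
      have bb: "(1 + norm x) ^ N * norm (partial b ?g (x - r *\<^sub>R t)) \<le> C b * (1 + norm t) ^ N" if b: "b \<in> Basis" for b
      proof -
        have "(1 + norm x) ^ N * norm (partial b ?g (x - r *\<^sub>R t))
            \<le> ((1 + norm (x - r *\<^sub>R t)) ^ N * (1 + norm (r *\<^sub>R t)) ^ N) * norm (partial b ?g (x - r *\<^sub>R t))"
          using one_plus_norm_triangle_power[of "x - r *\<^sub>R t" "r *\<^sub>R t" N] by (intro mult_right_mono) auto
        also have "\<dots> = ((1 + norm (x - r *\<^sub>R t)) ^ N * norm (partial b ?g (x - r *\<^sub>R t)))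
            * (1 + norm (r *\<^sub>R t)) ^ N" by (simp add: mult_ac)
        also have "\<dots> \<le> C b * (1 + norm t) ^ N" by (intro mult_mono C b rt C0) auto
        finally show ?thesis .
      qed
      show "onorm (\<lambda>s. (1 + norm x) ^ N *\<^sub>R (\<Sum>b\<in>Basis. ((- (s *\<^sub>R t)) \<bullet> b) *\<^sub>R partial b ?g (x - r *\<^sub>R t))) \<le> ?B"
      proof (rule onorm_le)
        fix s :: real
        have "norm ((1 + norm x) ^ N *\<^sub>R (\<Sum>b\<in>Basis. ((- (s *\<^sub>R t)) \<bullet> b) *\<^sub>R partial b ?g (x - r *\<^sub>R t)))
            \<le> (1 + norm x) ^ N * (\<Sum>b\<in>Basis. norm (((- (s *\<^sub>R t)) \<bullet> b) *\<^sub>R partial b ?g (x - r *\<^sub>R t)))"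
          unfolding norm_scaleR[of "(1 + norm x) ^ N"]
              by (simp only: power_abs abs_of_nonneg[OF add_nonneg_nonneg[OF zero_le_one norm_ge_zero]])
            (rule mult_left_mono[OF norm_sum], simp)
        also have "\<dots> = (\<Sum>b\<in>Basis. \<bar>(- (s *\<^sub>R t)) \<bullet> b\<bar> * ((1 + norm x) ^ N * norm (partial b ?g (x - r *\<^sub>R t))))"
          by (simp add: sum_distrib_left mult_ac)
        also have "\<dots> \<le> (\<Sum>b\<in>Basis. norm (- (s *\<^sub>R t)) * (C b * (1 + norm t) ^ N))"
          by (intro sum_mono mult_mono Basis_le_norm bb) auto
        also have "\<dots> = ?B * norm s" by (simp add: sum_distrib_left sum_distrib_right mult_ac)
        finally show "norm ((1 + norm x) ^ N *\<^sub>R (\<Sum>b\<in>Basis. ((- (s *\<^sub>R t)) \<bullet> b) *\<^sub>R partial b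
            ?g (x - r *\<^sub>R t))) \<le> ?B * norm s" .
      qed
    qed auto
    then show ?thesis by (simp flip: scaleR_diff_right)
  qed
  moreover have "0 \<le> (\<Sum>b\<in>Basis. C b)" using C0 by (intro sum_nonneg)
  ultimately show ?thesis by blast
qed

text \<open>As \<open>heat \<kappa>\<close> has integral 1, the error is a mean of translation
  differences, bounded by a constant times the weighted first moment of
  \<open>heat \<kappa>\<close>.\<close>

lemma schwartz_heat_approx:
  fixes f :: "'a::euclidean_space \<Rightarrow> complex"
  assumes f: "f \<in> schwartz" and e: "e > 0"
  shows "\<exists>\<kappa>. 0 < \<kappa> \<and> \<kappa> < 1 / 2 \<and> (\<forall>bs\<in>lists Basis. length bs \<le> N \<longrightarrow>
    (\<forall>x. (1 + norm x) ^ N * norm (partials bs f x - (LINT t|lborel. partials bs f (x - t) * heat \<kappa> t)) \<le> e))"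
proof -
  define L where "L = {bs \<in> lists (Basis :: 'a set). length bs \<le> N}"
  have fin: "finite L" unfolding L_def by (rule finite_lists_le)
  have "\<forall>bs\<in>L. \<exists>C\<ge>0. \<forall>x t. (1 + norm x) ^ N * norm (partials bs f x - partials bs f (x - t))
      \<le> C * (norm t * (1 + norm t) ^ N)"
    using schwartz_translation_lipschitz[OF f] unfolding L_def by blast
  then obtain C where C: "\<And>bs. bs \<in> L \<Longrightarrow> 0 \<le> C bs"
    "\<And>bs x t. bs \<in> L \<Longrightarrow> (1 + norm x) ^ N * norm (partials bs f x - partials bs f (x - t))
        \<le> C bs * (norm t * (1 + norm t) ^ N)"
    by metis
  define D where "D = (\<Sum>bs\<in>L. C bs)"
  have D: "0 \<le> D" unfolding D_def using C(1) by (intro sum_nonneg)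
  have CD: "C bs \<le> D" if "bs \<in> L" for bs unfolding D_def using fin that C(1) by (intro member_le_sum) auto
  from heat_moment_small[of "e / (D + 1)" N, where 'a = 'a] e D obtain \<kappa> where \<kappa>: "0 < \<kappa>" "\<kappa> < 1 / 2"
    and mi: "integrable lborel (\<lambda>t::'a. norm t * (1 + norm t) ^ N * heat \<kappa> t)"
    and ml: "(LINT t::'a|lborel. norm t * (1 + norm t) ^ N * heat \<kappa> t) \<le> e / (D + 1)" by auto
  have "(1 + norm x) ^ N * norm (partials bs f x
      - (LINT t|lborel. partials bs f (x - t) * heat \<kappa> t)) \<le> e" if bs: "bs \<in> L" for bs x
  proof -
    have bs': "bs \<in> lists Basis" using bs by (simp add: L_def)
    from schwartz_partials_bounded[OF f bs'] obtain B where B: "\<And>x. norm (partials bs f x) \<le> B" by blast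
    have [measurable]: "partials bs f \<in> borel_measurable borel"
      by (intro smooth_measurable smooth_partials schwartz_smooth[OF f] bs')
    have h: "integrable lborel (\<lambda>t::'a. complex_of_real (heat \<kappa> t))" using integrable_heat[OF \<kappa>(1)]
        by (rule integrable_of_real)
    have i1: "integrable lborel (\<lambda>t. partials bs f (x - t) * heat \<kappa> t)"
      by (rule integrable_bounded_mult[OF _ h B]) measurable
    have i2: "integrable lborel (\<lambda>t::'a. partials bs f x * complex_of_real (heat \<kappa> t))" using h
        by (rule integrable_mult_right)
    have "partials bs f x = (LINT t::'a|lborel. partials bs f x * heat \<kappa> t)"
      using integral_heat[OF \<kappa>(1), where 'a = 'a] by simp
    then have "partials bs f x - (LINT t|lborel. partials bs f (x - t) * heat \<kappa> t)
        = (LINT t|lborel. (partials bs f x - partials bs f (x - t)) * heat \<kappa> t)"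
      by (simp only: left_diff_distrib Bochner_Integration.integral_diff[OF i2 i1])
    then have "(1 + norm x) ^ N * norm (partials bs f x - (LINT t|lborel. partials bs f (x - t) * heat \<kappa> t))
        = (1 + norm x) ^ N * norm (LINT t|lborel. (partials bs f x - partials bs f (x - t)) * heat \<kappa> t)"
      by (simp only:)
    also have "\<dots> = norm (LINT t|lborel. (1 + norm x) ^ N *\<^sub>R ((partials bs f x - partials bs f (x - t)) * heat \<kappa> t))"
      by simp
    also have "\<dots> \<le> (LINT t|lborel. norm
        ((1 + norm x) ^ N *\<^sub>R ((partials bs f x - partials bs f (x - t)) * heat \<kappa> t)))"
      by (rule integral_norm_bound)
    also have "\<dots> \<le> (LINT t::'a|lborel. D * (norm t * (1 + norm t) ^ N * heat \<kappa> t))"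
    proof (rule integral_mono_AE')
      show "AE t in lborel. norm ((1 + norm x) ^ N *\<^sub>R ((partials bs f x - partials bs f (x - t))
          * heat \<kappa> t)) \<le> D * (norm t * (1 + norm t) ^ N * heat \<kappa> t)"
      proof (intro AE_I2)
        fix t :: 'a
        have "(1 + norm x) ^ N * norm (partials bs f x - partials bs f (x - t)) \<le> D * (norm t * (1 + norm t) ^ N)"
          by (rule order_trans[OF C(2)[OF bs] mult_right_mono[OF CD[OF bs]]]) simp
        from mult_right_mono[OF this, of "heat \<kappa> t"]
        show "norm ((1 + norm x) ^ N *\<^sub>R ((partials bs f x - partials bs f (x - t)) * heat \<kappa> t))
            \<le> D * (norm t * (1 + norm t) ^ N * heat \<kappa> t)"
          using \<kappa> by (simp add: norm_mult mult_ac)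
      qed
    qed (use mi D \<kappa> in auto)
    also have "\<dots> \<le> (D + 1) * (e / (D + 1))"
      using ml D mult_mono[of D "D + 1" "LINT t::'a|lborel. norm t * (1 + norm t) ^ N * heat \<kappa> t" "e / (D + 1)"] \<kappa>
      by (simp add: integral_nonneg_AE)
    also have "\<dots> = e" using D by simp
    finally show ?thesis .
  qed
  then show ?thesis using \<kappa> by (intro exI[of _ \<kappa>]) (auto simp: L_def)
qed

lemma schwartz_sum:
  assumes "finite A" "\<And>v. v \<in> A \<Longrightarrow> f v \<in> schwartz"
  shows "(\<lambda>x. \<Sum>v\<in>A. f v x) \<in> schwartz"
  using assms
proof (induction A rule: finite_induct)
  case empty
  show ?case using schwartz_cmult[OF tfg_schwartz, of 0] by simp
next
  case (insert a A)
  then show ?case using schwartz_add[of "f a" "\<lambda>x. \<Sum>v\<in>A. f v x"] by simp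
qed

lemma tfg_sum_partials:
  assumes "finite A" and bs: "bs \<in> lists Basis"
  shows "partials bs (\<lambda>x. \<Sum>v\<in>A. k v * tfg [] v x) = (\<lambda>x. \<Sum>v\<in>A. k v * tfg bs v x)"
  using bs
proof (induction bs rule: list.induct)
  case (Cons b bs)
  have "dirderiv b (\<lambda>x. \<Sum>v\<in>A. k v * tfg bs v x) (\<lambda>x. \<Sum>v\<in>A. k v * tfg (b # bs) v x)"
    using Cons.prems by (intro dirderiv_sum dirderiv_cmult tfg_dirderiv) auto
  from dirderiv_partial[OF this] Cons show ?case by simp
qed simp

lemma norm_diff_triangle_ineq': "norm (a - c) \<le> norm (a - b) + norm (b - c)"
  using norm_triangle_ineq[of "a - b" "b - c"] by simp

text \<open>Density of the span of the shifts, in the dual form used for uniqueness. Smoothing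
  \<open>f\<close> by a narrow Gaussian gives a superposition of shifts, which is replaced by a
  finite sum; both errors are small in the one norm that controls \<open>u\<close>.\<close>

theorem schwartz_functional_eq_0:
  fixes u :: "('a::euclidean_space \<Rightarrow> complex) \<Rightarrow> complex"
  assumes add: "\<And>f g. f \<in> schwartz \<Longrightarrow> g \<in> schwartz \<Longrightarrow> u (\<lambda>x. f x + g x) = u f + u g"
    and cmult: "\<And>c f. f \<in> schwartz \<Longrightarrow> u (\<lambda>x. c * f x) = c * u f"
    and bnd: "\<And>f. f \<in> schwartz \<Longrightarrow> norm (u f) \<le> C * schwartz_norm N f"
    and zero: "\<And>p. u (tfg [] p) = 0" and f: "f \<in> schwartz"
  shows "u f = 0"
proof -
  have "norm (u f) \<le> 0"
  proof (rule field_le_epsilon)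
    fix e :: real assume e: "e > 0"
    \<comment> \<open>Two errors \<open>\<epsilon>\<close> are multiplied by at most
      \<open>\<bar>C\<bar>\<close>; the summand 1 avoids division by 0, and \<open>C\<close> may be
      negative.\<close>
    define \<epsilon> where "\<epsilon> = e / (2 * (\<bar>C\<bar> + 1))"
    have \<epsilon>: "\<epsilon> > 0" using e by (simp add: \<epsilon>_def add_nonneg_pos)
    from schwartz_heat_approx[OF f \<epsilon>, of N] obtain \<kappa> where \<kappa>: "0 < \<kappa>" "\<kappa> < 1 / 2"
      and 1: "\<And>bs x. bs \<in> lists Basis \<Longrightarrow> length bs \<le> N \<Longrightarrow>
         (1 + norm x) ^ N * norm (partials bs f x - (LINT t|lborel. partials bs f (x - t) * heat \<kappa> t)) \<le> \<epsilon>" by blast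
    from tfg_simple_approx[OF f \<kappa> \<epsilon>, of N] obtain s where s: "simple_function lborel s" "\<And>p. norm (s p) \<le> 2 * norm p"
      and 2: "\<And>bs x. bs \<in> lists Basis \<Longrightarrow> length bs \<le> N \<Longrightarrow> (1 + norm x) ^ N *
        norm ((LINT p|lborel. shw f \<kappa> p * tfg bs p x) - (LINT p|lborel. shw f \<kappa> p * tfg bs (s p) x)) \<le> \<epsilon>" by blast
    define k where "k v = (LINT p|lborel. shw f \<kappa> p * indicator (s -` {v}) p)" for v
    define S where "S = (\<lambda>x. \<Sum>v\<in>range s. k v * tfg [] v x)"
    have fin: "finite (range s)" using simple_functionD(1)[OF s(1)] by simp
    have om: "integrable lborel (shw f \<kappa>)"
      using integrable_shw[OF f \<kappa>, of 0] measurable_shw[OF schwartz_measurable[OF f]]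
          by (simp add: integrable_norm_iff)
    have S: "S \<in> schwartz" unfolding S_def by (intro schwartz_sum fin schwartz_cmult tfg_schwartz)
    have u0: "u (\<lambda>x. 0) = 0" using cmult[OF f, of 0] by simp
    have "u (\<lambda>x. \<Sum>v\<in>A. k v * tfg [] v x) = 0" if "finite A" for A
      using that
    proof (induction A rule: finite_induct)
      case (insert v A)
      then show ?case
        using add[OF schwartz_cmult[OF tfg_schwartz]
            schwartz_sum[OF insert.hyps(1) schwartz_cmult[OF tfg_schwartz]], of "k v" v k "\<lambda>v. v"]
        by (simp add: cmult[OF tfg_schwartz] zero)
    qed (simp add: u0)
    then have uS: "u S = 0" unfolding S_def using fin by blast
    have "schwartz_norm N (\<lambda>x. f x - S x) \<le> \<epsilon> + \<epsilon>"
    proof (rule schwartz_norm_le)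
      fix bs :: "'a list" and x :: 'a assume bs: "bs \<in> lists Basis" "length bs \<le> N"
      have "partials bs (\<lambda>x. f x - S x) x = partials bs f x - partials bs S x"
        using partials_add[OF schwartz_smooth[OF f] smooth_cmult[OF schwartz_smooth[OF S], of "-1"] bs(1)]
          partials_cmult[OF schwartz_smooth[OF S] bs(1), of "-1"] by simp
      also have "partials bs S x = (LINT p|lborel. shw f \<kappa> p * tfg bs (s p) x)"
        unfolding S_def tfg_sum_partials[OF fin bs(1)] integral_simple_superposition[OF s(1) om,
            where K = "\<lambda>v. tfg bs v x"] k_def by simp
      finally have "norm (partials bs (\<lambda>x. f x - S x) x)
          \<le> norm (partials bs f x - (LINT t|lborel. partials bs f (x - t) * heat \<kappa> t))
          + norm ((LINT p|lborel. shw f \<kappa> p * tfg bs p x) - (LINT p|lborel. shw f \<kappa> p * tfg bs (s p) x))"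
        unfolding tfg_superposition[OF f \<kappa> bs(1)] by (simp only:) (rule norm_diff_triangle_ineq')
      then have "(1 + norm x) ^ N * norm (partials bs (\<lambda>x. f x - S x) x)
          \<le> (1 + norm x) ^ N * (norm (partials bs f x - (LINT t|lborel. partials bs f (x - t) * heat \<kappa> t))
          + norm ((LINT p|lborel. shw f \<kappa> p * tfg bs p x) - (LINT p|lborel. shw f \<kappa> p * tfg bs (s p) x)))"
        by (rule mult_left_mono) simp
      also have "\<dots> \<le> \<epsilon> + \<epsilon>" unfolding distrib_left by (intro add_mono 1 2 bs)
      finally show "(1 + norm x) ^ N * norm (partials bs (\<lambda>x. f x - S x) x) \<le> \<epsilon> + \<epsilon>" .
    qed
    then have "\<bar>C\<bar> * schwartz_norm N (\<lambda>x. f x - S x) \<le> \<bar>C\<bar> * (\<epsilon> + \<epsilon>)"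
      by (rule mult_left_mono) simp
    moreover have "0 \<le> schwartz_norm N (\<lambda>x. f x - S x)"
      using order_trans[OF _ partials_le_schwartz_norm[OF schwartz_diff[OF f S], of "[]" N 0], of 0] by simp
    then have "C * schwartz_norm N (\<lambda>x. f x - S x) \<le> \<bar>C\<bar> * schwartz_norm N (\<lambda>x. f x - S x)"
      by (intro mult_right_mono) auto
    ultimately have "C * schwartz_norm N (\<lambda>x. f x - S x) \<le> \<bar>C\<bar> * (\<epsilon> + \<epsilon>)" by linarith
    also have "\<dots> \<le> (\<bar>C\<bar> + 1) * (\<epsilon> + \<epsilon>)" using \<epsilon> by (intro mult_right_mono) auto
    also have "\<dots> = e"
    proof -
      have "K * (e / (2 * K) + e / (2 * K)) = e" if "K \<noteq> 0" for K using that by (simp add: field_simps)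
      from this[of "\<bar>C\<bar> + 1"] show ?thesis unfolding \<epsilon>_def by simp
    qed
    finally have "norm (u (\<lambda>x. f x - S x)) \<le> e" using bnd[OF schwartz_diff[OF f S]] by linarith
    moreover have "u f = u (\<lambda>x. f x - S x)"
      using add[OF schwartz_diff[OF f S] S] uS by simp
    ultimately show "norm (u f) \<le> 0 + e" by simp
  qed
  then show ?thesis by simp
qed

subsection \<open>Products and inverses of smooth functions\<close>

text \<open>A class that contains the products and is stable under Leibniz's rule, as required by
  \<open>smooth_coinduct\<close>.\<close>

inductive_set smooth_products :: "('a::euclidean_space \<Rightarrow> complex) set" where
  mult: "smooth f \<Longrightarrow> smooth g \<Longrightarrow> (\<lambda>x. f x * g x) \<in> smooth_products"
| add: "f \<in> smooth_products \<Longrightarrow> g \<in> smooth_products \<Longrightarrow> (\<lambda>x. f x + g x) \<in> smooth_products"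

lemma smooth_products_partial:
  assumes "f \<in> smooth_products" "b \<in> Basis"
  shows "\<exists>f'\<in>smooth_products. dirderiv b f f'"
  using assms(1)
proof induction
  case (mult f g)
  have p: "smooth (partial b f)" "smooth (partial b g)"
    using smooth_partials[of f "[b]"] smooth_partials[of g "[b]"] mult assms(2) by auto
  have "dirderiv b (\<lambda>x. f x * g x) (\<lambda>x. partial b f x * g x + f x * partial b g x)"
    by (intro dirderiv_mult smooth_dirderiv mult assms)
  moreover have "(\<lambda>x. partial b f x * g x + f x * partial b g x) \<in> smooth_products"
    by (intro smooth_products.intros mult p)
  ultimately show ?case by blast
next
  case (add f g)
  then show ?case by (blast intro: smooth_products.add dirderiv_add)
qed

lemma smooth_mult:
  assumes "smooth f" "smooth g"
  shows "smooth (\<lambda>x. f x * g x)"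
proof (rule smooth_coinduct(1)[where X = smooth_products])
  show "(\<lambda>x. f x * g x) \<in> smooth_products" by (intro smooth_products.mult assms)
  show "f differentiable at x" if "f \<in> smooth_products" for f :: "'a \<Rightarrow> complex" and x
    using that by induction (auto intro: differentiable_mult smooth_differentiable differentiable_add)
  show "partial b f \<in> smooth_products" if "f \<in> smooth_products" "b \<in> Basis" for f :: "'a \<Rightarrow> complex" and b
    using smooth_products_partial[OF that] dirderiv_partial by metis
qed

lemma smooth_const: "smooth (\<lambda>x. c)"
proof (rule smooth_coinduct(1)[where X = "range (\<lambda>c x. c)"])
  show "partial b f \<in> range (\<lambda>c x. c)" if "f \<in> range (\<lambda>c x. c)" for f :: "'a \<Rightarrow> complex" and b
    using that dirderiv_partial[OF dirderiv_const] by (auto intro: rangeI)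
qed auto

lemma dirderiv_inverse:
  assumes "dirderiv b f f'" and "\<And>x. f x \<noteq> 0"
  shows "dirderiv b (\<lambda>x. inverse (f x)) (\<lambda>x. - f' x * inverse (f x) ^ 2)"
  unfolding dirderiv_def
proof
  fix x
  have "((\<lambda>t. f (x + t *\<^sub>R b)) has_vector_derivative f' x) (at 0)" using assms(1) by (simp add: dirderiv_def)
  moreover have "(inverse has_field_derivative
      - (inverse (f (x + 0 *\<^sub>R b)) * 1 * inverse (f (x + 0 *\<^sub>R b)))) (at (f (x + 0 *\<^sub>R b)))"
    by (rule DERIV_inverse') (auto simp: assms)
  ultimately have "((inverse \<circ> (\<lambda>t. f (x + t *\<^sub>R b))) has_vector_derivative f' x
      * - (inverse (f (x + 0 *\<^sub>R b)) * 1 * inverse (f (x + 0 *\<^sub>R b)))) (at 0)"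
    by (rule field_vector_diff_chain_at)
  then show "((\<lambda>t. inverse (f (x + t *\<^sub>R b))) has_vector_derivative - f' x * inverse (f x) ^ 2) (at 0)"
    by (simp add: o_def power2_eq_square)
qed

text \<open>Coinduction over all quotients g / f^n with smooth g: differentiation raises n by one
  and leaves a smooth numerator.\<close>

lemma smooth_inverse:
  fixes f :: "'a::euclidean_space \<Rightarrow> complex"
  assumes f: "smooth f" and nz: "\<And>x. f x \<noteq> 0"
  shows "smooth (\<lambda>x. inverse (f x))"
proof (rule smooth_coinduct(1)[where X = "{\<lambda>x. g x * inverse (f x) ^ n |g n. smooth g}"])
  let ?X = "{\<lambda>x. g x * inverse (f x) ^ n |g n. smooth g}"
  have "(\<lambda>x. 1 * inverse (f x) ^ 1) \<in> ?X"
    by (intro CollectI exI[of _ "\<lambda>_. 1"] exI[of _ 1] conjI refl smooth_const)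
  then show "(\<lambda>x. inverse (f x)) \<in> ?X" by simp
  show "h differentiable at x" if "h \<in> ?X" for h x
  proof -
    from that obtain g n where "smooth g" "h = (\<lambda>x. g x * inverse (f x) ^ n)" by blast
    then show ?thesis using smooth_differentiable[OF f, of x] nz
      by (auto intro!: differentiable_mult[OF smooth_differentiable] differentiable_power differentiable_inverse)
  qed
  fix h b assume h: "h \<in> ?X" and b: "b \<in> (Basis :: 'a set)"
  then obtain g n where g: "smooth g" and h: "h = (\<lambda>x. g x * inverse (f x) ^ n)" by blast
  have ps: "smooth (partial b f)" "smooth (partial b g)"
    using smooth_partials[OF f, of "[b]"] smooth_partials[OF g, of "[b]"] b by auto
  have pw: "dirderiv b (\<lambda>x. inverse (f x) ^ n) (\<lambda>x. - of_nat n * partial b f x * inverse (f x) ^ Suc n)" for n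
  proof (induction n)
    case (Suc n)
    from dirderiv_mult[OF dirderiv_inverse[OF smooth_dirderiv[OF f b] nz] Suc]
    show ?case by (simp add: algebra_simps power2_eq_square)
  qed (simp add: dirderiv_const)
  have "dirderiv b h (\<lambda>x. partial b g x * inverse (f x) ^ n
      + g x * (- of_nat n * partial b f x * inverse (f x) ^ Suc n))"
    unfolding h by (intro dirderiv_mult smooth_dirderiv g b pw)
  also have "(\<lambda>x. partial b g x * inverse (f x) ^ n + g x * (- of_nat n * partial b f x * inverse (f x) ^ Suc n))
      = (\<lambda>x. (partial b g x * f x + (- of_nat n) * (g x * partial b f x)) * inverse (f x) ^ Suc n)"
    using nz by (auto simp: field_simps)
  finally have "partial b h = (\<lambda>x. (partial b g x * f x + (- of_nat n) * (g x * partial b f x))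
      * inverse (f x) ^ Suc n)"
    by (rule dirderiv_partial)
  moreover have "smooth (\<lambda>x. partial b g x * f x + (- of_nat n) * (g x * partial b f x))"
    by (intro smooth_add smooth_mult smooth_const f g ps)
  ultimately show "partial b h \<in> ?X"
    by (intro CollectI exI[of _ "\<lambda>x. partial b g x * f x + (- of_nat n) * (g x * partial b f x)"]
        exI[of _ "Suc n"] conjI)
qed

lemma smooth_sum: "finite A \<Longrightarrow> (\<And>i. i \<in> A \<Longrightarrow> smooth (f i)) \<Longrightarrow> smooth (\<lambda>x. \<Sum>i\<in>A. f i x)"
  by (induction A rule: finite_induct) (auto intro: smooth_const smooth_add)

text \<open>Coinduction over real multiples of everywhere convergent power series in
  \<open>s \<bullet> v\<close>: a partial derivative multiplies by \<open>b \<bullet> v\<close> and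
  replaces the coefficients by \<open>diffs c\<close>.\<close>

lemma smooth_power_series_inner:
  fixes c :: "nat \<Rightarrow> real" and v :: "'a::euclidean_space"
  assumes "\<And>t. summable (\<lambda>n. c n * t ^ n)"
  shows "smooth (\<lambda>s. of_real (\<Sum>n. c n * (s \<bullet> v) ^ n))"
proof (rule smooth_coinduct(1)[where X
    = "{\<lambda>s. of_real (k * (\<Sum>n. c n * (s \<bullet> v) ^ n)) |k c. \<forall>t. summable (\<lambda>n. c n * t ^ n)}"])
  let ?X = "{\<lambda>s. complex_of_real (k * (\<Sum>n. c n * (s \<bullet> v) ^ n)) |(k::real) c. \<forall>t. summable (\<lambda>n. c n * t ^ n)}"
  have "(\<lambda>s. complex_of_real (1 * (\<Sum>n. c n * (s \<bullet> v) ^ n))) \<in> ?X" using assms by blast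
  then show "(\<lambda>s. of_real (\<Sum>n. c n * (s \<bullet> v) ^ n)) \<in> ?X" by simp
  have der: "((\<lambda>s. complex_of_real (k * (\<Sum>n. c n * (s \<bullet> v) ^ n))) has_derivative
      (\<lambda>h. of_real (k * ((h \<bullet> v) * (\<Sum>n. diffs c n * (x \<bullet> v) ^ n))))) (at x)"
    if c: "\<forall>t. summable (\<lambda>n. c n * t ^ n)" for k c and x :: 'a
  proof -
    have "((\<lambda>t. \<Sum>n. c n * t ^ n) has_real_derivative (\<Sum>n. diffs c n * (x \<bullet> v) ^ n)) (at (x \<bullet> v))"
      using c by (intro termdiffs_strong_converges_everywhere) auto
    then have 1: "((\<lambda>t. \<Sum>n. c n * t ^ n) has_derivative (\<lambda>h. (\<Sum>n. diffs c n * (x \<bullet> v) ^ n) * h)) (at (x \<bullet> v))"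
      by (simp add: has_field_derivative_def)
    have 2: "((\<lambda>s. s \<bullet> v) has_derivative (\<lambda>h. h \<bullet> v)) (at x)" by (auto intro!: derivative_eq_intros)
    have "((\<lambda>s. \<Sum>n. c n * (s \<bullet> v) ^ n) has_derivative (\<lambda>h. (\<Sum>n. diffs c n * (x \<bullet> v) ^ n) * (h \<bullet> v))) (at x)"
      by (rule has_derivative_compose[OF 2 1])
    from has_derivative_of_real[OF has_derivative_mult_right[OF this, of k]] show ?thesis
      by (simp add: mult_ac)
  qed
  show "h differentiable at x" if "h \<in> ?X" for h x
    using that der by (blast intro: differentiableI)
  fix h b assume "h \<in> ?X" "b \<in> (Basis :: 'a set)"
  then obtain k c where h: "h = (\<lambda>s. complex_of_real (k * (\<Sum>n. c n * (s \<bullet> v) ^ n)))"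
      and c: "\<forall>t. summable (\<lambda>n. c n * t ^ n)" by blast
  have "partial b h = (\<lambda>s. of_real ((k * (b \<bullet> v)) * (\<Sum>n. diffs c n * (s \<bullet> v) ^ n)))"
    using dirderiv_partial[OF has_derivative_dirderiv[OF der[OF c]], of b] unfolding h by (simp add: mult_ac)
  moreover have "\<forall>t. summable (\<lambda>n. diffs c n * t ^ n)" using termdiff_converges_all[of c] c by blast
  ultimately show "partial b h \<in> ?X" by blast
qed

subsection \<open>An entire function of Gevrey type\<close>

text \<open>The denominators match the Gevrey growth of the k-th derivatives of the symbol.\<close>

definition gcoeff :: "real \<Rightarrow> real \<Rightarrow> nat \<Rightarrow> real" where
  "gcoeff \<mu> \<delta> k = (if even k then \<delta> ^ k / (fact k) powr \<mu> else 0)"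

lemma gcoeff_nonneg: "\<delta> \<ge> 0 \<Longrightarrow> 0 \<le> gcoeff \<mu> \<delta> k"
  by (simp add: gcoeff_def)

text \<open>The ratio of consecutive terms of the series over all \<open>k\<close> is
  \<open>\<delta> * r * real (Suc k) powr - \<mu>\<close>, which tends to 0. The ratio test precedes
  the removal of the odd terms, since it does not tolerate alternating zeros.\<close>

lemma summable_gcoeff:
  assumes \<mu>: "\<mu> > 0" and \<delta>: "\<delta> > 0" and r: "r \<ge> 0"
  shows "summable (\<lambda>k. gcoeff \<mu> \<delta> k * r ^ k)"
proof -
  have "summable (\<lambda>k. \<delta> ^ k / (fact k) powr \<mu> * r ^ k)"
  proof -
    have "(\<lambda>k. real (Suc k) powr - \<mu>) \<longlonglongrightarrow> 0"
      using tendsto_neg_powr[of "- \<mu>" "\<lambda>k. real (Suc k)" sequentially] \<mu>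
        filterlim_compose[OF filterlim_real_sequentially filterlim_Suc] by simp
    then have "(\<lambda>k. \<delta> * r * real (Suc k) powr - \<mu>) \<longlonglongrightarrow> \<delta> * r * 0" by (intro tendsto_intros)
    then have "eventually (\<lambda>k. \<delta> * r * real (Suc k) powr - \<mu> < 1/2) sequentially"
      by (intro order_tendstoD(2)) auto
    then obtain N where N: "\<And>k. k \<ge> N \<Longrightarrow> \<delta> * r * real (Suc k) powr - \<mu> < 1/2" by (auto simp: eventually_sequentially)
    show ?thesis
    proof (rule summable_ratio_test[of "1/2" N])
      fix k assume k: "N \<le> k"
      have "\<delta> ^ Suc k / (fact (Suc k)) powr \<mu> * r ^ Suc k
          = (\<delta> * r * real (Suc k) powr - \<mu>) * (\<delta> ^ k / (fact k) powr \<mu> * r ^ k)"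
        by (simp add: powr_mult powr_minus divide_inverse mult_ac del: of_nat_Suc)
      also have "\<dots> \<le> 1/2 * (\<delta> ^ k / (fact k) powr \<mu> * r ^ k)"
        using N[OF k] \<delta> r by (intro mult_right_mono) auto
      finally show "norm (\<delta> ^ Suc k / (fact (Suc k)) powr \<mu> * r ^ Suc k)
          \<le> 1/2 * norm (\<delta> ^ k / (fact k) powr \<mu> * r ^ k)"
        using \<delta> r by (simp add: abs_mult)
    qed simp
  qed
  then show ?thesis
    by (rule summable_comparison_test[rotated]) (use \<delta> r in \<open>auto simp: gcoeff_def intro!: exI[of _ 0]\<close>)
qed

lemma summable_gcoeff_all:
  assumes \<mu>: "\<mu> > 0" and \<delta>: "\<delta> > 0"
  shows "summable (\<lambda>k. gcoeff \<mu> \<delta> k * t ^ k)"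
  by (rule summable_comparison_test[OF _ summable_gcoeff[OF \<mu> \<delta>, of "\<bar>t\<bar>"]])
    (use \<delta> in \<open>auto simp: abs_mult power_abs gcoeff_nonneg intro!: exI[of _ 0]\<close>)

definition gseries :: "real \<Rightarrow> real \<Rightarrow> real \<Rightarrow> real" where
  "gseries \<mu> \<delta> t = (\<Sum>k. gcoeff \<mu> \<delta> k * t ^ k)"

lemma gseries_ge:
  assumes \<mu>: "\<mu> > 0" and \<delta>: "\<delta> > 0"
  shows "gcoeff \<mu> \<delta> k * t ^ k \<le> gseries \<mu> \<delta> t"
proof -
  have nn: "0 \<le> gcoeff \<mu> \<delta> j * t ^ j" for j
    using \<delta> by (cases "even j") (auto simp: gcoeff_def)
  have "sum (\<lambda>k. gcoeff \<mu> \<delta> k * t ^ k) {k} \<le> gseries \<mu> \<delta> t"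
    unfolding gseries_def by (rule sum_le_suminf[OF summable_gcoeff_all[OF \<mu> \<delta>]]) (use nn in auto)
  then show ?thesis by simp
qed

lemma gseries_ge_1:
  assumes \<mu>: "\<mu> > 0" and \<delta>: "\<delta> > 0"
  shows "1 \<le> gseries \<mu> \<delta> t"
  using gseries_ge[OF assms, of 0 t] by (simp add: gcoeff_def)

lemma power_powr_commute: "(0::real) \<le> y \<Longrightarrow> (y ^ n) powr a = (y powr a) ^ n"
  by (induction n) (auto simp: powr_mult)

text \<open>The \<open>\<mu>\<close>-th root of each term of the series is a term of the exponential series.\<close>

lemma gseries_lower:
  assumes \<mu>: "\<mu> > 0" and \<delta>: "\<delta> > 0"
  shows "exp (\<mu> / 2 * (\<delta> * \<bar>t\<bar>) powr (1 / \<mu>)) \<le> 4 powr \<mu> * gseries \<mu> \<delta> t"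
proof -
  define x where "x = (\<delta> * \<bar>t\<bar>) powr (1 / \<mu>)"
  define Q where "Q = gseries \<mu> \<delta> t powr (1 / \<mu>)"
  have x0: "0 \<le> x" by (simp add: x_def)
  have G: "0 < gseries \<mu> \<delta> t" using gseries_ge_1[OF assms, of t] by linarith
  have Q0: "0 \<le> Q" by (simp add: Q_def)
  have xk: "x ^ n / fact n \<le> Q" if "even n" for n
  proof -
    have "(\<delta> * \<bar>t\<bar>) ^ n / (fact n) powr \<mu> \<le> gseries \<mu> \<delta> t"
      using gseries_ge[OF assms, of n t] that by (simp add: gcoeff_def power_mult_distrib power_even_abs)
    then have "((\<delta> * \<bar>t\<bar>) ^ n / (fact n) powr \<mu>) powr (1 / \<mu>) \<le> Q"
      unfolding Q_def using \<mu> \<delta> by (intro powr_mono2) auto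
    moreover have "((\<delta> * \<bar>t\<bar>) ^ n / (fact n) powr \<mu>) powr (1 / \<mu>) = x ^ n / fact n"
      using \<mu> \<delta> by (simp add: powr_divide powr_powr power_powr_commute x_def del: power_mult_distrib)
    ultimately show ?thesis by simp
  qed
  \<comment> \<open>Every even power satisfies \<open>x ^ n / fact n \<le> Q\<close>. Halving the
    argument supplies the factor \<open>(1/2) ^ n\<close> that makes the bounds summable, with sum
    \<open>Q * 2\<close>; together with exp \<le> 2 cosh this gives \<open>4 * Q\<close>, the origin
    of \<open>4 powr \<mu>\<close>.\<close>
  have "cosh (x / 2) \<le> Q * 2"
  proof (rule sums_le[OF _ cosh_converges])
    show "(\<lambda>n. Q * (1/2) ^ n) sums (Q * 2)"
      using sums_mult[OF geometric_sums[of "1/2 :: real"], of Q] by simp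
    show "(if even n then (x / 2) ^ n /\<^sub>R fact n else 0) \<le> Q * (1/2) ^ n" for n
    proof (cases "even n")
      case True
      have "(x / 2) ^ n /\<^sub>R fact n = (x ^ n / fact n) * (1/2) ^ n"
        by (simp add: power_divide field_simps)
      also have "\<dots> \<le> Q * (1/2) ^ n" by (intro mult_right_mono xk True) auto
      finally show ?thesis using True by simp
    qed (use Q0 in auto)
  qed
  moreover have "exp (x / 2) \<le> 2 * cosh (x / 2)" by (simp add: cosh_def)
  ultimately have "exp (x / 2) \<le> 4 * Q" by linarith
  then have "exp (x / 2) powr \<mu> \<le> (4 * Q) powr \<mu>" using \<mu> by (intro powr_mono2) auto
  then show ?thesis using \<mu> G Q0
    by (simp add: powr_mult Q_def powr_powr x_def exp_powr_real[symmetric] powr_def[of "exp _"] mult_ac)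
qed

definition gdenom :: "real \<Rightarrow> real \<Rightarrow> 'a::euclidean_space \<Rightarrow> real" where
  "gdenom \<mu> \<delta> s = (\<Sum>b\<in>Basis. gseries \<mu> \<delta> (s \<bullet> b))"

lemma gdenom_ge:
  assumes \<mu>: "\<mu> > 0" and \<delta>: "\<delta> > 0" and b: "b \<in> Basis"
  shows "gseries \<mu> \<delta> (s \<bullet> b) \<le> gdenom \<mu> \<delta> s"
  unfolding gdenom_def
  by (rule member_le_sum[OF b]) (auto intro: order_trans[OF zero_le_one gseries_ge_1[OF \<mu> \<delta>]])

lemma gdenom_ge_1:
  assumes \<mu>: "\<mu> > 0" and \<delta>: "\<delta> > 0"
  shows "1 \<le> gdenom \<mu> \<delta> s"
proof -
  obtain b :: 'a where "b \<in> Basis" using nonempty_Basis by blast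
  from gdenom_ge[OF \<mu> \<delta> this, of s] gseries_ge_1[OF \<mu> \<delta>, of "s \<bullet> b"] show ?thesis by linarith
qed

definition gdecay :: "real \<Rightarrow> real \<Rightarrow> 'a::euclidean_space \<Rightarrow> complex" where
  "gdecay \<mu> \<delta> s = inverse (of_real (gdenom \<mu> \<delta> s))"

lemma smooth_gdecay:
  assumes \<mu>: "\<mu> > 0" and \<delta>: "\<delta> > 0"
  shows "smooth (gdecay \<mu> \<delta>)"
  unfolding gdecay_def[abs_def]
proof (rule smooth_inverse)
  show "smooth (\<lambda>s. complex_of_real (gdenom \<mu> \<delta> s))"
    unfolding gdenom_def gseries_def of_real_sum
    by (intro smooth_sum smooth_power_series_inner summable_gcoeff_all assms) auto
  show "complex_of_real (gdenom \<mu> \<delta> s) \<noteq> 0" for s :: 'a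
    using gdenom_ge_1[OF assms, of s] by simp
qed

text \<open>If all coordinates were smaller, their sum would fall below the norm, against
  \<open>norm_le_l1\<close>.\<close>

lemma ex_Basis_norm_le: "\<exists>b\<in>Basis. norm (s::'a::euclidean_space) \<le> DIM('a) * \<bar>s \<bullet> b\<bar>"
proof (rule ccontr)
  assume "\<not> ?thesis"
  then have *: "DIM('a) * \<bar>s \<bullet> b\<bar> < norm s" if "b \<in> Basis" for b using that by (auto simp: not_le)
  have "DIM('a) * norm s \<le> DIM('a) * (\<Sum>b\<in>Basis. \<bar>s \<bullet> b\<bar>)" by (intro mult_left_mono norm_le_l1) auto
  also have "\<dots> = (\<Sum>b\<in>Basis. DIM('a) * \<bar>s \<bullet> b\<bar>)" by (simp add: sum_distrib_left)
  also have "\<dots> < (\<Sum>b\<in>(Basis::'a set). norm s)" by (intro sum_strict_mono *) auto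
  finally show False by simp
qed

text \<open>The series of a coordinate of size at least \<open>norm s / DIM('a)\<close> alone bounds
  \<open>gdenom\<close> from below; the division by the dimension reappears in the exponent.\<close>

lemma gdecay_bound:
  assumes \<mu>: "\<mu> > 0" and \<delta>: "\<delta> > 0"
  shows "norm (gdecay \<mu> \<delta> (s::'a::euclidean_space))
    \<le> 4 powr \<mu> * exp (- (\<mu> / 2 * (\<delta> / DIM('a)) powr (1 / \<mu>)) * norm s powr (1 / \<mu>))"
proof -
  obtain b :: 'a where b: "b \<in> Basis" "norm s \<le> DIM('a) * \<bar>s \<bullet> b\<bar>" using ex_Basis_norm_le by blast
  have "(\<delta> / DIM('a)) powr (1 / \<mu>) * norm s powr (1 / \<mu>) = (\<delta> * (norm s / DIM('a))) powr (1 / \<mu>)"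
    using \<delta> by (simp flip: powr_mult)
  also have "\<dots> \<le> (\<delta> * \<bar>s \<bullet> b\<bar>) powr (1 / \<mu>)"
    using b \<mu> \<delta> by (intro powr_mono2 mult_left_mono) (auto simp: field_simps)
  finally have "\<mu> / 2 * ((\<delta> / DIM('a)) powr (1 / \<mu>) * norm s powr (1 / \<mu>)) \<le> \<mu> / 2 * (\<delta> * \<bar>s \<bullet> b\<bar>) powr (1 / \<mu>)"
    using \<mu> by (intro mult_left_mono) auto
  then have "exp (\<mu> / 2 * ((\<delta> / DIM('a)) powr (1 / \<mu>) * norm s powr (1 / \<mu>))) \<le> 4 powr \<mu> * gseries \<mu> \<delta> (s \<bullet> b)"
    by (intro order_trans[OF _ gseries_lower[OF assms]]) simp
  also have "\<dots> \<le> 4 powr \<mu> * gdenom \<mu> \<delta> s" by (intro mult_left_mono gdenom_ge assms b) auto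
  finally have 1: "exp (\<mu> / 2 * ((\<delta> / DIM('a)) powr (1 / \<mu>) * norm s powr (1 / \<mu>))) \<le> 4 powr \<mu> * gdenom \<mu> \<delta> s" .
  have p: "0 < gdenom \<mu> \<delta> s" using gdenom_ge_1[OF assms, of s] by linarith
  have "norm (gdecay \<mu> \<delta> s) = inverse (gdenom \<mu> \<delta> s)" using p by (simp add: gdecay_def norm_inverse)
  also have "\<dots> \<le> 4 powr \<mu> * exp (- (\<mu> / 2 * ((\<delta> / DIM('a)) powr (1 / \<mu>) * norm s powr (1 / \<mu>))))"
    using 1 p by (simp add: exp_minus field_simps)
  finally show ?thesis by (simp add: mult_ac)
qed

subsection \<open>Infinite order differential operators on the Fourier side\<close>

text \<open>The derivatives of order \<open>j\<close> in direction \<open>c\<close> of the monomial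
  \<open>(s \<bullet> b) ^ k\<close>; for a basis vector \<open>c\<close> other than
  \<open>b\<close> orthogonality kills all positive orders.\<close>

definition monod :: "'a::euclidean_space \<Rightarrow> nat \<Rightarrow> 'a \<Rightarrow> nat \<Rightarrow> 'a \<Rightarrow> complex" where
  "monod b k c j s = (if c = b then (if j \<le> k then (fact k / fact (k - j)) * of_real (s \<bullet> b) ^ (k - j) else 0)
     else if j = 0 then of_real (s \<bullet> b) ^ k else 0)"

lemma dseq_monod:
  assumes "b \<in> Basis" "c \<in> Basis"
  shows "dseq c (monod b k c)"
  unfolding dseq_def
proof (intro allI conjI)
  fix j
  show "continuous_on UNIV (monod b k c j)"
    by (cases "c = b"; cases "j \<le> k"; cases "j = 0") (auto simp: monod_def[abs_def] intro!: continuous_intros)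
  have lin: "dirderiv c (\<lambda>s. complex_of_real (s \<bullet> b)) (\<lambda>s. of_real (c \<bullet> b))"
    unfolding dirderiv_def by (auto intro!: derivative_eq_intros simp: inner_add_left)
  have pw: "dirderiv c (\<lambda>s. complex_of_real (s \<bullet> b) ^ n) (\<lambda>s. of_nat n * of_real (c \<bullet> b)
      * of_real (s \<bullet> b) ^ (n - 1))" for n
  proof (induction n)
    case (Suc n)
    from dirderiv_mult[OF lin Suc] show ?case
      by (cases n) (simp_all add: algebra_simps)
  qed (simp add: dirderiv_const)
  show "dirderiv c (monod b k c j) (monod b k c (Suc j))"
  proof (cases "c = b")
    case True
    consider "j < k" | "j = k" | "j > k" by linarith
    then show ?thesis
    proof cases
      case 1
      have f: "fact (k - j) = (of_nat (k - j) :: complex) * fact (k - Suc j)"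
        using 1 by (metis Suc_diff_Suc fact_Suc of_nat_fact of_nat_mult)
      from dirderiv_cmult[OF pw[of "k - j"], of "fact k / fact (k - j)"]
      have "dirderiv c (monod b k c j)
          (\<lambda>s. (fact k / fact (k - j)) * (of_nat (k - j) * of_real (c \<bullet> b) * of_real (s \<bullet> b) ^ (k - j - 1)))"
        using 1 True by (simp add: monod_def[abs_def])
      also have "(\<lambda>s. (fact k / fact (k - j)) * (of_nat (k - j) * of_real (c \<bullet> b) * of_real (s \<bullet> b)
          ^ (k - j - 1))) = monod b k c (Suc j)"
        using 1 True assms by (auto simp: monod_def[abs_def] f inner_same_Basis)
      finally show ?thesis .
    next
      case 2
      have "monod b k c j = (\<lambda>s. fact k)" "monod b k c (Suc j) = (\<lambda>s. 0)"
        using 2 True by (auto simp: monod_def[abs_def])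
      then show ?thesis using dirderiv_const by simp
    next
      case 3
      have "monod b k c j = (\<lambda>s. 0)" "monod b k c (Suc j) = (\<lambda>s. 0)"
        using 3 True by (auto simp: monod_def[abs_def])
      then show ?thesis using dirderiv_const by simp
    qed
  next
    case False
    show ?thesis
    proof (cases "j = 0")
      case True
      have "c \<bullet> b = 0" using False assms by (simp add: inner_Basis)
      with pw[of k] True False show ?thesis by (simp add: monod_def[abs_def])
    next
      case j: False
      then have "monod b k c j = (\<lambda>s. 0)" "monod b k c (Suc j) = (\<lambda>s. 0)"
        using False by (auto simp: monod_def[abs_def])
      then show ?thesis using dirderiv_const by simp
    qed
  qed
qed

lemma fact_div_fact_le: "j \<le> k \<Longrightarrow> (fact k / fact (k - j) :: real) \<le> real k ^ j"
proof (induction j)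
  case (Suc j)
  then have "fact (k - j) = (real (k - j)) * fact (k - Suc j)"
    by (metis Suc_diff_Suc Suc_le_lessD fact_Suc of_nat_fact of_nat_mult)
  moreover have "real (k - j) \<noteq> 0" using Suc.prems by simp
  ultimately have "(fact k / fact (k - Suc j) :: real) = real (k - j) * (fact k / fact (k - j))"
    by (simp del: of_nat_diff)
  also have "\<dots> \<le> real k * real k ^ j"
    using Suc by (intro mult_mono) auto
  finally show ?case by simp
qed simp

lemma norm_monod_le:
  assumes "b \<in> Basis" "norm s \<le> R" "1 \<le> R"
  shows "norm (monod b k c j s) \<le> (1 + real k) ^ j * R ^ k"
proof -
  have sb: "\<bar>s \<bullet> b\<bar> \<le> R" using Basis_le_norm[OF assms(1), of s] assms by linarith
  have pw: "\<bar>s \<bullet> b\<bar> ^ n \<le> R ^ k" if "n \<le> k" for n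
    using power_mono[OF sb, of n] power_increasing[OF that assms(3)] by linarith
  have nn: "0 \<le> (1 + real k) ^ j * R ^ k" "1 \<le> (1 + real k) ^ j" using assms by auto
  show ?thesis
  proof (cases "c = b")
    case True
    show ?thesis
    proof (cases "j \<le> k")
      case jk: True
      have "norm (monod b k c j s) = (fact k / fact (k - j)) * \<bar>s \<bullet> b\<bar> ^ (k - j)"
        using True jk by (simp add: monod_def norm_mult norm_divide norm_power)
      also have "\<dots> \<le> (1 + real k) ^ j * R ^ k"
      proof (rule mult_mono)
        have "real k ^ j \<le> (1 + real k) ^ j" by (intro power_mono) auto
        then show "fact k / fact (k - j) \<le> (1 + real k) ^ j" using fact_div_fact_le[OF jk] by linarith
      qed (auto intro: pw)
      finally show ?thesis .
    qed (use True nn in \<open>simp add: monod_def\<close>)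
  next
    case False
    then show ?thesis using nn pw[of k] by (cases "j = 0") (auto simp: monod_def norm_power)
  qed
qed

section \<open>Transforms of compactly supported functions times monomials\<close>

lemma continuous_compact_support:
  fixes f :: "'a::euclidean_space \<Rightarrow> complex"
  assumes c: "continuous_on UNIV f" and z: "\<And>s. norm s > R \<Longrightarrow> f s = 0"
  shows "\<exists>B\<ge>0. \<forall>s. norm (f s) \<le> B"
proof -
  have "compact (f ` cball 0 R)" by (intro compact_continuous_image continuous_on_subset[OF c]) auto
  then have "bounded (f ` cball 0 R)" by (rule compact_imp_bounded)
  then obtain B where "\<forall>y\<in>f ` cball 0 R. norm y \<le> B" unfolding bounded_iff by blast
  then have B: "norm s \<le> R \<Longrightarrow> norm (f s) \<le> B" for s by simp
  have "norm (f s) \<le> \<bar>B\<bar>" for s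
    using B[of s] z[of s] by (cases "norm s \<le> R") auto
  then show ?thesis by (intro exI[of _ "\<bar>B\<bar>"]) auto
qed

lemma integrable_compact_support:
  fixes f :: "'a::euclidean_space \<Rightarrow> complex"
  assumes [measurable]: "f \<in> borel_measurable borel" and B: "\<And>s. norm (f s) \<le> B" and z: "\<And>s. norm s > R \<Longrightarrow> f s = 0"
  shows "integrable lborel f" and "(LINT s|lborel. norm (f s)) \<le> B * measure lborel (cball (0::'a) R)"
proof -
  have ind: "integrable lborel (\<lambda>x::'a. B * indicator (cball 0 R) x :: real)"
    using emeasure_bounded_finite[of "cball (0::'a) R"]
    by (intro integrable_mult_right integrable_real_indicator) auto
  have le: "norm (f s) \<le> B * indicator (cball 0 R) s" for s
    using B[of s] z[of s] by (cases "norm s \<le> R") auto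
  show "integrable lborel f"
    by (rule Bochner_Integration.integrable_bound[OF ind])
      (use le in \<open>auto intro!: AE_I2 intro: order_trans[OF le abs_ge_self]\<close>)
  then have "(LINT s|lborel. norm (f s)) \<le> (LINT x|lborel. B * indicator (cball (0::'a) R) x)"
    using ind le by (intro integral_mono) auto
  also have "\<dots> = B * measure lborel (cball (0::'a) R)" by simp
  finally show "(LINT s|lborel. norm (f s)) \<le> B * measure lborel (cball (0::'a) R)" .
qed

lemma inverse_fourier_integrable:
  fixes D :: "'a::euclidean_space \<Rightarrow> nat \<Rightarrow> 'a \<Rightarrow> complex"
  assumes D: "\<And>b. b \<in> Basis \<Longrightarrow> dseq b (D b)" "\<And>b. b \<in> Basis \<Longrightarrow> D b 0 = f" and f: "f \<in> borel_measurable borel"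
    and int: "\<And>b n. b \<in> Basis \<Longrightarrow> n \<le> 2 * DIM('a) \<Longrightarrow> integrable lborel (D b n)"
  shows "integrable lborel (inverse_fourier f)"
    and "(LINT \<eta>|lborel. norm (inverse_fourier f \<eta>))
        \<le> (LINT x::'a|lborel. inverse ((1 + norm x) ^ (2 * DIM('a)))) * ((1 + DIM('a)) ^ (2 * DIM('a)) *
      ((LINT x|lborel. norm (f x)) + (\<Sum>b\<in>Basis. LINT x|lborel. norm (D b (2 * DIM('a)) x))))"
    (is "_ \<le> ?W * ?C")
proof -
  have m: "inverse_fourier f \<in> borel_measurable borel" using f by simp
  note le = inverse_fourier_decay[OF D int, of "2 * DIM('a)"]
  show "integrable lborel (inverse_fourier f)" by (rule integrable_decay[OF m order_refl le])
  show "(LINT \<eta>|lborel. norm (inverse_fourier f \<eta>)) \<le> ?W * ?C" by (rule integral_decay_le[OF m order_refl le])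
qed

text \<open>For fixed \<open>j\<close> the polynomial cost of differentiating a \<open>k\<close>-th
  power is absorbed by a geometric factor.\<close>

lemma Suc_power_le: "(1 + real k) ^ j \<le> (2 ^ j) ^ k"
proof -
  have "1 + real k \<le> 2 ^ k" using less_exp[of k]
      by (metis Suc_leI of_nat_Suc of_nat_le_iff of_nat_numeral of_nat_power add.commute)
  then have "(1 + real k) ^ j \<le> (2 ^ k) ^ j" by (intro power_mono) auto
  then show ?thesis by (simp add: mult.commute flip: power_mult)
qed

text \<open>At most geometric growth in \<open>k\<close> is what lets the series with coefficients
  \<open>gcoeff\<close> converge in L^1. On the support a coordinate is at most \<open>R\<close>,
  which costs \<open>R ^ k\<close>; integrability of the transform takes \<open>2 * DIM('a)\<close>
  derivatives, which cost a power of \<open>1 + real k\<close> and thus a further geometric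
  factor.\<close>

lemma monomial_mult_inverse_fourier:
  fixes X :: "'a::euclidean_space \<Rightarrow> nat \<Rightarrow> 'a \<Rightarrow> complex" and \<phi> :: "'a \<Rightarrow> complex"
  assumes X: "\<And>c. c \<in> Basis \<Longrightarrow> dseq c (X c)" "\<And>c. c \<in> Basis \<Longrightarrow> X c 0 = \<phi>"
    and supp: "\<And>c n s. c \<in> Basis \<Longrightarrow> norm s > R \<Longrightarrow> X c n s = 0" and R: "1 \<le> R" and b: "b \<in> Basis"
  shows "integrable lborel (\<lambda>s. of_real (s \<bullet> b) ^ k * \<phi> s)"
    and "integrable lborel (inverse_fourier (\<lambda>s. of_real (s \<bullet> b) ^ k * \<phi> s))"
    and "\<exists>A\<ge>0. \<exists>r\<ge>0. \<forall>k. (LINT \<eta>|lborel. norm (inverse_fourier (\<lambda>s. of_real (s \<bullet> b) ^ k * \<phi> s) \<eta>)) \<le> A * r ^ k"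
proof -
  define K where "K = 2 * DIM('a)"
  \<comment> \<open>Leibniz's rule for the \<open>n\<close>-th derivative in direction
    \<open>c\<close> of the monomial times \<phi>.\<close>
  define Y where "Y k c n s = (\<Sum>j\<le>n. of_nat (n choose j) * (monod b k c j s * X c (n - j) s))" for k c n s
  have "\<forall>c\<in>Basis. \<forall>n. \<exists>B\<ge>0. \<forall>s. norm (X c n s) \<le> B"
    using X(1) supp by (auto simp: dseq_def intro!: continuous_compact_support)
  then obtain B0 where B0: "\<And>c n s. c \<in> Basis \<Longrightarrow> norm (X c n s) \<le> B0 c n" "\<And>c n. c \<in> Basis \<Longrightarrow> 0 \<le> B0 c n" by metis
  define B where "B = (\<Sum>c\<in>Basis. \<Sum>n\<le>K. B0 c n)"
  have B: "norm (X c n s) \<le> B" if "c \<in> Basis" "n \<le> K" for c n s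
  proof -
    have "B0 c n \<le> (\<Sum>n\<le>K. B0 c n)" using that B0(2) by (intro member_le_sum) auto
    also have "\<dots> \<le> B" unfolding B_def using that B0(2)
      by (intro member_le_sum[of c Basis "\<lambda>c. \<Sum>n\<le>K. B0 c n"]) (auto intro!: sum_nonneg)
    finally show ?thesis using B0(1)[OF that(1), of n s] by linarith
  qed
  have Bnn: "0 \<le> B" unfolding B_def using B0(2) by (intro sum_nonneg) auto
  have dY: "dseq c (Y k c)" if "c \<in> Basis" for c k
    unfolding Y_def[abs_def] by (rule dseq_mult[OF dseq_monod[OF b that] X(1)[OF that]])
  have Y0: "Y k c 0 = (\<lambda>s. of_real (s \<bullet> b) ^ k * \<phi> s)" if "c \<in> Basis" for c k
    using X(2)[OF that] by (auto simp: Y_def monod_def)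
  have Ysupp: "Y k c n s = 0" if "c \<in> Basis" "norm s > R" for c n k s
    unfolding Y_def using supp[OF that] by (intro sum.neutral) auto
  have Ybound: "norm (Y k c n s) \<le> (2 ^ K * B) * ((2 ^ K) * R) ^ k" if c: "c \<in> Basis" and n: "n \<le> K" for c n k s
  proof (cases "norm s > R")
    case True
    then show ?thesis using Ysupp[OF c] Bnn R by simp
  next
    case False
    have "norm (Y k c n s) \<le> (\<Sum>j\<le>n. norm (of_nat (n choose j) * (monod b k c j s * X c (n - j) s)))"
      unfolding Y_def by (rule norm_sum)
    also have "\<dots> \<le> (\<Sum>j\<le>n. real (n choose j) * (((2 ^ K) ^ k * R ^ k) * B))"
    proof (intro sum_mono)
      fix j assume j: "j \<in> {..n}"
      have "norm (monod b k c j s) \<le> (1 + real k) ^ j * R ^ k"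
        using False R by (intro norm_monod_le b) auto
      also have "\<dots> \<le> (1 + real k) ^ K * R ^ k" using j n R by (intro mult_right_mono power_increasing) auto
      also have "\<dots> \<le> (2 ^ K) ^ k * R ^ k" using R by (intro mult_right_mono Suc_power_le) auto
      finally have "norm (monod b k c j s) * norm (X c (n - j) s) \<le> ((2 ^ K) ^ k * R ^ k) * B"
        using R n by (intro mult_mono B c) auto
      then show "norm (of_nat (n choose j) * (monod b k c j s * X c (n - j) s))
          \<le> real (n choose j) * (((2 ^ K) ^ k * R ^ k) * B)"
        unfolding norm_mult norm_of_nat by (rule mult_left_mono) simp
    qed
    also have "\<dots> = 2 ^ n * (((2 ^ K) ^ k * R ^ k) * B)"
      by (simp add: sum_distrib_right[symmetric] choose_row_sum flip: of_nat_sum)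
    also have "\<dots> \<le> 2 ^ K * (((2 ^ K) ^ k * R ^ k) * B)"
      using n Bnn R by (intro mult_right_mono power_increasing) auto
    finally show ?thesis by (simp add: power_mult_distrib mult_ac)
  qed
  have Ym: "Y k c n \<in> borel_measurable borel" if "c \<in> Basis" for c n k
    using dY[OF that, of k] by (intro borel_measurable_continuous_onI) (simp add: dseq_def)
  have Yi: "integrable lborel (Y k c n)" "(LINT s|lborel. norm (Y k c n s))
      \<le> ((2 ^ K * B) * ((2 ^ K) * R) ^ k) * measure lborel (cball (0::'a) R)"
    if "c \<in> Basis" "n \<le> K" for c n k
    using integrable_compact_support[OF Ym[OF that(1)] Ybound[OF that] Ysupp[OF that(1)]] by auto
  let ?f = "\<lambda>k s. of_real (s \<bullet> b) ^ k * \<phi> s"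
  have fi: "integrable lborel (?f k)" and fl: "(LINT s|lborel. norm (?f k s))
      \<le> ((2 ^ K * B) * ((2 ^ K) * R) ^ k) * measure lborel (cball (0::'a) R)" for k
    using Yi[OF b, of 0 k] unfolding Y0[OF b] by simp_all
  show "integrable lborel (?f k)" by (rule fi)
  note IF = inverse_fourier_integrable[of "Y k" "?f k"
      for k, OF dY Y0 borel_measurable_integrable[OF fi, simplified] Yi(1)[unfolded K_def]]
  show "integrable lborel (inverse_fourier (?f k))" by (rule IF(1))
  define W where "W = (LINT x::'a|lborel. inverse ((1 + norm x) ^ K))"
  have W: "0 \<le> W" unfolding W_def by (intro integral_nonneg_AE) auto
  define V where "V = (2 ^ K * B) * measure lborel (cball (0::'a) R)"
  have V: "0 \<le> V" using Bnn by (simp add: V_def)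
  have "(LINT \<eta>|lborel. norm (inverse_fourier (?f k) \<eta>))
      \<le> (W * ((1 + DIM('a)) ^ K * (V + DIM('a) * V))) * (2 ^ K * R) ^ k" for k
  proof -
    have "(LINT s|lborel. norm (?f k s)) + (\<Sum>c\<in>Basis. LINT s|lborel. norm (Y k c K s))
        \<le> V * (2 ^ K * R) ^ k + (\<Sum>c\<in>(Basis::'a set). V * (2 ^ K * R) ^ k)"
      using fl[of k] Yi(2)[of _ K k] by (intro add_mono sum_mono) (auto simp: V_def mult_ac)
    also have "\<dots> = (V + DIM('a) * V) * (2 ^ K * R) ^ k" by (simp add: algebra_simps)
    finally have "W * ((1 + DIM('a)) ^ K * ((LINT s|lborel. norm (?f k s))
        + (\<Sum>c\<in>Basis. LINT s|lborel. norm (Y k c K s))))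
        \<le> W * ((1 + DIM('a)) ^ K * ((V + DIM('a) * V) * (2 ^ K * R) ^ k))"
      using W by (intro mult_left_mono) auto
    with IF(2)[of k] show ?thesis unfolding K_def[symmetric] W_def[symmetric] by (simp add: mult_ac)
  qed
  moreover have "0 \<le> W * ((1 + DIM('a)) ^ K * (V + DIM('a) * V))" "0 \<le> 2 ^ K * R" using W V R by auto
  ultimately show "\<exists>A\<ge>0. \<exists>r\<ge>0. \<forall>k. (LINT \<eta>|lborel. norm (inverse_fourier (?f k) \<eta>)) \<le> A * r ^ k" by blast
qed

lemma dirderiv_inverse_fourier:
  fixes f :: "'a::euclidean_space \<Rightarrow> complex"
  assumes f: "integrable lborel f" and sf: "integrable lborel (\<lambda>s. of_real (s \<bullet> b) * f s)"
  shows "dirderiv b (inverse_fourier f) (\<lambda>\<eta>. 2 * pi * \<i> * inverse_fourier (\<lambda>s. of_real (s \<bullet> b) * f s) \<eta>)"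
proof -
  have "dirderiv b (\<lambda>\<eta>. LINT s|lborel. f s * ch (s \<bullet> \<eta>))
      (\<lambda>\<eta>. LINT s|lborel. f s * (2 * pi * \<i> * (b \<bullet> s) * ch (\<eta> \<bullet> s)))"
  proof (rule dirderiv_integral)
    show "dirderiv b (\<lambda>\<eta>. f s * ch (s \<bullet> \<eta>)) (\<lambda>\<eta>. f s * (2 * pi * \<i> * (b \<bullet> s) * ch (\<eta> \<bullet> s)))" for s
      using dirderiv_cmult[OF dirderiv_ch[of b s], of "f s"] by (simp add: inner_commute[of s])
    show "integrable lborel (\<lambda>s. f s * ch (s \<bullet> \<eta>))" for \<eta> using f by (intro integrable_mult_ch) auto
    show "(\<lambda>s. f s * (2 * pi * \<i> * (b \<bullet> s) * ch (\<eta> \<bullet> s))) \<in> borel_measurable lborel" for \<eta>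
      using borel_measurable_integrable[OF f] by measurable
    show "\<exists>g. integrable lborel g \<and> (\<forall>s\<in>space lborel. \<forall>t. \<bar>t\<bar> \<le> 1
        \<longrightarrow> norm (f s * (2 * pi * \<i> * (b \<bullet> s) * ch ((x + t *\<^sub>R b) \<bullet> s))) \<le> g s)" for x
      by (intro exI[of _ "\<lambda>s. 2 * pi * norm (of_real (s \<bullet> b) * f s)"] conjI integrable_mult_right integrable_norm sf)
        (auto simp: norm_mult inner_commute)
  qed
  moreover have "(LINT s|lborel. f s * (2 * pi * \<i> * (b \<bullet> s) * ch (\<eta> \<bullet> s)))
      = 2 * pi * \<i> * inverse_fourier (\<lambda>s. of_real (s \<bullet> b) * f s) \<eta>" for \<eta>
    unfolding inverse_fourier_ch by (subst integral_mult_right_zero[symmetric]) (simp add: inner_commute mult_ac)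
  ultimately show ?thesis by (simp add: inverse_fourier_ch[abs_def])
qed

lemma continuous_on_inverse_fourier:
  fixes f :: "'a::euclidean_space \<Rightarrow> complex"
  assumes f: "integrable lborel f"
  shows "continuous_on UNIV (inverse_fourier f)"
proof (rule continuous_at_imp_continuous_on, intro ballI)
  fix \<eta> :: 'a
  show "isCont (inverse_fourier f) \<eta>"
    unfolding continuous_at_sequentially o_def
  proof (intro allI impI)
    fix x assume x: "x \<longlonglongrightarrow> \<eta>"
    show "(\<lambda>n. inverse_fourier f (x n)) \<longlonglongrightarrow> inverse_fourier f \<eta>"
      unfolding inverse_fourier_ch
    proof (rule integral_dominated_convergence[where w = "\<lambda>s. norm (f s)"])
      show "AE s in lborel. (\<lambda>n. f s * ch (s \<bullet> x n)) \<longlonglongrightarrow> f s * ch (s \<bullet> \<eta>)"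
      proof (intro AE_I2 tendsto_mult tendsto_const)
        fix s :: 'a
        have "continuous_on UNIV ch" by (intro continuous_intros)
        moreover have "(\<lambda>n. s \<bullet> x n) \<longlonglongrightarrow> s \<bullet> \<eta>" by (intro tendsto_intros x)
        ultimately show "(\<lambda>n. ch (s \<bullet> x n)) \<longlonglongrightarrow> ch (s \<bullet> \<eta>)" by (rule continuous_on_tendsto_compose) auto
      qed
    qed (use f borel_measurable_integrable[OF f] in \<open>auto simp: norm_mult\<close>)
  qed
qed

text \<open>Moving the derivatives from \<open>m\<close> to the Fourier transform turns them into powers of \<open>s\<close>;
  the compact support of \<open>\<phi>\<close> makes the resulting series converge.\<close>

lemma gseries_pairing:
  fixes X :: "'a::euclidean_space \<Rightarrow> nat \<Rightarrow> 'a \<Rightarrow> complex" and \<phi> :: "'a \<Rightarrow> complex"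
  assumes X: "\<And>c. c \<in> Basis \<Longrightarrow> dseq c (X c)" "\<And>c. c \<in> Basis \<Longrightarrow> X c 0 = \<phi>"
    and supp: "\<And>c n s. c \<in> Basis \<Longrightarrow> norm s > R \<Longrightarrow> X c n s = 0" and R: "1 \<le> R" and b: "b \<in> Basis"
    and M: "dseq b M" "M 0 = m" and Mb: "\<And>n \<eta>. norm (M n \<eta>) \<le> G n"
    and \<mu>: "\<mu> > 0" and \<delta>: "\<delta> > 0"
    and sG: "summable (\<lambda>k. gcoeff \<mu> \<delta> k * (1 / (2 * pi)) ^ k * G k)"
  shows "(LINT \<eta>|lborel. (\<Sum>k. gcoeff \<mu> \<delta> k * (\<i> / (2 * pi)) ^ k * M k \<eta>) * inverse_fourier \<phi> \<eta>)
     = (LINT \<eta>|lborel. m \<eta> * inverse_fourier (\<lambda>s. gseries \<mu> \<delta> (s \<bullet> b) * \<phi> s) \<eta>)"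
    and "integrable lborel (\<lambda>\<eta>. (\<Sum>k. gcoeff \<mu> \<delta> k * (\<i> / (2 * pi)) ^ k * M k \<eta>) * inverse_fourier \<phi> \<eta>)"
    and "integrable lborel (\<lambda>\<eta>. m \<eta> * inverse_fourier (\<lambda>s. gseries \<mu> \<delta> (s \<bullet> b) * \<phi> s) \<eta>)"
    and "integrable lborel (\<lambda>s. gseries \<mu> \<delta> (s \<bullet> b) * \<phi> s)"
proof -
  define \<phi>k where "\<phi>k k s = of_real (s \<bullet> b) ^ k * \<phi> s" for k s
  define H where "H k = inverse_fourier (\<phi>k k)" for k
  let ?c = "gcoeff \<mu> \<delta>"
  have c0: "0 \<le> ?c k" for k using \<delta> by (intro gcoeff_nonneg) auto
  note mm = monomial_mult_inverse_fourier[OF X supp R b]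
  have ik: "integrable lborel (\<phi>k k)" for k unfolding \<phi>k_def[abs_def] by (rule mm(1))
  have iH: "integrable lborel (H k)" for k unfolding H_def \<phi>k_def[abs_def] by (rule mm(2))
  obtain A r where A: "0 \<le> A" "0 \<le> r" "\<And>k. (LINT \<eta>|lborel. norm (H k \<eta>)) \<le> A * r ^ k"
    using mm(3) unfolding H_def \<phi>k_def[abs_def] by blast
  have H0: "H 0 = inverse_fourier \<phi>" by (simp add: H_def \<phi>k_def[abs_def])
  have \<phi>0: "\<phi> s = 0" if "norm s > R" for s using supp[OF b that, of 0] X(2)[OF b] by simp
  have [measurable]: "H k \<in> borel_measurable borel" "\<phi>k k \<in> borel_measurable borel" for k
    using borel_measurable_integrable[OF iH[of k]] borel_measurable_integrable[OF ik[of k]] by simp_all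
  have [measurable]: "\<phi> \<in> borel_measurable borel"
    using borel_measurable_integrable[OF ik[of 0]] by (simp add: \<phi>k_def[abs_def])
  have i\<phi>: "integrable lborel \<phi>" using ik[of 0] by (simp add: \<phi>k_def[abs_def])
  have Mcont: "continuous_on UNIV (M n)" for n using M(1) by (simp add: dseq_def)
  have [measurable]: "M n \<in> borel_measurable borel" for n by (rule borel_measurable_continuous_onI[OF Mcont])
  have [measurable]: "m \<in> borel_measurable borel" using M(2) by auto
  have G0: "0 \<le> G n" for n using Mb[of n 0] order_trans norm_ge_zero by blast
  have MH: "integrable lborel (\<lambda>\<eta>. M n \<eta> * H l \<eta>)" for n l
    by (rule integrable_bounded_mult[OF _ iH Mb]) simp
  have dH: "dirderiv b (H l) (\<lambda>\<eta>. 2 * pi * \<i> * H (Suc l) \<eta>)" for l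
    using dirderiv_inverse_fourier[OF ik[of l], of b] ik[of "Suc l"] by (simp add: H_def \<phi>k_def[abs_def] mult.assoc)
  have Hcont: "continuous_on UNIV (H l)" for l unfolding H_def by (rule continuous_on_inverse_fourier[OF ik])
  have ibp: "(LINT \<eta>|lborel. M (Suc n) \<eta> * H l \<eta>) = - (2 * pi * \<i>) * (LINT \<eta>|lborel. M n \<eta> * H (Suc l) \<eta>)" for n l
  proof -
    have "(LINT \<eta>|lborel. M (Suc n) \<eta> * H l \<eta>) = - (LINT \<eta>|lborel. M n \<eta> * (2 * pi * \<i> * H (Suc l) \<eta>))"
    proof (rule integral_by_parts_dirderiv[OF _ dH])
      show "dirderiv b (M n) (M (Suc n))" using M(1) by (simp add: dseq_def)
      show "integrable lborel (\<lambda>\<eta>. M n \<eta> * (2 * pi * \<i> * H (Suc l) \<eta>))"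
        using integrable_mult_right[OF MH[of n "Suc l"], of "2 * pi * \<i>"] by (simp add: mult_ac)
    qed (auto intro!: Mcont MH Hcont continuous_intros)
    also have "(LINT \<eta>|lborel. M n \<eta> * (2 * pi * \<i> * H (Suc l) \<eta>))
        = 2 * pi * \<i> * (LINT \<eta>|lborel. M n \<eta> * H (Suc l) \<eta>)"
      by (subst integral_mult_right_zero[symmetric]) (simp add: mult_ac)
    finally show ?thesis by simp
  qed
  have ibpk: "(LINT \<eta>|lborel. M k \<eta> * H l \<eta>) = (- (2 * pi * \<i>)) ^ k * (LINT \<eta>|lborel. m \<eta> * H (k + l) \<eta>)" for k l
  proof (induction k arbitrary: l)
    case (Suc k)
    have "(LINT \<eta>|lborel. M (Suc k) \<eta> * H l \<eta>) = - (2 * pi * \<i>) * (LINT \<eta>|lborel. M k \<eta> * H (Suc l) \<eta>)" by (rule ibp)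
    also have "(LINT \<eta>|lborel. M k \<eta> * H (Suc l) \<eta>)
        = (- (2 * pi * \<i>)) ^ k * (LINT \<eta>|lborel. m \<eta> * H (k + Suc l) \<eta>)" by (rule Suc)
    finally show ?case by (simp only: power_Suc mult.assoc add_Suc add_Suc_right)
  qed (simp add: M(2))
  have trm: "(LINT \<eta>|lborel. (?c k * (\<i> / (2 * pi)) ^ k * M k \<eta>) * H 0 \<eta>) = ?c k * (LINT \<eta>|lborel. m \<eta> * H k \<eta>)" for k
  proof -
    have "(LINT \<eta>|lborel. (?c k * (\<i> / (2 * pi)) ^ k * M k \<eta>) * H 0 \<eta>)
        = ?c k * (\<i> / (2 * pi)) ^ k * (LINT \<eta>|lborel. M k \<eta> * H 0 \<eta>)"
      by (subst integral_mult_right_zero[symmetric]) (simp add: mult_ac)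
    also have "(LINT \<eta>|lborel. M k \<eta> * H 0 \<eta>) = (- (2 * pi * \<i>)) ^ k * (LINT \<eta>|lborel. m \<eta> * H k \<eta>)"
      using ibpk[of k 0] by simp
    also have "?c k * (\<i> / (2 * pi)) ^ k * ((- (2 * pi * \<i>)) ^ k * (LINT \<eta>|lborel. m \<eta> * H k \<eta>))
        = ?c k * ((\<i> / (2 * pi)) * (- (2 * pi * \<i>))) ^ k * (LINT \<eta>|lborel. m \<eta> * H k \<eta>)"
      by (simp only: power_mult_distrib mult.assoc)
    \<comment> \<open>The factor per order in the series is chosen to cancel the one from each
      integration by parts.\<close>
    also have "(\<i> / (2 * pi)) * (- (2 * pi * \<i>)) = 1" by (simp add: field_simps)
    finally show ?thesis by simp
  qed
  have nM: "norm (?c k * (\<i> / (2 * pi)) ^ k * M k \<eta>) \<le> ?c k * (1 / (2 * pi)) ^ k * G k" for k \<eta>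
    using Mb[of k \<eta>] c0[of k] by (simp add: norm_mult norm_power norm_divide mult_left_mono)
  have sM: "summable (\<lambda>k. norm (?c k * (\<i> / (2 * pi)) ^ k * M k \<eta>))" for \<eta>
    by (rule summable_comparison_test[OF _ sG]) (use nM in auto)
  \<comment> \<open>The terms of the left-hand side. By \<open>sG\<close> their L^1 norms are
    summable, so sum and integral may be exchanged.\<close>
  define L where "L k \<eta> = (?c k * (\<i> / (2 * pi)) ^ k * M k \<eta>) * H 0 \<eta>" for k \<eta>
  have Li: "integrable lborel (L k)" for k
    unfolding L_def using integrable_mult_right[OF MH[of k 0], of "?c k * (\<i> / (2 * pi)) ^ k"] by (simp add: mult_ac)
  have Ls: "AE \<eta> in lborel. summable (\<lambda>k. norm (L k \<eta>))"
    unfolding L_def norm_mult[of "_ * _ * _"] by (intro AE_I2 summable_mult2 sM)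
  have Ll: "summable (\<lambda>k. LINT \<eta>|lborel. norm (L k \<eta>))"
  proof (rule summable_comparison_test[OF _
      summable_mult2[OF sG, of "LINT \<eta>|lborel. norm (H 0 \<eta>)"]], intro exI[of _ 0] allI impI)
    fix k
    have "(LINT \<eta>|lborel. norm (L k \<eta>)) \<le> (LINT \<eta>|lborel. ?c k * (1 / (2 * pi)) ^ k * G k * norm (H 0 \<eta>))"
    proof (rule integral_mono[OF integrable_norm[OF Li] integrable_mult_right[OF integrable_norm[OF iH]]])
      show "norm (L k \<eta>) \<le> ?c k * (1 / (2 * pi)) ^ k * G k * norm (H 0 \<eta>)" for \<eta>
        unfolding L_def norm_mult[of _ "H 0 \<eta>"] by (intro mult_right_mono nM) simp
    qed
    then show "norm (LINT \<eta>|lborel. norm (L k \<eta>)) \<le> ?c k * (1 / (2 * pi)) ^ k * G k * (LINT \<eta>|lborel. norm (H 0 \<eta>))"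
      by simp
  qed
  have Leq: "(\<Sum>k. L k \<eta>) = (\<Sum>k. ?c k * (\<i> / (2 * pi)) ^ k * M k \<eta>) * inverse_fourier \<phi> \<eta>" for \<eta>
    unfolding L_def H0 by (rule suminf_mult2[symmetric]) (rule summable_norm_cancel[OF sM])
  \<comment> \<open>The terms after all derivatives have been moved. Their L^1 norms are summable
    because those of \<open>H k\<close> grow at most geometrically, while \<open>gcoeff\<close>
    decays faster than any geometric sequence.\<close>
  define S where "S k \<eta> = m \<eta> * (?c k * H k \<eta>)" for k \<eta>
  have Si: "integrable lborel (S k)" for k
    unfolding S_def using integrable_mult_right[OF MH[of 0 k], of "?c k"] by (simp add: M(2) mult_ac)
  have sR: "summable (\<lambda>k. ?c k * R ^ k)" using R by (intro summable_gcoeff \<mu> \<delta>) auto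
  have \<phi>k_le: "norm (\<phi>k k s) \<le> R ^ k * norm (\<phi> s)" for k s
  proof (cases "norm s > R")
    case False
    then have "\<bar>s \<bullet> b\<bar> \<le> R" using Basis_le_norm[OF b, of s] by linarith
    then have "\<bar>s \<bullet> b\<bar> ^ k \<le> R ^ k" by (intro power_mono) auto
    then show ?thesis by (simp add: \<phi>k_def norm_mult norm_power mult_right_mono)
  qed (simp add: \<phi>k_def \<phi>0)
  have \<phi>k_int_le: "(LINT s|lborel. norm (\<phi>k k s)) \<le> R ^ k * (LINT s|lborel. norm (\<phi> s))" for k
  proof -
    have "(LINT s|lborel. norm (\<phi>k k s)) \<le> (LINT s|lborel. R ^ k * norm (\<phi> s))"
      using ik[of k] i\<phi> \<phi>k_le by (intro integral_mono) auto
    then show ?thesis by simp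
  qed
  have ck\<phi>: "summable (\<lambda>k. ?c k * R ^ k * (LINT s|lborel. norm (\<phi> s)))" by (rule summable_mult2[OF sR])
  have sH: "summable (\<lambda>k. norm (?c k * H k \<eta>))" for \<eta>
  proof (rule summable_comparison_test[OF _ ck\<phi>], intro exI[of _ 0] allI impI)
    fix k
    have "norm (H k \<eta>) \<le> R ^ k * (LINT s|lborel. norm (\<phi> s))"
      unfolding H_def by (rule order_trans[OF norm_inverse_fourier_le \<phi>k_int_le])
    from mult_left_mono[OF this c0[of k]]
    show "norm (norm (?c k * H k \<eta>)) \<le> ?c k * R ^ k * (LINT s|lborel. norm (\<phi> s))"
      using c0[of k] by (simp add: norm_mult mult_ac)
  qed
  have Ss: "AE \<eta> in lborel. summable (\<lambda>k. norm (S k \<eta>))"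
    unfolding S_def norm_mult[of "m _"] by (intro AE_I2 summable_mult sH)
  have Sl: "summable (\<lambda>k. LINT \<eta>|lborel. norm (S k \<eta>))"
  proof (rule summable_comparison_test[OF _ summable_mult2[OF summable_gcoeff[OF \<mu> \<delta> A(2)],
      of "G 0 * A"]], intro exI[of _ 0] allI impI)
    fix k
    have "norm (S k \<eta>) \<le> G 0 * ?c k * norm (H k \<eta>)" for \<eta>
    proof -
      have "norm (m \<eta>) * (?c k * norm (H k \<eta>)) \<le> G 0 * (?c k * norm (H k \<eta>))"
        using Mb[of 0 \<eta>] M(2) c0[of k] by (intro mult_right_mono) auto
      then show ?thesis using c0[of k] by (simp add: S_def norm_mult mult_ac)
    qed
    then have "(LINT \<eta>|lborel. norm (S k \<eta>)) \<le> (LINT \<eta>|lborel. G 0 * ?c k * norm (H k \<eta>))"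
      using Si[of k] iH[of k] by (intro integral_mono) auto
    also have "\<dots> = G 0 * ?c k * (LINT \<eta>|lborel. norm (H k \<eta>))" by simp
    also have "\<dots> \<le> G 0 * ?c k * (A * r ^ k)" using G0[of 0] c0[of k] by (intro mult_left_mono A) auto
    finally show "norm (LINT \<eta>|lborel. norm (S k \<eta>)) \<le> ?c k * r ^ k * (G 0 * A)" by (simp add: mult_ac)
  qed
  \<comment> \<open>A second exchange, now under the inverse transform, reassembles the monomials
    into \<open>gseries\<close>.\<close>
  have inner: "(\<Sum>k. ?c k * H k \<eta>) = inverse_fourier (\<lambda>s. gseries \<mu> \<delta> (s \<bullet> b) * \<phi> s) \<eta>"
    and inner_int: "integrable lborel (\<lambda>s. gseries \<mu> \<delta> (s \<bullet> b) * \<phi> s)" for \<eta>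
  proof -
    define U where "U \<eta> k s = ?c k * \<phi>k k s * ch (s \<bullet> \<eta>)" for \<eta> k s
    have U: "integrable lborel (U \<eta> k)" for k \<eta>
      unfolding U_def by (intro integrable_mult_ch integrable_mult_right ik) auto
    have nU: "norm (U \<eta> k s) \<le> ?c k * R ^ k * norm (\<phi> s)" for k s \<eta>
      using mult_left_mono[OF \<phi>k_le[of k s] c0[of k]] c0[of k] by (simp add: U_def norm_mult mult_ac)
    have Us: "summable (\<lambda>k. norm (U \<eta> k s))" for s \<eta>
      by (rule summable_comparison_test[OF _ summable_mult2[OF sR, of "norm (\<phi> s)"]]) (use nU in auto)
    have Ul: "summable (\<lambda>k. LINT s|lborel. norm (U \<eta> k s))" for \<eta>
    proof (rule summable_comparison_test[OF _ ck\<phi>], intro exI[of _ 0] allI impI)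
      fix k
      have "(LINT s|lborel. norm (U \<eta> k s)) \<le> (LINT s|lborel. ?c k * R ^ k * norm (\<phi> s))"
        using U[of \<eta> k] i\<phi> nU by (intro integral_mono) auto
      then show "norm (LINT s|lborel. norm (U \<eta> k s)) \<le> ?c k * R ^ k * (LINT s|lborel. norm (\<phi> s))" by simp
    qed
    have Ueq: "(\<Sum>k. U \<eta> k s) = gseries \<mu> \<delta> (s \<bullet> b) * \<phi> s * ch (s \<bullet> \<eta>)" for s \<eta>
    proof -
      have "(\<lambda>k. complex_of_real (?c k * (s \<bullet> b) ^ k)) sums complex_of_real (gseries \<mu> \<delta> (s \<bullet> b))"
        unfolding gseries_def by (intro sums_of_real summable_sums summable_gcoeff_all \<mu> \<delta>)
      from sums_mult2[OF this, of "\<phi> s * ch (s \<bullet> \<eta>)"]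
      have "(\<lambda>k. U \<eta> k s) sums (gseries \<mu> \<delta> (s \<bullet> b) * (\<phi> s * ch (s \<bullet> \<eta>)))" by (simp add: U_def \<phi>k_def mult_ac)
      then show ?thesis by (simp add: sums_iff mult_ac)
    qed
    have "(\<Sum>k. LINT s|lborel. U \<eta> k s) = (LINT s|lborel. (\<Sum>k. U \<eta> k s))"
      using integral_suminf[OF U AE_I2[OF Us] Ul] by simp
    also have "\<dots> = inverse_fourier (\<lambda>s. gseries \<mu> \<delta> (s \<bullet> b) * \<phi> s) \<eta>" by (simp only: Ueq inverse_fourier_ch)
    also have "(\<lambda>k. LINT s|lborel. U \<eta> k s) = (\<lambda>k. ?c k * H k \<eta>)"
      by (auto simp: U_def H_def inverse_fourier_ch mult.assoc)
    finally show "(\<Sum>k. ?c k * H k \<eta>) = inverse_fourier (\<lambda>s. gseries \<mu> \<delta> (s \<bullet> b) * \<phi> s) \<eta>" .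
    show "integrable lborel (\<lambda>s. gseries \<mu> \<delta> (s \<bullet> b) * \<phi> s)"
      using integrable_suminf[OF U AE_I2[OF Us] Ul, of 0] by (simp add: Ueq)
  qed
  have Seq: "(\<Sum>k. S k \<eta>) = m \<eta> * inverse_fourier (\<lambda>s. gseries \<mu> \<delta> (s \<bullet> b) * \<phi> s) \<eta>" for \<eta>
    unfolding S_def inner[symmetric] by (rule suminf_mult) (rule summable_norm_cancel[OF sH])
  show "integrable lborel (\<lambda>\<eta>. (\<Sum>k. ?c k * (\<i> / (2 * pi)) ^ k * M k \<eta>) * inverse_fourier \<phi> \<eta>)"
    using integrable_suminf[OF Li Ls Ll] by (simp only: Leq)
  show "integrable lborel (\<lambda>\<eta>. m \<eta> * inverse_fourier (\<lambda>s. gseries \<mu> \<delta> (s \<bullet> b) * \<phi> s) \<eta>)"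
    using integrable_suminf[OF Si Ss Sl] by (simp only: Seq)
  show "integrable lborel (\<lambda>s. gseries \<mu> \<delta> (s \<bullet> b) * \<phi> s)" by (rule inner_int)
  have "(LINT \<eta>|lborel. (\<Sum>k. ?c k * (\<i> / (2 * pi)) ^ k * M k \<eta>) * inverse_fourier \<phi> \<eta>) = (\<Sum>k. LINT \<eta>|lborel. L k \<eta>)"
    using integral_suminf[OF Li Ls Ll] by (simp only: Leq)
  also have "(\<lambda>k. LINT \<eta>|lborel. L k \<eta>) = (\<lambda>k. LINT \<eta>|lborel. S k \<eta>)"
    unfolding L_def trm by (auto simp: S_def mult.left_commute[of "m _"])
  also have "(\<Sum>k. LINT \<eta>|lborel. S k \<eta>) = (LINT \<eta>|lborel. m \<eta> * inverse_fourier (\<lambda>s. gseries \<mu> \<delta> (s \<bullet> b) * \<phi> s) \<eta>)"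
    using integral_suminf[OF Si Ss Sl] by (simp only: Seq)
  finally show "(LINT \<eta>|lborel. (\<Sum>k. ?c k * (\<i> / (2 * pi)) ^ k * M k \<eta>) * inverse_fourier \<phi> \<eta>)
     = (LINT \<eta>|lborel. m \<eta> * inverse_fourier (\<lambda>s. gseries \<mu> \<delta> (s \<bullet> b) * \<phi> s) \<eta>)" .
qed

subsection \<open>The symbol on the Fourier side\<close>

lemma dseq_affine:
  assumes "dseq b D"
  shows "dseq b (\<lambda>n x. of_real c ^ n * D n (a + c *\<^sub>R x))"
  unfolding dseq_def
proof (intro allI conjI)
  fix n
  have "continuous_on UNIV (D n)" using assms by (simp add: dseq_def)
  then have "continuous_on UNIV (\<lambda>x. D n (a + c *\<^sub>R x))"
    by (rule continuous_on_compose2) (auto intro!: continuous_intros)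
  then show "continuous_on UNIV (\<lambda>x. of_real c ^ n * D n (a + c *\<^sub>R x))"
    by (intro continuous_intros)
  have "dirderiv b (D n) (D (Suc n))" using assms by (simp add: dseq_def)
  from dirderiv_cmult[OF dirderiv_affine[OF this, of a c], of "of_real c ^ n"]
  show "dirderiv b (\<lambda>x. of_real c ^ n * D n (a + c *\<^sub>R x)) (\<lambda>x. of_real c ^ Suc n * D (Suc n) (a + c *\<^sub>R x))"
    by (simp add: mult_ac)
qed

lemma dseq_cnj: "dseq b D \<Longrightarrow> dseq b (\<lambda>n x. cnj (D n x))"
  by (auto simp: dseq_def intro!: continuous_intros dirderiv_cnj)

definition wsym :: "('a::euclidean_space \<Rightarrow> complex) \<Rightarrow> 'a \<Rightarrow> 'a \<Rightarrow> complex" where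
  "wsym \<sigma> \<xi> \<eta> = \<sigma> (\<xi> + (1/2) *\<^sub>R \<eta>) * cnj (\<sigma> (\<xi> - (1/2) *\<^sub>R \<eta>))"

text \<open>Leibniz's rule for the derivatives of \<open>wsym \<sigma> \<xi>\<close> in direction
  \<open>b\<close>, in the form delivered by \<open>dseq_mult\<close> and
  \<open>dseq_affine\<close>; this is why the second argument is a sum with coefficient
  \<open>- (1/2)\<close>.\<close>

definition wsymD :: "('a::euclidean_space \<Rightarrow> complex) \<Rightarrow> 'a \<Rightarrow> 'a \<Rightarrow> nat \<Rightarrow> 'a \<Rightarrow> complex" where
  "wsymD \<sigma> b \<xi> n \<eta> = (\<Sum>k\<le>n. of_nat (n choose k) *
     ((of_real (1/2) ^ k * partials (replicate k b) \<sigma> (\<xi> + (1/2) *\<^sub>R \<eta>)) *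
      (of_real (- (1/2)) ^ (n - k) * cnj (partials (replicate (n - k) b) \<sigma> (\<xi> + (- (1/2)) *\<^sub>R \<eta>)))))"

lemma dseq_wsymD:
  assumes "smooth \<sigma>" "b \<in> Basis"
  shows "dseq b (wsymD \<sigma> b \<xi>)"
  unfolding wsymD_def[abs_def]
  by (rule dseq_mult[OF dseq_affine[OF smooth_dseq[OF assms]] dseq_affine[OF dseq_cnj[OF smooth_dseq[OF assms]]]])

lemma wsymD_0: "wsymD \<sigma> b \<xi> 0 = wsym \<sigma> \<xi>"
  by (auto simp: wsymD_def wsym_def)

text \<open>The condition \<open>norm z > R\<close> is open, so the difference quotients vanish for
  small increments and the derivative exists and is 0 there.\<close>

lemma partials_zero_outside:
  fixes f :: "'a::euclidean_space \<Rightarrow> complex"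
  assumes "\<And>z. norm z > R \<Longrightarrow> f z = 0"
  shows "norm z > R \<Longrightarrow> partials bs f z = 0"
proof (induction bs arbitrary: z)
  case Nil
  then show ?case by (simp add: assms)
next
  case (Cons b bs)
  have "((\<lambda>t. norm (z + t *\<^sub>R b)) \<longlongrightarrow> norm (z + 0 *\<^sub>R b)) (at 0)" by (intro tendsto_intros)
  then have "eventually (\<lambda>t. norm (z + t *\<^sub>R b) > R) (at 0)"
    using Cons.prems by (intro order_tendstoD(1)) auto
  then have "eventually (\<lambda>t. (1 / t) *\<^sub>R (partials bs f (z + t *\<^sub>R b) - partials bs f (z + 0 *\<^sub>R b)) = 0) (at 0)"
    by eventually_elim (simp add: Cons)
  then have "((\<lambda>t. partials bs f (z + t *\<^sub>R b)) has_vector_derivative 0) (at 0)"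
    unfolding has_vector_derivative_0_iff by (rule tendsto_eventually)
  then show ?case by (simp add: partial_def vector_derivative_at)
qed

lemma dseq_slice:
  fixes D :: "nat \<Rightarrow> 'a::euclidean_space \<times> 'b::euclidean_space \<Rightarrow> complex"
  assumes "dseq (b, 0) D"
  shows "dseq b (\<lambda>n s. D n (s, \<xi>))"
  unfolding dseq_def
proof (intro allI conjI)
  fix n
  have c: "continuous_on UNIV (D n)" and d: "dirderiv (b, 0) (D n) (D (Suc n))" using assms by (auto simp: dseq_def)
  show "continuous_on UNIV (\<lambda>s. D n (s, \<xi>))"
    by (rule continuous_on_compose2[OF c]) (auto intro!: continuous_intros)
  show "dirderiv b (\<lambda>s. D n (s, \<xi>)) (\<lambda>s. D (Suc n) (s, \<xi>))"
    unfolding dirderiv_def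
  proof
    fix s
    have "((\<lambda>t. D n ((s, \<xi>) + t *\<^sub>R (b, 0))) has_vector_derivative D (Suc n) (s, \<xi>)) (at 0)"
      using d by (simp add: dirderiv_def)
    then show "((\<lambda>t. D n (s + t *\<^sub>R b, \<xi>)) has_vector_derivative D (Suc n) (s, \<xi>)) (at 0)" by simp
  qed
qed

section \<open>Gevrey estimates and the symbol of the second factor\<close>

locale gevrey_symbol =
  fixes \<sigma> :: "'a::euclidean_space \<Rightarrow> complex" and \<mu> C\<^sub>0 :: real
  assumes \<mu>: "\<mu> > 0" and smooth_\<sigma>: "smooth \<sigma>" and C\<^sub>0: "C\<^sub>0 > 0"
    and \<sigma>_bound: "\<And>\<xi> \<alpha>. norm (mderiv \<alpha> \<sigma> \<xi>) \<le> C\<^sub>0 ^ (mi_abs \<alpha> + 1) * real (mi_fact \<alpha>) powr \<mu>"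
begin

lemma pure_bound:
  assumes "b \<in> Basis"
  shows "norm (partials (replicate n b) \<sigma> \<xi>) \<le> C\<^sub>0 ^ (n + 1) * (fact n) powr \<mu>"
proof -
  have bs: "replicate n b \<in> lists Basis" using assms by (auto simp: in_lists_conv_set)
  have c: "count_list (replicate n b) c = (if c = b then n else 0)" for c by (induction n) auto
  have "mi_fact (count_list (replicate n b)) = (\<Prod>c\<in>Basis. if c = b then fact n else 1)"
    unfolding mi_fact_def c by (intro prod.cong) auto
  also have "\<dots> = fact n" using assms by (simp add: prod.delta)
  finally show ?thesis
    using \<sigma>_bound[of "count_list (replicate n b)" \<xi>] partials_eq_mderiv[OF smooth_\<sigma> bs]
        mi_abs_count_list[OF bs] by simp
qed

lemma \<sigma>_bounded: "norm (\<sigma> \<xi>) \<le> C\<^sub>0"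
proof -
  obtain b :: 'a where "b \<in> Basis" using nonempty_Basis by blast
  from pure_bound[OF this, of 0 \<xi>] show ?thesis by simp
qed

lemma continuous_\<sigma>: "continuous_on A \<sigma>"
  by (rule smooth_continuous[OF smooth_\<sigma>])

lemma measurable_\<sigma> [measurable]: "\<sigma> \<in> borel_measurable borel"
  by (rule smooth_measurable[OF smooth_\<sigma>])

lemma norm_wsym_le: "norm (wsym \<sigma> \<xi> \<eta>) \<le> C\<^sub>0 * C\<^sub>0"
  unfolding wsym_def norm_mult complex_mod_cnj using C\<^sub>0 by (intro mult_mono \<sigma>_bounded) auto

lemma measurable_wsym [measurable]: "(\<lambda>z. wsym \<sigma> (fst z) (snd z)) \<in> borel_measurable borel"
  unfolding wsym_def by (simp add: borel_prod[symmetric])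

text \<open>The factors 1/2 of the two affine arguments cancel the sum \<open>2 ^ n\<close> of the
  binomial coefficients, and \<open>fact k * fact (n - k) \<le> fact n\<close>. So the product
  satisfies a Gevrey estimate with the same base \<open>C\<^sub>0\<close> as \<sigma>.\<close>

lemma wsymD_bound:
  assumes b: "b \<in> Basis"
  shows "norm (wsymD \<sigma> b \<xi> n \<eta>) \<le> C\<^sub>0 ^ (n + 2) * (fact n) powr \<mu>"
proof -
  have "norm (wsymD \<sigma> b \<xi> n \<eta>) \<le> (\<Sum>k\<le>n. real (n choose k) * ((1/2) ^ n * (C\<^sub>0 ^ (n + 2) * (fact n) powr \<mu>)))"
    unfolding wsymD_def
  proof (intro order_trans[OF norm_sum] sum_mono)
    fix k assume "k \<in> {..n}"
    then have k: "k \<le> n" by simp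
    have "norm (partials (replicate k b) \<sigma> (\<xi> + (1/2) *\<^sub>R \<eta>))
        * norm (partials (replicate (n - k) b) \<sigma> (\<xi> + (- (1/2)) *\<^sub>R \<eta>))
        \<le> (C\<^sub>0 ^ (k + 1) * (fact k) powr \<mu>) * (C\<^sub>0 ^ (n - k + 1) * (fact (n - k)) powr \<mu>)"
      using C\<^sub>0 by (intro mult_mono pure_bound b) auto
    also have "\<dots> = C\<^sub>0 ^ ((k + 1) + (n - k + 1)) * (fact k * fact (n - k)) powr \<mu>"
      by (simp add: power_add powr_mult mult_ac)
    also have "(k + 1) + (n - k + 1) = n + 2" using k by simp
    also have "C\<^sub>0 ^ (n + 2) * (fact k * fact (n - k)) powr \<mu> \<le> C\<^sub>0 ^ (n + 2) * (fact n) powr \<mu>"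
    proof (intro mult_left_mono powr_mono2)
      have "fact k * fact (n - k) * (n choose k) = fact n" by (rule binomial_fact_lemma[OF k])
      moreover have "1 \<le> (n choose k)" using Suc_leI[OF zero_less_binomial[OF k]] unfolding One_nat_def .
      ultimately have "(fact k * fact (n - k) :: nat) \<le> fact n"
        by (metis mult.right_neutral mult_le_mono2)
      then have "real (fact k * fact (n - k)) \<le> real (fact n)" by (simp only: of_nat_le_iff)
      then show "fact k * fact (n - k) \<le> (fact n :: real)" by simp
    qed (use \<mu> C\<^sub>0 in auto)
    finally have *: "norm (partials (replicate k b) \<sigma> (\<xi> + (1/2) *\<^sub>R \<eta>))
        * norm (partials (replicate (n - k) b) \<sigma> (\<xi> + (- (1/2)) *\<^sub>R \<eta>))
        \<le> C\<^sub>0 ^ (n + 2) * (fact n) powr \<mu>" .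
    have "(1/2::real) ^ k * (1/2) ^ (n - k) = (1/2) ^ n" using k by (simp flip: power_add)
    then have "norm (of_nat (n choose k) * ((of_real (1/2) ^ k * partials (replicate k b) \<sigma> (\<xi> + (1/2) *\<^sub>R \<eta>)) *
      (of_real (- (1/2)) ^ (n - k) * cnj (partials (replicate (n - k) b) \<sigma> (\<xi> + (- (1/2)) *\<^sub>R \<eta>)))))
      = real (n choose k) * ((1/2) ^ n * (norm (partials (replicate k b) \<sigma> (\<xi> + (1/2) *\<^sub>R \<eta>)) * norm
          (partials (replicate (n - k) b) \<sigma> (\<xi> + (- (1/2)) *\<^sub>R \<eta>))))"
      unfolding norm_mult norm_power norm_of_nat norm_of_real complex_mod_cnj by simp
    also have "\<dots> \<le> real (n choose k) * ((1/2) ^ n * (C\<^sub>0 ^ (n + 2) * (fact n) powr \<mu>))"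
      by (intro mult_left_mono *) auto
    finally show "norm (of_nat (n choose k) * ((of_real (1/2) ^ k * partials (replicate k b) \<sigma> (\<xi> + (1/2) *\<^sub>R \<eta>)) *
      (of_real (- (1/2)) ^ (n - k) * cnj (partials (replicate (n - k) b) \<sigma> (\<xi> + (- (1/2)) *\<^sub>R \<eta>)))))
      \<le> real (n choose k) * ((1/2) ^ n * (C\<^sub>0 ^ (n + 2) * (fact n) powr \<mu>))" .
  qed
  also have "\<dots> = (2 ^ n * (1/2) ^ n) * (C\<^sub>0 ^ (n + 2) * (fact n) powr \<mu>)"
    by (simp add: choose_row_sum flip: of_nat_sum sum_distrib_right mult.assoc)
  also have "(2 ^ n * (1/2) ^ n :: real) = 1" by (simp flip: power_mult_distrib)
  finally show ?thesis by simp
qed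

definition \<delta> :: real where "\<delta> = pi / C\<^sub>0"

lemma \<delta>_pos: "\<delta> > 0"
  using C\<^sub>0 by (simp add: \<delta>_def)

text \<open>The Gevrey factor cancels against the denominator of \<open>gcoeff\<close>, and the
  remaining ratio \<open>\<delta> * (1 / (2 * pi)) * C\<^sub>0\<close> is 1/2.\<close>

lemma gcoeff_growth: "gcoeff \<mu> \<delta> k * (1 / (2 * pi)) ^ k * (C\<^sub>0 ^ (k + 2) * (fact k) powr \<mu>) \<le> C\<^sub>0\<^sup>2 * (1/2) ^ k"
proof -
  have alg: "x ^ k / F * a ^ k * (C ^ (k + 2) * F) = C\<^sup>2 * (x * a * C) ^ k" if "F \<noteq> 0" for x a C F :: real
    using that by (simp add: power_add power_mult_distrib power2_eq_square)
  have "gcoeff \<mu> \<delta> k * (1 / (2 * pi)) ^ k * (C\<^sub>0 ^ (k + 2) * (fact k) powr \<mu>)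
      \<le> \<delta> ^ k / (fact k) powr \<mu> * (1 / (2 * pi)) ^ k * (C\<^sub>0 ^ (k + 2) * (fact k) powr \<mu>)"
    using \<delta>_pos C\<^sub>0 by (intro mult_right_mono) (auto simp: gcoeff_def)
  also have "\<dots> = C\<^sub>0\<^sup>2 * (\<delta> * (1 / (2 * pi)) * C\<^sub>0) ^ k"
    by (rule alg) simp
  also have "\<delta> * (1 / (2 * pi)) * C\<^sub>0 = 1/2" using C\<^sub>0 by (simp add: \<delta>_def)
  finally show ?thesis .
qed

lemma gcoeff_growth_summable: "summable (\<lambda>k. gcoeff \<mu> \<delta> k * (1 / (2 * pi)) ^ k * (C\<^sub>0 ^ (k + 2) * (fact k) powr \<mu>))"
  by (rule summable_comparison_test[OF _ summable_mult[OF summable_geometric[of "1/2::real"], of "C\<^sub>0\<^sup>2"]])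
    (use gcoeff_growth gcoeff_nonneg[of \<delta> \<mu>] \<delta>_pos C\<^sub>0 in \<open>auto simp: abs_mult intro!: exI[of _ 0]\<close>)

text \<open>The infinite-order operator obtained by inserting \<open>\<i> / (2 * pi)\<close> times
  the derivative in direction \<open>b\<close> into \<open>gseries\<close>, applied to
  \<open>wsym \<sigma> \<xi>\<close>.\<close>

definition bpart :: "'a \<Rightarrow> 'a \<Rightarrow> 'a \<Rightarrow> complex" where
  "bpart b \<xi> \<eta> = (\<Sum>k. gcoeff \<mu> \<delta> k * (\<i> / (2 * pi)) ^ k * wsymD \<sigma> b \<xi> k \<eta>)"

text \<open>The Fourier transform of the distribution \<open>a2 \<xi>\<close> below.\<close>

definition bsym :: "'a \<Rightarrow> 'a \<Rightarrow> complex" where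
  "bsym \<xi> \<eta> = (\<Sum>b\<in>Basis. bpart b \<xi> \<eta>)"

lemma bpart_term_le:
  assumes "b \<in> Basis"
  shows "norm (gcoeff \<mu> \<delta> k * (\<i> / (2 * pi)) ^ k * wsymD \<sigma> b \<xi> k \<eta>) \<le> C\<^sub>0\<^sup>2 * (1/2) ^ k"
proof -
  have c0: "0 \<le> gcoeff \<mu> \<delta> k" using \<delta>_pos by (intro gcoeff_nonneg) auto
  have "norm (gcoeff \<mu> \<delta> k * (\<i> / (2 * pi)) ^ k * wsymD \<sigma> b \<xi> k \<eta>)
      = gcoeff \<mu> \<delta> k * (1 / (2 * pi)) ^ k * norm (wsymD \<sigma> b \<xi> k \<eta>)"
    using c0 by (simp add: norm_mult norm_power norm_divide)
  also have "\<dots> \<le> gcoeff \<mu> \<delta> k * (1 / (2 * pi)) ^ k * (C\<^sub>0 ^ (k + 2) * (fact k) powr \<mu>)"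
    using c0 by (intro mult_left_mono wsymD_bound assms) auto
  finally show ?thesis using gcoeff_growth[of k] by linarith
qed

lemma norm_bpart_le:
  assumes "b \<in> Basis"
  shows "norm (bpart b \<xi> \<eta>) \<le> 2 * C\<^sub>0\<^sup>2"
proof -
  have s: "summable (\<lambda>k. C\<^sub>0\<^sup>2 * (1/2::real) ^ k)" by (intro summable_mult summable_geometric) simp
  have "norm (bpart b \<xi> \<eta>) \<le> (\<Sum>k. C\<^sub>0\<^sup>2 * (1/2) ^ k)"
    unfolding bpart_def by (rule norm_suminf_le[OF bpart_term_le[OF assms] s])
  also have "\<dots> = 2 * C\<^sub>0\<^sup>2"
    using suminf_mult[OF summable_geometric[of "1/2::real"], of "C\<^sub>0\<^sup>2"] suminf_geometric[of "1/2::real"] by simp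
  finally show ?thesis .
qed

lemma norm_bsym_le: "norm (bsym \<xi> \<eta>) \<le> DIM('a) * (2 * C\<^sub>0\<^sup>2)"
  unfolding bsym_def by (rule order_trans[OF norm_sum sum_bounded_above]) (rule norm_bpart_le)

lemma measurable_bpart:
  assumes "b \<in> Basis"
  shows "bpart b \<xi> \<in> borel_measurable borel"
proof -
  have [measurable]: "wsymD \<sigma> b \<xi> k \<in> borel_measurable borel" for k
    using dseq_wsymD[OF smooth_\<sigma> assms] by (intro borel_measurable_continuous_onI) (simp add: dseq_def)
  show ?thesis unfolding bpart_def by measurable
qed

lemma measurable_bsym [measurable]: "bsym \<xi> \<in> borel_measurable borel"
  unfolding bsym_def by (intro borel_measurable_sum measurable_bpart)

text \<open>The factorisation of \<open>F\<close> at fixed \<xi>, in weak form.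
  \<open>gseries_pairing\<close> is applied to \<open>gdecay \<mu> \<delta> s * \<phi> s\<close> in
  each direction; the factors \<open>gseries \<mu> \<delta> (s \<bullet> b)\<close> then add up to
  the denominator of \<open>gdecay\<close> and cancel it.\<close>

lemma bsym_pairing:
  fixes X :: "'a \<Rightarrow> nat \<Rightarrow> 'a \<Rightarrow> complex" and \<phi> :: "'a \<Rightarrow> complex"
  assumes X: "\<And>c. c \<in> Basis \<Longrightarrow> dseq c (X c)" "\<And>c. c \<in> Basis \<Longrightarrow> X c 0 = \<phi>"
    and supp: "\<And>c n s. c \<in> Basis \<Longrightarrow> norm s > R \<Longrightarrow> X c n s = 0" and R: "1 \<le> R"
  shows "(LINT \<eta>|lborel. bsym \<xi> \<eta> * inverse_fourier (\<lambda>s. gdecay \<mu> \<delta> s * \<phi> s) \<eta>)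
      = (LINT \<eta>|lborel. wsym \<sigma> \<xi> \<eta> * inverse_fourier \<phi> \<eta>)"
proof -
  define \<psi> where "\<psi> s = gdecay \<mu> \<delta> s * \<phi> s" for s :: 'a
  define Z where "Z c n s = (\<Sum>k\<le>n. of_nat (n choose k) * (partials (replicate k c) (gdecay \<mu> \<delta>) s
      * X c (n - k) s))" for c n and s :: 'a
  have Z: "dseq c (Z c)" "Z c 0 = \<psi>" if "c \<in> Basis" for c
    using dseq_mult[OF smooth_dseq[OF smooth_gdecay[OF \<mu> \<delta>_pos] that] X(1)[OF that]] X(2)[OF that]
    by (auto simp: Z_def[abs_def] \<psi>_def)
  have Zs: "Z c n s = 0" if "c \<in> Basis" "norm s > R" for c n s
    unfolding Z_def using supp[OF that] by (intro sum.neutral) auto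
  note gp = gseries_pairing[OF Z Zs R _ dseq_wsymD[OF smooth_\<sigma>] wsymD_0 wsymD_bound \<mu> \<delta>_pos
      gcoeff_growth_summable, folded bpart_def]
  have "(LINT \<eta>|lborel. bsym \<xi> \<eta> * inverse_fourier \<psi> \<eta>)
      = (\<Sum>b\<in>Basis. LINT \<eta>|lborel. bpart b \<xi> \<eta> * inverse_fourier \<psi> \<eta>)"
    unfolding bsym_def sum_distrib_right using gp(2) by (intro Bochner_Integration.integral_sum) auto
  also have "\<dots> = (\<Sum>b\<in>Basis. LINT \<eta>|lborel. wsym \<sigma> \<xi> \<eta> * inverse_fourier (\<lambda>s. gseries \<mu> \<delta> (s \<bullet> b) * \<psi> s) \<eta>)"
    using gp(1) by (intro sum.cong refl) auto
  also have "\<dots> = (LINT \<eta>|lborel. (\<Sum>b\<in>Basis. wsym \<sigma> \<xi> \<eta> * inverse_fourier (\<lambda>s. gseries \<mu> \<delta> (s \<bullet> b) * \<psi> s) \<eta>))"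
    using gp(3) by (intro Bochner_Integration.integral_sum[symmetric]) auto
  also have "\<dots> = (LINT \<eta>|lborel. wsym \<sigma> \<xi> \<eta> * inverse_fourier \<phi> \<eta>)"
  proof (intro Bochner_Integration.integral_cong refl)
    fix \<eta>
    have "(\<Sum>b\<in>Basis. inverse_fourier (\<lambda>s. gseries \<mu> \<delta> (s \<bullet> b) * \<psi> s) \<eta>)
        = inverse_fourier (\<lambda>s. \<Sum>b\<in>Basis. gseries \<mu> \<delta> (s \<bullet> b) * \<psi> s) \<eta>"
      unfolding inverse_fourier_ch sum_distrib_right using gp(4)
      by (intro Bochner_Integration.integral_sum[symmetric] integrable_mult_ch) auto
    also have "(\<lambda>s. \<Sum>b\<in>Basis. gseries \<mu> \<delta> (s \<bullet> b) * \<psi> s) = \<phi>"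
    proof
      fix s :: 'a
      have "gdenom \<mu> \<delta> s \<noteq> 0" using gdenom_ge_1[OF \<mu> \<delta>_pos, of s] by linarith
      moreover have "(\<Sum>b\<in>Basis. gseries \<mu> \<delta> (s \<bullet> b) * \<psi> s) = complex_of_real (gdenom \<mu> \<delta> s) * \<psi> s"
        by (simp add: gdenom_def sum_distrib_right)
      ultimately show "(\<Sum>b\<in>Basis. gseries \<mu> \<delta> (s \<bullet> b) * \<psi> s) = \<phi> s" by (simp add: \<psi>_def gdecay_def)
    qed
    finally show "(\<Sum>b\<in>Basis. wsym \<sigma> \<xi> \<eta> * inverse_fourier (\<lambda>s. gseries \<mu> \<delta> (s \<bullet> b) * \<psi> s) \<eta>)
        = wsym \<sigma> \<xi> \<eta> * inverse_fourier \<phi> \<eta>"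
      by (simp flip: sum_distrib_left)
  qed
  finally show ?thesis by (simp only: \<psi>_def[abs_def])
qed

end

subsection \<open>Fourier multipliers as tempered distributions\<close>

lemma dseq_along:
  fixes D :: "nat \<Rightarrow> 'b::euclidean_space \<Rightarrow> complex" and L :: "'a::euclidean_space \<Rightarrow> 'b"
  assumes "dseq v D" and L: "\<And>s t. L (s + t *\<^sub>R b) = L s + t *\<^sub>R v" and cL: "continuous_on UNIV L"
  shows "dseq b (\<lambda>n s. D n (L s))"
  unfolding dseq_def
proof (intro allI conjI)
  fix n
  have c: "continuous_on UNIV (D n)" and d: "dirderiv v (D n) (D (Suc n))" using assms by (auto simp: dseq_def)
  show "continuous_on UNIV (\<lambda>s. D n (L s))"
    by (rule continuous_on_compose2[OF c cL]) auto
  show "dirderiv b (\<lambda>s. D n (L s)) (\<lambda>s. D (Suc n) (L s))"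
    using d by (simp add: dirderiv_def L)
qed

text \<open>The constant is quantified before the function, its derivatives and the bound, since
  continuity of a functional in a Schwartz norm demands a constant independent of the
  function.\<close>

lemma inverse_fourier_decay_uniform:
  "\<exists>A\<ge>0. \<forall>(D :: 'a::euclidean_space \<Rightarrow> nat \<Rightarrow> 'a \<Rightarrow> complex) f B.
    (\<forall>b\<in>Basis. dseq b (D b) \<and> D b 0 = f) \<longrightarrow>
    (\<forall>b\<in>Basis. \<forall>n\<le>2 * DIM('a). \<forall>x. (1 + norm x) ^ (2 * DIM('a)) * norm (D b n x) \<le> B) \<longrightarrow>
    (\<forall>\<eta>. (1 + norm \<eta>) ^ (2 * DIM('a)) * norm (inverse_fourier f \<eta>) \<le> A * B)"
proof (intro exI conjI allI impI)
  let ?K = "2 * DIM('a)"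
  define K where "K = ?K"
  define W where "W = (LINT x::'a|lborel. inverse ((1 + norm x) ^ ?K))"
  have W: "0 \<le> W" unfolding W_def by (intro integral_nonneg_AE) auto
  show "0 \<le> (1 + real DIM('a)) ^ K * ((1 + DIM('a)) * W)" using W by simp
  show "(1 + norm \<eta>) ^ (2 * DIM('a)) * norm (inverse_fourier f \<eta>)
      \<le> ((1 + real DIM('a)) ^ K * ((1 + DIM('a)) * W)) * B"
    if DD: "\<forall>b\<in>Basis. dseq b (D b) \<and> D b 0 = f"
      and BB: "\<forall>b\<in>Basis. \<forall>n\<le>2 * DIM('a). \<forall>x. (1 + norm x) ^ (2 * DIM('a)) * norm (D b n x) \<le> B"
    for D :: "'a \<Rightarrow> nat \<Rightarrow> 'a \<Rightarrow> complex" and f B \<eta>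
  proof -
    have D: "dseq b (D b)" "D b 0 = f" if "b \<in> Basis" for b using DD that by auto
    note B = BB[rule_format, folded K_def]
    have m: "D b n \<in> borel_measurable borel" if "b \<in> Basis" for b n
      using D(1)[OF that] by (intro borel_measurable_continuous_onI) (simp add: dseq_def)
    have K: "2 * DIM('a) \<le> K" by (simp add: K_def)
    have int: "integrable lborel (D b n)" if "b \<in> Basis" "n \<le> K" for b n
      by (rule integrable_decay[OF m[OF that(1)] K B[OF that]])
    have le: "(LINT x|lborel. norm (D b n x)) \<le> W * B" if "b \<in> Basis" "n \<le> K" for b n
      using integral_decay_le[OF m[OF that(1)] K B[OF that]] by (simp add: W_def K_def)
    obtain b0 :: 'a where b0: "b0 \<in> Basis" using nonempty_Basis by blast
    have "(LINT x|lborel. norm (f x)) \<le> W * B" using le[OF b0, of 0] D(2)[OF b0] by simp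
    moreover have "(\<Sum>b\<in>Basis. LINT x|lborel. norm (D b K x)) \<le> (\<Sum>b\<in>(Basis::'a set). W * B)"
      by (intro sum_mono le) auto
    ultimately have s: "(LINT x|lborel. norm (f x)) + (\<Sum>b\<in>Basis. LINT x|lborel. norm (D b K x))
        \<le> (1 + DIM('a)) * W * B"
      by (simp add: algebra_simps)
    have "(1 + norm \<eta>) ^ K * norm (inverse_fourier f \<eta>)
        \<le> (1 + real DIM('a)) ^ K * ((LINT x|lborel. norm (f x)) + (\<Sum>b\<in>Basis. LINT x|lborel. norm (D b K x)))"
      using inverse_fourier_decay[OF D int, of K \<eta>] by simp
    also have "\<dots> \<le> (1 + real DIM('a)) ^ K * ((1 + DIM('a)) * W * B)"
      by (intro mult_left_mono s) auto
    finally show ?thesis unfolding K_def[symmetric] by (simp only: mult.assoc)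
  qed
qed

lemma schwartz_norm_nonneg: "f \<in> schwartz \<Longrightarrow> 0 \<le> schwartz_norm N f"
  using order_trans[OF _ partials_le_schwartz_norm[of f "[]" N 0], of 0] by simp

lemma schwartz_inverse_fourier_uniform:
  "\<exists>A\<ge>0. \<forall>f\<in>(schwartz :: ('a::euclidean_space \<Rightarrow> complex) set). integrable lborel (inverse_fourier f) \<and>
     (LINT \<eta>|lborel. norm (inverse_fourier f \<eta>)) \<le> A * schwartz_norm (2 * DIM('a)) f"
proof -
  define K where "K = 2 * DIM('a)"
  define W where "W = (LINT x::'a|lborel. inverse ((1 + norm x) ^ K))"
  have W: "0 \<le> W" unfolding W_def by (intro integral_nonneg_AE) auto
  from inverse_fourier_decay_uniform[where 'a = 'a] obtain A where A: "A \<ge> 0"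
    "\<forall>(D :: 'a \<Rightarrow> nat \<Rightarrow> 'a \<Rightarrow> complex) f B. (\<forall>b\<in>Basis. dseq b (D b) \<and> D b 0 = f) \<longrightarrow>
    (\<forall>b\<in>Basis. \<forall>n\<le>K. \<forall>x. (1 + norm x) ^ K * norm (D b n x) \<le> B) \<longrightarrow>
    (\<forall>\<eta>. (1 + norm \<eta>) ^ K * norm (inverse_fourier f \<eta>) \<le> A * B)"
    unfolding K_def[symmetric] by (elim exE conjE) (rule that)
  have "integrable lborel (inverse_fourier f) \<and> (LINT \<eta>|lborel. norm (inverse_fourier f \<eta>))
      \<le> (W * A) * schwartz_norm K f"
    if f: "f \<in> schwartz" for f :: "'a \<Rightarrow> complex"
  proof -
    have b: "(1 + norm \<eta>) ^ K * norm (inverse_fourier f \<eta>) \<le> A * schwartz_norm K f" for \<eta>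
    proof (rule A(2)[rule_format, of "\<lambda>b n. partials (replicate n b) f"])
      show "(1 + norm x) ^ K * norm (partials (replicate n b) f x) \<le> schwartz_norm K f"
          if "b \<in> Basis" "n \<le> K" for b n x
        using that by (intro partials_le_schwartz_norm f) (auto simp: in_lists_conv_set)
      show "dseq b (\<lambda>n. partials (replicate n b) f) \<and> partials (replicate 0 b) f = f" if "b \<in> Basis" for b
        using smooth_dseq[OF schwartz_smooth[OF f] that] by simp
    qed
    have m: "inverse_fourier f \<in> borel_measurable borel"
      using schwartz_measurable[OF f] by measurable
    have K: "2 * DIM('a) \<le> K" by (simp add: K_def)
    show ?thesis
      using integrable_decay[OF m K b] integral_decay_le[OF m K b] unfolding W_def mult.assoc by blast
  qed
  then show ?thesis unfolding K_def[symmetric] using W A(1) by (intro exI[of _ "W * A"]) auto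
qed

text \<open>The distribution with Fourier transform \<open>b\<close>, defined by moving the inverse
  transform to the test function.\<close>

definition mult_dist :: "('a::euclidean_space \<Rightarrow> complex) \<Rightarrow> ('a \<Rightarrow> complex) \<Rightarrow> complex" where
  "mult_dist b \<phi> = (LINT \<eta>|lborel. b \<eta> * inverse_fourier \<phi> \<eta>)"

lemma tempered_mult_dist:
  fixes b :: "'a::euclidean_space \<Rightarrow> complex"
  assumes [measurable]: "b \<in> borel_measurable borel" and B: "\<And>\<eta>. norm (b \<eta>) \<le> B"
  shows "tempered (mult_dist b)"
proof -
  have B0: "0 \<le> B" using order_trans[OF norm_ge_zero B[of 0]] .
  from schwartz_inverse_fourier_uniform obtain A where A: "A \<ge> 0"
    "\<And>f::'a \<Rightarrow> complex. f \<in> schwartz \<Longrightarrow> integrable lborel (inverse_fourier f)"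
    "\<And>f::'a \<Rightarrow> complex. f \<in> schwartz \<Longrightarrow> (LINT \<eta>|lborel. norm (inverse_fourier f \<eta>))
        \<le> A * schwartz_norm (2 * DIM('a)) f" by blast
  have i: "integrable lborel (\<lambda>\<eta>. b \<eta> * inverse_fourier f \<eta>)" if "f \<in> schwartz" for f
    by (rule integrable_bounded_mult[OF _ A(2)[OF that] B]) simp
  show ?thesis
    unfolding tempered_def
  proof (intro conjI ballI allI)
    fix f g :: "'a \<Rightarrow> complex" assume f: "f \<in> schwartz" and g: "g \<in> schwartz"
    show "mult_dist b (\<lambda>x. f x + g x) = mult_dist b f + mult_dist b g"
      unfolding mult_dist_def inverse_fourier_add[OF schwartz_integrable[OF f] schwartz_integrable[OF g]] distrib_left
      by (rule Bochner_Integration.integral_add[OF i[OF f] i[OF g]])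
  next
    fix c and f :: "'a \<Rightarrow> complex" assume f: "f \<in> schwartz"
    show "mult_dist b (\<lambda>x. c * f x) = c * mult_dist b f"
      unfolding mult_dist_def inverse_fourier_cmult by (subst integral_mult_right_zero[symmetric]) (simp add: mult_ac)
  next
    show "\<exists>C N. \<forall>f\<in>schwartz. norm (mult_dist b f) \<le> C * schwartz_norm N f"
    proof (intro exI ballI)
      fix f :: "'a \<Rightarrow> complex" assume f: "f \<in> schwartz"
      have "norm (mult_dist b f) \<le> (LINT \<eta>|lborel. norm (b \<eta> * inverse_fourier f \<eta>))"
        unfolding mult_dist_def by (rule integral_norm_bound)
      also have "\<dots> \<le> (LINT \<eta>|lborel. B * norm (inverse_fourier f \<eta>))"
        by (rule integral_mono[OF integrable_norm[OF i[OF f]]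
            integrable_mult_right[OF integrable_norm[OF A(2)[OF f]]]])
          (unfold norm_mult, rule mult_right_mono[OF B], simp)
      also have "\<dots> = B * (LINT \<eta>|lborel. norm (inverse_fourier f \<eta>))" by simp
      also have "\<dots> \<le> B * (A * schwartz_norm (2 * DIM('a)) f)" by (intro mult_left_mono A f B0)
      finally show "norm (mult_dist b f) \<le> (B * A) * schwartz_norm (2 * DIM('a)) f" by (simp add: mult_ac)
    qed
  qed
qed

lemma inverse_fourier_reflect:
  fixes g :: "'a::euclidean_space \<Rightarrow> complex"
  assumes [measurable]: "g \<in> borel_measurable borel"
  shows "inverse_fourier (\<lambda>s. g (x - s)) \<eta> = fourier g \<eta> * ch (x \<bullet> \<eta>)"
proof -
  have "inverse_fourier (\<lambda>s. g (x - s)) \<eta> = (LINT s|lborel. g (x - s) * ch ((x - (x - s)) \<bullet> \<eta>))"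
    by (simp add: inverse_fourier_ch)
  also have "\<dots> = (LINT t|lborel. g t * ch ((x - t) \<bullet> \<eta>))"
    by (rule integral_lborel_reflect) measurable
  also have "\<dots> = (LINT t|lborel. (g t * ch (- (t \<bullet> \<eta>))) * ch (x \<bullet> \<eta>))"
    by (simp add: mult.assoc inner_diff_left flip: ch_add)
  also have "\<dots> = fourier g \<eta> * ch (x \<bullet> \<eta>)" unfolding fourier_ch by (rule integral_mult_left_zero)
  finally show ?thesis .
qed

text \<open>Reflecting and translating the test function multiplies its transform by the character
  \<open>ch (x \<bullet> \<eta>)\<close>, which reproduces the inversion integral at
  \<open>x\<close>.\<close>

lemma convolution_mult_dist:
  assumes "g \<in> borel_measurable borel"
  shows "Defs.convolution (mult_dist b) g x = fourier_multiplier b g x"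
  unfolding Defs.convolution_def mult_dist_def fourier_multiplier_def inverse_fourier_reflect[OF assms]
  by (simp add: inverse_fourier_ch inner_commute mult.assoc)

subsection \<open>Partial Fourier transforms\<close>

text \<open>The transform acts on the first variable, but in the result the parameter \<xi> comes
  first and the dual variable \<eta> second.\<close>

definition pft :: "('a::euclidean_space \<times> 'a \<Rightarrow> complex) \<Rightarrow> 'a \<times> 'a \<Rightarrow> complex" where
  "pft H z = inverse_fourier (\<lambda>s. H (s, fst z)) (snd z)"

lemma measurable_pft:
  assumes "H \<in> borel_measurable borel"
  shows "pft H \<in> borel_measurable borel"
proof -
  have [measurable]: "H \<in> borel_measurable (borel \<Otimes>\<^sub>M borel)" using assms by (simp add: borel_prod)
  show ?thesis unfolding pft_def[abs_def] inverse_fourier_ch by (simp add: borel_prod[symmetric])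
qed

lemma integrable_pair_decay:
  fixes G :: "'a::euclidean_space \<times> 'a \<Rightarrow> complex"
  assumes G: "G \<in> borel_measurable borel" and K: "2 * DIM('a) \<le> K"
    and bnd: "\<And>x y. (1 + norm x) ^ K * (1 + norm y) ^ K * norm (G (x, y)) \<le> C"
  shows "integrable lborel G"
    and "(LINT z|lborel. norm (G z)) \<le> (LINT x::'a|lborel. inverse ((1 + norm x) ^ K))\<^sup>2 * C"
proof -
  let ?w = "\<lambda>x::'a. inverse ((1 + norm x) ^ K)"
  have iw: "integrable lborel (\<lambda>(x, y). ?w x * ?w y)"
    using integrable_inverse_norm_power[OF K] integrable_inverse_norm_power[OF K]
        by (rule integrable_lborel_pair_mult)
  have iC: "integrable lborel (\<lambda>z. (case z of (x, y) \<Rightarrow> ?w x * ?w y) * C)" by (rule integrable_mult_left[OF iw])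
  have le: "norm (G z) \<le> (case z of (x, y) \<Rightarrow> ?w x * ?w y) * C" for z
  proof (cases z)
    case (Pair x y)
    have "(1 + norm x) ^ K > 0" "(1 + norm y) ^ K > 0" by (simp_all add: add_pos_nonneg)
    then show ?thesis using bnd[of x y] Pair by (simp add: field_simps)
  qed
  show i: "integrable lborel G"
  proof (rule Bochner_Integration.integrable_bound[OF iC])
    show "AE z in lborel. norm (G z) \<le> norm ((case z of (x, y) \<Rightarrow> ?w x * ?w y) * C)"
      by (rule AE_I2, rule order_trans[OF le]) (simp only: real_norm_def abs_ge_self)
  qed (use G in simp)
  have "(LINT z|lborel. norm (G z)) \<le> (LINT z|lborel. (case z of (x, y) \<Rightarrow> ?w x * ?w y) * C)"
    using i iC le by (intro integral_mono) auto
  also have "\<dots> = (LINT z|lborel. (case z of (x, y) \<Rightarrow> ?w x * ?w y)) * C" by simp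
  also have "(LINT z|lborel. (case z of (x, y) \<Rightarrow> ?w x * ?w y)) = (LINT x|lborel. LINT y|lborel. ?w x * ?w y)"
    by (subst integral_lborel_pair(1)[OF iw, symmetric]) simp
  also have "\<dots> = (LINT x|lborel. ?w x)\<^sup>2" by (simp add: power2_eq_square)
  finally show "(LINT z|lborel. norm (G z)) \<le> (LINT x|lborel. ?w x)\<^sup>2 * C" .
qed

text \<open>The weight of order \<open>4 * DIM('a)\<close> is split evenly: one half in
  \<open>s\<close> secures the decay of the transform in \<eta>, the other half remains as decay in
  \<xi>.\<close>

lemma schwartz_pft_bound:
  "\<exists>A\<ge>0. \<forall>H\<in>(schwartz :: ('a::euclidean_space \<times> 'a \<Rightarrow> complex) set). \<forall>\<xi> \<eta>.
     (1 + norm \<xi>) ^ (2 * DIM('a)) * (1 + norm \<eta>) ^ (2 * DIM('a)) * norm (pft H (\<xi>, \<eta>)) \<le> A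
         * schwartz_norm (4 * DIM('a)) H"
proof -
  define K where "K = 2 * DIM('a)"
  from inverse_fourier_decay_uniform[where 'a = 'a] obtain A where A: "A \<ge> 0"
    "\<forall>(D :: 'a \<Rightarrow> nat \<Rightarrow> 'a \<Rightarrow> complex) f B. (\<forall>b\<in>Basis. dseq b (D b) \<and> D b 0 = f) \<longrightarrow>
    (\<forall>b\<in>Basis. \<forall>n\<le>K. \<forall>x. (1 + norm x) ^ K * norm (D b n x) \<le> B) \<longrightarrow>
    (\<forall>\<eta>. (1 + norm \<eta>) ^ K * norm (inverse_fourier f \<eta>) \<le> A * B)"
    unfolding K_def[symmetric] by (elim exE conjE) (rule that)
  have "(1 + norm \<xi>) ^ K * (1 + norm \<eta>) ^ K * norm (pft H (\<xi>, \<eta>)) \<le> A * schwartz_norm (4 * DIM('a)) H"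
    if H: "H \<in> schwartz" for H :: "'a \<times> 'a \<Rightarrow> complex" and \<xi> \<eta>
  proof -
    have pos: "(1 + norm \<xi>) ^ K > 0" by (simp add: add_pos_nonneg)
    have "(1 + norm \<eta>) ^ K * norm (inverse_fourier (\<lambda>s. H (s, \<xi>)) \<eta>)
        \<le> A * (schwartz_norm (4 * DIM('a)) H / (1 + norm \<xi>) ^ K)"
    proof (rule A(2)[rule_format, of "\<lambda>b n s. partials (replicate n (b, 0)) H (s, \<xi>)"])
      fix b :: 'a assume b: "b \<in> Basis"
      have b': "(b, 0) \<in> (Basis :: ('a \<times> 'a) set)" using b by (simp add: Basis_prod_def)
      show "dseq b (\<lambda>n s. partials (replicate n (b, 0)) H (s, \<xi>))
          \<and> (\<lambda>s. partials (replicate 0 (b, 0)) H (s, \<xi>)) = (\<lambda>s. H (s, \<xi>))"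
        using dseq_slice[OF smooth_dseq[OF schwartz_smooth[OF H] b']] by simp
      fix n and s :: 'a assume n: "n \<le> K"
      have "(1 + norm s) ^ K * (1 + norm \<xi>) ^ K \<le> (1 + norm (s, \<xi>)) ^ K * (1 + norm (s, \<xi>)) ^ K"
        using norm_fst_le[of s \<xi>] norm_snd_le[of \<xi> s] by (intro mult_mono power_mono) auto
      also have "\<dots> = (1 + norm (s, \<xi>)) ^ (4 * DIM('a))" by (simp add: K_def flip: power_add)
      finally have "(1 + norm s) ^ K * (1 + norm \<xi>) ^ K * norm (partials (replicate n (b, 0)) H (s, \<xi>))
          \<le> (1 + norm (s, \<xi>)) ^ (4 * DIM('a)) * norm (partials (replicate n (b, 0)) H (s, \<xi>))"
        by (rule mult_right_mono) simp
      also have "\<dots> \<le> schwartz_norm (4 * DIM('a)) H"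
        using b' n by (intro partials_le_schwartz_norm H) (auto simp: in_lists_conv_set K_def)
      finally show "(1 + norm s) ^ K * norm (partials (replicate n (b, 0)) H (s, \<xi>))
          \<le> schwartz_norm (4 * DIM('a)) H / (1 + norm \<xi>) ^ K"
        using pos by (simp add: pos_le_divide_eq mult_ac)
    qed
    then show ?thesis using pos by (simp add: pft_def field_simps)
  qed
  then show ?thesis unfolding K_def[symmetric] using A(1) by blast
qed

lemma schwartz_slice_integrable:
  fixes H :: "'a::euclidean_space \<times> 'a \<Rightarrow> complex"
  assumes H: "H \<in> schwartz"
  shows "integrable lborel (\<lambda>s. H (s, \<xi>))"
proof -
  from schwartz_decay[OF H, of "2 * DIM('a)"] obtain C
      where C: "\<And>z. (1 + norm z) ^ (2 * DIM('a)) * norm (H z) \<le> C" by blast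
  show ?thesis
  proof (rule integrable_decay[OF _ order_refl])
    show "(1 + norm s) ^ (2 * DIM('a)) * norm (H (s, \<xi>)) \<le> C" for s
    proof -
      have "(1 + norm s) ^ (2 * DIM('a)) * norm (H (s, \<xi>)) \<le> (1 + norm (s, \<xi>)) ^ (2 * DIM('a)) * norm (H (s, \<xi>))"
        using norm_fst_le[of s \<xi>] by (intro mult_right_mono power_mono) auto
      then show ?thesis using C[of "(s, \<xi>)"] by linarith
    qed
    have [measurable]: "H \<in> borel_measurable (borel \<Otimes>\<^sub>M borel)" using schwartz_measurable[OF H]
        by (simp add: borel_prod)
    show "(\<lambda>s. H (s, \<xi>)) \<in> borel_measurable borel" by measurable
  qed
qed

text \<open>Conditions under which \<open>F\<close> below is additive. They hold for Schwartz
  functions and also for the diagonal integrals \<open>Rker \<Psi>\<close>, where they are derived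
  directly from the decay of \<Psi>.\<close>

definition pft_admissible :: "('a::euclidean_space \<times> 'a \<Rightarrow> complex) \<Rightarrow> bool" where
  "pft_admissible H \<longleftrightarrow> (\<forall>\<xi>. integrable lborel (\<lambda>s. H (s, \<xi>))) \<and> integrable lborel (pft H)"

lemma pft_admissible_schwartz: "H \<in> schwartz \<Longrightarrow> pft_admissible H"
proof -
  fix H :: "'a \<times> 'a \<Rightarrow> complex" assume H: "H \<in> schwartz"
  from schwartz_pft_bound H obtain A where
    "\<And>\<xi> \<eta>. (1 + norm \<xi>) ^ (2 * DIM('a)) * (1 + norm \<eta>) ^ (2 * DIM('a)) * norm (pft H (\<xi>, \<eta>))
        \<le> A * schwartz_norm (4 * DIM('a)) H" by blast
  from integrable_pair_decay(1)[OF measurable_pft[OF schwartz_measurable[OF H]] order_refl this]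
  show "pft_admissible H" using schwartz_slice_integrable[OF H] by (simp add: pft_admissible_def)
qed

lemma pft_add: "pft_admissible G \<Longrightarrow> pft_admissible H \<Longrightarrow> pft (\<lambda>z. G z + H z) = (\<lambda>z. pft G z + pft H z)"
  by (auto simp: pft_def pft_admissible_def inverse_fourier_add)

lemma pft_cmult: "pft (\<lambda>z. c * H z) = (\<lambda>z. c * pft H z)"
  by (auto simp: pft_def inverse_fourier_cmult)

section \<open>The distribution \<open>F\<close> and its factorisation\<close>

context gevrey_symbol
begin

definition F :: "('a \<times> 'a \<Rightarrow> complex) \<Rightarrow> complex" where
  "F H = (LINT z|lborel. wsym \<sigma> (fst z) (snd z) * pft H z)"

lemma F_integrable:
  assumes "pft_admissible H"
  shows "integrable lborel (\<lambda>z. wsym \<sigma> (fst z) (snd z) * pft H z)"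
  by (rule integrable_bounded_mult[OF _ _ norm_wsym_le]) (use assms in \<open>auto simp: pft_admissible_def\<close>)

lemma F_add: "pft_admissible G \<Longrightarrow> pft_admissible H \<Longrightarrow> F (\<lambda>z. G z + H z) = F G + F H"
  unfolding F_def pft_add distrib_left by (rule Bochner_Integration.integral_add[OF F_integrable F_integrable])

lemma F_cmult: "F (\<lambda>z. c * H z) = c * F H"
  unfolding F_def pft_cmult by (subst integral_mult_right_zero[symmetric]) (simp add: mult_ac)

lemma F_bound:
  assumes H: "H \<in> borel_measurable borel"
    and bnd: "\<And>\<xi> \<eta>. (1 + norm \<xi>) ^ (2 * DIM('a)) * (1 + norm \<eta>) ^ (2 * DIM('a)) * norm (pft H (\<xi>, \<eta>)) \<le> B"
  shows "norm (F H) \<le> (C\<^sub>0 * C\<^sub>0) * ((LINT x::'a|lborel. inverse ((1 + norm x) ^ (2 * DIM('a))))\<^sup>2 * B)"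
proof -
  note d = integrable_pair_decay[OF measurable_pft[OF H] order_refl bnd]
  have i: "integrable lborel (\<lambda>z. wsym \<sigma> (fst z) (snd z) * pft H z)"
    by (rule integrable_bounded_mult[OF _ d(1) norm_wsym_le]) simp
  have "norm (F H) \<le> (LINT z|lborel. norm (wsym \<sigma> (fst z) (snd z) * pft H z))"
    unfolding F_def by (rule integral_norm_bound)
  also have "\<dots> \<le> (LINT z|lborel. (C\<^sub>0 * C\<^sub>0) * norm (pft H z))"
    by (rule integral_mono[OF integrable_norm[OF i] integrable_mult_right[OF integrable_norm[OF d(1)]]])
      (unfold norm_mult, rule mult_right_mono[OF norm_wsym_le], simp)
  also have "\<dots> = (C\<^sub>0 * C\<^sub>0) * (LINT z|lborel. norm (pft H z))" by simp
  also have "\<dots> \<le> (C\<^sub>0 * C\<^sub>0) * ((LINT x::'a|lborel. inverse ((1 + norm x) ^ (2 * DIM('a))))\<^sup>2 * B)"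
    using C\<^sub>0 by (intro mult_left_mono d) auto
  finally show ?thesis .
qed

lemma tempered_F: "tempered F"
  unfolding tempered_def
proof (intro conjI ballI allI)
  from schwartz_pft_bound obtain A where A: "A \<ge> 0"
    "\<And>(H :: 'a \<times> 'a \<Rightarrow> complex) \<xi> \<eta>. H \<in> schwartz
        \<Longrightarrow> (1 + norm \<xi>) ^ (2 * DIM('a)) * (1 + norm \<eta>) ^ (2 * DIM('a)) * norm (pft H (\<xi>, \<eta>)) \<le> A
        * schwartz_norm (4 * DIM('a)) H"
    by blast
  show "\<exists>C N. \<forall>f\<in>schwartz. norm (F f) \<le> C * schwartz_norm N f"
  proof (intro exI ballI)
    fix f :: "'a \<times> 'a \<Rightarrow> complex" assume f: "f \<in> schwartz"
    show "norm (F f) \<le> ((C\<^sub>0 * C\<^sub>0) * (LINT x::'a|lborel. inverse ((1 + norm x) ^ (2 * DIM('a))))\<^sup>2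
        * A) * schwartz_norm (4 * DIM('a)) f"
      using F_bound[OF schwartz_measurable[OF f] A(2)[OF f]] by (simp add: mult.assoc)
  qed
qed (auto intro: F_add F_cmult pft_admissible_schwartz)

definition a2 :: "'a \<Rightarrow> ('a \<Rightarrow> complex) \<Rightarrow> complex" where
  "a2 \<xi> = mult_dist (bsym \<xi>)"

lemma tempered_a2: "tempered (a2 \<xi>)"
  unfolding a2_def by (rule tempered_mult_dist[OF measurable_bsym norm_bsym_le])

lemma bounded_convolution_a2: "bounded_convolution_kernel (DIM('a) * (2 * C\<^sub>0\<^sup>2)) (a2 \<xi>)"
  unfolding a2_def
proof (rule bounded_convolution_kernel_multiplier[OF measurable_bsym _ norm_bsym_le])
  show "0 < real DIM('a) * (2 * C\<^sub>0\<^sup>2)" using C\<^sub>0 by simp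
qed (auto intro!: convolution_mult_dist schwartz_measurable schwartz_fourier_nice[THEN subsetD])

lemma test_function_support:
  fixes \<Phi> :: "'b::euclidean_space \<Rightarrow> complex"
  assumes "\<Phi> \<in> test_functions"
  shows "\<exists>R\<ge>1. \<forall>z. norm z > R \<longrightarrow> \<Phi> z = 0"
proof -
  have "bounded (closure {x. \<Phi> x \<noteq> 0})" using assms by (simp add: test_functions_def compact_imp_bounded)
  then obtain R where R: "\<forall>x\<in>closure {x. \<Phi> x \<noteq> 0}. norm x \<le> R" unfolding bounded_iff by blast
  have le: "norm x \<le> R" if "\<Phi> x \<noteq> 0" for x using closure_subset[of "{x. \<Phi> x \<noteq> 0}"] that R by auto
  show ?thesis
  proof (intro exI conjI allI impI)
    show "\<Phi> z = 0" if "max 1 R < norm z" for z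
    proof (rule ccontr)
      assume "\<Phi> z \<noteq> 0"
      from le[OF this] that show False by simp
    qed
  qed simp
qed

lemma test_function_schwartz:
  fixes \<Phi> :: "'b::euclidean_space \<Rightarrow> complex"
  assumes \<Phi>: "\<Phi> \<in> test_functions"
  shows "\<Phi> \<in> schwartz"
proof (rule schwartzI)
  show sm: "smooth \<Phi>" using \<Phi> by (simp add: test_functions_def)
  from test_function_support[OF \<Phi>] obtain R where R: "R \<ge> 1" "\<And>z. norm z > R \<Longrightarrow> \<Phi> z = 0" by blast
  fix bs :: "'b list" and N assume bs: "bs \<in> lists Basis"
  have z: "partials bs \<Phi> x = 0" if "norm x > R" for x
    using that by (rule partials_zero_outside[of R \<Phi>, rotated]) (rule R(2))
  from continuous_compact_support[OF smooth_continuous[OF smooth_partials[OF sm bs]] z] obtain B where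
    B: "0 \<le> B" "\<And>x. norm (partials bs \<Phi> x) \<le> B" by blast
  have "(1 + norm x) ^ N * norm (partials bs \<Phi> x) \<le> (1 + R) ^ N * B" for x
  proof (cases "norm x > R")
    case False
    then show ?thesis using B(2)[of x] R(1) by (intro mult_mono power_mono) auto
  qed (use z R(1) B(1) in auto)
  then show "\<exists>C. \<forall>x. (1 + norm x) ^ N * norm (partials bs \<Phi> x) \<le> C" by blast
qed

text \<open>For each \<xi> the slice of the test function has support in a fixed ball, so
  \<open>bsym_pairing\<close> applies to it; Fubini collects the slices into
  \<open>F\<close>.\<close>

lemma is_product_F: "is_product F (gdecay \<mu> \<delta>) a2"
  unfolding is_product_def
proof
  fix \<Phi> :: "'a \<times> 'a \<Rightarrow> complex" assume \<Phi>: "\<Phi> \<in> test_functions"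
  note S = test_function_schwartz[OF \<Phi>]
  from test_function_support[OF \<Phi>] obtain R where R: "R \<ge> 1" "\<And>z. norm z > R \<Longrightarrow> \<Phi> z = 0" by blast
  have eq: "a2 \<xi> (\<lambda>s. gdecay \<mu> \<delta> s * \<Phi> (s, \<xi>)) = (LINT \<eta>|lborel. wsym \<sigma> \<xi> \<eta> * pft \<Phi> (\<xi>, \<eta>))" for \<xi>
    unfolding a2_def mult_dist_def pft_def fst_conv snd_conv
  proof (rule bsym_pairing[where X = "\<lambda>c n s. partials (replicate n (c, 0)) \<Phi> (s, \<xi>)" and R = R])
    fix c :: 'a assume c: "c \<in> Basis"
    then have "(c, 0) \<in> (Basis :: ('a \<times> 'a) set)" by (simp add: Basis_prod_def)
    then show "dseq c (\<lambda>n s. partials (replicate n (c, 0)) \<Phi> (s, \<xi>))"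
      by (intro dseq_slice smooth_dseq schwartz_smooth S)
  next
    fix c s :: 'a and n assume "R < norm s"
    then have "R < norm (s, \<xi>)" using norm_fst_le[of s \<xi>] by linarith
    then show "partials (replicate n (c, 0)) \<Phi> (s, \<xi>) = 0"
        by (rule partials_zero_outside[of R \<Phi>, rotated]) (rule R(2))
  qed (use R in auto)
  note i = F_integrable[OF pft_admissible_schwartz[OF S]]
  show "has_bochner_integral lborel (\<lambda>\<xi>. a2 \<xi> (\<lambda>s. gdecay \<mu> \<delta> s * \<Phi> (s, \<xi>))) (F \<Phi>)"
    unfolding eq F_def has_bochner_integral_iff
    using integral_lborel_pair(1)[OF i] integral_lborel_pair(3)[OF i] by simp
qed

subsection \<open>The delta kernel is tempered\<close>

text \<open>The transpose of the passage from \<open>F\<close> to \<open>delta_kernel F\<close>: the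
  test function is restricted to equal frequencies and integrated over all pairs of points with
  difference \<open>s\<close>.\<close>

definition Rker :: "(('a \<times> 'a) \<times> ('a \<times> 'a) \<Rightarrow> complex) \<Rightarrow> 'a \<times> 'a \<Rightarrow> complex" where
  "Rker \<Psi> = (\<lambda>(s, \<xi>). LINT y|lborel. \<Psi> ((y + s, \<xi>), (y, \<xi>)))"

lemma delta_kernel_Rker: "delta_kernel F \<Psi> = F (Rker \<Psi>)"
  by (simp add: delta_kernel_def Rker_def)

text \<open>The weight in \<open>s\<close> costs two weights of the full variable, because
  \<open>s = (y + s) - y\<close>. With one more each for \<xi> and \<open>y\<close> this makes the
  order four times \<open>2 * DIM('a)\<close>. The direction \<open>((b, 0), (0, 0))\<close> is
  differentiation in \<open>s\<close>.\<close>

lemma diagonal_decay: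
  fixes \<Psi> :: "('a \<times> 'a) \<times> ('a \<times> 'a) \<Rightarrow> complex"
  assumes \<Psi>: "\<Psi> \<in> schwartz" and b: "b \<in> Basis" and n: "n \<le> 2 * DIM('a)"
  shows "(1 + norm s) ^ (2 * DIM('a)) * (1 + norm \<xi>) ^ (2 * DIM('a)) * (1 + norm y) ^ (2 * DIM('a)) *
     norm (partials (replicate n ((b, 0), (0, 0))) \<Psi> ((y + s, \<xi>), (y, \<xi>))) \<le> schwartz_norm (8 * DIM('a)) \<Psi>"
proof -
  define K where "K = 2 * DIM('a)"
  define Z where "Z = norm ((y + s, \<xi>), (y, \<xi>))"
  let ?p = "norm (partials (replicate n ((b, 0), (0, 0))) \<Psi> ((y + s, \<xi>), (y, \<xi>)))"
  have Z: "norm (y + s) \<le> Z" "norm \<xi> \<le> Z" "norm y \<le> Z"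
    unfolding Z_def using norm_fst_le[of "(y + s, \<xi>)" "(y, \<xi>)"] norm_snd_le[of "(y, \<xi>)" "(y + s, \<xi>)"]
      norm_fst_le[of "y + s" \<xi>] norm_fst_le[of y \<xi>] norm_snd_le[of \<xi> y] by linarith+
  have Z0: "0 \<le> Z" by (simp add: Z_def)
  have "(1 + norm s) ^ K \<le> (1 + norm (y + s)) ^ K * (1 + norm y) ^ K"
    using one_plus_norm_triangle_power[of "y + s" "- y" K] by simp
  also have "\<dots> \<le> (1 + Z) ^ K * (1 + Z) ^ K" using Z Z0 by (intro mult_mono power_mono) auto
  finally have "(1 + norm s) ^ K * (1 + norm \<xi>) ^ K * (1 + norm y) ^ K
      \<le> ((1 + Z) ^ K * (1 + Z) ^ K) * (1 + Z) ^ K * (1 + Z) ^ K"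
    using Z Z0 by (intro mult_mono power_mono) auto
  also have "\<dots> = (1 + Z) ^ (8 * DIM('a))" by (simp add: K_def flip: power_add)
  finally have "(1 + norm s) ^ K * (1 + norm \<xi>) ^ K * (1 + norm y) ^ K * ?p \<le> (1 + Z) ^ (8 * DIM('a)) * ?p"
    by (rule mult_right_mono) simp
  also have "\<dots> \<le> schwartz_norm (8 * DIM('a)) \<Psi>"
    unfolding Z_def using b n by (intro partials_le_schwartz_norm \<Psi>)
        (auto simp: in_lists_conv_set Basis_prod_def zero_prod_def)
  finally show ?thesis by (simp add: K_def)
qed

text \<open>Fubini puts the transform in \<open>s\<close> inside the integral over \<open>y\<close>,
  where it acts on a slice of \<Psi>. The decay in \<xi> and \<eta> then comes from \<Psi> itself,
  and no derivatives of \<open>Rker \<Psi>\<close> appear.\<close>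

lemma Rker_properties:
  "\<exists>A\<ge>0. \<forall>\<Psi>\<in>schwartz. Rker \<Psi> \<in> borel_measurable borel \<and> (\<forall>s \<xi>. integrable lborel (\<lambda>y. \<Psi> ((y + s, \<xi>), (y, \<xi>)))) \<and>
     (\<forall>\<xi>. integrable lborel (\<lambda>s. Rker \<Psi> (s, \<xi>))) \<and>
     (\<forall>\<xi> \<eta>. (1 + norm \<xi>) ^ (2 * DIM('a)) * (1 + norm \<eta>) ^ (2 * DIM('a)) * norm (pft (Rker \<Psi>) (\<xi>, \<eta>))
         \<le> A * schwartz_norm (8 * DIM('a)) \<Psi>)"
proof -
  define K where "K = 2 * DIM('a)"
  define W where "W = (LINT x::'a|lborel. inverse ((1 + norm x) ^ K))"
  have W: "0 \<le> W" unfolding W_def by (intro integral_nonneg_AE) auto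
  from inverse_fourier_decay_uniform[where 'a = 'a] obtain A where A: "A \<ge> 0"
    "\<forall>(D :: 'a \<Rightarrow> nat \<Rightarrow> 'a \<Rightarrow> complex) f B. (\<forall>b\<in>Basis. dseq b (D b) \<and> D b 0 = f) \<longrightarrow>
    (\<forall>b\<in>Basis. \<forall>n\<le>K. \<forall>x. (1 + norm x) ^ K * norm (D b n x) \<le> B) \<longrightarrow>
    (\<forall>\<eta>. (1 + norm \<eta>) ^ K * norm (inverse_fourier f \<eta>) \<le> A * B)"
    unfolding K_def[symmetric] by (elim exE conjE) (rule that)
  obtain b0 :: 'a where b0: "b0 \<in> Basis" using nonempty_Basis by blast
  have "Rker \<Psi> \<in> borel_measurable borel \<and> (\<forall>s \<xi>. integrable lborel (\<lambda>y. \<Psi> ((y + s, \<xi>), (y, \<xi>)))) \<and>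
     (\<forall>\<xi>. integrable lborel (\<lambda>s. Rker \<Psi> (s, \<xi>))) \<and>
     (\<forall>\<xi> \<eta>. (1 + norm \<xi>) ^ K * (1 + norm \<eta>) ^ K * norm (pft (Rker \<Psi>) (\<xi>, \<eta>)) \<le> (W * A)
         * schwartz_norm (8 * DIM('a)) \<Psi>)"
    if \<Psi>: "\<Psi> \<in> schwartz" for \<Psi> :: "('a \<times> 'a) \<times> ('a \<times> 'a) \<Rightarrow> complex"
  proof -
    let ?B = "schwartz_norm (8 * DIM('a)) \<Psi>"
    have B0: "0 \<le> ?B" by (rule schwartz_norm_nonneg[OF \<Psi>])
    note dd = diagonal_decay[OF \<Psi>, folded K_def]
    have d0: "(1 + norm s) ^ K * (1 + norm \<xi>) ^ K * (1 + norm y) ^ K * norm (\<Psi> ((y + s, \<xi>), (y, \<xi>))) \<le> ?B" for s \<xi> y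
      using dd[OF b0, of 0 s \<xi> y] by simp
    have cont: "continuous_on UNIV (\<lambda>p. \<Psi> ((fst (fst p) + snd (fst p), snd p), (fst (fst p), snd p)))"
      by (rule continuous_on_compose2[OF smooth_continuous[OF schwartz_smooth[OF \<Psi>]]])
          (auto intro!: continuous_intros)
    have m3: "(\<lambda>p. \<Psi> ((fst (fst p) + snd (fst p), snd p), (fst (fst p), snd p))) \<in>
        borel_measurable ((borel \<Otimes>\<^sub>M borel) \<Otimes>\<^sub>M borel)"
      using borel_measurable_continuous_onI[OF cont] by (simp add: borel_prod)
    have mR [measurable]: "(\<lambda>(z, y). \<Psi> ((y + fst z, snd z), (y, snd z))) \<in>
        borel_measurable ((borel \<Otimes>\<^sub>M borel) \<Otimes>\<^sub>M borel)"
      using measurable_compose[OF _ m3, of "\<lambda>p. ((snd p, fst (fst p)), snd (fst p))" "(borel \<Otimes>\<^sub>M borel) \<Otimes>\<^sub>M borel"]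
      by (simp add: case_prod_unfold)
    have "(\<lambda>z. LINT y|lborel. \<Psi> ((y + fst z, snd z), (y, snd z))) \<in> borel_measurable (borel \<Otimes>\<^sub>M borel)"
      by measurable
    then have m: "Rker \<Psi> \<in> borel_measurable borel" by (simp add: Rker_def case_prod_unfold borel_prod)
    have cys: "continuous_on UNIV (\<lambda>p. \<Psi> ((fst p + snd p, \<xi>), (fst p, \<xi>)))" for \<xi>
      by (rule continuous_on_compose2[OF smooth_continuous[OF schwartz_smooth[OF \<Psi>]]])
          (auto intro!: continuous_intros)
    have one: "1 \<le> (1 + norm \<xi>) ^ K" for \<xi> :: 'a by (rule one_le_power) simp
    have drop: "(1 + norm y) ^ K * (1 + norm s) ^ K * norm (\<Psi> ((y + s, \<xi>), (y, \<xi>))) \<le> ?B" for y s \<xi>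
    proof -
      have "1 * ((1 + norm y) ^ K * (1 + norm s) ^ K * norm (\<Psi> ((y + s, \<xi>), (y, \<xi>))))
          \<le> (1 + norm \<xi>) ^ K * ((1 + norm y) ^ K * (1 + norm s) ^ K * norm (\<Psi> ((y + s, \<xi>), (y, \<xi>))))"
        by (intro mult_right_mono one) auto
      also have "\<dots> \<le> ?B" using d0[of s \<xi> y] by (simp add: mult_ac)
      finally show ?thesis by simp
    qed
    have iys: "integrable lborel (\<lambda>p. \<Psi> ((fst p + snd p, \<xi>), (fst p, \<xi>)))" for \<xi>
      by (rule integrable_pair_decay(1)[OF borel_measurable_continuous_onI[OF cys]]) (use drop in \<open>auto simp: K_def\<close>)
    have iy: "integrable lborel (\<lambda>y. \<Psi> ((y + s, \<xi>), (y, \<xi>)))" for s \<xi>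
    proof (rule integrable_decay)
      have "continuous_on UNIV (\<lambda>y. \<Psi> ((y + s, \<xi>), (y, \<xi>)))"
        by (rule continuous_on_compose2[OF smooth_continuous[OF schwartz_smooth[OF \<Psi>]]])
            (auto intro!: continuous_intros)
      then show "(\<lambda>y. \<Psi> ((y + s, \<xi>), (y, \<xi>))) \<in> borel_measurable borel" by (rule borel_measurable_continuous_onI)
      show "(1 + norm y) ^ K * norm (\<Psi> ((y + s, \<xi>), (y, \<xi>))) \<le> ?B" for y
      proof -
        have "1 * ((1 + norm y) ^ K * norm (\<Psi> ((y + s, \<xi>), (y, \<xi>))))
            \<le> (1 + norm s) ^ K * ((1 + norm y) ^ K * norm (\<Psi> ((y + s, \<xi>), (y, \<xi>))))"
          by (intro mult_right_mono one) auto
        also have "\<dots> \<le> ?B" using drop[of y s \<xi>] by (simp add: mult_ac)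
        finally show ?thesis by simp
      qed
    qed (simp add: K_def)
    have ints: "integrable lborel (\<lambda>s. Rker \<Psi> (s, \<xi>))" for \<xi>
      using integral_lborel_pair(4)[OF iys] by (simp add: Rker_def)
    have bound: "(1 + norm \<xi>) ^ K * (1 + norm \<eta>) ^ K * norm (pft (Rker \<Psi>) (\<xi>, \<eta>)) \<le> (W * A) * ?B" for \<xi> \<eta>
    proof -
      define h where "h y = inverse_fourier (\<lambda>s. \<Psi> ((y + s, \<xi>), (y, \<xi>))) \<eta>" for y
      have int: "integrable lborel (\<lambda>p. \<Psi> ((fst p + snd p, \<xi>), (fst p, \<xi>)) * ch (snd p \<bullet> \<eta>))"
        by (rule integrable_mult_ch[OF iys])
            (unfold measurable_lborel2, intro borel_measurable_continuous_onI continuous_intros)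
      have "pft (Rker \<Psi>) (\<xi>, \<eta>) = (LINT s|lborel. LINT y|lborel. \<Psi> ((y + s, \<xi>), (y, \<xi>)) * ch (s \<bullet> \<eta>))"
        by (simp add: pft_def inverse_fourier_ch Rker_def)
      also have "\<dots> = (LINT y|lborel. h y)"
        unfolding h_def inverse_fourier_ch using integral_lborel_pair(1,2)[OF int] by simp
      finally have eq: "pft (Rker \<Psi>) (\<xi>, \<eta>) = (LINT y|lborel. h y)" .
      have hm: "h \<in> borel_measurable borel"
        unfolding h_def inverse_fourier_ch using integral_lborel_pair(3)[OF int]
            by (auto dest: borel_measurable_integrable)
      have pos: "(1 + norm x) ^ K > 0" for x :: 'a by (simp add: add_pos_nonneg)
      have hb: "(1 + norm \<eta>) ^ K * norm (h y) \<le> A * (?B / ((1 + norm \<xi>) ^ K * (1 + norm y) ^ K))" for y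
        unfolding h_def
      proof (rule A(2)[rule_format, of "\<lambda>b n s. partials (replicate n ((b, 0), (0, 0))) \<Psi> ((y + s, \<xi>), (y, \<xi>))"])
        fix b :: 'a assume b: "b \<in> Basis"
        have b': "((b, 0), (0, 0)) \<in> (Basis :: (('a \<times> 'a) \<times> ('a \<times> 'a)) set)" using b
            by (simp add: Basis_prod_def zero_prod_def)
        show "dseq b (\<lambda>n s. partials (replicate n ((b, 0), (0, 0))) \<Psi> ((y + s, \<xi>), (y, \<xi>))) \<and>
            (\<lambda>s. partials (replicate 0 ((b, 0), (0, 0))) \<Psi> ((y + s, \<xi>), (y, \<xi>))) = (\<lambda>s. \<Psi> ((y + s, \<xi>), (y, \<xi>)))"
          by (intro conjI dseq_along[OF smooth_dseq[OF schwartz_smooth[OF \<Psi>] b']]) (auto intro!: continuous_intros)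
        fix n and s :: 'a assume n: "n \<le> K"
        show "(1 + norm s) ^ K * norm (partials (replicate n ((b, 0), (0, 0))) \<Psi>
            ((y + s, \<xi>), (y, \<xi>))) \<le> ?B / ((1 + norm \<xi>) ^ K * (1 + norm y) ^ K)"
          using dd[OF b n, of s \<xi> y] pos by (simp add: pos_le_divide_eq mult_ac)
      qed
      have "(1 + norm y) ^ K * norm (h y) \<le> A * ?B / ((1 + norm \<xi>) ^ K * (1 + norm \<eta>) ^ K)" for y
        using hb[of y] pos[of y] pos[of \<xi>] pos[of \<eta>] by (simp add: pos_le_divide_eq field_simps)
      from integral_decay_le[OF hm _ this]
      have "(LINT y|lborel. norm (h y)) \<le> W * (A * ?B / ((1 + norm \<xi>) ^ K * (1 + norm \<eta>) ^ K))"
          by (simp add: K_def W_def)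
      then have "norm (pft (Rker \<Psi>) (\<xi>, \<eta>)) \<le> W * (A * ?B / ((1 + norm \<xi>) ^ K * (1 + norm \<eta>) ^ K))"
        unfolding eq using integral_norm_bound[of lborel h] by linarith
      then show ?thesis using pos[of \<xi>] pos[of \<eta>] by (simp add: pos_le_divide_eq field_simps)
    qed
    show ?thesis using m iy ints bound by blast
  qed
  then show ?thesis unfolding K_def[symmetric] using W A(1) by (intro exI[of _ "W * A"]) auto
qed

lemma Rker_admissible: "\<Psi> \<in> schwartz \<Longrightarrow> pft_admissible (Rker \<Psi>)"
proof -
  assume \<Psi>: "\<Psi> \<in> schwartz"
  from Rker_properties \<Psi> obtain A where A: "Rker \<Psi> \<in> borel_measurable borel"
      "\<And>\<xi>. integrable lborel (\<lambda>s. Rker \<Psi> (s, \<xi>))"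
    "\<And>\<xi> \<eta>. (1 + norm \<xi>) ^ (2 * DIM('a)) * (1 + norm \<eta>) ^ (2 * DIM('a)) * norm (pft (Rker \<Psi>) (\<xi>, \<eta>))
        \<le> A * schwartz_norm (8 * DIM('a)) \<Psi>" by blast
  from integrable_pair_decay(1)[OF measurable_pft[OF A(1)] order_refl A(3)] A(2) show ?thesis
    by (simp add: pft_admissible_def)
qed

lemma tempered_delta_kernel: "tempered (delta_kernel F)"
  unfolding tempered_def delta_kernel_Rker
proof (intro conjI ballI allI)
  from Rker_properties obtain A where "A \<ge> 0" and A: "\<forall>\<Psi>\<in>schwartz. Rker \<Psi> \<in> borel_measurable borel \<and>
     (\<forall>s \<xi>. integrable lborel (\<lambda>y. \<Psi> ((y + s, \<xi>), (y, \<xi>)))) \<and> (\<forall>\<xi>. integrable lborel (\<lambda>s. Rker \<Psi> (s, \<xi>))) \<and>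
     (\<forall>\<xi> \<eta>. (1 + norm \<xi>) ^ (2 * DIM('a)) * (1 + norm \<eta>) ^ (2 * DIM('a)) * norm (pft (Rker \<Psi>) (\<xi>, \<eta>))
         \<le> A * schwartz_norm (8 * DIM('a)) \<Psi>)"
    by (elim exE conjE) (rule that)
  show "\<exists>C N. \<forall>f\<in>schwartz. norm (F (Rker f)) \<le> C * schwartz_norm N f"
  proof (intro exI ballI)
    fix f :: "('a \<times> 'a) \<times> ('a \<times> 'a) \<Rightarrow> complex" assume f: "f \<in> schwartz"
    show "norm (F (Rker f)) \<le> ((C\<^sub>0 * C\<^sub>0)
        * (LINT x::'a|lborel. inverse ((1 + norm x) ^ (2 * DIM('a))))\<^sup>2 * A) * schwartz_norm (8 * DIM('a)) f"
      using F_bound[of "Rker f" "A * schwartz_norm (8 * DIM('a)) f"] A f by (simp add: mult.assoc)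
  qed
  fix f g :: "('a \<times> 'a) \<times> ('a \<times> 'a) \<Rightarrow> complex" and c :: complex
  have "Rker (\<lambda>x. c * f x) = (\<lambda>z. c * Rker f z)" by (auto simp: Rker_def)
  then show "F (Rker (\<lambda>x. c * f x)) = c * F (Rker f)" by (simp add: F_cmult)
  assume f: "f \<in> schwartz" and g: "g \<in> schwartz"
  have "Rker (\<lambda>x. f x + g x) = (\<lambda>z. Rker f z + Rker g z)" using A f g by (auto simp: Rker_def)
  then show "F (Rker (\<lambda>x. f x + g x)) = F (Rker f) + F (Rker g)" by (simp add: F_add Rker_admissible f g)
qed

end

subsection \<open>The cross-Wigner distribution on the Fourier side\<close>

lemma wigner_ch: "wigner f g (x, \<xi>)
    = (LINT y|lborel. f (x + (1/2) *\<^sub>R y) * cnj (g (x - (1/2) *\<^sub>R y)) * ch (- (y \<bullet> \<xi>)))"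
  unfolding wigner_def case_prod_conv ch_eq_exp(2)[symmetric] by simp

text \<open>The substitution a = y + t/2 frees the argument of \<open>f\<close> from
  \<open>y\<close> and leaves \<open>2 *\<^sub>R y - a\<close> in \<open>g\<close>, which prepares
  Fubini in (y, a).\<close>

lemma wigner_subst:
  fixes f g :: "'a::euclidean_space \<Rightarrow> complex"
  assumes [measurable]: "f \<in> borel_measurable borel" "g \<in> borel_measurable borel"
  shows "wigner f g (y, \<xi>) = (LINT a|lborel. 2 ^ DIM('a) * (f a * cnj (g (2 *\<^sub>R y - a)) * ch (- 2 * ((a - y) \<bullet> \<xi>))))"
proof -
  have "(LINT a|lborel. f a * cnj (g (2 *\<^sub>R y - a)) * ch (- 2 * ((a - y) \<bullet> \<xi>)))
    = (1/2) ^ DIM('a) *\<^sub>R (LINT t|lborel. f (y + (1/2) *\<^sub>R t) * cnj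
        (g (2 *\<^sub>R y - (y + (1/2) *\<^sub>R t))) * ch (- 2 * ((y + (1/2) *\<^sub>R t - y) \<bullet> \<xi>)))"
    by (subst integral_lborel_affine[where c = "1/2" and t = y]) auto
  also have "(\<lambda>t. f (y + (1/2) *\<^sub>R t) * cnj (g (2 *\<^sub>R y - (y + (1/2) *\<^sub>R t)))
      * ch (- 2 * ((y + (1/2) *\<^sub>R t - y) \<bullet> \<xi>)))
    = (\<lambda>t. f (y + (1/2) *\<^sub>R t) * cnj (g (y - (1/2) *\<^sub>R t)) * ch (- (t \<bullet> \<xi>)))"
  proof
    fix t
    have *: "2 *\<^sub>R y - (y + (1/2) *\<^sub>R t) = y - (1/2) *\<^sub>R t" by (simp add: scaleR_2)
    show "f (y + (1/2) *\<^sub>R t) * cnj (g (2 *\<^sub>R y - (y + (1/2) *\<^sub>R t))) * ch (- 2 * ((y + (1/2) *\<^sub>R t - y) \<bullet> \<xi>))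
      = f (y + (1/2) *\<^sub>R t) * cnj (g (y - (1/2) *\<^sub>R t)) * ch (- (t \<bullet> \<xi>))" unfolding * by simp
  qed
  finally have *: "(LINT a|lborel. f a * cnj (g (2 *\<^sub>R y - a)) * ch (- 2 * ((a - y) \<bullet> \<xi>)))
      = (1/2) ^ DIM('a) *\<^sub>R wigner f g (y, \<xi>)"
    by (simp only: wigner_ch)
  show ?thesis unfolding integral_mult_right_zero * by (simp add: scaleR_conv_of_real power_one_over)
qed

text \<open>After \<open>wigner_subst\<close> the phase splits into a part linear in
  \<open>a\<close> and a part linear in \<open>2 *\<^sub>R y - a\<close>, so the double integral
  factors into the two transforms.\<close>

lemma wigner_marginal:
  fixes f g :: "'a::euclidean_space \<Rightarrow> complex"
  assumes f: "integrable lborel f" and g: "integrable lborel g"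
  shows "integrable lborel (\<lambda>y. wigner f g (y, \<xi>))"
    and "(LINT y|lborel. wigner f g (y, \<xi>) * ch (- (y \<bullet> \<eta>)))
      = fourier f (\<xi> + (1/2) *\<^sub>R \<eta>) * cnj (fourier g (\<xi> - (1/2) *\<^sub>R \<eta>))"
proof -
  have fm [measurable]: "f \<in> borel_measurable borel" and gm [measurable]: "g \<in> borel_measurable borel"
    using f g by auto
  define J where "J = (\<lambda>(y, a). 2 ^ DIM('a) * (f a * cnj (g (2 *\<^sub>R y - a)) * ch (- 2 * ((a - y) \<bullet> \<xi>))))"
  have Jm [measurable]: "J \<in> borel_measurable (borel \<Otimes>\<^sub>M borel)" unfolding J_def by measurable
  have ga: "integrable lborel (\<lambda>y. g (2 *\<^sub>R y - a))" for a
    using integrable_lborel_affine[OF g, of 2 "- a"] by simp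
  have J: "integrable lborel J"
  proof (rule integrable_lborel_pairI')
    show "J \<in> borel_measurable borel" using Jm by (simp add: borel_prod)
    show "integrable lborel (\<lambda>y. J (y, a))" for a
    proof -
      have "integrable lborel (\<lambda>y. 2 ^ DIM('a) * f a * cnj (g (2 *\<^sub>R y - a)) * ch (- 2 * ((a - y) \<bullet> \<xi>)))"
        by (intro integrable_mult_ch integrable_mult_right) (use ga in auto)
      then show ?thesis by (simp add: J_def mult.assoc)
    qed
    have "(LINT y|lborel. norm (J (y, a))) = norm (f a) * (LINT y|lborel. norm (g y))" for a
    proof -
      have "(LINT y|lborel. norm (g y)) = 2 ^ DIM('a) * (LINT y|lborel. norm (g (- a + 2 *\<^sub>R y)))"
        by (subst integral_lborel_affine[where c = 2 and t = "- a"]) auto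
      then show ?thesis by (simp add: J_def norm_mult norm_power)
    qed
    then show "integrable lborel (\<lambda>a. LINT y|lborel. norm (J (y, a)))" using f by simp
  qed
  have W: "wigner f g (y, \<xi>) = (LINT a|lborel. J (y, a))" for y
    by (simp only: wigner_subst[OF fm gm] J_def case_prod_conv)
  show "integrable lborel (\<lambda>y. wigner f g (y, \<xi>))" unfolding W by (rule integral_lborel_pair(3)[OF J])
  have J': "integrable lborel (\<lambda>z. J z * ch (- (fst z \<bullet> \<eta>)))"
    by (rule integrable_mult_ch[OF J])
        (unfold measurable_lborel2, intro borel_measurable_continuous_onI continuous_intros)
  have inner: "(LINT y|lborel. J (y, a) * ch (- (y \<bullet> \<eta>)))
      = (f a * ch (- (a \<bullet> (\<xi> + (1/2) *\<^sub>R \<eta>)))) * cnj (fourier g (\<xi> - (1/2) *\<^sub>R \<eta>))" for a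
  proof -
    have "cnj (fourier g (\<xi> - (1/2) *\<^sub>R \<eta>)) = (LINT b|lborel. cnj (g b) * ch (b \<bullet> (\<xi> - (1/2) *\<^sub>R \<eta>)))"
      unfolding fourier_ch by (subst Bochner_Integration.integral_cnj[symmetric]) (simp add: ch_uminus)
    also have "\<dots> = 2 ^ DIM('a) *\<^sub>R (LINT y|lborel. cnj (g (- a + 2 *\<^sub>R y))
        * ch ((- a + 2 *\<^sub>R y) \<bullet> (\<xi> - (1/2) *\<^sub>R \<eta>)))"
      by (subst integral_lborel_affine[where c = 2 and t = "- a"]) auto
    finally have c: "cnj (fourier g (\<xi> - (1/2) *\<^sub>R \<eta>))
      = 2 ^ DIM('a) * (LINT y|lborel. cnj (g (2 *\<^sub>R y - a)) * ch ((2 *\<^sub>R y - a) \<bullet> (\<xi> - (1/2) *\<^sub>R \<eta>)))"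
      by (simp add: scaleR_conv_of_real)
    have "J (y, a) * ch (- (y \<bullet> \<eta>)) = (f a * ch (- (a \<bullet> (\<xi> + (1/2) *\<^sub>R \<eta>))) * 2 ^ DIM('a)) *
        (cnj (g (2 *\<^sub>R y - a)) * ch ((2 *\<^sub>R y - a) \<bullet> (\<xi> - (1/2) *\<^sub>R \<eta>)))" for y
    proof -
      have "- 2 * ((a - y) \<bullet> \<xi>) + - (y \<bullet> \<eta>) = - (a \<bullet> (\<xi> + (1/2) *\<^sub>R \<eta>)) + (2 *\<^sub>R y - a) \<bullet> (\<xi> - (1/2) *\<^sub>R \<eta>)"
        by (simp add: inner_diff_left inner_diff_right inner_add_right algebra_simps)
      then have e: "ch (- 2 * ((a - y) \<bullet> \<xi>)) * ch (- (y \<bullet> \<eta>))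
        = ch (- (a \<bullet> (\<xi> + (1/2) *\<^sub>R \<eta>))) * ch ((2 *\<^sub>R y - a) \<bullet> (\<xi> - (1/2) *\<^sub>R \<eta>))" by (simp only: flip: ch_add)
      have "J (y, a) * ch (- (y \<bullet> \<eta>)) = 2 ^ DIM('a) * f a * cnj (g (2 *\<^sub>R y - a))
          * (ch (- 2 * ((a - y) \<bullet> \<xi>)) * ch (- (y \<bullet> \<eta>)))"
        unfolding J_def case_prod_conv by (simp only: mult.assoc)
      then show ?thesis unfolding e by (simp only: mult_ac)
    qed
    then have "(LINT y|lborel. J (y, a) * ch (- (y \<bullet> \<eta>))) = (f a * ch (- (a \<bullet> (\<xi> + (1/2) *\<^sub>R \<eta>))) * 2 ^ DIM('a)) *
        (LINT y|lborel. cnj (g (2 *\<^sub>R y - a)) * ch ((2 *\<^sub>R y - a) \<bullet> (\<xi> - (1/2) *\<^sub>R \<eta>)))"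
      by (simp only: integral_mult_right_zero)
    then show ?thesis unfolding c by (simp only: mult.assoc)
  qed
  have "(LINT y|lborel. wigner f g (y, \<xi>) * ch (- (y \<bullet> \<eta>)))
      = (LINT y|lborel. LINT a|lborel. J (y, a) * ch (- (y \<bullet> \<eta>)))"
    unfolding W by simp
  also have "\<dots> = (LINT a|lborel. LINT y|lborel. J (y, a) * ch (- (y \<bullet> \<eta>)))"
    using integral_lborel_pair(1,2)[OF J'] by simp
  also have "\<dots> = fourier f (\<xi> + (1/2) *\<^sub>R \<eta>) * cnj (fourier g (\<xi> - (1/2) *\<^sub>R \<eta>))"
    unfolding inner by (simp add: fourier_ch)
  finally show "(LINT y|lborel. wigner f g (y, \<xi>) * ch (- (y \<bullet> \<eta>)))
      = fourier f (\<xi> + (1/2) *\<^sub>R \<eta>) * cnj (fourier g (\<xi> - (1/2) *\<^sub>R \<eta>))" .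
qed

text \<open>Under the Wigner integral both factors are inverse transforms as functions of
  \<open>y\<close>, namely of \<open>p\<close> and \<open>r\<close>. Parseval therefore replaces the
  integral over \<open>y\<close> by one over frequencies.\<close>

lemma wigner_inverse_fourier:
  fixes u v :: "'a::euclidean_space \<Rightarrow> complex"
  assumes u: "integrable lborel u" "continuous_on UNIV u" "\<And>x. norm (u x) \<le> B"
    and v: "integrable lborel v" "\<And>x. norm (v x) \<le> B'"
  shows "wigner (inverse_fourier u) (inverse_fourier v) (x, \<xi>)
    = inverse_fourier (\<lambda>\<eta>. u (\<xi> + (1/2) *\<^sub>R \<eta>) * cnj (v (\<xi> - (1/2) *\<^sub>R \<eta>))) x"
proof -
  have [measurable]: "u \<in> borel_measurable borel" "v \<in> borel_measurable borel" using u v by auto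
  \<comment> \<open>\<open>p\<close> and \<open>r\<close> absorb the dilation by 1/2 and, as a
    character, the translation by \<open>x\<close>; \<open>r\<close> also absorbs the character of
    the Wigner integral, as a shift by \<open>2 *\<^sub>R \<xi>\<close>.\<close>
  define p where "p \<zeta> = 2 ^ DIM('a) * (u (0 + 2 *\<^sub>R \<zeta>) * ch ((0 + 2 *\<^sub>R \<zeta>) \<bullet> x))" for \<zeta>
  define r where "r \<zeta> = 2 ^ DIM('a) * (v (2 *\<^sub>R \<xi> + (- 2) *\<^sub>R \<zeta>) * ch ((2 *\<^sub>R \<xi> + (- 2) *\<^sub>R \<zeta>) \<bullet> x))" for \<zeta>
  have p: "integrable lborel p" unfolding p_def
    by (intro integrable_mult_right integrable_mult_ch integrable_lborel_affine u) auto
  have pc: "continuous_on UNIV p" unfolding p_def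
    by (intro continuous_intros continuous_on_compose2[OF u(2)]) auto
  have pB: "norm (p \<zeta>) \<le> 2 ^ DIM('a) * B" for \<zeta>
    unfolding p_def using u(3)[of "0 + 2 *\<^sub>R \<zeta>"] by (simp add: norm_mult norm_power)
  have r: "integrable lborel r" unfolding r_def
    by (intro integrable_mult_right integrable_mult_ch integrable_lborel_affine v) auto
  have rB: "norm (r \<zeta>) \<le> 2 ^ DIM('a) * B'" for \<zeta>
    unfolding r_def using v(2)[of "2 *\<^sub>R \<xi> + (- 2) *\<^sub>R \<zeta>"] by (simp add: norm_mult norm_power)
  have U: "inverse_fourier u (x + (1/2) *\<^sub>R y) = inverse_fourier p y" for y
  proof -
    have "inverse_fourier u (x + (1/2) *\<^sub>R y)
      = \<bar>2\<bar> ^ DIM('a) *\<^sub>R (LINT \<zeta>|lborel. u (0 + 2 *\<^sub>R \<zeta>) * ch ((0 + 2 *\<^sub>R \<zeta>) \<bullet> (x + (1/2) *\<^sub>R y)))"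
      unfolding inverse_fourier_ch by (rule integral_lborel_affine) auto
    also have "\<dots> = inverse_fourier p y"
      by (simp add: inverse_fourier_ch p_def scaleR_conv_of_real mult.assoc inner_add_right ch_add)
    finally show ?thesis .
  qed
  have V: "inverse_fourier v (x - (1/2) *\<^sub>R y) * ch (y \<bullet> \<xi>) = inverse_fourier r y" for y
  proof -
    have "inverse_fourier v (x - (1/2) *\<^sub>R y)
      = \<bar>- 2\<bar> ^ DIM('a) *\<^sub>R (LINT \<zeta>|lborel. v (2 *\<^sub>R \<xi> + (- 2) *\<^sub>R \<zeta>) * ch
          ((2 *\<^sub>R \<xi> + (- 2) *\<^sub>R \<zeta>) \<bullet> (x - (1/2) *\<^sub>R y)))"
      unfolding inverse_fourier_ch by (rule integral_lborel_affine) auto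
    then have "inverse_fourier v (x - (1/2) *\<^sub>R y) * ch (y \<bullet> \<xi>)
      = (LINT \<zeta>|lborel. 2 ^ DIM('a) *
          ((v (2 *\<^sub>R \<xi> + (- 2) *\<^sub>R \<zeta>) * ch ((2 *\<^sub>R \<xi> + (- 2) *\<^sub>R \<zeta>) \<bullet> (x - (1/2) *\<^sub>R y))) * ch (y \<bullet> \<xi>)))"
      by (simp add: scaleR_conv_of_real)
    also have "(\<lambda>\<zeta>. 2 ^ DIM('a) * ((v (2 *\<^sub>R \<xi> + (- 2) *\<^sub>R \<zeta>)
        * ch ((2 *\<^sub>R \<xi> + (- 2) *\<^sub>R \<zeta>) \<bullet> (x - (1/2) *\<^sub>R y))) * ch (y \<bullet> \<xi>)))
      = (\<lambda>\<zeta>. r \<zeta> * ch (\<zeta> \<bullet> y))"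
    proof
      fix \<zeta>
      have "(2 *\<^sub>R \<xi> + (- 2) *\<^sub>R \<zeta>) \<bullet> (x - (1/2) *\<^sub>R y) + y \<bullet> \<xi> = (2 *\<^sub>R \<xi> + (- 2) *\<^sub>R \<zeta>) \<bullet> x + \<zeta> \<bullet> y"
        by (simp add: inner_diff_left inner_diff_right inner_commute)
      then have "ch ((2 *\<^sub>R \<xi> + (- 2) *\<^sub>R \<zeta>) \<bullet> (x - (1/2) *\<^sub>R y)) * ch (y \<bullet> \<xi>)
          = ch ((2 *\<^sub>R \<xi> + (- 2) *\<^sub>R \<zeta>) \<bullet> x) * ch (\<zeta> \<bullet> y)"
        by (simp only: flip: ch_add)
      then show "2 ^ DIM('a) * ((v (2 *\<^sub>R \<xi> + (- 2) *\<^sub>R \<zeta>)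
          * ch ((2 *\<^sub>R \<xi> + (- 2) *\<^sub>R \<zeta>) \<bullet> (x - (1/2) *\<^sub>R y))) * ch (y \<bullet> \<xi>)) = r \<zeta> * ch (\<zeta> \<bullet> y)"
        unfolding r_def by (simp only: mult.assoc)
    qed
    finally show ?thesis by (simp only: inverse_fourier_ch inner_commute)
  qed
  have "wigner (inverse_fourier u) (inverse_fourier v) (x, \<xi>)
    = (LINT y|lborel. inverse_fourier p y * cnj (inverse_fourier r y))"
    unfolding wigner_ch U V[symmetric] by (simp add: ch_uminus mult.assoc)
  also have "\<dots> = (LINT \<zeta>|lborel. p \<zeta> * cnj (r \<zeta>))"
    by (rule parseval[OF p pc pB r square_integrable_bounded[OF r rB]])
  \<comment> \<open>The substitution of \<xi>/2 + \<eta>/4 for \<zeta> produces the arguments \<xi>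
    + \<eta>/2 and \<xi> - \<eta>/2.\<close>
  also have "\<dots> = \<bar>1/4\<bar> ^ DIM('a) *\<^sub>R (LINT \<eta>|lborel. p ((1/2) *\<^sub>R \<xi> + (1/4) *\<^sub>R \<eta>)
      * cnj (r ((1/2) *\<^sub>R \<xi> + (1/4) *\<^sub>R \<eta>)))"
    by (rule integral_lborel_affine) (use p r in auto)
  also have "\<dots> = (LINT \<eta>|lborel. u (\<xi> + (1/2) *\<^sub>R \<eta>) * cnj (v (\<xi> - (1/2) *\<^sub>R \<eta>)) * ch (x \<bullet> \<eta>))"
  proof -
    have "p ((1/2) *\<^sub>R \<xi> + (1/4) *\<^sub>R \<eta>) * cnj (r ((1/2) *\<^sub>R \<xi> + (1/4) *\<^sub>R \<eta>))
        = 4 ^ DIM('a) * (u (\<xi> + (1/2) *\<^sub>R \<eta>) * cnj (v (\<xi> - (1/2) *\<^sub>R \<eta>)) * ch (x \<bullet> \<eta>))" for \<eta>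
    proof -
      have 1: "0 + 2 *\<^sub>R ((1/2) *\<^sub>R \<xi> + (1/4) *\<^sub>R \<eta>) = \<xi> + (1/2) *\<^sub>R \<eta>" by (simp add: scaleR_add_right)
      have 2: "2 *\<^sub>R \<xi> + (- 2) *\<^sub>R ((1/2) *\<^sub>R \<xi> + (1/4) *\<^sub>R \<eta>) = \<xi> - (1/2) *\<^sub>R \<eta>"
          by (simp add: scaleR_add_right scaleR_2)
      have "(\<xi> + (1/2) *\<^sub>R \<eta>) \<bullet> x + - ((\<xi> - (1/2) *\<^sub>R \<eta>) \<bullet> x) = x \<bullet> \<eta>"
        by (simp add: inner_add_left inner_diff_left inner_commute[of \<eta> x])
      then have 3: "ch ((\<xi> + (1/2) *\<^sub>R \<eta>) \<bullet> x) * cnj (ch ((\<xi> - (1/2) *\<^sub>R \<eta>) \<bullet> x)) = ch (x \<bullet> \<eta>)"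
        by (simp only: flip: ch_add ch_uminus)
      have 4: "(4::complex) ^ DIM('a) = 2 ^ DIM('a) * 2 ^ DIM('a)" by (simp flip: power_mult_distrib)
      show ?thesis unfolding p_def r_def 1 2 4 3[symmetric] complex_cnj_mult by (simp add: mult_ac)
    qed
    then show ?thesis by (simp add: scaleR_conv_of_real power_one_over)
  qed
  finally show ?thesis by (simp add: inverse_fourier_ch inner_commute)
qed

text \<open>The convolution theorem for a correlation: translating the inner variable by
  \<open>y\<close> leaves the character of \<open>y\<close> with the opposite sign on
  \<open>A\<close>.\<close>

lemma inverse_fourier_correlation:
  fixes A B :: "'a::euclidean_space \<Rightarrow> complex"
  assumes A: "integrable lborel A" and B: "integrable lborel B"
  shows "inverse_fourier (\<lambda>s. LINT y|lborel. B (y + s) * A y) \<eta>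
      = (LINT y|lborel. A y * ch (- (y \<bullet> \<eta>))) * inverse_fourier B \<eta>"
proof -
  have [measurable]: "A \<in> borel_measurable borel" "B \<in> borel_measurable borel" using A B by auto
  define J where "J = (\<lambda>(y, s). B (y + s) * A y)"
  have Jm: "J \<in> borel_measurable (borel \<Otimes>\<^sub>M borel)" unfolding J_def by measurable
  have J: "integrable lborel J"
  proof (rule integrable_lborel_pairI)
    show "J \<in> borel_measurable borel" using Jm by (simp add: borel_prod)
    show "integrable lborel (\<lambda>s. J (y, s))" for y
      unfolding J_def case_prod_conv by (intro integrable_mult_left integrable_lborel_translate B)
    have "(LINT s|lborel. norm (J (y, s))) = (LINT s|lborel. norm (B s)) * norm (A y)" for y
      using integral_lborel_translate[of "\<lambda>s. norm (B s)" y] by (simp add: J_def norm_mult)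
    then show "integrable lborel (\<lambda>y. LINT s|lborel. norm (J (y, s)))" using A by simp
  qed
  have J': "integrable lborel (\<lambda>z. J z * ch (snd z \<bullet> \<eta>))"
    by (rule integrable_mult_ch[OF J])
        (unfold measurable_lborel2, intro borel_measurable_continuous_onI continuous_intros)
  have inner: "(LINT s|lborel. J (y, s) * ch (s \<bullet> \<eta>)) = (A y * ch (- (y \<bullet> \<eta>))) * inverse_fourier B \<eta>" for y
  proof -
    have "inverse_fourier B \<eta> = (LINT s|lborel. B (y + s) * ch ((y + s) \<bullet> \<eta>))"
      unfolding inverse_fourier_ch by (subst integral_lborel_translate) auto
    then have "(A y * ch (- (y \<bullet> \<eta>))) * inverse_fourier B \<eta>
        = (LINT s|lborel. (A y * ch (- (y \<bullet> \<eta>))) * (B (y + s) * ch ((y + s) \<bullet> \<eta>)))"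
      by (simp only: integral_mult_right_zero)
    also have "(\<lambda>s. (A y * ch (- (y \<bullet> \<eta>))) * (B (y + s) * ch ((y + s) \<bullet> \<eta>))) = (\<lambda>s. J (y, s) * ch (s \<bullet> \<eta>))"
    proof
      fix s
      have "ch (- (y \<bullet> \<eta>)) * ch ((y + s) \<bullet> \<eta>) = ch (s \<bullet> \<eta>)" by (simp add: inner_add_left flip: ch_add)
      then show "(A y * ch (- (y \<bullet> \<eta>))) * (B (y + s) * ch ((y + s) \<bullet> \<eta>)) = J (y, s) * ch (s \<bullet> \<eta>)"
        by (simp add: J_def mult_ac)
    qed
    finally show ?thesis by simp
  qed
  have "inverse_fourier (\<lambda>s. LINT y|lborel. B (y + s) * A y) \<eta>
      = (LINT s|lborel. LINT y|lborel. J (y, s) * ch (s \<bullet> \<eta>))"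
    by (simp add: inverse_fourier_ch J_def)
  also have "\<dots> = (LINT y|lborel. LINT s|lborel. J (y, s) * ch (s \<bullet> \<eta>))"
    using integral_lborel_pair(1,2)[OF J'] by simp
  finally show ?thesis unfolding inner by simp
qed

lemma schwartz_fourier:
  fixes f :: "'a::euclidean_space \<Rightarrow> complex"
  assumes f: "f \<in> schwartz"
  shows "integrable lborel (fourier f)" and "continuous_on UNIV (fourier f)" and "\<exists>B. \<forall>\<xi>. norm (fourier f \<xi>) \<le> B"
proof -
  show "integrable lborel (fourier f)" using schwartz_fourier_nice f by (auto simp: fourier_nice_def)
  show "continuous_on UNIV (fourier f)" unfolding fourier_eq_inverse_fourier[abs_def]
    by (intro continuous_on_compose2[OF continuous_on_inverse_fourier[OF schwartz_integrable[OF f]]]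
        continuous_intros) auto
  show "\<exists>B. \<forall>\<xi>. norm (fourier f \<xi>) \<le> B" using norm_fourier_le by blast
qed

section \<open>The Wigner kernel identity\<close>

context gevrey_symbol
begin

text \<open>Both sides equal the integral of \<open>q\<close> times \<open>pft \<Phi>\<close>. On
  the left, the multiplication formula moves the transform from \<open>q\<close> to \<Phi>. On the
  right, \<open>wigner_marginal\<close> supplies the transforms of \<open>f\<close> and
  \<open>g\<close>, and the factor \<open>wsym\<close> turns them into \<open>u\<close> and
  \<open>v\<close>.\<close>

lemma wigner_kernel_identity_delta_kernel: "wigner_kernel_identity (fourier_multiplier \<sigma>) (delta_kernel F)"
  unfolding wigner_kernel_identity_def
proof (intro ballI)
  fix f g :: "'a \<Rightarrow> complex" and \<Phi> :: "'a \<times> 'a \<Rightarrow> complex"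
  assume f: "f \<in> schwartz" and g: "g \<in> schwartz" and \<Phi>: "\<Phi> \<in> schwartz"
  note ff = schwartz_fourier[OF f] and fg = schwartz_fourier[OF g]
  from ff(3) obtain Bf where Bf: "\<And>\<xi>. norm (fourier f \<xi>) \<le> Bf" by blast
  from fg(3) obtain Bg where Bg: "\<And>\<xi>. norm (fourier g \<xi>) \<le> Bg" by blast
  define u where "u \<xi> = \<sigma> \<xi> * fourier f \<xi>" for \<xi>
  define v where "v \<xi> = \<sigma> \<xi> * fourier g \<xi>" for \<xi>
  define q where "q z = u (fst z + (1/2) *\<^sub>R snd z) * cnj (v (fst z - (1/2) *\<^sub>R snd z))" for z
  have u: "integrable lborel u" and v: "integrable lborel v"
    unfolding u_def v_def by (intro integrable_bounded_mult[OF _ _ \<sigma>_bounded] ff fg; simp)+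
  have uc: "continuous_on UNIV u" and vc: "continuous_on UNIV v"
    unfolding u_def v_def by (intro continuous_intros continuous_\<sigma> ff fg)+
  have uB: "norm (u \<xi>) \<le> C\<^sub>0 * Bf" and vB: "norm (v \<xi>) \<le> C\<^sub>0 * Bg" for \<xi>
    unfolding u_def v_def norm_mult using C\<^sub>0 by (intro mult_mono \<sigma>_bounded Bf Bg; simp)+
  have qc: "continuous_on UNIV q"
    unfolding q_def by (intro continuous_intros continuous_on_compose2[OF uc] continuous_on_compose2[OF vc]) auto
  have qm: "q \<in> borel_measurable borel" using qc by (rule borel_measurable_continuous_onI)
  then have [measurable]: "q \<in> borel_measurable (borel \<Otimes>\<^sub>M borel)" by (simp add: borel_prod)
  have qB: "norm (q z) \<le> (C\<^sub>0 * Bf) * (C\<^sub>0 * Bg)" for z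
    unfolding q_def norm_mult complex_mod_cnj by (intro mult_mono uB vB order_trans[OF norm_ge_zero uB]) simp
  have ui: "integrable lborel (\<lambda>\<eta>. u (\<xi> + (1/2) *\<^sub>R \<eta>))" for \<xi> by (rule integrable_lborel_affine[OF u]) simp
  have q_le: "norm (q (\<xi>, \<eta>)) \<le> (C\<^sub>0 * Bg) * norm (u (\<xi> + (1/2) *\<^sub>R \<eta>))" for \<xi> \<eta>
    unfolding q_def norm_mult complex_mod_cnj fst_conv snd_conv
    by (subst mult.commute) (intro mult_right_mono vB norm_ge_zero)
  have qi: "integrable lborel (\<lambda>\<eta>. q (\<xi>, \<eta>))" for \<xi>
    by (rule Bochner_Integration.integrable_bound[OF
        integrable_mult_right[OF integrable_norm[OF ui[of \<xi>]], of "C\<^sub>0 * Bg"]])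
      (measurable, intro AE_I2 order_trans[OF q_le], simp)
  define w where "w = wigner (fourier_multiplier \<sigma> f) (fourier_multiplier \<sigma> g)"
  have w: "w (x, \<xi>) = inverse_fourier (\<lambda>\<eta>. q (\<xi>, \<eta>)) x" for x \<xi>
    using wigner_inverse_fourier[OF u uc uB v vB, of x \<xi>]
    by (simp add: w_def fourier_multiplier_def u_def[symmetric] v_def[symmetric] q_def)
  have wm: "w \<in> borel_measurable borel"
  proof -
    have "(\<lambda>z. LINT \<eta>|lborel. q (snd z, \<eta>) * ch (\<eta> \<bullet> fst z)) \<in> borel_measurable (borel \<Otimes>\<^sub>M borel)" by measurable
    moreover have "w = (\<lambda>z. LINT \<eta>|lborel. q (snd z, \<eta>) * ch (\<eta> \<bullet> fst z))"
      by (auto simp: fun_eq_iff w inverse_fourier_ch)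
    ultimately show ?thesis by (simp add: borel_prod)
  qed
  have wB: "norm (w z) \<le> (C\<^sub>0 * Bg) * (2 ^ DIM('a) * (LINT \<xi>|lborel. norm (u \<xi>)))" for z
  proof (cases z)
    case (Pair x \<xi>)
    have "norm (w z) \<le> (LINT \<eta>|lborel. norm (q (\<xi>, \<eta>)))" unfolding Pair w by (rule norm_inverse_fourier_le)
    also have "\<dots> \<le> (LINT \<eta>|lborel. (C\<^sub>0 * Bg) * norm (u (\<xi> + (1/2) *\<^sub>R \<eta>)))"
      by (rule integral_mono[OF integrable_norm[OF qi] integrable_mult_right[OF integrable_norm[OF ui]] q_le])
    also have "\<dots> = (C\<^sub>0 * Bg) * (LINT \<eta>|lborel. norm (u (\<xi> + (1/2) *\<^sub>R \<eta>)))" by simp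
    also have "(LINT \<eta>|lborel. norm (u (\<xi> + (1/2) *\<^sub>R \<eta>))) = 2 ^ DIM('a) * (LINT \<xi>|lborel. norm (u \<xi>))"
      using u by (subst integral_lborel_affine[of "\<lambda>\<xi>. norm (u \<xi>)" "1/2" \<xi>]) (auto simp: power_one_over)
    finally show ?thesis .
  qed
  have G: "integrable lborel (\<lambda>z. w z * \<Phi> z)"
    by (rule integrable_bounded_mult[OF _ schwartz_integrable[OF \<Phi>] wB]) (use wm in simp)
  define \<Psi> where "\<Psi> = (\<lambda>(z, w). \<Phi> z * wigner f g w)"
  have pR: "pft (Rker \<Psi>) (\<xi>, \<eta>) = (fourier f (\<xi> + (1/2) *\<^sub>R \<eta>) * cnj (fourier g (\<xi> - (1/2) *\<^sub>R \<eta>)))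
      * pft \<Phi> (\<xi>, \<eta>)" for \<xi> \<eta>
    using inverse_fourier_correlation[OF wigner_marginal(1)[OF schwartz_integrable[OF f]
        schwartz_integrable[OF g], of \<xi>]
        schwartz_slice_integrable[OF \<Phi>, of \<xi>], of \<eta>]
    by (simp add: pft_def Rker_def \<Psi>_def wigner_marginal(2)[OF schwartz_integrable[OF f] schwartz_integrable[OF g]])
  have k: "delta_kernel F \<Psi> = (LINT z|lborel. q z * pft \<Phi> z)"
    unfolding delta_kernel_Rker F_def
    by (rule Bochner_Integration.integral_cong) (auto simp: pR q_def u_def v_def wsym_def)
  have i: "integrable lborel (\<lambda>z. q z * pft \<Phi> z)"
    by (rule integrable_bounded_mult[OF _ _ qB]) (use qm pft_admissible_schwartz[OF \<Phi>]
        in \<open>auto simp: pft_admissible_def\<close>)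
  have inner: "(LINT x|lborel. w (x, \<xi>) * \<Phi> (x, \<xi>)) = (LINT \<eta>|lborel. q (\<xi>, \<eta>) * pft \<Phi> (\<xi>, \<eta>))" for \<xi>
    using fourier_multiplication[OF qi schwartz_slice_integrable[OF \<Phi>], of \<xi> 1 \<xi>]
    by (simp add: w pft_def inverse_fourier_ch inner_commute)
  have "(LINT z|lborel. w z * \<Phi> z) = (LINT \<xi>|lborel. LINT x|lborel. w (x, \<xi>) * \<Phi> (x, \<xi>))"
    using integral_lborel_pair(2)[OF G] by simp
  also have "\<dots> = (LINT z|lborel. q z * pft \<Phi> z)"
    unfolding inner using integral_lborel_pair(1)[OF i] by simp
  finally show "has_bochner_integral lborel (\<lambda>z. wigner (fourier_multiplier \<sigma> f) (fourier_multiplier \<sigma> g) z * \<Phi> z)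
      (delta_kernel F (\<lambda>(z, w). \<Phi> z * wigner f g w))"
    using G k by (simp add: has_bochner_integral_iff w_def \<Psi>_def)
qed

end

subsection \<open>Uniqueness of the Wigner kernel\<close>

lemma schwartz_norm_mono:
  fixes f :: "'a::euclidean_space \<Rightarrow> complex"
  assumes f: "f \<in> schwartz" and MN: "M \<le> N"
  shows "schwartz_norm M f \<le> schwartz_norm N f"
proof (rule schwartz_norm_le)
  fix bs :: "'a list" and x assume bs: "bs \<in> lists Basis" "length bs \<le> M"
  have "(1 + norm x) ^ M * norm (partials bs f x) \<le> (1 + norm x) ^ N * norm (partials bs f x)"
    using MN by (intro mult_right_mono power_increasing) auto
  also have "\<dots> \<le> schwartz_norm N f" using bs MN by (intro partials_le_schwartz_norm f) auto
  finally show "(1 + norm x) ^ M * norm (partials bs f x) \<le> schwartz_norm N f" .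
qed

text \<open>The difference of the functionals is controlled by a single Schwartz norm, of the larger
  of the two orders, so \<open>schwartz_functional_eq_0\<close> applies to it.\<close>

lemma tempered_eqI:
  fixes u v :: "('a::euclidean_space \<Rightarrow> complex) \<Rightarrow> complex"
  assumes u: "tempered u" and v: "tempered v" and eq: "\<And>p. u (tfg [] p) = v (tfg [] p)" and f: "f \<in> schwartz"
  shows "u f = v f"
proof -
  from u obtain C M where C: "\<And>f. f \<in> schwartz \<Longrightarrow> norm (u f) \<le> C * schwartz_norm M f" unfolding tempered_def by blast
  from v obtain D N where D: "\<And>f. f \<in> schwartz \<Longrightarrow> norm (v f) \<le> D * schwartz_norm N f" unfolding tempered_def by blast
  have "u f - v f = 0"
  proof (rule schwartz_functional_eq_0[where u = "\<lambda>f. u f - v f" and C = "\<bar>C\<bar> + \<bar>D\<bar>" and N = "max M N", OF _ _ _ _ f])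
    show "u (\<lambda>x. f x + g x) - v (\<lambda>x. f x + g x) = (u f - v f) + (u g - v g)" if "f \<in> schwartz" "g \<in> schwartz" for f g
      using u v that by (simp add: tempered_def)
    show "u (\<lambda>x. c * f x) - v (\<lambda>x. c * f x) = c * (u f - v f)" if "f \<in> schwartz" for c f
      using u v that by (simp add: tempered_def right_diff_distrib)
    show "norm (u f - v f) \<le> (\<bar>C\<bar> + \<bar>D\<bar>) * schwartz_norm (max M N) f" if f: "f \<in> schwartz" for f
    proof -
      have le: "E * schwartz_norm K f \<le> \<bar>E\<bar> * schwartz_norm (max M N) f" if "K \<le> max M N" for E K
        by (intro mult_mono schwartz_norm_mono schwartz_norm_nonneg f that) auto
      have "norm (u f - v f) \<le> norm (u f) + norm (v f)" by (rule norm_triangle_ineq4)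
      also have "\<dots> \<le> \<bar>C\<bar> * schwartz_norm (max M N) f + \<bar>D\<bar> * schwartz_norm (max M N) f"
        by (intro add_mono order_trans[OF C[OF f] le] order_trans[OF D[OF f] le]) auto
      finally show ?thesis by (simp only: distrib_right)
    qed
  qed (simp add: eq)
  then show ?thesis by simp
qed

lemma partials_dilate:
  fixes f :: "'a::euclidean_space \<Rightarrow> complex"
  assumes f: "smooth f" and bs: "bs \<in> lists Basis"
  shows "partials bs (\<lambda>x. f (c *\<^sub>R x)) = (\<lambda>x. of_real c ^ length bs * partials bs f (c *\<^sub>R x))"
  using bs
proof (induction bs rule: list.induct)
  case (Cons b bs)
  then have b: "b \<in> Basis" "bs \<in> lists Basis" by auto
  from dirderiv_cmult[OF dirderiv_affine[OF smooth_partials_dirderiv[OF f b], of 0 c]]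
  have "dirderiv b (\<lambda>x. of_real c ^ length bs * partials bs f (c *\<^sub>R x))
      (\<lambda>x. of_real c ^ length bs * (of_real c * partials (b # bs) f (c *\<^sub>R x)))" by simp
  from dirderiv_partial[OF this] Cons.IH[OF b(2)] show ?case by (simp add: mult_ac)
qed simp

lemma schwartz_dilate:
  fixes f :: "'a::euclidean_space \<Rightarrow> complex"
  assumes f: "f \<in> schwartz" and c: "c \<noteq> 0"
  shows "(\<lambda>x. f (c *\<^sub>R x)) \<in> schwartz"
proof (rule schwartzI)
  note sf = schwartz_smooth[OF f]
  show "smooth (\<lambda>x. f (c *\<^sub>R x))"
    unfolding smooth_def
  proof (intro ballI allI)
    fix bs :: "'a list" and x assume bs: "bs \<in> lists Basis"
    have "(\<lambda>x. partials bs f (c *\<^sub>R x)) differentiable (at x)"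
      using differentiable_chain_at[of "\<lambda>x. c *\<^sub>R x" x "partials bs f"]
          smooth_differentiable[OF smooth_partials[OF sf bs]]
      by (simp add: o_def)
    then show "partials bs (\<lambda>x. f (c *\<^sub>R x)) differentiable (at x)" unfolding partials_dilate[OF sf bs] by simp
  qed
  fix bs :: "'a list" and N :: nat assume bs: "bs \<in> lists Basis"
  from schwartz_partials_bound[OF f bs, of N] obtain C
      where C: "\<And>x. (1 + norm x) ^ N * norm (partials bs f x) \<le> C" by blast
  have "(1 + norm x) ^ N * norm (partials bs (\<lambda>x. f (c *\<^sub>R x)) x)
      \<le> (1 + 1 / \<bar>c\<bar>) ^ N * \<bar>c\<bar> ^ length bs * C" for x :: 'a
  proof -
    have "1 + norm x \<le> (1 + 1 / \<bar>c\<bar>) * (1 + norm (c *\<^sub>R x))" using c by (simp add: field_simps)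
    then have "(1 + norm x) ^ N \<le> (1 + 1 / \<bar>c\<bar>) ^ N * (1 + norm (c *\<^sub>R x)) ^ N"
      by (subst power_mult_distrib[symmetric]) (intro power_mono, auto)
    then have "(1 + norm x) ^ N * (\<bar>c\<bar> ^ length bs * norm (partials bs f (c *\<^sub>R x)))
      \<le> ((1 + 1 / \<bar>c\<bar>) ^ N * (1 + norm (c *\<^sub>R x)) ^ N) * (\<bar>c\<bar> ^ length bs * norm (partials bs f (c *\<^sub>R x)))"
      by (rule mult_right_mono) simp
    also have "\<dots> = ((1 + 1 / \<bar>c\<bar>) ^ N * \<bar>c\<bar> ^ length bs)
        * ((1 + norm (c *\<^sub>R x)) ^ N * norm (partials bs f (c *\<^sub>R x)))"
      by (simp only: mult_ac)
    also have "\<dots> \<le> ((1 + 1 / \<bar>c\<bar>) ^ N * \<bar>c\<bar> ^ length bs) * C" by (intro mult_left_mono C) simp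
    finally show ?thesis by (simp add: partials_dilate[OF sf bs] norm_mult norm_power)
  qed
  then show "\<exists>C. \<forall>x. (1 + norm x) ^ N * norm (partials bs (\<lambda>x. f (c *\<^sub>R x)) x) \<le> C" by blast
qed

text \<open>A coherent state at position \<open>q\<close> and frequency \<open>p\<close>. The width
  is the one for which cross-Wigner distributions are shifts of \<open>gauss 2\<close> in position
  and frequency alike.\<close>

definition cg :: "'a::euclidean_space \<Rightarrow> 'a \<Rightarrow> 'a \<Rightarrow> complex" where
  "cg q p t = ch ((t - q) \<bullet> p) * gauss 1 (t - q)"

text \<open>\<open>gauss 1\<close> is \<open>gauss 2\<close> dilated by \<open>sqrt 2\<close>, so a
  coherent state is a dilated time-frequency shift.\<close>

lemma cg_schwartz: "cg q p \<in> schwartz"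
proof -
  have "cg q p = (\<lambda>t. tfg [] ((1 / sqrt 2) *\<^sub>R q, sqrt 2 *\<^sub>R p) ((1 / sqrt 2) *\<^sub>R t))"
  proof
    fix t
    have "(1 / sqrt 2) *\<^sub>R t - (1 / sqrt 2) *\<^sub>R q = (1 / sqrt 2) *\<^sub>R (t - q)" by (simp add: scaleR_diff_right)
    then show "cg q p t = tfg [] ((1 / sqrt 2) *\<^sub>R q, sqrt 2 *\<^sub>R p) ((1 / sqrt 2) *\<^sub>R t)"
      by (simp add: tfg_Nil cg_def gauss_def power_divide)
  qed
  then show ?thesis using schwartz_dilate[OF tfg_schwartz, of "1 / sqrt 2"] by simp
qed

lemma parallelogram_half:
  "(norm (Y + (1/2) *\<^sub>R s))\<^sup>2 + (norm (Y - (1/2) *\<^sub>R s))\<^sup>2 = 2 * (norm (Y::'a::real_inner))\<^sup>2 + (1/2) * (norm s)\<^sup>2"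
  by (simp add: power2_norm_eq_inner inner_add_left inner_add_right inner_diff_left inner_diff_right inner_commute)

text \<open>The states are chosen by solving for the shift: their midpoint in phase space is (a1,
  a2), their frequencies differ by c1 and their positions by c2. So every time-frequency shift of
  \<open>gauss 2\<close> on phase space is a multiple of a cross-Wigner distribution.\<close>

lemma wigner_cg:
  fixes a1 a2 c1 c2 :: "'a::euclidean_space"
  shows "wigner (cg (a1 - (1/2) *\<^sub>R c2) (a2 + (1/2) *\<^sub>R c1)) (cg (a1 + (1/2) *\<^sub>R c2) (a2 - (1/2) *\<^sub>R c1)) w
    = ((1 / sqrt (1/2)) ^ DIM('a) * ch (a2 \<bullet> c2)) * tfg [] ((a1, a2), (c1, c2)) w"
proof (cases w)
  case (Pair y \<eta>)
  define Y where "Y = y - a1"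
  let ?h = "\<lambda>s. (ch (Y \<bullet> c1 + c2 \<bullet> \<eta>) * gauss 2 Y) * (gauss (1/2) s * ch (s \<bullet> (a2 - \<eta>)))"
  have e: "cg (a1 - (1/2) *\<^sub>R c2) (a2 + (1/2) *\<^sub>R c1) (y + (1/2) *\<^sub>R t) *
      cnj (cg (a1 + (1/2) *\<^sub>R c2) (a2 - (1/2) *\<^sub>R c1) (y - (1/2) *\<^sub>R t)) * ch (- (t \<bullet> \<eta>)) = ?h (c2 + t)" for t
  proof -
    \<comment> \<open>In this variable the Gaussians have the arguments Y + s/2 and Y - s/2, and the
      parallelogram law separates Y from s.\<close>
    define s where "s = c2 + t"
    have 1: "y + (1/2) *\<^sub>R t - (a1 - (1/2) *\<^sub>R c2) = Y + (1/2) *\<^sub>R s"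
        "y - (1/2) *\<^sub>R t - (a1 + (1/2) *\<^sub>R c2) = Y - (1/2) *\<^sub>R s"
      by (simp_all add: s_def Y_def scaleR_add_right)
    have "gauss 1 (Y + (1/2) *\<^sub>R s) * gauss 1 (Y - (1/2) *\<^sub>R s)
        = exp (- (pi * ((norm (Y + (1/2) *\<^sub>R s))\<^sup>2 + (norm (Y - (1/2) *\<^sub>R s))\<^sup>2)))"
      by (simp add: gauss_def distrib_left flip: exp_add)
    also have "\<dots> = gauss 2 Y * gauss (1/2) s"
      unfolding parallelogram_half by (simp add: gauss_def distrib_left flip: exp_add)
    finally have G: "gauss 1 (Y + (1/2) *\<^sub>R s) * gauss 1 (Y - (1/2) *\<^sub>R s) = gauss 2 Y * gauss (1/2) s" .
    have t: "t = s - c2" by (simp add: s_def)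
    have "(Y + (1/2) *\<^sub>R s) \<bullet> (a2 + (1/2) *\<^sub>R c1) + - ((Y - (1/2) *\<^sub>R s) \<bullet> (a2 - (1/2) *\<^sub>R c1)) + - (t \<bullet> \<eta>)
        = Y \<bullet> c1 + c2 \<bullet> \<eta> + s \<bullet> (a2 - \<eta>)"
      by (simp add: t inner_add_left inner_add_right inner_diff_left inner_diff_right field_simps)
    then have P: "ch ((Y + (1/2) *\<^sub>R s) \<bullet> (a2 + (1/2) *\<^sub>R c1))
        * cnj (ch ((Y - (1/2) *\<^sub>R s) \<bullet> (a2 - (1/2) *\<^sub>R c1))) * ch (- (t \<bullet> \<eta>))
        = ch (Y \<bullet> c1 + c2 \<bullet> \<eta>) * ch (s \<bullet> (a2 - \<eta>))"
      by (simp only: flip: ch_add ch_uminus)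
    have "cg (a1 - (1/2) *\<^sub>R c2) (a2 + (1/2) *\<^sub>R c1) (y + (1/2) *\<^sub>R t) *
      cnj (cg (a1 + (1/2) *\<^sub>R c2) (a2 - (1/2) *\<^sub>R c1) (y - (1/2) *\<^sub>R t)) * ch (- (t \<bullet> \<eta>))
      = (ch ((Y + (1/2) *\<^sub>R s) \<bullet> (a2 + (1/2) *\<^sub>R c1)) * cnj
          (ch ((Y - (1/2) *\<^sub>R s) \<bullet> (a2 - (1/2) *\<^sub>R c1))) * ch (- (t \<bullet> \<eta>))) *
        of_real (gauss 1 (Y + (1/2) *\<^sub>R s) * gauss 1 (Y - (1/2) *\<^sub>R s))"
      unfolding cg_def 1 by (simp add: mult_ac)
    then show ?thesis unfolding P G s_def[symmetric] by (simp add: mult_ac)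
  qed
  have "wigner (cg (a1 - (1/2) *\<^sub>R c2) (a2 + (1/2) *\<^sub>R c1))
      (cg (a1 + (1/2) *\<^sub>R c2) (a2 - (1/2) *\<^sub>R c1)) (y, \<eta>) = (LINT t|lborel. ?h (c2 + t))"
    unfolding wigner_ch e ..
  also have "\<dots> = (LINT s|lborel. ?h s)" by (rule integral_lborel_translate) measurable
  also have "\<dots> = (ch (Y \<bullet> c1 + c2 \<bullet> \<eta>) * gauss 2 Y) * ((1 / sqrt (1/2)) ^ DIM('a) * gauss 2 (\<eta> - a2))"
  proof -
    have "gauss 2 (a2 - \<eta>) = gauss 2 (\<eta> - a2)" using gauss_minus[of 2 "\<eta> - a2"] by simp
    then show ?thesis unfolding integral_mult_right_zero inverse_fourier_gauss[of "1/2", simplified] by simp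
  qed
  also have "ch (Y \<bullet> c1 + c2 \<bullet> \<eta>) = ch (a2 \<bullet> c2) * ch ((y - a1, \<eta> - a2) \<bullet> (c1, c2))"
    unfolding ch_add[symmetric] by (simp add: Y_def inner_diff_left inner_commute[of c2 \<eta>] algebra_simps)
  also have "(ch (a2 \<bullet> c2) * ch ((y - a1, \<eta> - a2) \<bullet> (c1, c2)) * gauss 2 Y)
      * ((1 / sqrt (1/2)) ^ DIM('a) * gauss 2 (\<eta> - a2))
    = ((1 / sqrt (1/2)) ^ DIM('a) * ch (a2 \<bullet> c2)) * (ch ((y - a1, \<eta> - a2) \<bullet> (c1, c2)) * of_real
        (gauss 2 Y * gauss 2 (\<eta> - a2)))"
    by (simp add: mult_ac)
  also have "gauss 2 Y * gauss 2 (\<eta> - a2) = gauss 2 (y - a1, \<eta> - a2)"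
    by (simp add: Y_def gauss_def norm_Pair distrib_left flip: exp_add)
  finally show ?thesis unfolding Pair tfg_Nil by simp
qed

lemma tfg_Pair: "tfg [] ((z0, w0), (cz, cw)) (z, w) = tfg [] (z0, cz) z * tfg [] (w0, cw) w"
proof -
  have "gauss 2 (z - z0, w - w0) = gauss 2 (z - z0) * gauss 2 (w - w0)"
    by (simp add: gauss_def norm_Pair distrib_left flip: exp_add)
  then show ?thesis by (simp add: tfg_Nil ch_add)
qed

text \<open>A shift on the product space is a tensor product of shifts in \<open>z\<close> and in
  \<open>w\<close>, and by \<open>wigner_cg\<close> the second is a multiple of a cross-Wigner
  distribution. The identity prescribes the value of both kernels there, and density does the
  rest.\<close>

lemma wigner_kernel_unique:
  fixes k k' :: "(('a::euclidean_space \<times> 'a) \<times> ('a \<times> 'a) \<Rightarrow> complex) \<Rightarrow> complex"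
  assumes "tempered k" "tempered k'" and k: "wigner_kernel_identity T k" and k': "wigner_kernel_identity T k'"
    and \<Psi>: "\<Psi> \<in> schwartz"
  shows "k' \<Psi> = k \<Psi>"
proof (rule tempered_eqI[OF assms(2,1) _ \<Psi>])
  fix p :: "(('a \<times> 'a) \<times> ('a \<times> 'a)) \<times> (('a \<times> 'a) \<times> ('a \<times> 'a))"
  obtain z0 a1 a2 cz c1 c2 where p: "p = ((z0, (a1, a2)), (cz, (c1, c2)))" by (metis surj_pair)
  \<comment> \<open>The constant of \<open>wigner_cg\<close>, nonzero because characters have
    modulus 1; it is divided out of the factor in \<open>z\<close>.\<close>
  define \<kappa> :: complex where "\<kappa> = (1 / sqrt (1/2)) ^ DIM('a) * ch (a2 \<bullet> c2)"
  have \<kappa>: "\<kappa> \<noteq> 0" using norm_ch[of "a2 \<bullet> c2"] by (auto simp: \<kappa>_def simp del: norm_ch)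
  let ?f = "cg (a1 - (1/2) *\<^sub>R c2) (a2 + (1/2) *\<^sub>R c1)" and ?g = "cg (a1 + (1/2) *\<^sub>R c2) (a2 - (1/2) *\<^sub>R c1)"
  define \<Phi> where "\<Phi> = (\<lambda>z. (1 / \<kappa>) * tfg [] (z0, cz) z)"
  have \<Phi>: "\<Phi> \<in> schwartz" unfolding \<Phi>_def by (rule schwartz_cmult[OF tfg_schwartz])
  have eq: "tfg [] p = (\<lambda>(z, w). \<Phi> z * wigner ?f ?g w)"
    unfolding wigner_cg \<kappa>_def[symmetric] using \<kappa>
        by (auto simp: fun_eq_iff p tfg_Pair \<Phi>_def simp del: split_paired_All)
  have h: "has_bochner_integral lborel (\<lambda>z. wigner (T ?f) (T ?g) z * \<Phi> z) (k (\<lambda>(z, w). \<Phi> z * wigner ?f ?g w))"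
    using k \<Phi> cg_schwartz unfolding wigner_kernel_identity_def by blast
  have h': "has_bochner_integral lborel (\<lambda>z. wigner (T ?f) (T ?g) z * \<Phi> z) (k' (\<lambda>(z, w). \<Phi> z * wigner ?f ?g w))"
    using k' \<Phi> cg_schwartz unfolding wigner_kernel_identity_def by blast
  show "k' (tfg [] p) = k (tfg [] p)" unfolding eq by (rule has_bochner_integral_eq[OF h' h])
qed

theorem theorem4p4:
  fixes \<sigma> :: "'a::euclidean_space \<Rightarrow> complex" and \<mu> C\<^sub>0 :: real
  assumes "\<mu> > 0"
    and "smooth \<sigma>"
    and "C\<^sub>0 > 0"
    and "\<And>\<xi> \<alpha>. norm (mderiv \<alpha> \<sigma> \<xi>) \<le> C\<^sub>0 ^ (mi_abs \<alpha> + 1) * real (mi_fact \<alpha>) powr \<mu>"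
  shows "\<exists>(F :: ('a \<times> 'a \<Rightarrow> complex) \<Rightarrow> complex) (a\<^sub>1 :: 'a \<Rightarrow> complex)
            (a\<^sub>2 :: 'a \<Rightarrow> ('a \<Rightarrow> complex) \<Rightarrow> complex).
           tempered F \<and>
           is_wigner_kernel (fourier_multiplier \<sigma>) (delta_kernel F) \<and>
           smooth a\<^sub>1 \<and>
           (\<forall>\<xi>. tempered (a\<^sub>2 \<xi>)) \<and>
           is_product F a\<^sub>1 a\<^sub>2 \<and>
           (\<exists>C>0. \<exists>\<epsilon>>0. \<forall>s. norm (a\<^sub>1 s) \<le> C * exp (- \<epsilon> * norm s powr (1 / \<mu>))) \<and>
           (\<exists>C>0. \<forall>\<xi>. bounded_convolution_kernel C (a\<^sub>2 \<xi>))"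
proof -
  interpret gevrey_symbol \<sigma> \<mu> C\<^sub>0 by unfold_locales (fact assms)+
  show ?thesis
  \<comment> \<open>The witnesses are \<open>F\<close>, \<open>gdecay \<mu> \<delta>\<close> and
    \<open>a2\<close>, with the constants of \<open>gdecay_bound\<close> and
    \<open>norm_bsym_le\<close>.\<close>
  proof (intro exI conjI allI)
    show "tempered F" by (rule tempered_F)
    show "is_wigner_kernel (fourier_multiplier \<sigma>) (delta_kernel F)"
      unfolding is_wigner_kernel_def
      using tempered_delta_kernel wigner_kernel_identity_delta_kernel wigner_kernel_unique by blast
    show "smooth (gdecay \<mu> \<delta> :: 'a \<Rightarrow> complex)" by (rule smooth_gdecay[OF \<mu> \<delta>_pos])
    show "tempered (a2 \<xi>)" for \<xi> by (rule tempered_a2)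
    show "is_product F (gdecay \<mu> \<delta>) a2" by (rule is_product_F)
    show "(4::real) powr \<mu> > 0" by simp
    show "\<mu> / 2 * (\<delta> / DIM('a)) powr (1 / \<mu>) > 0" using \<mu> \<delta>_pos by simp
    show "norm (gdecay \<mu> \<delta> s) \<le> 4 powr \<mu> * exp (- (\<mu> / 2 * (\<delta> / DIM('a)) powr (1 / \<mu>))
        * norm s powr (1 / \<mu>))" for s :: 'a
      by (rule gdecay_bound[OF \<mu> \<delta>_pos])
    show "real DIM('a) * (2 * C\<^sub>0\<^sup>2) > 0" using C\<^sub>0 by simp
    show "bounded_convolution_kernel (real DIM('a) * (2 * C\<^sub>0\<^sup>2)) (a2 \<xi>)" for \<xi> by (rule bounded_convolution_a2)
  qed
qed

end
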